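(* Let $d\ge1$, $0<s<1$, $a=1-2s$. For every $z>0$, the multiplier $$m_s(z;\xi,\tau)=\frac{2^{1-s}}{\Gamma(s)}\Bigl(z\,\theta(\xi,\tau)|p(\xi,\tau)|^{1/2}\Bigr)^{s}K_s\Bigl(z\,\theta(\xi,\tau)|p(\xi,\tau)|^{1/2}\Bigr)$$ is the Fourier transform, in $\mathscr S'(\mathbb R^{d+1})$, of the kernel $P_a(z,t)\,S(x,t)$, i.e. $\mathscr F^{-1}_{(\xi,\tau)\to(x,t)}\bigl(m_s(z;\cdot)\bigr)=P_a(z,t)\,S(x,t)$, where $$P_a(z,t)=\frac{e^{\,i\frac{(a-1)\pi}{4}}}{2^{1-a}\,\Gamma\!\left(\frac{1-a}{2}\right)}\,\frac{z^{1-a}}{t^{\frac{3-a}{2}}}\,e^{i\frac{z^2}{4t}}\,\mathbf 1_{(0,\infty)}(t),\qquad S(x,t)=(4\pi it)^{-d/2}e^{i\frac{|x|^2}{4t}}.$$ Consequently, for $u\in\mathscr S(\mathbb R^{d+1})$, the function $U$ with $\widehat U(\xi,z,\tau)=m_s(z;\xi,\tau)\widehat u(\xi,\tau)$, which solves the extension problem $\partial_tU-i(\Delta_xU+\partial_{zz}U+\frac az\partial_zU)=0$ for $z>0$, $U(x,0,t)=u(x,t)$, is given by $$U(x,z,t)=\int_0^\infty\int_{\mathbb R^d}P_a(z,\sigma)\,S(x-y,\sigma)\,u(y,t-\sigma)\,dy\,d\sigma.$$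
   Context: Fourier transform on $\mathbb R^{d+1}=\mathbb R^d_x\times\mathbb R_t$: $\widehat u(\xi,\tau)=\int_{\mathbb R^{d+1}}e^{-2\pi i(\tau t+\langle\xi,x\rangle)}u(x,t)\,dx\,dt$; $\widehat U(\xi,z,\tau)$ is the partial Fourier transform in $(x,t)$. $p(\xi,\tau)=2\pi\tau+4\pi^2|\xi|^2$; $\theta=1$ where $p>0$ and $\theta=-i$ where $p<0$; powers use the principal branch; $K_s$ is the modified Bessel function of the third kind. The multiplier is defined for $p(\xi,\tau)\ne0$ (the complement is a null set). The kernel $P_a(z,t)S(x,t)$ is oscillatory and is not locally integrable near $t=0$; it denotes the tempered distribution $\Phi\mapsto\lim_{\varepsilon\to0^+}\int_\varepsilon^\infty P_a(z,t)\bigl(\int_{\mathbb R^d}S(x,t)\Phi(x,t)\,dx\bigr)dt$. Likewise, in the formula for $U$ the $y$-integral is taken first and the $\sigma$-integral is an improper integral at $\sigma=0$. *)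

theory Defs
  imports "HOL-Analysis.Analysis"
begin

section \<open>Schwartz functions and tempered distributions\<close>

text \<open>
  A list \<open>[b1, ..., bk]\<close> of basis vectors plays the role of a multi-index; the value below is
  the iterated partial derivative only where the functions involved are differentiable, which is
  part of the definition of \<open>schwartz\<close>.
\<close>

primrec iter_pderiv :: "'a::euclidean_space list \<Rightarrow> ('a \<Rightarrow> complex) \<Rightarrow> 'a \<Rightarrow> complex" where
  "iter_pderiv [] f = f"
| "iter_pderiv (b # bs) f = (\<lambda>x. frechet_derivative (iter_pderiv bs f) (at x) b)"

definition schwartz :: "('a::euclidean_space \<Rightarrow> complex) set" where
  "schwartz = {f. \<forall>bs. set bs \<subseteq> Basis \<longrightarrow>
     (\<forall>x. iter_pderiv bs f differentiable (at x)) \<and>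
     (\<forall>k. bounded (range (\<lambda>x. norm x ^ k *\<^sub>R iter_pderiv bs f x)))}"

definition schwartz_seminorm :: "nat \<Rightarrow> 'a::euclidean_space list \<Rightarrow> ('a \<Rightarrow> complex) \<Rightarrow> real" where
  "schwartz_seminorm k bs f = (SUP x. norm x ^ k * norm (iter_pderiv bs f x))"

text \<open>
  A distribution is a functional of which only the values on \<open>schwartz\<close> matter. Continuity on the
  locally convex space \<open>schwartz\<close> is domination by finitely many seminorms.
\<close>

definition tempered_distribution ::
    "(('a::euclidean_space \<Rightarrow> complex) \<Rightarrow> complex) \<Rightarrow> bool" where
  "tempered_distribution T \<longleftrightarrow>
     (\<forall>f\<in>schwartz. \<forall>g\<in>schwartz. T (\<lambda>x. f x + g x) = T f + T g) \<and>
     (\<forall>c. \<forall>f\<in>schwartz. T (\<lambda>x. c * f x) = c * T f) \<and>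
     (\<exists>C N. \<forall>f\<in>schwartz.
        norm (T f) \<le> C * (\<Sum>k\<le>N. \<Sum>bs | set bs \<subseteq> Basis \<and> length bs \<le> N.
                              schwartz_seminorm k bs f))"

definition regular_dist ::
    "('a::euclidean_space \<Rightarrow> complex) \<Rightarrow> ('a \<Rightarrow> complex) \<Rightarrow> complex" where
  "regular_dist f \<Phi> = (LINT x|lborel. f x * \<Phi> x)"

definition tempered_function :: "('a::euclidean_space \<Rightarrow> complex) \<Rightarrow> bool" where
  "tempered_function f \<longleftrightarrow>
     (\<forall>\<Phi>\<in>schwartz. integrable lborel (\<lambda>x. f x * \<Phi> x)) \<and>
     tempered_distribution (regular_dist f)"


section \<open>Fourier transform\<close>

text \<open>
  On \<open>(real^'d) \<times> real\<close> the inner product is \<open>(\<xi>, \<tau>) \<bullet> (x, t) = \<xi> \<bullet> x + \<tau> * t\<close>.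
\<close>

definition fourier :: "('a::euclidean_space \<Rightarrow> complex) \<Rightarrow> 'a \<Rightarrow> complex" where
  "fourier f \<zeta> = (LINT x|lborel. exp (- 2 * of_real pi * \<i> * of_real (\<zeta> \<bullet> x)) * f x)"

definition inv_fourier :: "('a::euclidean_space \<Rightarrow> complex) \<Rightarrow> 'a \<Rightarrow> complex" where
  "inv_fourier f x = (LINT \<zeta>|lborel. exp (2 * of_real pi * \<i> * of_real (\<zeta> \<bullet> x)) * f \<zeta>)"

definition fourier_dist ::
    "(('a::euclidean_space \<Rightarrow> complex) \<Rightarrow> complex) \<Rightarrow> ('a \<Rightarrow> complex) \<Rightarrow> complex" where
  "fourier_dist T \<Phi> = T (fourier \<Phi>)"

definition inv_fourier_dist ::
    "(('a::euclidean_space \<Rightarrow> complex) \<Rightarrow> complex) \<Rightarrow> ('a \<Rightarrow> complex) \<Rightarrow> complex" where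
  "inv_fourier_dist T \<Phi> = T (inv_fourier \<Phi>)"

text \<open>The function \<open>f\<close> has the function \<open>g\<close> as its Fourier transform in the sense of tempered
  distributions.\<close>

definition has_tempered_fourier ::
    "('a::euclidean_space \<Rightarrow> complex) \<Rightarrow> ('a \<Rightarrow> complex) \<Rightarrow> bool" where
  "has_tempered_fourier f g \<longleftrightarrow>
     tempered_function f \<and> tempered_function g \<and>
     (\<forall>\<Phi>\<in>schwartz. fourier_dist (regular_dist f) \<Phi> = regular_dist g \<Phi>)"


section \<open>Modified Bessel functions\<close>

text \<open>Principal branch, from \<open>powr\<close>.\<close>

definition besselI :: "complex \<Rightarrow> complex \<Rightarrow> complex" where
  "besselI \<nu> w =
     (w / 2) powr \<nu> * (\<Sum>k. (w\<^sup>2 / 4) ^ k / fact k * rGamma (\<nu> + of_nat k + 1))"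

definition besselK :: "complex \<Rightarrow> complex \<Rightarrow> complex" where
  "besselK \<nu> w =
     (let K = (\<lambda>\<mu>. of_real pi / 2 * (besselI (- \<mu>) w - besselI \<mu> w)
                    / sin (of_real pi * \<mu>))
      in if \<nu> \<in> \<int> then Lim (at \<nu>) K else K \<nu>)"


section \<open>Multiplier and kernel\<close>

definition symb :: "real^'d \<Rightarrow> real \<Rightarrow> real" where
  "symb \<xi> \<tau> = 2 * pi * \<tau> + 4 * pi\<^sup>2 * (norm \<xi>)\<^sup>2"

text \<open>The values of \<open>theta\<close> and \<open>multiplier\<close> on the null set \<open>symb \<xi> \<tau> = 0\<close> are irrelevant.\<close>

definition theta :: "real^'d \<Rightarrow> real \<Rightarrow> complex" where
  "theta \<xi> \<tau> = (if symb \<xi> \<tau> > 0 then 1 else - \<i>)"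

definition multiplier :: "real \<Rightarrow> real \<Rightarrow> real^'d \<Rightarrow> real \<Rightarrow> complex" where
  "multiplier s z \<xi> \<tau> =
     (let w = of_real z * theta \<xi> \<tau> * of_real (sqrt \<bar>symb \<xi> \<tau>\<bar>)
      in of_real (2 powr (1 - s) / Gamma s) * w powr of_real s * besselK (of_real s) w)"

definition P_kernel :: "real \<Rightarrow> real \<Rightarrow> real \<Rightarrow> complex" where
  "P_kernel a z t =
     (if t > 0 then
        exp (\<i> * of_real ((a - 1) * pi / 4))
          / of_real (2 powr (1 - a) * Gamma ((1 - a) / 2))
        * of_real (z powr (1 - a) / t powr ((3 - a) / 2))
        * exp (\<i> * of_real (z\<^sup>2 / (4 * t)))
      else 0)"

definition S_kernel :: "real^'d \<Rightarrow> real \<Rightarrow> complex" where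
  "S_kernel x t =
     (4 * of_real pi * \<i> * of_real t) powr of_real (- (real CARD('d) / 2))
     * exp (\<i> * of_real ((norm x)\<^sup>2 / (4 * t)))"

text \<open>Integral over \<open>(0, \<infinity>)\<close>, improper at \<open>0\<close> only.\<close>

definition has_improper_integral :: "(real \<Rightarrow> complex) \<Rightarrow> complex \<Rightarrow> bool" where
  "has_improper_integral g L \<longleftrightarrow>
     (\<forall>\<epsilon>>0. set_integrable lborel {\<epsilon>..} g) \<and>
     ((\<lambda>\<epsilon>. LINT t:{\<epsilon>..}|lborel. g t) \<longlongrightarrow> L) (at_right 0)"

definition kernel_integrand ::
    "real \<Rightarrow> real \<Rightarrow> ((real^'d) \<times> real \<Rightarrow> complex) \<Rightarrow> real \<Rightarrow> complex" where
  "kernel_integrand a z \<Phi> t =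
     P_kernel a z t * (LINT x|lborel. S_kernel x t * \<Phi> (x, t))"

definition kernel_dist ::
    "real \<Rightarrow> real \<Rightarrow> ((real^'d) \<times> real \<Rightarrow> complex) \<Rightarrow> complex" where
  "kernel_dist a z \<Phi> =
     Lim (at_right 0) (\<lambda>\<epsilon>. LINT t:{\<epsilon>..}|lborel. kernel_integrand a z \<Phi> t)"


section \<open>The extension problem\<close>

text \<open>
  The identity for the Fourier transform determines \<open>U\<close> at each height \<open>z\<close> only almost everywhere;
  the continuous representative is meant.
\<close>

definition is_extension ::
    "real \<Rightarrow> ((real^'d) \<times> real \<Rightarrow> complex) \<Rightarrow> (real^'d \<Rightarrow> real \<Rightarrow> real \<Rightarrow> complex) \<Rightarrow> bool" where
  "is_extension s u U \<longleftrightarrow> (\<forall>z>0.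
     continuous_on UNIV (\<lambda>(x, t). U x z t) \<and>
     has_tempered_fourier (\<lambda>(x, t). U x z t)
       (\<lambda>(\<xi>, \<tau>). multiplier s z \<xi> \<tau> * fourier u (\<xi>, \<tau>)))"

text \<open>
  Classical solution for \<open>z > 0\<close>; the boundary values are attained uniformly as \<open>z\<close> tends to \<open>0\<close>
  from above.
\<close>

definition solves_extension_problem ::
    "real \<Rightarrow> ((real^'d) \<times> real \<Rightarrow> complex) \<Rightarrow> (real^'d \<Rightarrow> real \<Rightarrow> real \<Rightarrow> complex) \<Rightarrow> bool" where
  "solves_extension_problem a u U \<longleftrightarrow>
     (\<exists>Ut Uz Uzz Ux Uxx. \<forall>x t. \<forall>z>0.
        ((\<lambda>r. U x z r) has_vector_derivative Ut x z t) (at t) \<and>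
        ((\<lambda>r. U x r t) has_vector_derivative Uz x z t) (at z) \<and>
        ((\<lambda>r. Uz x r t) has_vector_derivative Uzz x z t) (at z) \<and>
        (\<forall>j::'d.
           ((\<lambda>r. U (x + r *\<^sub>R axis j 1) z t) has_vector_derivative Ux j x z t) (at 0) \<and>
           ((\<lambda>r. Ux j (x + r *\<^sub>R axis j 1) z t) has_vector_derivative Uxx j x z t) (at 0)) \<and>
        Ut x z t - \<i> * ((\<Sum>j\<in>UNIV. Uxx j x z t) + Uzz x z t + of_real (a / z) * Uz x z t) = 0) \<and>
     uniform_limit UNIV (\<lambda>z (x, t). U x z t) u (at_right 0)"

end

theory Submission
  imports Defs "HOL-Probability.Probability"
begin

text \<open>
  In space and time frequencies the kernel is a function of the symbol alone. Indeed, for \<open>t > 0\<close> the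
  Fourier transform of \<open>S(\<cdot>, t)\<close> is \<open>exp (- 4 \<pi>\<^sup>2 \<i> |\<xi>|\<^sup>2 t)\<close>; pairing with a Fourier transform
  therefore gives \<open>\<integral> S(x, t) (fourier \<Psi>)(x, t) dx = \<integral> exp (- \<i> p(\<zeta>) t) \<Psi>(\<zeta>) d\<zeta>\<close>, where \<open>p\<close> is the symbol
  (\<open>schroedinger_identity\<close>). By Fubini, everything reduces to the improper integral
  \<open>\<integral> P\<^sub>a(z, t) exp (- \<i> p t) dt\<close> for real \<open>p \<noteq> 0\<close>: it has to be identified with the multiplier, and the
  truncated integrals have to be bounded by a multiple of \<open>1 + |p|\<close>, for then the limit \<open>\<epsilon> \<rightarrow> 0\<close> may be
  taken under the integral against the Schwartz function \<open>\<Psi>\<close>.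

  This integral is \<open>\<integral> t\<^bsup>-1-s\<^esup> exp (- \<alpha> / t - \<beta> t) dt\<close> up to a factor, with \<open>\<alpha> = - \<i> z\<^sup>2 / 4\<close> and \<open>\<beta> = \<i> p\<close>. For
  \<open>\<alpha>\<close> and \<open>\<beta>\<close> in the right half plane it converges absolutely, and as a function of \<open>\<beta>\<close> it solves the same
  linear system as two Bessel series. Constant Wronskians, evaluated as \<open>\<beta> \<rightarrow> 0\<close>, express it through the series
  (\<open>bessel_int_formula\<close>); this is the integral representation of \<open>K\<^sub>s\<close>. On the imaginary axes one integration by
  parts restores absolute convergence at \<open>t = 0\<close>. It yields the passage to the boundary
  (\<open>truncated_tendsto\<close>) together with the uniform bound (\<open>truncated_bound\<close>). As \<open>\<beta>\<close> approaches \<open>\<i> p\<close> from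
  the right half plane, \<open>- \<i> \<beta>\<close> approaches \<open>p\<close> from the lower half plane: this is why \<open>\<theta> = - \<i>\<close> for negative
  \<open>p\<close>.

  Fourier inversion for Schwartz functions turns the result into one about arbitrary test functions
  (\<open>kernel_dist_eq\<close>). For \<open>u\<close> in \<open>schwartz\<close> the extension is the inverse Fourier transform of the integrable
  function \<open>m\<^sub>s(z; \<cdot>) (fourier u)\<close>, and it is the only continuous function with that Fourier transform
  (\<open>is_extension_unique\<close>). Testing the kernel with \<open>(y, \<sigma>) \<mapsto> u(x - y, t - \<sigma>)\<close> gives the integral formula. The
  multiplier, as a function \<open>M\<close> of \<open>z\<close>, satisfies \<open>\<partial>\<^sub>z (z\<^sup>a \<partial>\<^sub>z M) = z\<^sup>a p M\<close> and \<open>M \<rightarrow> 1\<close> as \<open>z \<rightarrow> 0\<close>. Integration of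
  this equation bounds the derivatives of \<open>M\<close> polynomially in \<open>p\<close> (\<open>profile_flux_bound\<close>), so the extension may
  be differentiated under the integral sign, and it solves the extension problem (\<open>ext_sol_solves\<close>).
\<close>

section \<open>Lebesgue integrals depending on a parameter\<close>

text \<open>
  The filter \<open>at a within S\<close> of a metric space is determined by sequences, so dominated convergence
  carries over from sequences to continuous parameters.
\<close>

lemma tendsto_integral_dominated:
  fixes f :: "'v::metric_space \<Rightarrow> 'x \<Rightarrow> complex"
  assumes l: "l \<in> borel_measurable M"
    and f: "\<And>y. y \<in> S \<Longrightarrow> f y \<in> borel_measurable M"
    and w: "integrable M w"
    and lim: "AE x in M. ((\<lambda>y. f y x) \<longlongrightarrow> l x) (at a within S)"
    and bound: "\<And>y. y \<in> S \<Longrightarrow> AE x in M. norm (f y x) \<le> w x"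
  shows "((\<lambda>y. LINT x|M. f y x) \<longlongrightarrow> (LINT x|M. l x)) (at a within S)"
  unfolding tendsto_at_iff_sequentially
proof (intro allI impI)
  fix X assume X: "\<forall>i. X i \<in> S - {a}" "X \<longlonglongrightarrow> a"
  have "AE x in M. (\<lambda>i. f (X i) x) \<longlonglongrightarrow> l x"
    using lim
  proof eventually_elim
    case (elim x)
    then show ?case
      using X unfolding tendsto_at_iff_sequentially by (auto simp: o_def)
  qed
  then have "(\<lambda>i. LINT x|M. f (X i) x) \<longlonglongrightarrow> (LINT x|M. l x)"
    using X by (intro integral_dominated_convergence[OF l _ w]) (auto intro!: f bound)
  then show "((\<lambda>y. LINT x|M. f y x) \<circ> X) \<longlonglongrightarrow> (LINT x|M. l x)"
    by (simp add: o_def)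
qed

text \<open>
  By the mean value inequality on the convex set \<open>S\<close>, the remainder of the first order expansion
  of the integrand is at most \<open>2 * g x * norm (y - y0)\<close>; dominated convergence applies to the quotient.
\<close>

lemma has_derivative_integral:
  fixes f :: "'v::euclidean_space \<Rightarrow> 'x \<Rightarrow> complex"
  assumes S: "open S" "convex S" "y0 \<in> S"
    and int: "\<And>y. y \<in> S \<Longrightarrow> integrable M (f y)"
    and der: "AE x in M. \<forall>y\<in>S. ((\<lambda>y. f y x) has_derivative f' y x) (at y)"
    and bd: "AE x in M. \<forall>y\<in>S. \<forall>h. norm (f' y x h) \<le> g x * norm h"
    and g: "integrable M g"
    and meas: "\<And>h. (\<lambda>x. f' y0 x h) \<in> borel_measurable M"
  shows "((\<lambda>y. LINT x|M. f y x) has_derivative (\<lambda>h. LINT x|M. f' y0 x h)) (at y0)"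
proof -
  let ?D = "\<lambda>h. LINT x|M. f' y0 x h"
  have lin: "AE x in M. bounded_linear (f' y0 x)"
    using der by eventually_elim (use S(3) in \<open>auto dest: has_derivative_bounded_linear\<close>)
  have intD: "integrable M (\<lambda>x. f' y0 x h)" for h
  proof (rule Bochner_Integration.integrable_bound[where f = "\<lambda>x. norm h * g x"])
    show "AE x in M. norm (f' y0 x h) \<le> norm (norm h * g x)"
      using bd by eventually_elim
        (smt (verit) S(3) mult.commute norm_ge_zero real_norm_def)
  qed (use g meas in auto)
  have bl: "bounded_linear ?D"
  proof (rule bounded_linear_intro[where K = "LINT x|M. g x"])
    fix h k
    have "?D (h + k) = (LINT x|M. f' y0 x h + f' y0 x k)"
      by (rule integral_cong_AE)
         (use meas lin in \<open>auto elim!: eventually_mono simp: linear_add bounded_linear.linear\<close>)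
    then show "?D (h + k) = ?D h + ?D k"
      using intD by simp
  next
    fix r h
    have "?D (r *\<^sub>R h) = (LINT x|M. r *\<^sub>R f' y0 x h)"
      by (rule integral_cong_AE)
         (use meas lin in \<open>auto elim!: eventually_mono simp: linear_scale bounded_linear.linear\<close>)
    then show "?D (r *\<^sub>R h) = r *\<^sub>R ?D h"
      using intD by simp
  next
    fix h
    have "norm (?D h) \<le> (LINT x|M. norm (f' y0 x h))" by (rule integral_norm_bound)
    also have "\<dots> \<le> (LINT x|M. norm h * g x)"
    proof (rule integral_mono_AE)
      show "AE x in M. norm (f' y0 x h) \<le> norm h * g x"
        using bd by eventually_elim (use S(3) in \<open>auto simp: mult.commute\<close>)
    qed (use intD g in auto)
    finally show "norm (?D h) \<le> norm h * (LINT x|M. g x)" by simp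
  qed
  \<comment> \<open>the remainder of the expansion at \<open>y0\<close>, divided by the distance\<close>
  let ?q = "\<lambda>y x. (1 / norm (y - y0)) *\<^sub>R (f y x - (f y0 x + f' y0 x (y - y0)))"
  have "((\<lambda>y. LINT x|M. ?q y x) \<longlongrightarrow> (LINT x|M. 0)) (at y0 within S)"
  proof (rule tendsto_integral_dominated[where w = "\<lambda>x. 2 * g x"])
    show "AE x in M. ((\<lambda>y. ?q y x) \<longlongrightarrow> 0) (at y0 within S)"
      using der
    proof eventually_elim
      case (elim x)
      then have "((\<lambda>y. f y x) has_derivative f' y0 x) (at y0)" using S(3) by auto
      then show ?case
        unfolding has_derivative_within
        by (auto intro: tendsto_within_subset)
    qed
  next
    fix y assume y: "y \<in> S"
    show "AE x in M. norm (?q y x) \<le> 2 * g x"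
      using der bd
    proof eventually_elim
      case (elim x)
      have on: "onorm (f' z x) \<le> g x" if "z \<in> S" for z
        by (rule onorm_le) (use elim that in \<open>auto simp: mult.commute\<close>)
      have "norm (f y x - f y0 x) \<le> g x * norm (y - y0)"
        by (rule differentiable_bound[OF S(2), where f' = "\<lambda>z. f' z x"])
           (use elim S y on in \<open>auto intro: has_derivative_at_withinI\<close>)
      moreover have "norm (f' y0 x (y - y0)) \<le> g x * norm (y - y0)"
        using elim S(3) by auto
      ultimately have *: "norm (f y x - (f y0 x + f' y0 x (y - y0))) \<le> 2 * g x * norm (y - y0)"
        using norm_triangle_ineq4[of "f y x - f y0 x" "f' y0 x (y - y0)"]
        by (simp add: algebra_simps)
      show ?case
      proof (cases "y = y0")
        case True
        have "0 \<le> g x"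
        proof -
          have "bounded_linear (f' y0 x)"
            using elim(1) S(3) has_derivative_bounded_linear by blast
          from onorm_pos_le[OF this] on[OF S(3)] show ?thesis by linarith
        qed
        then show ?thesis using True by simp
      next
        case False
        then show ?thesis
          using * by (simp only: norm_scaleR real_norm_def) (simp add: pos_divide_le_eq)
      qed
    qed
  qed (use int intD g S in auto)
  then have lim0: "((\<lambda>y. LINT x|M. ?q y x) \<longlongrightarrow> 0) (at y0)"
    unfolding at_within_open[OF S(3) S(1)] by (simp only: integral_zero)
  have "(LINT x|M. ?q y x) =
      (1 / norm (y - y0)) *\<^sub>R ((LINT x|M. f y x) - ((LINT x|M. f y0 x) + ?D (y - y0)))" if "y \<in> S" for y
    using int[OF that] int[OF S(3)] intD[of "y - y0"]
    by (simp only: integral_scaleR_right Bochner_Integration.integral_diff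
        Bochner_Integration.integral_add Bochner_Integration.integrable_add)
  then have "\<forall>\<^sub>F y in at y0. (LINT x|M. ?q y x) =
      (1 / norm (y - y0)) *\<^sub>R ((LINT x|M. f y x) - ((LINT x|M. f y0 x) + ?D (y - y0)))"
    using eventually_at_in_open'[OF S(1) S(3)] by (rule eventually_mono[rotated])
  with lim0 have "((\<lambda>y. (1 / norm (y - y0)) *\<^sub>R ((LINT x|M. f y x) - ((LINT x|M. f y0 x) + ?D (y - y0)))) \<longlongrightarrow> 0) (at y0)"
    by (rule Lim_transform_eventually)
  then show ?thesis
    unfolding has_derivative_within using bl by blast
qed

text \<open>
  Since \<open>\<phi>\<close> is nonnegative, the exponential only gets smaller when \<open>Re c\<close> grows, so that the value at
  \<open>\<delta>\<close> dominates the derivative on the whole half plane. Real Gaussian integrals and the Bessel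
  integrals, in either of their parameters, are of this form.
\<close>

lemma has_field_derivative_laplace:
  fixes w :: "'x \<Rightarrow> complex" and \<phi> :: "'x \<Rightarrow> real"
  assumes \<phi>: "\<And>x. 0 \<le> \<phi> x" and m[measurable]: "w \<in> borel_measurable M" "\<phi> \<in> borel_measurable M"
    and int: "\<And>c. \<delta> < Re c \<Longrightarrow> integrable M (\<lambda>x. w x * exp (- c * of_real (\<phi> x)))"
    and int1: "integrable M (\<lambda>x. of_real (\<phi> x) * w x * exp (- of_real \<delta> * of_real (\<phi> x)))"
    and c: "\<delta> < Re c"
  shows "((\<lambda>c. LINT x|M. w x * exp (- c * of_real (\<phi> x))) has_field_derivative
      - (LINT x|M. of_real (\<phi> x) * w x * exp (- c * of_real (\<phi> x)))) (at c)"
proof -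
  have "((\<lambda>c. LINT x|M. w x * exp (- c * of_real (\<phi> x))) has_derivative
      (\<lambda>h. LINT x|M. - (of_real (\<phi> x) * w x * exp (- c * of_real (\<phi> x))) * h)) (at c)"
  proof (rule has_derivative_integral[where S = "{z. \<delta> < Re z}"
        and g = "\<lambda>x. norm (of_real (\<phi> x) * w x * exp (- of_real \<delta> * of_real (\<phi> x)))"
        and f' = "\<lambda>c x h. - (of_real (\<phi> x) * w x * exp (- c * of_real (\<phi> x))) * h"])
    show "open {z. \<delta> < Re z}" by (rule open_halfspace_Re_gt)
    show "convex {z. \<delta> < Re z}" by (rule convex_halfspace_Re_gt)
    have "((\<lambda>c. w x * exp (- c * of_real (\<phi> x))) has_field_derivative
        - (of_real (\<phi> x) * w x * exp (- y * of_real (\<phi> x)))) (at y)" for x y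
      by (rule derivative_eq_intros refl)+ (simp add: mult_ac)
    then show "AE x in M. \<forall>y\<in>{z. \<delta> < Re z}. ((\<lambda>c. w x * exp (- c * of_real (\<phi> x))) has_derivative
        (\<lambda>h. - (of_real (\<phi> x) * w x * exp (- y * of_real (\<phi> x))) * h)) (at y)"
      unfolding has_field_derivative_def by blast
    show "AE x in M. \<forall>y\<in>{z. \<delta> < Re z}. \<forall>h. norm (- (of_real (\<phi> x) * w x * exp (- y * of_real (\<phi> x))) * h)
        \<le> norm (of_real (\<phi> x) * w x * exp (- of_real \<delta> * of_real (\<phi> x))) * norm h"
    proof (intro AE_I2 ballI allI)
      fix x y h assume y: "y \<in> {z. \<delta> < Re z}"
      have "norm (exp (- y * of_real (\<phi> x))) \<le> norm (exp (- of_real \<delta> * complex_of_real (\<phi> x)))"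
        using y \<phi>[of x] by (simp add: norm_exp_eq_Re mult_right_mono)
      then show "norm (- (of_real (\<phi> x) * w x * exp (- y * of_real (\<phi> x))) * h)
        \<le> norm (of_real (\<phi> x) * w x * exp (- of_real \<delta> * of_real (\<phi> x))) * norm h"
        unfolding norm_mult norm_minus_cancel by (intro mult_right_mono mult_left_mono) auto
    qed
    show "integrable M (\<lambda>x. norm (of_real (\<phi> x) * w x * exp (- of_real \<delta> * of_real (\<phi> x))))"
      by (rule integrable_norm[OF int1])
  qed (use c int in auto)
  moreover have "(\<lambda>h. LINT x|M. - (of_real (\<phi> x) * w x * exp (- c * of_real (\<phi> x))) * h)
      = (*) (- (LINT x|M. of_real (\<phi> x) * w x * exp (- c * of_real (\<phi> x))))"
    by (rule ext) (simp only: integral_mult_left_zero integral_minus)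
  ultimately show ?thesis
    by (simp add: has_field_derivative_def)
qed

lemma integral_lincomb:
  fixes f g :: "'x \<Rightarrow> complex"
  assumes "integrable M f" "integrable M g"
  shows "(LINT x|M. c * f x + d * g x) = c * (LINT x|M. f x) + d * (LINT x|M. g x)"
  using assms by simp

text \<open>
  This transfers gauge integrals with known values, the Gamma integral above all, to Lebesgue integrals.
\<close>

lemma lborel_integral_of_has_integral_nonneg:
  fixes f :: "real \<Rightarrow> real"
  assumes f: "(f has_integral r) S" and nn: "\<And>x. x \<in> S \<Longrightarrow> 0 \<le> f x"
    and m: "(\<lambda>x. if x \<in> S then f x else 0) \<in> borel_measurable borel"
  shows "integrable lborel (\<lambda>x. if x \<in> S then f x else 0)"
    and "(LINT x|lborel. (if x \<in> S then f x else 0)) = r"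
proof -
  let ?g = "\<lambda>x. if x \<in> S then f x else 0"
  have "(?g has_integral r) UNIV"
    using f by (simp only: has_integral_restrict_UNIV)
  then have *: "integral\<^sup>N lebesgue ?g = ennreal r" and r: "0 \<le> r"
    using nn has_integral_iff_nn_integral_lebesgue[of ?g r] by auto
  have "integral\<^sup>N lborel ?g = ennreal r"
    using * m by (simp add: nn_integral_completion)
  then have "integrable lborel ?g \<and> integral\<^sup>L lborel ?g = r"
    using nn_integral_eq_integrable[of ?g lborel r] m nn r by auto
  then show "integrable lborel ?g" "integral\<^sup>L lborel ?g = r" by auto
qed

lemma norm_integral_le:
  fixes f :: "'x \<Rightarrow> complex"
  assumes "integrable M f" "integrable M g" "\<And>x. norm (f x) \<le> g x"
  shows "norm (LINT x|M. f x) \<le> (LINT x|M. g x)"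
  by (rule order_trans[OF integral_norm_bound integral_mono]) (use assms in auto)

lemma integrable_pair_mult:
  fixes f :: "'a::euclidean_space \<Rightarrow> complex" and g :: "'b::euclidean_space \<Rightarrow> complex"
  assumes f: "integrable lborel f" and g: "integrable lborel g"
  shows "integrable (lborel \<Otimes>\<^sub>M lborel) (\<lambda>(x, y). f x * g y)"
proof -
  have [measurable]: "f \<in> borel_measurable borel" "g \<in> borel_measurable borel"
    using f g by (auto dest: borel_measurable_integrable)
  show ?thesis
    by (rule lborel_pair.Fubini_integrable)
       (use f g in \<open>auto simp: norm_mult\<close>)
qed

text \<open>
  All kernels that occur here are oscillatory or damped exponentials and hence bounded; two integrable
  functions and a bounded kernel between them is the only situation in which integrals get exchanged.
\<close>

lemma Fubini_bounded_kernel: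
  fixes f :: "'a::euclidean_space \<Rightarrow> complex" and g :: "'b::euclidean_space \<Rightarrow> complex"
    and k :: "'a \<Rightarrow> 'b \<Rightarrow> complex"
  assumes f: "integrable lborel f" and g: "integrable lborel g"
    and k: "(\<lambda>(x, y). k x y) \<in> borel_measurable borel"
    and b: "\<And>x y. norm (k x y) \<le> B"
  shows "integrable lborel (\<lambda>x. f x * (LINT y|lborel. k x y * g y))"
    and "(LINT x|lborel. f x * (LINT y|lborel. k x y * g y))
       = (LINT y|lborel. g y * (LINT x|lborel. k x y * f x))"
proof -
  have [measurable]: "f \<in> borel_measurable borel" "g \<in> borel_measurable borel"
    using f g by (auto dest: borel_measurable_integrable)
  have [measurable]: "(\<lambda>(x, y). k x y) \<in> borel_measurable (borel \<Otimes>\<^sub>M borel)"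
    using k by (simp add: borel_prod)
  have B: "0 \<le> B" using b[of undefined undefined] norm_ge_zero order_trans by blast
  have I: "integrable (lborel \<Otimes>\<^sub>M lborel) (\<lambda>(x, y). f x * (k x y * g y))"
  proof (rule Bochner_Integration.integrable_bound)
    show "integrable (lborel \<Otimes>\<^sub>M lborel) (\<lambda>z. of_real B * (\<lambda>(x, y). f x * g y) z)"
      using integrable_pair_mult[OF f g] by (rule integrable_mult_right)
    show "AE z in lborel \<Otimes>\<^sub>M lborel. norm ((\<lambda>(x, y). f x * (k x y * g y)) z)
        \<le> norm (complex_of_real B * (\<lambda>(x, y). f x * g y) z)"
    proof (intro AE_I2, clarify)
      fix x y
      have "norm (k x y) * norm (f x * g y) \<le> B * norm (f x * g y)"
        by (rule mult_right_mono) (use b in auto)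
      then show "norm (f x * (k x y * g y)) \<le> norm (complex_of_real B * (f x * g y))"
        using B by (simp add: norm_mult mult_ac)
    qed
  qed measurable
  have "integrable lborel (\<lambda>x. LINT y|lborel. f x * (k x y * g y))"
    using lborel_pair.integrable_fst'[OF I] by simp
  then show "integrable lborel (\<lambda>x. f x * (LINT y|lborel. k x y * g y))"
    by simp
  have "(LINT x|lborel. LINT y|lborel. f x * (k x y * g y))
      = (LINT y|lborel. LINT x|lborel. f x * (k x y * g y))"
    using lborel_pair.Fubini_integral[OF I] by simp
  also have "\<dots> = (LINT y|lborel. LINT x|lborel. g y * (k x y * f x))"
    by (simp add: mult_ac)
  finally show "(LINT x|lborel. f x * (LINT y|lborel. k x y * g y))
       = (LINT y|lborel. g y * (LINT x|lborel. k x y * f x))"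
    by simp
qed

lemma integral_lborel_affine:
  fixes f :: "'a::euclidean_space \<Rightarrow> complex"
  assumes [measurable]: "f \<in> borel_measurable borel" and c: "c \<noteq> 0"
  shows "(LINT x|lborel. f x) = \<bar>c\<bar> ^ DIM('a) *\<^sub>R (LINT x|lborel. f (t + c *\<^sub>R x))"
  by (subst lborel_affine[OF c, of t]) (simp add: integral_density integral_distr)

lemma integrable_lborel_affine:
  fixes f :: "'a::euclidean_space \<Rightarrow> complex"
  assumes "integrable lborel f" and c: "c \<noteq> 0"
  shows "integrable lborel (\<lambda>x. f (t + c *\<^sub>R x))"
proof -
  have [measurable]: "f \<in> borel_measurable borel"
    using assms by (auto dest: borel_measurable_integrable)
  have "integrable (density (distr lborel borel (\<lambda>x. t + c *\<^sub>R x)) (\<lambda>_. ennreal (\<bar>c\<bar> ^ DIM('a)))) f"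
    using assms by (simp flip: lborel_affine)
  then have "integrable lborel (\<lambda>x. (\<bar>c\<bar> ^ DIM('a)) *\<^sub>R f (t + c *\<^sub>R x))"
    using c by (simp add: integrable_density integrable_distr_eq)
  then have "integrable lborel (\<lambda>x. inverse (\<bar>c\<bar> ^ DIM('a)) *\<^sub>R (\<bar>c\<bar> ^ DIM('a)) *\<^sub>R f (t + c *\<^sub>R x))"
    by (rule integrable_scaleR_right)
  then show ?thesis
    using c by simp
qed

lemma integral_lborel_prod_Basis:
  fixes f :: "'a::euclidean_space \<Rightarrow> real \<Rightarrow> 'c::{real_normed_field,banach,second_countable_topology}"
  assumes f: "\<And>b. b \<in> Basis \<Longrightarrow> integrable lborel (f b)"
  shows "integrable lborel (\<lambda>x::'a. \<Prod>b\<in>Basis. f b (x \<bullet> b))"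
    and "integral\<^sup>L lborel (\<lambda>x::'a. \<Prod>b\<in>Basis. f b (x \<bullet> b)) = (\<Prod>b\<in>Basis. LINT x|lborel. f b x)"
proof -
  interpret product_sigma_finite "\<lambda>_::'a. lborel :: real measure" ..
  have m: "f b \<in> borel_measurable borel" if "b \<in> Basis" for b
    using f[OF that] by (auto dest: borel_measurable_integrable)
  have [measurable]: "(\<lambda>x::'a. \<Prod>b\<in>Basis. f b (x \<bullet> b)) \<in> borel_measurable borel"
    using m by (intro borel_measurable_prod) (auto intro!: measurable_compose[OF _ m])
  have T[measurable]: "(\<lambda>g. \<Sum>b\<in>(Basis::'a set). g b *\<^sub>R b) \<in> measurable (\<Pi>\<^sub>M b\<in>Basis. lborel) borel"
    by measurable
  have eq: "(\<Prod>b\<in>Basis. f b ((\<Sum>b\<in>(Basis::'a set). g b *\<^sub>R b) \<bullet> b)) = (\<Prod>b\<in>Basis. f b (g b))" for g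
    by (intro prod.cong) (auto)
  show "integrable lborel (\<lambda>x::'a. \<Prod>b\<in>Basis. f b (x \<bullet> b))"
    by (subst lborel_eq, subst integrable_distr_eq[OF T])
       (use product_integrable_prod[OF finite_Basis f] in \<open>auto simp: eq\<close>)
  show "integral\<^sup>L lborel (\<lambda>x::'a. \<Prod>b\<in>Basis. f b (x \<bullet> b)) = (\<Prod>b\<in>Basis. LINT x|lborel. f b x)"
    by (subst lborel_eq, subst integral_distr[OF T])
       (use product_integral_prod[OF finite_Basis f] in \<open>auto simp: eq\<close>)
qed

text \<open>
  Since \<open>1 + (x \<bullet> b)\<^sup>2 \<le> (1 + norm x)\<^sup>2\<close> for each coordinate, the function is dominated by a product
  of integrable functions of one variable. This fixes the weight \<open>2 * DIM('a)\<close> that serves from here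
  on to deduce integrability from decay.
\<close>

lemma integrable_inverse_one_plus_norm_power:
  "integrable lborel (\<lambda>x::'a::euclidean_space. inverse ((1 + norm x) ^ (2 * DIM('a))))"
proof (rule Bochner_Integration.integrable_bound)
  show "integrable lborel (\<lambda>x::'a. \<Prod>b\<in>Basis. inverse (1 + (x \<bullet> b)\<^sup>2))"
    by (rule integral_lborel_prod_Basis)
       (use integrable_inverse_1_plus_square in \<open>simp_all add: set_integrable_def\<close>)
next
  show "AE x::'a in lborel. norm (inverse ((1 + norm x) ^ (2 * DIM('a))))
     \<le> norm (\<Prod>b\<in>Basis. inverse (1 + (x \<bullet> b)\<^sup>2))"
  proof (rule AE_I2)
    fix x :: 'a
    have "(\<Prod>b\<in>Basis. 1 + (x \<bullet> b)\<^sup>2) \<le> (\<Prod>b\<in>(Basis::'a set). (1 + norm x)\<^sup>2)"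
    proof (rule prod_mono)
      fix b :: 'a assume b: "b \<in> Basis"
      have "(x \<bullet> b)\<^sup>2 \<le> (norm x)\<^sup>2"
        using Basis_le_norm[OF b, of x] by (simp add: abs_le_square_iff[symmetric])
      then show "0 \<le> 1 + (x \<bullet> b)\<^sup>2 \<and> 1 + (x \<bullet> b)\<^sup>2 \<le> (1 + norm x)\<^sup>2"
        by (simp add: power2_sum) (smt (verit) norm_ge_zero)
    qed
    also have "\<dots> = (1 + norm x) ^ (2 * DIM('a))"
      by (simp add: power_mult)
    finally have *: "(\<Prod>b\<in>Basis. 1 + (x \<bullet> b)\<^sup>2) \<le> (1 + norm x) ^ (2 * DIM('a))" .
    have "0 < (\<Prod>b\<in>Basis. 1 + (x \<bullet> b)\<^sup>2)"
      by (rule prod_pos) (smt (verit) zero_le_power2)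
    moreover have "(\<Prod>b\<in>Basis. inverse (1 + (x \<bullet> b)\<^sup>2)) = inverse (\<Prod>b\<in>Basis. 1 + (x \<bullet> b)\<^sup>2)"
      using prod_inversef[of "\<lambda>b. 1 + (x \<bullet> b)\<^sup>2" Basis] by (simp add: o_def)
    moreover have "inverse ((1 + norm x) ^ (2 * DIM('a))) \<le> inverse (\<Prod>b\<in>Basis. 1 + (x \<bullet> b)\<^sup>2)"
      using * \<open>0 < _\<close> by (rule le_imp_inverse_le)
    ultimately show "norm (inverse ((1 + norm x) ^ (2 * DIM('a)))) \<le> norm (\<Prod>b\<in>Basis. inverse (1 + (x \<bullet> b)\<^sup>2))"
      by simp
  qed
qed simp

section \<open>Schwartz functions\<close>

text \<open>
  The set \<open>schwartz\<close> refers to iterated partial derivatives of all orders, for which explicit formulas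
  are unwieldy. It suffices to exhibit a class of decaying differentiable functions that is closed under
  first partial derivatives.
\<close>

lemma schwartz_coinduct:
  assumes "f \<in> S"
    and diff: "\<And>f x. f \<in> S \<Longrightarrow> f differentiable (at x)"
    and decay: "\<And>f k. f \<in> S \<Longrightarrow> bounded (range (\<lambda>x. norm x ^ k *\<^sub>R f x))"
    and pd: "\<And>f b. f \<in> S \<Longrightarrow> b \<in> Basis \<Longrightarrow> (\<lambda>x. frechet_derivative f (at x) b) \<in> S"
  shows "f \<in> schwartz"
proof -
  have "iter_pderiv bs f \<in> S" if "set bs \<subseteq> Basis" for bs
    using that by (induction bs) (use assms in auto)
  then show ?thesis
    using diff decay by (auto simp: schwartz_def)
qed

lemma schwartz_differentiable: "f \<in> schwartz \<Longrightarrow> f differentiable (at x)"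
  by (auto simp: schwartz_def dest!: spec[of _ "[]"])

lemma schwartz_bounded: "f \<in> schwartz \<Longrightarrow> bounded (range (\<lambda>x. norm x ^ k *\<^sub>R f x))"
  by (auto simp: schwartz_def dest!: spec[of _ "[]"])

lemma iter_pderiv_append: "iter_pderiv (bs @ cs) f = iter_pderiv bs (iter_pderiv cs f)"
  by (induction bs) auto

lemma iter_pderiv_schwartz:
  assumes "f \<in> schwartz" "set cs \<subseteq> Basis"
  shows "iter_pderiv cs f \<in> schwartz"
  unfolding schwartz_def
proof (clarify, intro conjI allI)
  fix bs :: "'a list" assume bs: "set bs \<subseteq> Basis"
  have "set (bs @ cs) \<subseteq> Basis" using bs assms by auto
  then show "iter_pderiv bs (iter_pderiv cs f) differentiable at x"
    "bounded (range (\<lambda>x. norm x ^ k *\<^sub>R iter_pderiv bs (iter_pderiv cs f) x))" for x k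
    using assms(1) unfolding schwartz_def iter_pderiv_append[symmetric] by blast+
qed

lemma schwartz_pderiv:
  assumes "f \<in> schwartz" "b \<in> Basis"
  shows "(\<lambda>x. frechet_derivative f (at x) b) \<in> schwartz"
  using iter_pderiv_schwartz[of f "[b]"] assms by simp

lemma schwartz_continuous: "f \<in> schwartz \<Longrightarrow> continuous_on A f"
  by (meson continuous_at_imp_continuous_on differentiable_imp_continuous_within schwartz_differentiable)

lemma schwartz_borel_measurable: "f \<in> schwartz \<Longrightarrow> f \<in> borel_measurable borel"
  by (rule borel_measurable_continuous_onI) (rule schwartz_continuous)

lemma frechet_derivative_eq: "(f has_derivative f') (at x) \<Longrightarrow> frechet_derivative f (at x) = f'"
  by (rule frechet_derivative_at[symmetric])

lemma schwartz_has_derivative: "f \<in> schwartz \<Longrightarrow> (f has_derivative frechet_derivative f (at x)) (at x)"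
  using schwartz_differentiable frechet_derivative_works by blast

lemma le_schwartz_seminorm:
  assumes f: "f \<in> schwartz" and bs: "set bs \<subseteq> Basis"
  shows "norm x ^ k * norm (iter_pderiv bs f x) \<le> schwartz_seminorm k bs f"
proof -
  have "bounded (range (\<lambda>x. norm x ^ k *\<^sub>R iter_pderiv bs f x))"
    using schwartz_bounded iter_pderiv_schwartz[OF f bs] by blast
  then obtain B where "\<And>x. norm (norm x ^ k *\<^sub>R iter_pderiv bs f x) \<le> B"
    unfolding bounded_iff by blast
  then have "bdd_above (range (\<lambda>x. norm x ^ k * norm (iter_pderiv bs f x)))"
    by (auto intro!: bdd_aboveI[of _ B])
  then show ?thesis
    unfolding schwartz_seminorm_def by (rule cSUP_upper2) auto
qed

lemma schwartz_seminorm_nonneg: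
  assumes "f \<in> schwartz" "set bs \<subseteq> Basis"
  shows "0 \<le> schwartz_seminorm k bs f"
  by (rule order_trans[OF _ le_schwartz_seminorm[OF assms, where x = 0]]) simp

text \<open>
  The exponent \<open>0\<close> is kept on the right since the seminorms come with a power of the norm.
\<close>

lemma one_plus_power_le: "0 \<le> r \<Longrightarrow> (1 + r) ^ K \<le> 2 ^ K * (r ^ 0 + r ^ K)" for r :: real
proof -
  assume "0 \<le> r"
  then have "(1 + r) ^ K \<le> (2 * max 1 r) ^ K" by (intro power_mono) auto
  also have "\<dots> = 2 ^ K * (max 1 r) ^ K" by (simp add: power_mult_distrib)
  also have "\<dots> \<le> 2 ^ K * (r ^ 0 + r ^ K)" using \<open>0 \<le> r\<close> by (auto simp: max_def)
  finally show ?thesis .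
qed

lemma schwartz_decay:
  assumes f: "f \<in> schwartz" and bs: "set bs \<subseteq> Basis"
  shows "(1 + norm x) ^ K * norm (iter_pderiv bs f x)
    \<le> 2 ^ K * (schwartz_seminorm 0 bs f + schwartz_seminorm K bs f)"
proof -
  let ?g = "iter_pderiv bs f"
  have "(1 + norm x) ^ K * norm (?g x) \<le> 2 ^ K * (norm x ^ 0 + norm x ^ K) * norm (?g x)"
    by (intro mult_right_mono one_plus_power_le) auto
  also have "\<dots> = 2 ^ K * (norm x ^ 0 * norm (?g x) + norm x ^ K * norm (?g x))"
    by (simp add: algebra_simps)
  also have "\<dots> \<le> 2 ^ K * (schwartz_seminorm 0 bs f + schwartz_seminorm K bs f)"
    by (intro mult_left_mono add_mono le_schwartz_seminorm f bs) auto
  finally show ?thesis .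
qed

lemma schwartz_decay_ex:
  assumes f: "f \<in> schwartz"
  obtains C where "\<And>x. (1 + norm x) ^ K * norm (f x) \<le> C"
  using schwartz_decay[OF f, of "[]"] by auto

lemma schwartzI_bounded:
  assumes "\<And>k. \<exists>C. \<forall>x. (1 + norm x) ^ k * norm (f x) \<le> C"
  shows "bounded (range (\<lambda>x. norm x ^ k *\<^sub>R f x))"
proof -
  obtain C where C: "\<And>x. (1 + norm x) ^ k * norm (f x) \<le> C" using assms by blast
  have "norm (norm x ^ k *\<^sub>R f x) \<le> C" for x
  proof -
    have "norm x ^ k * norm (f x) \<le> (1 + norm x) ^ k * norm (f x)"
      by (intro mult_right_mono power_mono) auto
    then show ?thesis using C[of x] by simp
  qed
  then show ?thesis by (auto simp: bounded_iff)
qed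

lemma schwartz_lincomb:
  fixes f g :: "'a::euclidean_space \<Rightarrow> complex"
  assumes "f \<in> schwartz" "g \<in> schwartz"
  shows "(\<lambda>x. a * f x + b * g x) \<in> schwartz"
proof (rule schwartz_coinduct[where S = "{\<lambda>x. a * f x + b * g x |f g. f \<in> schwartz \<and> g \<in> schwartz}"])
  show "(\<lambda>x. a * f x + b * g x) \<in> {\<lambda>x. a * f x + b * g x |f g. f \<in> schwartz \<and> g \<in> schwartz}"
    using assms by blast
next
  fix h :: "'a \<Rightarrow> complex" and x v :: 'a
  assume "h \<in> {\<lambda>x. a * f x + b * g x |f g. f \<in> schwartz \<and> g \<in> schwartz}"
  then obtain f g where h: "h = (\<lambda>x. a * f x + b * g x)" and f: "f \<in> schwartz" and g: "g \<in> schwartz"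
    by blast
  have D: "(h has_derivative (\<lambda>v. a * frechet_derivative f (at x) v + b * frechet_derivative g (at x) v)) (at x)" for x
    unfolding h
    by (rule derivative_eq_intros schwartz_has_derivative f g refl)+ simp
  show "h differentiable (at x)" using D by (rule differentiableI)
  assume v: "v \<in> Basis"
  show "(\<lambda>x. frechet_derivative h (at x) v) \<in> {\<lambda>x. a * f x + b * g x |f g. f \<in> schwartz \<and> g \<in> schwartz}"
    unfolding frechet_derivative_eq[OF D]
    using schwartz_pderiv[OF f v] schwartz_pderiv[OF g v]
    by (intro CollectI exI[of _ "\<lambda>x. frechet_derivative f (at x) v"]
        exI[of _ "\<lambda>x. frechet_derivative g (at x) v"]) simp
next
  fix h :: "'a \<Rightarrow> complex" and k
  assume "h \<in> {\<lambda>x. a * f x + b * g x |f g. f \<in> schwartz \<and> g \<in> schwartz}"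
  then obtain f g where h: "h = (\<lambda>x. a * f x + b * g x)" and f: "f \<in> schwartz" and g: "g \<in> schwartz"
    by blast
  obtain A where A: "\<And>x. norm (norm x ^ k *\<^sub>R f x) \<le> A"
    using schwartz_bounded[OF f, of k] unfolding bounded_iff by blast
  obtain B where B: "\<And>x. norm (norm x ^ k *\<^sub>R g x) \<le> B"
    using schwartz_bounded[OF g, of k] unfolding bounded_iff by blast
  have "norm (norm x ^ k *\<^sub>R h x) \<le> norm a * A + norm b * B" for x
  proof -
    have "norm x ^ k *\<^sub>R h x = a * (norm x ^ k *\<^sub>R f x) + b * (norm x ^ k *\<^sub>R g x)"
      unfolding h by (simp add: scaleR_conv_of_real algebra_simps)
    also have "norm \<dots> \<le> norm (a * (norm x ^ k *\<^sub>R f x)) + norm (b * (norm x ^ k *\<^sub>R g x))"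
      by (rule norm_triangle_ineq)
    also have "\<dots> \<le> norm a * A + norm b * B"
      unfolding norm_mult[of a] norm_mult[of b] by (intro add_mono mult_left_mono A B) auto
    finally show ?thesis .
  qed
  then show "bounded (range (\<lambda>x. norm x ^ k *\<^sub>R h x))"
    unfolding bounded_iff by blast
qed

lemma schwartz_add: "f \<in> schwartz \<Longrightarrow> g \<in> schwartz \<Longrightarrow> (\<lambda>x. f x + g x) \<in> schwartz"
  using schwartz_lincomb[of f g 1 1] by simp

lemma schwartz_cmult: "f \<in> schwartz \<Longrightarrow> (\<lambda>x. c * f x) \<in> schwartz"
  using schwartz_lincomb[of f f c 0] by simp

text \<open>
  A derivative of \<open>(x \<bullet> c) * f x\<close> produces the additional term \<open>(b \<bullet> c) * f x\<close>. With an arbitrary second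
  summand \<open>g\<close> the class becomes closed under differentiation.
\<close>

lemma schwartz_mult_coord_add:
  fixes f g :: "'a::euclidean_space \<Rightarrow> complex"
  assumes "f \<in> schwartz" "g \<in> schwartz"
  shows "(\<lambda>x. of_real (x \<bullet> c) * f x + g x) \<in> schwartz"
proof (rule schwartz_coinduct[where S = "{\<lambda>x. of_real (x \<bullet> c) * f x + g x |f g. f \<in> schwartz \<and> g \<in> schwartz}"])
  show "(\<lambda>x. of_real (x \<bullet> c) * f x + g x) \<in> {\<lambda>x. of_real (x \<bullet> c) * f x + g x |f g. f \<in> schwartz \<and> g \<in> schwartz}"
    using assms by blast
next
  fix h :: "'a \<Rightarrow> complex" and x b :: 'a
  assume "h \<in> {\<lambda>x. of_real (x \<bullet> c) * f x + g x |f g. f \<in> schwartz \<and> g \<in> schwartz}"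
  then obtain f g where h: "h = (\<lambda>x. of_real (x \<bullet> c) * f x + g x)" and f: "f \<in> schwartz" and g: "g \<in> schwartz"
    by blast
  have D: "(h has_derivative (\<lambda>v. of_real (x \<bullet> c) * frechet_derivative f (at x) v
       + (of_real (v \<bullet> c) * f x + frechet_derivative g (at x) v))) (at x)" for x
  proof -
    have "((\<lambda>x. complex_of_real (x \<bullet> c)) has_derivative (\<lambda>v. of_real (v \<bullet> c))) (at x)"
      by (auto intro!: derivative_eq_intros)
    from has_derivative_add[OF has_derivative_mult[OF this schwartz_has_derivative[OF f]]
        schwartz_has_derivative[OF g]]
    show ?thesis unfolding h by (simp add: add.assoc)
  qed
  show "h differentiable (at x)" using D by (rule differentiableI)
  assume b: "b \<in> Basis"
  show "(\<lambda>x. frechet_derivative h (at x) b) \<in> {\<lambda>x. of_real (x \<bullet> c) * f x + g x |f g. f \<in> schwartz \<and> g \<in> schwartz}"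
    unfolding frechet_derivative_eq[OF D]
    using schwartz_pderiv[OF f b] schwartz_add[OF schwartz_cmult[OF f, of "of_real (b \<bullet> c)"] schwartz_pderiv[OF g b]]
    by (intro CollectI exI[of _ "\<lambda>x. frechet_derivative f (at x) b"]
        exI[of _ "\<lambda>x. of_real (b \<bullet> c) * f x + frechet_derivative g (at x) b"]) simp
next
  fix h :: "'a \<Rightarrow> complex" and k
  assume "h \<in> {\<lambda>x. of_real (x \<bullet> c) * f x + g x |f g. f \<in> schwartz \<and> g \<in> schwartz}"
  then obtain f g where h: "h = (\<lambda>x. of_real (x \<bullet> c) * f x + g x)" and f: "f \<in> schwartz" and g: "g \<in> schwartz"
    by blast
  obtain A where A: "\<And>x. norm (norm x ^ Suc k *\<^sub>R f x) \<le> A"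
    using schwartz_bounded[OF f, of "Suc k"] unfolding bounded_iff by blast
  obtain B where B: "\<And>x. norm (norm x ^ k *\<^sub>R g x) \<le> B"
    using schwartz_bounded[OF g, of k] unfolding bounded_iff by blast
  have "norm (norm x ^ k *\<^sub>R h x) \<le> norm c * A + B" for x
  proof -
    have "norm (norm x ^ k *\<^sub>R h x) = norm x ^ k * norm (of_real (x \<bullet> c) * f x + g x)"
      unfolding h by simp
    also have "\<dots> \<le> norm x ^ k * (\<bar>x \<bullet> c\<bar> * norm (f x) + norm (g x))"
      by (intro mult_left_mono order_trans[OF norm_triangle_ineq]) (auto simp: norm_mult)
    also have "\<dots> \<le> norm x ^ k * ((norm x * norm c) * norm (f x) + norm (g x))"
      by (intro mult_left_mono add_mono mult_right_mono Cauchy_Schwarz_ineq2) auto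
    also have "\<dots> = norm c * norm (norm x ^ Suc k *\<^sub>R f x) + norm (norm x ^ k *\<^sub>R g x)"
      by (simp add: algebra_simps)
    also have "\<dots> \<le> norm c * A + B"
      by (intro add_mono mult_left_mono A B) auto
    finally show ?thesis .
  qed
  then show "bounded (range (\<lambda>x. norm x ^ k *\<^sub>R h x))"
    unfolding bounded_iff by blast
qed

lemma schwartz_mult_coord: "f \<in> schwartz \<Longrightarrow> (\<lambda>x. of_real (x \<bullet> c) * f x) \<in> schwartz"
  using schwartz_mult_coord_add[of f "\<lambda>x. 0 * f x" c] schwartz_cmult[of f 0] by simp

lemma schwartz_affine:
  fixes f :: "'a::euclidean_space \<Rightarrow> complex" and c :: real
  assumes "f \<in> schwartz" and c: "c \<noteq> 0"
  shows "(\<lambda>x. f (t + c *\<^sub>R x)) \<in> schwartz"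
proof (rule schwartz_coinduct[where S = "{\<lambda>x. f (t + c *\<^sub>R x) |f. f \<in> schwartz}"])
  show "(\<lambda>x. f (t + c *\<^sub>R x)) \<in> {\<lambda>x. f (t + c *\<^sub>R x) |f. f \<in> schwartz}"
    using assms by blast
next
  fix h :: "'a \<Rightarrow> complex" and x v :: 'a
  assume "h \<in> {\<lambda>x. f (t + c *\<^sub>R x) |f. f \<in> schwartz}"
  then obtain f where h: "h = (\<lambda>x. f (t + c *\<^sub>R x))" and f: "f \<in> schwartz"
    by blast
  have D: "(h has_derivative (\<lambda>v. frechet_derivative f (at (t + c *\<^sub>R x)) (c *\<^sub>R v))) (at x)" for x
    unfolding h
    by (rule has_derivative_compose[OF _ schwartz_has_derivative[OF f]])
       (auto intro!: derivative_eq_intros)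
  show "h differentiable (at x)" using D by (rule differentiableI)
  assume v: "v \<in> Basis"
  have lin: "frechet_derivative f (at y) (c *\<^sub>R v) = of_real c * frechet_derivative f (at y) v" for y
    using linear_frechet_derivative[OF schwartz_differentiable[OF f], of y]
    by (simp add: linear_scale scaleR_conv_of_real)
  show "(\<lambda>x. frechet_derivative h (at x) v) \<in> {\<lambda>x. f (t + c *\<^sub>R x) |f. f \<in> schwartz}"
    unfolding frechet_derivative_eq[OF D] lin
    using schwartz_cmult[OF schwartz_pderiv[OF f v], of c]
    by (intro CollectI exI[of _ "\<lambda>y. of_real c * frechet_derivative f (at y) v"]) simp
next
  fix h :: "'a \<Rightarrow> complex" and k
  assume "h \<in> {\<lambda>x. f (t + c *\<^sub>R x) |f. f \<in> schwartz}"
  then obtain f where h: "h = (\<lambda>x. f (t + c *\<^sub>R x))" and f: "f \<in> schwartz"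
    by blast
  obtain A where A: "\<And>x. (1 + norm x) ^ k * norm (f x) \<le> A"
    using schwartz_decay_ex[OF f] by blast
  \<comment> \<open>the ratio by which the weight \<open>1 + norm\<close> changes under the affine map\<close>
  define R where "R = (1 + norm t) / \<bar>c\<bar>"
  have "norm (norm x ^ k *\<^sub>R h x) \<le> R ^ k * A" for x
  proof -
    have "\<bar>c\<bar> * norm x \<le> norm t + norm (t + c *\<^sub>R x)"
      using norm_triangle_ineq4[of "t + c *\<^sub>R x" t] by simp
    also have "\<dots> \<le> (1 + norm t) * (1 + norm (t + c *\<^sub>R x))"
      by (simp add: algebra_simps)
    finally have "norm x \<le> R * (1 + norm (t + c *\<^sub>R x))"
      using c by (simp add: R_def field_simps)
    then have "norm x ^ k \<le> R ^ k * (1 + norm (t + c *\<^sub>R x)) ^ k"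
      by (simp add: power_mono flip: power_mult_distrib)
    then have "norm (norm x ^ k *\<^sub>R h x) \<le> R ^ k * (1 + norm (t + c *\<^sub>R x)) ^ k * norm (h x)"
      by (simp add: mult_right_mono)
    also have "\<dots> \<le> R ^ k * A"
      using A[of "t + c *\<^sub>R x"] by (simp add: h mult_left_mono R_def mult.assoc)
    finally show ?thesis .
  qed
  then show "bounded (range (\<lambda>x. norm x ^ k *\<^sub>R h x))"
    unfolding bounded_iff by blast
qed

lemma schwartz_uminus: "f \<in> schwartz \<Longrightarrow> (\<lambda>x. f (- x)) \<in> schwartz"
  using schwartz_affine[of f "-1" 0] by simp

text \<open>
  Polynomial multiples of a Gaussian, generated by just those operations that differentiation brings in.
\<close>

inductive_set gaussian_class :: "real \<Rightarrow> 'a::euclidean_space \<Rightarrow> ('a \<Rightarrow> complex) set" for n :: real and c where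
  base: "(\<lambda>x. of_real (exp (- n * (norm (x - c))\<^sup>2))) \<in> gaussian_class n c"
| add: "f \<in> gaussian_class n c \<Longrightarrow> g \<in> gaussian_class n c \<Longrightarrow> (\<lambda>x. f x + g x) \<in> gaussian_class n c"
| mult: "f \<in> gaussian_class n c \<Longrightarrow> (\<lambda>x. of_real (r * ((x - c) \<bullet> b)) * f x) \<in> gaussian_class n c"
| smult: "f \<in> gaussian_class n c \<Longrightarrow> (\<lambda>x. of_real r * f x) \<in> gaussian_class n c"

lemma gaussian_class_derivative:
  assumes "f \<in> gaussian_class n c"
  shows "\<exists>f'. (\<forall>x. (f has_derivative f' x) (at x)) \<and> (\<forall>v. (\<lambda>x. f' x v) \<in> gaussian_class n c)"
  using assms
proof induction
  case base
  let ?g = "\<lambda>x. complex_of_real (exp (- n * (norm (x - c))\<^sup>2))"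
  have "(?g has_derivative (\<lambda>v. of_real (- 2 * n * ((x - c) \<bullet> v)) * ?g x)) (at x)" for x
    unfolding power2_norm_eq_inner
    by (rule derivative_eq_intros refl)+ (auto simp: inner_commute algebra_simps)
  then show ?case
    by (intro exI[of _ "\<lambda>x v. of_real (- 2 * n * ((x - c) \<bullet> v)) * ?g x"] conjI allI
        gaussian_class.mult gaussian_class.base) auto
next
  case (add f g)
  then obtain f' g' where "\<forall>x. (f has_derivative f' x) (at x)" "\<forall>v. (\<lambda>x. f' x v) \<in> gaussian_class n c"
    "\<forall>x. (g has_derivative g' x) (at x)" "\<forall>v. (\<lambda>x. g' x v) \<in> gaussian_class n c" by blast
  then show ?case
    by (intro exI[of _ "\<lambda>x v. f' x v + g' x v"] conjI allI gaussian_class.add)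
       (auto intro!: derivative_eq_intros)
next
  case (mult f r b)
  then obtain f' where f': "\<forall>x. (f has_derivative f' x) (at x)" "\<forall>v. (\<lambda>x. f' x v) \<in> gaussian_class n c"
    by blast
  have "((\<lambda>x. of_real (r * ((x - c) \<bullet> b)) * f x) has_derivative
      (\<lambda>v. of_real (r * ((x - c) \<bullet> b)) * f' x v + of_real (r * (v \<bullet> b)) * f x)) (at x)" for x
    by (rule derivative_eq_intros f'(1)[rule_format] refl)+ simp
  then show ?case
    using f'(2) mult(1)
    by (intro exI[of _ "\<lambda>x v. of_real (r * ((x - c) \<bullet> b)) * f' x v + of_real (r * (v \<bullet> b)) * f x"]
        conjI allI gaussian_class.add gaussian_class.mult gaussian_class.smult) auto
next
  case (smult f r)
  then obtain f' where f': "\<forall>x. (f has_derivative f' x) (at x)" "\<forall>v. (\<lambda>x. f' x v) \<in> gaussian_class n c"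
    by blast
  then show ?case
    by (intro exI[of _ "\<lambda>x v. of_real r * f' x v"] conjI allI gaussian_class.smult)
       (auto intro!: derivative_eq_intros)
qed

lemma power_mult_exp_bounded:
  assumes n: "0 < (n::real)"
  shows "\<exists>C. \<forall>r\<ge>0. (1 + r) ^ k * exp (- n * r\<^sup>2) \<le> C"
proof -
  have "((\<lambda>r::real. (1 + r) ^ k * exp (- n * r\<^sup>2)) \<longlongrightarrow> 0) at_top"
    using n by real_asymp
  then have "\<forall>\<^sub>F r in at_top. (1 + r) ^ k * exp (- n * r\<^sup>2) < 1"
    by (rule order_tendstoD) simp
  then obtain R where R: "\<And>r. r \<ge> R \<Longrightarrow> (1 + r) ^ k * exp (- n * r\<^sup>2) < 1"
    by (auto simp: eventually_at_top_linorder)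
  have "(1 + r) ^ k * exp (- n * r\<^sup>2) \<le> max 1 ((1 + \<bar>R\<bar>) ^ k)" if "r \<ge> 0" for r
  proof (cases "r \<ge> R")
    case True
    show ?thesis by (rule order_trans[OF less_imp_le[OF R[OF True]]]) simp
  next
    case False
    have "(1 + r) ^ k * exp (- n * r\<^sup>2) \<le> (1 + \<bar>R\<bar>) ^ k * 1"
      using that n False by (intro mult_mono power_mono) auto
    then show ?thesis by simp
  qed
  then show ?thesis by blast
qed

text \<open>
  The power is arbitrary in the induction: a linear factor is absorbed by raising it by one.
\<close>

lemma gaussian_class_decay:
  assumes "f \<in> gaussian_class n c" and n: "0 < n"
  shows "\<exists>C. \<forall>x. (1 + norm (x - c)) ^ k * norm (f x) \<le> C"
  using assms(1)
proof (induction arbitrary: k)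
  case base
  obtain C where "\<forall>r\<ge>0. (1 + r) ^ k * exp (- n * r\<^sup>2) \<le> C"
    using power_mult_exp_bounded[OF n] by blast
  then show ?case by (intro exI[of _ C]) auto
next
  case (add f g)
  obtain A where A: "\<And>x. (1 + norm (x - c)) ^ k * norm (f x) \<le> A" using add by blast
  obtain B where B: "\<And>x. (1 + norm (x - c)) ^ k * norm (g x) \<le> B" using add by blast
  have "(1 + norm (x - c)) ^ k * norm (f x + g x) \<le> A + B" for x
  proof -
    have "(1 + norm (x - c)) ^ k * norm (f x + g x) \<le> (1 + norm (x - c)) ^ k * (norm (f x) + norm (g x))"
      by (intro mult_left_mono norm_triangle_ineq) auto
    then show ?thesis using A[of x] B[of x] by (simp add: algebra_simps)
  qed
  then show ?case by blast
next
  case (mult f r b)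
  obtain A where A: "\<And>x. (1 + norm (x - c)) ^ Suc k * norm (f x) \<le> A" using mult(2) by blast
  have "(1 + norm (x - c)) ^ k * norm (of_real (r * ((x - c) \<bullet> b)) * f x) \<le> \<bar>r\<bar> * norm b * A" for x
  proof -
    have "\<bar>(x - c) \<bullet> b\<bar> \<le> norm (x - c) * norm b" by (rule Cauchy_Schwarz_ineq2)
    also have "\<dots> \<le> (1 + norm (x - c)) * norm b" by (intro mult_right_mono) auto
    finally have "(1 + norm (x - c)) ^ k * (\<bar>r\<bar> * \<bar>(x - c) \<bullet> b\<bar> * norm (f x))
        \<le> (1 + norm (x - c)) ^ k * (\<bar>r\<bar> * ((1 + norm (x - c)) * norm b) * norm (f x))"
      by (intro mult_left_mono mult_right_mono) auto
    also have "\<dots> = \<bar>r\<bar> * norm b * ((1 + norm (x - c)) ^ Suc k * norm (f x))"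
      by (simp add: algebra_simps)
    also have "\<dots> \<le> \<bar>r\<bar> * norm b * A"
      by (intro mult_left_mono A) auto
    finally show ?thesis by (simp add: norm_mult abs_mult)
  qed
  then show ?case by blast
next
  case (smult f r)
  obtain A where A: "\<And>x. (1 + norm (x - c)) ^ k * norm (f x) \<le> A" using smult by blast
  have "(1 + norm (x - c)) ^ k * norm (of_real r * f x) \<le> \<bar>r\<bar> * A" for x
    using mult_left_mono[OF A[of x], of "\<bar>r\<bar>"] by (simp add: norm_mult mult_ac)
  then show ?case by blast
qed

lemma gaussian_schwartz:
  assumes n: "0 < n"
  shows "(\<lambda>x. complex_of_real (exp (- n * (norm (x - c))\<^sup>2))) \<in> schwartz"
proof (rule schwartz_coinduct[where S = "gaussian_class n c"])
  show "(\<lambda>x. complex_of_real (exp (- n * (norm (x - c))\<^sup>2))) \<in> gaussian_class n c"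
    by (rule gaussian_class.base)
next
  fix f x b assume f: "f \<in> gaussian_class n c"
  then obtain f' where f': "\<And>x. (f has_derivative f' x) (at x)" "\<And>v. (\<lambda>x. f' x v) \<in> gaussian_class n c"
    using gaussian_class_derivative by blast
  show "f differentiable (at x)" using f'(1) by (rule differentiableI)
  show "(\<lambda>x. frechet_derivative f (at x) b) \<in> gaussian_class n c"
    unfolding frechet_derivative_eq[OF f'(1)] by (rule f')
next
  fix f k assume f: "f \<in> gaussian_class n c"
  show "bounded (range (\<lambda>x. norm x ^ k *\<^sub>R f x))"
  proof (rule schwartzI_bounded)
    fix k
    obtain A where A: "\<And>x. (1 + norm (x - c)) ^ k * norm (f x) \<le> A"
      using gaussian_class_decay[OF f n] by blast
    have "(1 + norm x) ^ k * norm (f x) \<le> (1 + norm c) ^ k * A" for x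
    proof -
      have "1 + norm x \<le> 1 + (norm (x - c) + norm c)"
        using norm_triangle_ineq[of "x - c" c] by simp
      also have "\<dots> \<le> (1 + norm c) * (1 + norm (x - c))" by (simp add: algebra_simps)
      finally have "(1 + norm x) ^ k \<le> (1 + norm c) ^ k * (1 + norm (x - c)) ^ k"
        by (simp add: power_mono flip: power_mult_distrib)
      then have "(1 + norm x) ^ k * norm (f x) \<le> (1 + norm c) ^ k * (1 + norm (x - c)) ^ k * norm (f x)"
        by (intro mult_right_mono) auto
      also have "\<dots> \<le> (1 + norm c) ^ k * A"
        using A[of x] by (simp add: mult_left_mono mult.assoc)
      finally show ?thesis .
    qed
    then show "\<exists>C. \<forall>x. (1 + norm x) ^ k * norm (f x) \<le> C" by blast
  qed
qed

section \<open>The Fourier transform on Schwartz functions\<close>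

lemma norm_exp_ii: "norm (exp (2 * of_real pi * \<i> * of_real r)) = 1" "norm (exp (- 2 * of_real pi * \<i> * of_real r)) = 1"
  by (simp_all add: norm_exp_eq_Re)

lemma exp_inner_has_derivative:
  fixes c :: complex and u :: "'a::euclidean_space"
  shows "((\<lambda>x. exp (c * of_real (u \<bullet> x))) has_derivative
     (\<lambda>v. exp (c * of_real (u \<bullet> y)) * (c * of_real (u \<bullet> v)))) (at y)"
proof -
  have "((\<lambda>x. c * of_real (u \<bullet> x)) has_derivative (\<lambda>v. c * of_real (u \<bullet> v))) (at y)"
    by (auto intro!: derivative_eq_intros)
  moreover have "(exp has_derivative (*) (exp (c * of_real (u \<bullet> y)))) (at (c * of_real (u \<bullet> y)))"
    using DERIV_exp unfolding has_field_derivative_def .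
  ultimately show ?thesis
    by (rule has_derivative_compose)
qed

lemma integrable_of_decay:
  fixes f :: "'a::euclidean_space \<Rightarrow> complex"
  assumes f: "f \<in> borel_measurable borel" and b: "\<And>x. (1 + norm x) ^ (2 * DIM('a)) * norm (f x) \<le> C"
  shows "integrable lborel f"
    and "(LINT x|lborel. norm (f x)) \<le> C * (\<integral>x. inverse ((1 + norm (x::'a)) ^ (2 * DIM('a))) \<partial>lborel)"
proof -
  have b': "norm (f x) \<le> C * inverse ((1 + norm x) ^ (2 * DIM('a)))" for x
  proof -
    have "0 < (1 + norm x) ^ (2 * DIM('a))" by (smt (verit) norm_ge_zero zero_less_power)
    then show ?thesis using b[of x] by (simp add: field_simps)
  qed
  have C: "integrable lborel (\<lambda>x::'a. C * inverse ((1 + norm x) ^ (2 * DIM('a))))"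
    by (intro integrable_mult_right integrable_inverse_one_plus_norm_power)
  show I: "integrable lborel f"
    by (rule Bochner_Integration.integrable_bound[OF C])
       (use f in \<open>auto intro!: AE_I2 order_trans[OF b'] simp del: abs_mult abs_inverse\<close>)
  have "(LINT x|lborel. norm (f x)) \<le> (\<integral>x. C * inverse ((1 + norm (x::'a)) ^ (2 * DIM('a))) \<partial>lborel)"
    by (rule integral_mono[OF integrable_norm[OF I] C b'])
  then show "(LINT x|lborel. norm (f x)) \<le> C * (\<integral>x. inverse ((1 + norm (x::'a)) ^ (2 * DIM('a))) \<partial>lborel)"
    by simp
qed

text \<open>
  The bound depends on \<open>f\<close> only through \<open>C\<close>, hence through finitely many seminorms if \<open>f\<close> is a Schwartz
  function. This gives the continuity of the distributions below.
\<close>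

lemma weighted_integral:
  fixes f m :: "'a::euclidean_space \<Rightarrow> complex"
  assumes f: "f \<in> borel_measurable borel" and m: "m \<in> borel_measurable borel"
    and bm: "\<And>x. norm (m x) \<le> A * (1 + norm x) ^ j"
    and bf: "\<And>x. (1 + norm x) ^ (2 * DIM('a) + j) * norm (f x) \<le> C"
  shows "integrable lborel (\<lambda>x. m x * f x)"
    and "norm (LINT x|lborel. m x * f x) \<le> A * C * (\<integral>x. inverse ((1 + norm (x::'a)) ^ (2 * DIM('a))) \<partial>lborel)"
proof -
  have A: "0 \<le> A" using order_trans[OF norm_ge_zero bm[of 0]] by simp
  have b: "(1 + norm x) ^ (2 * DIM('a)) * norm (m x * f x) \<le> A * C" for x
  proof -
    have "(1 + norm x) ^ (2 * DIM('a)) * norm (m x * f x)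
        \<le> (1 + norm x) ^ (2 * DIM('a)) * (A * (1 + norm x) ^ j * norm (f x))"
      unfolding norm_mult by (intro mult_left_mono mult_right_mono bm) auto
    also have "\<dots> = A * ((1 + norm x) ^ (2 * DIM('a) + j) * norm (f x))"
      by (simp add: power_add)
    also have "\<dots> \<le> A * C" by (intro mult_left_mono bf A)
    finally show ?thesis .
  qed
  have mf: "(\<lambda>x. m x * f x) \<in> borel_measurable borel"
    using m f by (rule borel_measurable_times)
  show "integrable lborel (\<lambda>x. m x * f x)"
    by (rule integrable_of_decay(1)[OF mf b])
  show "norm (LINT x|lborel. m x * f x) \<le> A * C * (\<integral>x. inverse ((1 + norm (x::'a)) ^ (2 * DIM('a))) \<partial>lborel)"
    by (rule order_trans[OF integral_norm_bound integrable_of_decay(2)[OF mf b]])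
qed

lemma schwartz_integrable:
  fixes f :: "'a::euclidean_space \<Rightarrow> complex"
  assumes f: "f \<in> schwartz"
  shows "integrable lborel f"
proof -
  obtain C where "\<And>x. (1 + norm x) ^ (2 * DIM('a)) * norm (f x) \<le> C"
    using schwartz_decay_ex[OF f] by blast
  then show ?thesis
    by (rule integrable_of_decay(1)[OF schwartz_borel_measurable[OF f]])
qed

lemma schwartz_weighted_integrable:
  fixes f :: "'a::euclidean_space \<Rightarrow> complex"
  assumes f: "f \<in> schwartz" and m: "m \<in> borel_measurable borel" and b: "\<And>x. norm (m x) \<le> A * (1 + norm x) ^ j"
  shows "integrable lborel (\<lambda>x. m x * f x)"
proof -
  obtain C where "\<And>x. (1 + norm x) ^ (2 * DIM('a) + j) * norm (f x) \<le> C"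
    using schwartz_decay_ex[OF f] by blast
  then show ?thesis
    by (rule weighted_integral(1)[OF schwartz_borel_measurable[OF f] m b])
qed

lemma fourier_eq_inv_fourier: "fourier f \<zeta> = inv_fourier f (- \<zeta>)"
  unfolding fourier_def inv_fourier_def
  by (intro Bochner_Integration.integral_cong refl) (simp only: inner_commute[of _ "- \<zeta>"] inner_minus_left of_real_minus
      mult_minus_left mult_minus_right)

lemma inv_fourier_eq_fourier: "inv_fourier f x = fourier f (- x)"
  by (simp add: fourier_eq_inv_fourier)

lemma norm_fourier_le: "norm (fourier f \<zeta>) \<le> (LINT x|lborel. norm (f x))"
  unfolding fourier_def
  by (rule order_trans[OF integral_norm_bound]) (simp add: norm_mult norm_exp_eq_Re)

lemma exp_mult_integrable:
  fixes f :: "'a::euclidean_space \<Rightarrow> complex"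
  assumes "integrable lborel f"
  shows "integrable lborel (\<lambda>\<zeta>. exp (2 * of_real pi * \<i> * of_real (\<zeta> \<bullet> X)) * f \<zeta>)"
proof -
  note [measurable] = borel_measurable_integrable[OF assms]
  show ?thesis
    by (rule Bochner_Integration.integrable_bound[OF assms]) (auto simp: norm_mult norm_exp_eq_Re)
qed

lemma inv_fourier_lincomb:
  assumes "integrable lborel f" "integrable lborel g"
  shows "inv_fourier (\<lambda>x. c * f x + d * g x) X = c * inv_fourier f X + d * inv_fourier g X"
proof -
  let ?e = "\<lambda>\<zeta>. exp (2 * of_real pi * \<i> * of_real (\<zeta> \<bullet> X)) :: complex"
  note i = exp_mult_integrable[OF assms(1), of X] exp_mult_integrable[OF assms(2), of X]
  have "?e \<zeta> * (c * f \<zeta> + d * g \<zeta>) = c * (?e \<zeta> * f \<zeta>) + d * (?e \<zeta> * g \<zeta>)" for \<zeta>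
    by (simp only: distrib_left mult.left_commute)
  then show ?thesis
    unfolding inv_fourier_def by (simp only: integral_lincomb[OF i])
qed

text \<open>
  The first moment of \<open>f\<close> dominates the derivative of the integrand.
\<close>

lemma inv_fourier_has_derivative:
  fixes f :: "'a::euclidean_space \<Rightarrow> complex"
  assumes f: "integrable lborel f" and f1: "integrable lborel (\<lambda>x. of_real (norm x) * f x)"
  shows "(inv_fourier f has_derivative
     (\<lambda>v. inv_fourier (\<lambda>\<zeta>. 2 * of_real pi * \<i> * of_real (\<zeta> \<bullet> v) * f \<zeta>) X)) (at X)"
proof -
  have [measurable]: "f \<in> borel_measurable borel"
    using f by (auto dest: borel_measurable_integrable)
  let ?e = "\<lambda>X \<zeta>. exp (2 * of_real pi * \<i> * of_real (\<zeta> \<bullet> X)) :: complex"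
  have "((\<lambda>X. LINT \<zeta>|lborel. ?e X \<zeta> * f \<zeta>) has_derivative
      (\<lambda>v. LINT \<zeta>|lborel. ?e X \<zeta> * (2 * of_real pi * \<i> * of_real (\<zeta> \<bullet> v) * f \<zeta>))) (at X)"
  proof (rule has_derivative_integral[where S = UNIV and g = "\<lambda>\<zeta>. 2 * pi * norm (of_real (norm \<zeta>) * f \<zeta>)"
        and f' = "\<lambda>X \<zeta> v. ?e X \<zeta> * (2 * of_real pi * \<i> * of_real (\<zeta> \<bullet> v) * f \<zeta>)"])
    show "integrable lborel (\<lambda>\<zeta>. ?e y \<zeta> * f \<zeta>)" for y
      by (rule Bochner_Integration.integrable_bound[OF f]) (auto simp: norm_mult norm_exp_eq_Re)
    have "((\<lambda>X. ?e X \<zeta> * f \<zeta>) has_derivative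
        (\<lambda>v. ?e y \<zeta> * (2 * of_real pi * \<i> * of_real (\<zeta> \<bullet> v) * f \<zeta>))) (at y)" for y \<zeta>
      using has_derivative_mult_left[OF exp_inner_has_derivative[of "2 * of_real pi * \<i>" \<zeta> y], of "f \<zeta>"]
      by (simp only: mult_ac)
    then show "AE \<zeta> in lborel. \<forall>y\<in>UNIV. ((\<lambda>X. ?e X \<zeta> * f \<zeta>) has_derivative
        (\<lambda>v. ?e y \<zeta> * (2 * of_real pi * \<i> * of_real (\<zeta> \<bullet> v) * f \<zeta>))) (at y)"
      by blast
    have "norm (?e y \<zeta> * (2 * of_real pi * \<i> * of_real (\<zeta> \<bullet> v) * f \<zeta>))
        \<le> 2 * pi * norm (of_real (norm \<zeta>) * f \<zeta>) * norm v" for y \<zeta> v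
    proof -
      have "norm (?e y \<zeta> * (2 * of_real pi * \<i> * of_real (\<zeta> \<bullet> v) * f \<zeta>)) = 2 * pi * \<bar>\<zeta> \<bullet> v\<bar> * norm (f \<zeta>)"
        by (simp add: norm_mult norm_exp_eq_Re)
      also have "\<dots> \<le> 2 * pi * (norm \<zeta> * norm v) * norm (f \<zeta>)"
        by (intro mult_left_mono mult_right_mono Cauchy_Schwarz_ineq2) auto
      finally show ?thesis by (simp add: norm_mult mult_ac)
    qed
    then show "AE \<zeta> in lborel. \<forall>y\<in>UNIV. \<forall>v. norm (?e y \<zeta> * (2 * of_real pi * \<i> * of_real (\<zeta> \<bullet> v) * f \<zeta>))
        \<le> 2 * pi * norm (of_real (norm \<zeta>) * f \<zeta>) * norm v"
      by blast
    show "integrable lborel (\<lambda>\<zeta>. 2 * pi * norm (of_real (norm \<zeta>) * f \<zeta>))"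
      using f1 by (intro integrable_mult_right integrable_norm)
  qed auto
  then show ?thesis
    unfolding inv_fourier_def .
qed

lemma fourier_has_derivative:
  fixes f :: "'a::euclidean_space \<Rightarrow> complex"
  assumes f: "integrable lborel f" and f1: "integrable lborel (\<lambda>x. of_real (norm x) * f x)"
  shows "(fourier f has_derivative
     (\<lambda>v. fourier (\<lambda>x. - 2 * of_real pi * \<i> * of_real (x \<bullet> v) * f x) \<zeta>)) (at \<zeta>)"
proof -
  have "((\<lambda>\<zeta>. inv_fourier f (- \<zeta>)) has_derivative
      (\<lambda>v. inv_fourier (\<lambda>x. 2 * of_real pi * \<i> * of_real (x \<bullet> (- v)) * f x) (- \<zeta>))) (at \<zeta>)"
    by (rule has_derivative_compose[OF _ inv_fourier_has_derivative[OF f f1]])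
       (auto intro!: derivative_eq_intros)
  then show ?thesis
    unfolding fourier_eq_inv_fourier by simp
qed

text \<open>
  The integral of \<open>g (r *\<^sub>R b + x)\<close> does not depend on \<open>r\<close>. Its derivative at \<open>r = 0\<close> is the integral of
  the directional derivative, so integration by parts on the whole space needs no iterated integrals.
\<close>

lemma integral_directional_derivative_eq_0:
  fixes g :: "'a::euclidean_space \<Rightarrow> complex"
  assumes der: "\<And>x. (g has_derivative g' x) (at x)"
    and g: "\<And>x. (1 + norm x) ^ (2 * DIM('a)) * norm (g x) \<le> A"
    and g': "\<And>x. (1 + norm x) ^ (2 * DIM('a)) * norm (g' x b) \<le> B"
    and meas: "(\<lambda>x. g' x b) \<in> borel_measurable borel"
    and b: "norm b = 1"
  shows "(LINT x|lborel. g' x b) = 0"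
proof -
  have "continuous_on UNIV g"
    by (intro continuous_at_imp_continuous_on ballI has_derivative_continuous[OF der])
  then have [measurable]: "g \<in> borel_measurable borel"
    by (rule borel_measurable_continuous_onI)
  have ig: "integrable lborel g"
    by (rule integrable_of_decay(1)) (use g in auto)
  have B: "0 \<le> B"
    using order_trans[OF norm_ge_zero g'[of 0, simplified]] .
  have "((\<lambda>r. LINT x|lborel. g (r *\<^sub>R b + x)) has_derivative
      (\<lambda>h. LINT x|lborel. h *\<^sub>R g' (0 *\<^sub>R b + x) b)) (at (0::real))"
  proof (rule has_derivative_integral[where S = "ball 0 1" and f' = "\<lambda>r x h. h *\<^sub>R g' (r *\<^sub>R b + x) b"
        and g = "\<lambda>x. 2 ^ (2 * DIM('a)) * B * inverse ((1 + norm x) ^ (2 * DIM('a)))"])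
    show "integrable lborel (\<lambda>x. g (r *\<^sub>R b + x))" for r
      using integrable_lborel_affine[OF ig, of 1 "r *\<^sub>R b"] by simp
    have "((\<lambda>r. g (r *\<^sub>R b + x)) has_derivative (\<lambda>h. h *\<^sub>R g' (r *\<^sub>R b + x) b)) (at r)" for x r
    proof -
      have "((\<lambda>r. g (r *\<^sub>R b + x)) has_derivative (\<lambda>h. g' (r *\<^sub>R b + x) (h *\<^sub>R b))) (at r)"
        by (rule has_derivative_compose[OF _ der]) (auto intro!: derivative_eq_intros)
      then show ?thesis
        using has_derivative_linear[OF der] by (simp add: linear_scale)
    qed
    then show "AE x in lborel. \<forall>r\<in>ball 0 1. ((\<lambda>r. g (r *\<^sub>R b + x)) has_derivative (\<lambda>h. h *\<^sub>R g' (r *\<^sub>R b + x) b)) (at r)"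
      by blast
    \<comment> \<open>a translation by at most \<open>1\<close> changes the weight \<open>1 + norm x\<close> by at most a factor \<open>2\<close>\<close>
    have "norm (g' (r *\<^sub>R b + x) b) \<le> 2 ^ (2 * DIM('a)) * B * inverse ((1 + norm x) ^ (2 * DIM('a)))"
      if "r \<in> ball 0 1" for r x
    proof -
      have "norm x \<le> norm (r *\<^sub>R b + x) + norm (r *\<^sub>R b)"
        using norm_triangle_ineq4[of "r *\<^sub>R b + x" "r *\<^sub>R b"] by simp
      also have "norm (r *\<^sub>R b) \<le> 1" using that b by simp
      finally have "1 + norm x \<le> 2 * (1 + norm (r *\<^sub>R b + x))"
        by (smt (verit) norm_ge_zero)
      then have "(1 + norm x) ^ (2 * DIM('a)) \<le> 2 ^ (2 * DIM('a)) * (1 + norm (r *\<^sub>R b + x)) ^ (2 * DIM('a))"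
        unfolding power_mult_distrib[symmetric] by (intro power_mono) auto
      then have "(1 + norm x) ^ (2 * DIM('a)) * norm (g' (r *\<^sub>R b + x) b)
          \<le> 2 ^ (2 * DIM('a)) * (1 + norm (r *\<^sub>R b + x)) ^ (2 * DIM('a)) * norm (g' (r *\<^sub>R b + x) b)"
        by (intro mult_right_mono) auto
      also have "\<dots> \<le> 2 ^ (2 * DIM('a)) * B"
        using g'[of "r *\<^sub>R b + x"] by (simp add: mult.assoc mult_left_mono)
      finally have *: "(1 + norm x) ^ (2 * DIM('a)) * norm (g' (r *\<^sub>R b + x) b) \<le> 2 ^ (2 * DIM('a)) * B" .
      have "0 < (1 + norm x) ^ (2 * DIM('a))" by (smt (verit) norm_ge_zero zero_less_power)
      then show ?thesis using * by (simp add: field_simps)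
    qed
    note bnd = this
    have "norm (h *\<^sub>R g' (r *\<^sub>R b + x) b) \<le> 2 ^ (2 * DIM('a)) * B * inverse ((1 + norm x) ^ (2 * DIM('a))) * norm h"
      if "r \<in> ball 0 1" for r x h
      unfolding norm_scaleR real_norm_def
      by (subst mult.commute) (rule mult_right_mono[OF bnd[OF that] abs_ge_zero])
    then show "AE x in lborel. \<forall>r\<in>ball 0 1. \<forall>h. norm (h *\<^sub>R g' (r *\<^sub>R b + x) b)
        \<le> 2 ^ (2 * DIM('a)) * B * inverse ((1 + norm x) ^ (2 * DIM('a))) * norm h"
      by blast
    show "integrable lborel (\<lambda>x::'a. 2 ^ (2 * DIM('a)) * B * inverse ((1 + norm x) ^ (2 * DIM('a))))"
      by (intro integrable_mult_right integrable_inverse_one_plus_norm_power)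
    show "(\<lambda>x. h *\<^sub>R g' (0 *\<^sub>R b + x) b) \<in> borel_measurable lborel" for h
      using meas by simp
  qed auto
  moreover have "(\<lambda>r. LINT x|lborel. g (r *\<^sub>R b + x)) = (\<lambda>r. LINT x|lborel. g x)"
    using integral_lborel_affine[of g 1] by simp
  ultimately have "((\<lambda>r::real. LINT x|lborel. g x) has_derivative (\<lambda>h. LINT x|lborel. h *\<^sub>R g' x b)) (at 0)"
    by simp
  moreover have "((\<lambda>r::real. LINT x|lborel. g x) has_derivative (\<lambda>h. 0)) (at 0)"
    by simp
  ultimately have "(\<lambda>h. LINT x|lborel. h *\<^sub>R g' x b) = (\<lambda>h::real. 0)"
    by (rule has_derivative_unique)
  from fun_cong[OF this, of 1] show ?thesis by simp
qed

text \<open>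
  Integrate the derivative of the product of \<open>f\<close> with the exponential.
\<close>

lemma fourier_pderiv:
  fixes f :: "'a::euclidean_space \<Rightarrow> complex"
  assumes f: "f \<in> schwartz" and b: "b \<in> Basis"
  shows "fourier (\<lambda>x. frechet_derivative f (at x) b) \<zeta> = 2 * of_real pi * \<i> * of_real (\<zeta> \<bullet> b) * fourier f \<zeta>"
proof -
  let ?e = "\<lambda>x. exp (- 2 * of_real pi * \<i> * of_real (\<zeta> \<bullet> x)) :: complex"
  let ?c = "\<lambda>v. - 2 * of_real pi * \<i> * of_real (\<zeta> \<bullet> v) :: complex"
  let ?f' = "\<lambda>x. frechet_derivative f (at x)"
  note f'b = schwartz_pderiv[OF f b]
  have [measurable]: "f \<in> borel_measurable borel" "(\<lambda>x. ?f' x b) \<in> borel_measurable borel"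
    using f f'b schwartz_borel_measurable by auto
  obtain A where A: "\<And>x. (1 + norm x) ^ (2 * DIM('a)) * norm (f x) \<le> A"
    using schwartz_decay_ex[OF f] by blast
  obtain B where B: "\<And>x. (1 + norm x) ^ (2 * DIM('a)) * norm (?f' x b) \<le> B"
    using schwartz_decay_ex[OF f'b] by blast
  have "(LINT x|lborel. ?e x * ?f' x b + ?e x * ?c b * f x) = 0"
  proof (rule integral_directional_derivative_eq_0[where g = "\<lambda>x. ?e x * f x" and g' = "\<lambda>x v. ?e x * ?f' x v + ?e x * ?c v * f x"
        and A = A and B = "B + norm (?c b) * A"])
    fix x
    have "(?e has_derivative (\<lambda>v. ?e x * ?c v)) (at x)"
      by (rule exp_inner_has_derivative)
    from has_derivative_mult[OF this schwartz_has_derivative[OF f]]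
    show "((\<lambda>x. ?e x * f x) has_derivative (\<lambda>v. ?e x * ?f' x v + ?e x * ?c v * f x)) (at x)" .
    show "(1 + norm x) ^ (2 * DIM('a)) * norm (?e x * f x) \<le> A"
      using A[of x] by (simp add: norm_mult norm_exp_eq_Re)
    have "norm (?e x * ?f' x b + ?e x * ?c b * f x) \<le> norm (?f' x b) + norm (?c b) * norm (f x)"
      by (rule order_trans[OF norm_triangle_ineq]) (simp add: norm_mult norm_exp_eq_Re)
    then have "(1 + norm x) ^ (2 * DIM('a)) * norm (?e x * ?f' x b + ?e x * ?c b * f x)
        \<le> (1 + norm x) ^ (2 * DIM('a)) * (norm (?f' x b) + norm (?c b) * norm (f x))"
      by (intro mult_left_mono) auto
    also have "\<dots> = (1 + norm x) ^ (2 * DIM('a)) * norm (?f' x b) + norm (?c b) * ((1 + norm x) ^ (2 * DIM('a)) * norm (f x))"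
      by (simp only: distrib_left mult.left_commute)
    also have "\<dots> \<le> B + norm (?c b) * A"
      by (intro add_mono mult_left_mono A B) auto
    finally show "(1 + norm x) ^ (2 * DIM('a)) * norm (?e x * ?f' x b + ?e x * ?c b * f x) \<le> B + norm (?c b) * A" .
  qed (use b in auto)
  moreover have "integrable lborel (\<lambda>x. ?e x * ?f' x b)" "integrable lborel (\<lambda>x. ?e x * ?c b * f x)"
  proof -
    show "integrable lborel (\<lambda>x. ?e x * ?f' x b)"
      by (rule Bochner_Integration.integrable_bound[OF schwartz_integrable[OF f'b]])
         (auto simp: norm_mult norm_exp_eq_Re)
    show "integrable lborel (\<lambda>x. ?e x * ?c b * f x)"
      by (rule Bochner_Integration.integrable_bound[OF integrable_mult_right[OF schwartz_integrable[OF f], of "?c b"]])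
         (auto simp: norm_mult norm_exp_eq_Re)
  qed
  ultimately have "(LINT x|lborel. ?e x * ?f' x b) + (LINT x|lborel. ?c b * (?e x * f x)) = 0"
    by (simp add: mult_ac)
  then show ?thesis
    unfolding fourier_def by (simp add: add_eq_0_iff)
qed

lemma fourier_iter_pderiv:
  assumes "f \<in> schwartz" "b \<in> Basis"
  shows "fourier (iter_pderiv (replicate j b) f) \<zeta> = (2 * of_real pi * \<i> * of_real (\<zeta> \<bullet> b)) ^ j * fourier f \<zeta>"
proof (induction j)
  case (Suc j)
  have "iter_pderiv (replicate j b) f \<in> schwartz"
    by (rule iter_pderiv_schwartz) (use assms in auto)
  from fourier_pderiv[OF this assms(2)] Suc show ?case by simp
qed simp

text \<open>
  The expression that dominates a tempered distribution.
\<close>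

definition schwartz_norm :: "nat \<Rightarrow> ('a::euclidean_space \<Rightarrow> complex) \<Rightarrow> real" where
  "schwartz_norm N f = (\<Sum>k\<le>N. \<Sum>bs | set bs \<subseteq> Basis \<and> length bs \<le> N. schwartz_seminorm k bs f)"

lemma schwartz_seminorm_le_norm:
  fixes f :: "'a::euclidean_space \<Rightarrow> complex"
  assumes f: "f \<in> schwartz" and "k \<le> N" "set bs \<subseteq> Basis" "length bs \<le> N"
  shows "schwartz_seminorm k bs f \<le> schwartz_norm N f"
proof -
  let ?L = "{bs. set bs \<subseteq> (Basis::'a set) \<and> length bs \<le> N}"
  have fin: "finite ?L" by (rule finite_lists_length_le) simp
  have "schwartz_seminorm k bs f \<le> (\<Sum>bs\<in>?L. schwartz_seminorm k bs f)"
    by (rule member_le_sum) (use assms fin schwartz_seminorm_nonneg[OF f] in auto)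
  also have "\<dots> \<le> (\<Sum>k\<le>N. \<Sum>bs\<in>?L. schwartz_seminorm k bs f)"
    by (rule member_le_sum[of k "{..N}" "\<lambda>k. \<Sum>bs\<in>?L. schwartz_seminorm k bs f"])
       (use assms schwartz_seminorm_nonneg[OF f] in \<open>auto intro!: sum_nonneg\<close>)
  finally show ?thesis by (simp add: schwartz_norm_def)
qed

lemma norm_power_le_sum_Basis:
  fixes x :: "'a::euclidean_space"
  shows "norm x ^ j \<le> real DIM('a) ^ j * (\<Sum>b\<in>Basis. \<bar>x \<bullet> b\<bar> ^ j)"
proof -
  obtain c :: 'a where c: "c \<in> Basis" "\<And>b. b \<in> Basis \<Longrightarrow> \<bar>x \<bullet> b\<bar> \<le> \<bar>x \<bullet> c\<bar>"
  proof -
    have "Max ((\<lambda>b. \<bar>x \<bullet> b\<bar>) ` Basis) \<in> (\<lambda>b. \<bar>x \<bullet> b\<bar>) ` (Basis :: 'a set)" by (rule Max_in) auto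
    then obtain c :: 'a where c: "c \<in> Basis" "Max ((\<lambda>b. \<bar>x \<bullet> b\<bar>) ` Basis) = \<bar>x \<bullet> c\<bar>"
      unfolding image_iff by blast
    have "\<bar>x \<bullet> b\<bar> \<le> \<bar>x \<bullet> c\<bar>" if "b \<in> Basis" for b
      unfolding c(2)[symmetric] using that by (intro Max_ge) auto
    with c(1) show ?thesis by (rule that)
  qed
  have "norm x \<le> (\<Sum>b\<in>Basis. \<bar>x \<bullet> b\<bar>)" by (rule norm_le_l1)
  also have "\<dots> \<le> real DIM('a) * \<bar>x \<bullet> c\<bar>" by (rule sum_bounded_above) (use c in auto)
  finally have "norm x ^ j \<le> (real DIM('a) * \<bar>x \<bullet> c\<bar>) ^ j" by (intro power_mono) auto
  also have "\<dots> = real DIM('a) ^ j * \<bar>x \<bullet> c\<bar> ^ j" by (simp add: power_mult_distrib)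
  also have "\<bar>x \<bullet> c\<bar> ^ j \<le> (\<Sum>b\<in>Basis. \<bar>x \<bullet> b\<bar> ^ j)"
    by (rule member_le_sum[of c Basis "\<lambda>b. \<bar>x \<bullet> b\<bar> ^ j"]) (use c in auto)
  finally show ?thesis by (simp add: mult_left_mono)
qed

text \<open>
  Powers of \<open>\<zeta> \<bullet> b\<close> are Fourier transforms of derivatives of \<open>f\<close>, and the \<open>L\<^sup>1\<close> norms of these are bounded by
  seminorms. The constants are uniform in \<open>f\<close>: this is the continuity of the Fourier transform on
  \<open>schwartz\<close>, to which the continuity of the kernel as a distribution reduces.
\<close>

lemma fourier_decay:
  "\<exists>C N. \<forall>f\<in>(schwartz :: ('a::euclidean_space \<Rightarrow> complex) set). \<forall>\<zeta>.
     (1 + norm \<zeta>) ^ j * norm (fourier f \<zeta>) \<le> C * schwartz_norm N f"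
proof -
  define K where "K = 2 * DIM('a)"
  define I where "I = (\<integral>x. inverse ((1 + norm (x::'a)) ^ K) \<partial>lborel)"
  \<comment> \<open>up to \<open>j\<close> derivatives, and decay of order \<open>K\<close> for integrability\<close>
  define N where "N = max j K"
  have I0: "0 \<le> I" unfolding I_def by (rule integral_nonneg_AE) auto
  have L1: "(LINT x|lborel. norm (iter_pderiv bs f x)) \<le> 2 ^ K * (2 * schwartz_norm N f) * I"
    if f: "f \<in> schwartz" and bs: "set bs \<subseteq> Basis" "length bs \<le> j" for f :: "'a \<Rightarrow> complex" and bs
  proof -
    have g: "iter_pderiv bs f \<in> schwartz" by (rule iter_pderiv_schwartz[OF f bs(1)])
    have "(1 + norm x) ^ K * norm (iter_pderiv bs f x) \<le> 2 ^ K * (2 * schwartz_norm N f)" for x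
    proof -
      have "schwartz_seminorm 0 bs f \<le> schwartz_norm N f" "schwartz_seminorm K bs f \<le> schwartz_norm N f"
        by (rule schwartz_seminorm_le_norm; use f bs in \<open>auto simp: N_def\<close>)+
      then show ?thesis
        by (intro order_trans[OF schwartz_decay[OF f bs(1)]] mult_left_mono) auto
    qed
    then show ?thesis
      unfolding I_def K_def by (intro integrable_of_decay(2) schwartz_borel_measurable[OF g])
  qed
  have bnd: "norm \<zeta> ^ i * norm (fourier f \<zeta>) \<le> real DIM('a) ^ i * (DIM('a) * (2 ^ K * (2 * schwartz_norm N f) * I))"
    if f: "f \<in> schwartz" and i: "i \<le> j" for f :: "'a \<Rightarrow> complex" and \<zeta> i
  proof -
    have *: "\<bar>\<zeta> \<bullet> b\<bar> ^ i * norm (fourier f \<zeta>) \<le> 2 ^ K * (2 * schwartz_norm N f) * I" if b: "b \<in> Basis" for b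
    proof -
      have "\<bar>\<zeta> \<bullet> b\<bar> \<le> 2 * pi * \<bar>\<zeta> \<bullet> b\<bar>"
        using pi_gt3 mult_right_mono[of 1 "2 * pi" "\<bar>\<zeta> \<bullet> b\<bar>"] by simp
      then have "\<bar>\<zeta> \<bullet> b\<bar> ^ i * norm (fourier f \<zeta>) \<le> (2 * pi * \<bar>\<zeta> \<bullet> b\<bar>) ^ i * norm (fourier f \<zeta>)"
        by (intro mult_right_mono power_mono) auto
      also have "\<dots> = norm (fourier (iter_pderiv (replicate i b) f) \<zeta>)"
        by (simp add: fourier_iter_pderiv[OF f b] norm_mult norm_power)
      also have "\<dots> \<le> (LINT x|lborel. norm (iter_pderiv (replicate i b) f x))"
        by (rule norm_fourier_le)
      also have "\<dots> \<le> 2 ^ K * (2 * schwartz_norm N f) * I"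
        by (rule L1[OF f]) (use b i in auto)
      finally show ?thesis .
    qed
    have "norm \<zeta> ^ i * norm (fourier f \<zeta>) \<le> real DIM('a) ^ i * (\<Sum>b\<in>Basis. \<bar>\<zeta> \<bullet> b\<bar> ^ i) * norm (fourier f \<zeta>)"
      by (intro mult_right_mono norm_power_le_sum_Basis) auto
    also have "\<dots> = real DIM('a) ^ i * (\<Sum>b\<in>Basis. \<bar>\<zeta> \<bullet> b\<bar> ^ i * norm (fourier f \<zeta>))"
      by (simp add: sum_distrib_right mult.assoc)
    also have "\<dots> \<le> real DIM('a) ^ i * (DIM('a) * (2 ^ K * (2 * schwartz_norm N f) * I))"
      by (intro mult_left_mono sum_bounded_above *) auto
    finally show ?thesis .
  qed
  have "(1 + norm \<zeta>) ^ j * norm (fourier f \<zeta>) \<le>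
     (2 ^ j * (1 + real DIM('a) ^ j) * DIM('a) * 2 ^ K * 2 * I) * schwartz_norm N f"
    if f: "f \<in> schwartz" for f :: "'a \<Rightarrow> complex" and \<zeta>
  proof -
    have "(1 + norm \<zeta>) ^ j * norm (fourier f \<zeta>)
        \<le> 2 ^ j * (norm \<zeta> ^ 0 + norm \<zeta> ^ j) * norm (fourier f \<zeta>)"
      by (intro mult_right_mono one_plus_power_le) auto
    also have "\<dots> = 2 ^ j * (norm \<zeta> ^ 0 * norm (fourier f \<zeta>) + norm \<zeta> ^ j * norm (fourier f \<zeta>))"
      by (simp add: algebra_simps)
    also have "\<dots> \<le> 2 ^ j * (real DIM('a) ^ 0 * (DIM('a) * (2 ^ K * (2 * schwartz_norm N f) * I))
          + real DIM('a) ^ j * (DIM('a) * (2 ^ K * (2 * schwartz_norm N f) * I)))"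
      by (intro mult_left_mono add_mono bnd f) auto
    finally show ?thesis by (simp add: algebra_simps)
  qed
  then show ?thesis by blast
qed

lemma fourier_decay_ex:
  fixes f :: "'a::euclidean_space \<Rightarrow> complex"
  assumes "f \<in> schwartz"
  shows "\<exists>C. \<forall>\<zeta>. (1 + norm \<zeta>) ^ j * norm (fourier f \<zeta>) \<le> C"
  using fourier_decay[where 'a = 'a, of j] assms by blast

text \<open>
  The class of all Fourier transforms of Schwartz functions is closed under partial derivatives, as these
  correspond to multiplication by coordinates.
\<close>

lemma fourier_schwartz:
  fixes f :: "'a::euclidean_space \<Rightarrow> complex"
  assumes "f \<in> schwartz"
  shows "fourier f \<in> schwartz"
proof (rule schwartz_coinduct[where S = "fourier ` schwartz"])
  show "fourier f \<in> fourier ` schwartz" using assms by blast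
next
  fix h :: "'a \<Rightarrow> complex" and x b :: 'a
  assume "h \<in> fourier ` schwartz"
  then obtain f where h: "h = fourier f" and f: "f \<in> schwartz" by blast
  have D: "(h has_derivative (\<lambda>v. fourier (\<lambda>x. - 2 * of_real pi * \<i> * of_real (x \<bullet> v) * f x) x)) (at x)" for x
    unfolding h
    by (rule fourier_has_derivative[OF schwartz_integrable[OF f] schwartz_weighted_integrable[OF f, where j = 1 and A = 1]])
       auto
  show "h differentiable (at x)" using D by (rule differentiableI)
  have "(\<lambda>x. (- 2 * of_real pi * \<i>) * (of_real (x \<bullet> b) * f x)) \<in> schwartz"
    by (intro schwartz_cmult schwartz_mult_coord f)
  then show "(\<lambda>x. frechet_derivative h (at x) b) \<in> fourier ` schwartz"
    unfolding frechet_derivative_eq[OF D] by (simp add: mult.assoc)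
next
  fix h :: "'a \<Rightarrow> complex" and k assume "h \<in> fourier ` schwartz"
  then show "bounded (range (\<lambda>x. norm x ^ k *\<^sub>R h x))"
    by (intro schwartzI_bounded) (use fourier_decay_ex in blast)
qed

lemma inv_fourier_schwartz: "f \<in> schwartz \<Longrightarrow> inv_fourier f \<in> schwartz"
  using schwartz_uminus[OF fourier_schwartz[of f]] unfolding inv_fourier_eq_fourier[abs_def] .

section \<open>Gaussians and Fourier inversion\<close>

text \<open>
  Complex \<open>w\<close> are essential: on the imaginary axis this is the Schroedinger kernel up to a factor, and
  it is reached as a limit from the half plane \<open>0 < Re w\<close>.
\<close>

abbreviation gauss :: "complex \<Rightarrow> 'a::euclidean_space \<Rightarrow> complex" where
  "gauss w x \<equiv> exp (- of_real pi * w * of_real ((norm x)\<^sup>2))"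

lemma norm_gauss: "norm (gauss w x) = exp (- (pi * Re w) * (norm x)\<^sup>2)"
  by (simp add: norm_exp_eq_Re)

lemma gauss_decay:
  assumes w: "0 < Re w"
  shows "\<exists>C. \<forall>x::'a::euclidean_space. (1 + norm x) ^ k * norm (gauss w x) \<le> C"
proof -
  have "0 < pi * Re w" using w by simp
  from power_mult_exp_bounded[OF this, of k] obtain C
    where "\<And>r. 0 \<le> r \<Longrightarrow> (1 + r) ^ k * exp (- (pi * Re w) * r\<^sup>2) \<le> C" by blast
  then show ?thesis
    unfolding norm_gauss by (intro exI[of _ C] allI) simp
qed

lemma gauss_weighted_integrable:
  fixes m :: "'a::euclidean_space \<Rightarrow> complex"
  assumes w: "0 < Re w" and m: "m \<in> borel_measurable borel"
    and b: "\<And>x. norm (m x) \<le> A * (1 + norm x) ^ j"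
  shows "integrable lborel (\<lambda>x. m x * gauss w x)"
proof -
  obtain C where C: "\<And>x::'a. (1 + norm x) ^ (2 * DIM('a) + j) * norm (gauss w x) \<le> C"
    using gauss_decay[OF w] by blast
  show ?thesis
    by (rule weighted_integral(1)[OF _ m b C]) measurable
qed

lemma gauss_integrable: "0 < Re w \<Longrightarrow> integrable lborel (gauss w :: 'a::euclidean_space \<Rightarrow> complex)"
  using gauss_weighted_integrable[of w "\<lambda>_::'a. 1" 1 0] by simp

lemma gauss_has_derivative:
  "(gauss w has_derivative (\<lambda>v. - 2 * of_real pi * w * of_real (x \<bullet> v) * gauss w x)) (at (x::'a::euclidean_space))"
proof -
  have "((\<lambda>x. - of_real pi * w * of_real ((norm x)\<^sup>2)) has_derivative
      (\<lambda>v. - 2 * of_real pi * w * of_real (x \<bullet> v))) (at x)"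
    unfolding power2_norm_eq_inner
    by (rule derivative_eq_intros refl)+ (auto simp: inner_commute algebra_simps)
  moreover have "(exp has_derivative (*) (gauss w x)) (at (- of_real pi * w * of_real ((norm x)\<^sup>2)))"
    using DERIV_exp unfolding has_field_derivative_def .
  ultimately have "(gauss w has_derivative (\<lambda>v. gauss w x * (- 2 * of_real pi * w * of_real (x \<bullet> v)))) (at x)"
    by (rule has_derivative_compose)
  then show ?thesis by (simp only: mult_ac)
qed

text \<open>
  Multiplication of \<open>gauss w\<close> by a coordinate is, up to a factor, differentiation. Integration by parts
  therefore gives a first order differential equation for the Fourier transform of \<open>gauss w\<close>.
\<close>

lemma fourier_coord_gauss:
  fixes \<zeta> :: "'a::euclidean_space"
  assumes w: "0 < Re w" and b: "b \<in> Basis"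
  shows "w * fourier (\<lambda>x. of_real (x \<bullet> b) * gauss w x) \<zeta> = - \<i> * of_real (\<zeta> \<bullet> b) * fourier (gauss w) \<zeta>"
proof -
  let ?e = "\<lambda>x. exp (- 2 * of_real pi * \<i> * of_real (\<zeta> \<bullet> x)) :: complex"
  let ?c = "\<lambda>v. - 2 * of_real pi * \<i> * of_real (\<zeta> \<bullet> v) :: complex"
  let ?g' = "\<lambda>x v. - 2 * of_real pi * w * of_real (x \<bullet> v) * gauss w x"
  obtain A where A: "\<And>x::'a. (1 + norm x) ^ (2 * DIM('a)) * norm (gauss w x) \<le> A"
    using gauss_decay[OF w] by blast
  obtain B where B: "\<And>x::'a. (1 + norm x) ^ (2 * DIM('a) + 1) * norm (gauss w x) \<le> B"
    using gauss_decay[OF w] by blast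
  have xb: "\<bar>x \<bullet> b\<bar> \<le> 1 + norm x" for x
    using Basis_le_norm[OF b, of x] by simp
  have B': "(1 + norm x) ^ (2 * DIM('a)) * norm (?g' x b) \<le> 2 * pi * norm w * B" for x
  proof -
    have "(1 + norm x) ^ (2 * DIM('a)) * norm (?g' x b)
        \<le> (1 + norm x) ^ (2 * DIM('a)) * (2 * pi * norm w * (1 + norm x) * norm (gauss w x))"
      unfolding norm_mult using xb[of x] by (intro mult_left_mono mult_right_mono mult_mono) auto
    also have "\<dots> = 2 * pi * norm w * ((1 + norm x) ^ (2 * DIM('a) + 1) * norm (gauss w x))"
      by simp
    also have "\<dots> \<le> 2 * pi * norm w * B" by (intro mult_left_mono B) auto
    finally show ?thesis .
  qed
  have "(LINT x|lborel. ?e x * ?g' x b + ?e x * ?c b * gauss w x) = 0"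
  proof (rule integral_directional_derivative_eq_0[where g = "\<lambda>x. ?e x * gauss w x"
        and g' = "\<lambda>x v. ?e x * ?g' x v + ?e x * ?c v * gauss w x"
        and A = A and B = "2 * pi * norm w * B + norm (?c b) * A"])
    fix x
    from has_derivative_mult[OF exp_inner_has_derivative gauss_has_derivative]
    show "((\<lambda>x. ?e x * gauss w x) has_derivative (\<lambda>v. ?e x * ?g' x v + ?e x * ?c v * gauss w x)) (at x)" .
    show "(1 + norm x) ^ (2 * DIM('a)) * norm (?e x * gauss w x) \<le> A"
      using A[of x] unfolding norm_mult norm_exp_ii by simp
    have "norm (?e x * ?g' x b + ?e x * ?c b * gauss w x) \<le> norm (?g' x b) + norm (?c b) * norm (gauss w x)"
      by (rule order_trans[OF norm_triangle_ineq]) (simp only: norm_mult norm_exp_ii mult_1_left order_refl)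
    then have "(1 + norm x) ^ (2 * DIM('a)) * norm (?e x * ?g' x b + ?e x * ?c b * gauss w x)
        \<le> (1 + norm x) ^ (2 * DIM('a)) * (norm (?g' x b) + norm (?c b) * norm (gauss w x))"
      by (intro mult_left_mono) auto
    also have "\<dots> = (1 + norm x) ^ (2 * DIM('a)) * norm (?g' x b) + norm (?c b) * ((1 + norm x) ^ (2 * DIM('a)) * norm (gauss w x))"
      by (simp only: distrib_left mult.left_commute)
    also have "\<dots> \<le> 2 * pi * norm w * B + norm (?c b) * A"
      by (intro add_mono mult_left_mono A B') auto
    finally show "(1 + norm x) ^ (2 * DIM('a)) * norm (?e x * ?g' x b + ?e x * ?c b * gauss w x)
       \<le> 2 * pi * norm w * B + norm (?c b) * A" .
  qed (use b in auto)
  moreover have "?e x * ?g' x b + ?e x * ?c b * gauss w x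
      = (- 2 * of_real pi * w) * (?e x * (of_real (x \<bullet> b) * gauss w x)) + ?c b * (?e x * gauss w x)" for x
    by (simp only: mult_ac)
  moreover have "integrable lborel (\<lambda>x. ?e x * (of_real (x \<bullet> b) * gauss w x))" "integrable lborel (\<lambda>x. ?e x * gauss w x)"
  proof -
    show "integrable lborel (\<lambda>x. ?e x * gauss w x)"
      by (rule gauss_weighted_integrable[OF w, where A = 1 and j = 0]) (simp_all add: norm_exp_eq_Re)
    have "integrable lborel (\<lambda>x. (?e x * of_real (x \<bullet> b)) * gauss w x)"
      by (rule gauss_weighted_integrable[OF w, where A = 1 and j = 1])
         (use xb in \<open>simp_all add: norm_mult norm_exp_eq_Re\<close>)
    then show "integrable lborel (\<lambda>x. ?e x * (of_real (x \<bullet> b) * gauss w x))"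
      by (simp only: mult.assoc)
  qed
  ultimately have "(- 2 * of_real pi * w) * fourier (\<lambda>x. of_real (x \<bullet> b) * gauss w x) \<zeta> + ?c b * fourier (gauss w) \<zeta> = 0"
    unfolding fourier_def by (simp only: integral_lincomb)
  then have "(- 2 * of_real pi) * (w * fourier (\<lambda>x. of_real (x \<bullet> b) * gauss w x) \<zeta> + \<i> * of_real (\<zeta> \<bullet> b) * fourier (gauss w) \<zeta>) = 0"
    by (simp add: algebra_simps)
  then show ?thesis by (simp add: add_eq_0_iff2)
qed

text \<open>
  Write \<open>I w\<close> for the integral. Differentiation in \<open>w\<close> and integration by parts in \<open>x\<close> both lead to the second
  moment; together they give \<open>I' w = - I w / (2 * w)\<close>. Hence \<open>I w * w powr (1/2)\<close> is constant on the half
  plane, and the constant is known from the normal distribution.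
\<close>

lemma integral_gauss_real:
  assumes w: "0 < Re w"
  shows "(LINT x|lborel. gauss w (x::real)) = w powr (- 1 / 2)"
proof -
  define I where "I w = (LINT x|lborel. gauss w (x::real))" for w
  define I2 where "I2 w = (LINT x|lborel. of_real (x\<^sup>2) * gauss w (x::real))" for w
  have int2: "integrable lborel (\<lambda>x::real. of_real (x\<^sup>2) * gauss w x)" if "0 < Re w" for w
  proof (rule gauss_weighted_integrable[OF that, where A = 1 and j = 2])
    show "norm (complex_of_real (x\<^sup>2)) \<le> 1 * (1 + norm x) ^ 2" for x :: real
      unfolding norm_of_real by (simp add: power2_sum)
  qed simp
  have der: "(I has_field_derivative (- of_real pi * I2 w)) (at w)" if w: "0 < Re w" for w
  proof -
    have eq: "1 * exp (- c * of_real (pi * x\<^sup>2)) = gauss c x"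
      and eq1: "of_real (pi * x\<^sup>2) * 1 * exp (- c * of_real (pi * x\<^sup>2)) = of_real pi * (of_real (x\<^sup>2) * gauss c x)"
      for c and x :: real
      by (simp_all add: mult_ac)
    have "((\<lambda>c. LINT x::real|lborel. 1 * exp (- c * of_real (pi * x\<^sup>2))) has_field_derivative
        - (LINT x::real|lborel. of_real (pi * x\<^sup>2) * 1 * exp (- w * of_real (pi * x\<^sup>2)))) (at w)"
    proof (rule has_field_derivative_laplace[where \<delta> = "Re w / 2"])
      show "integrable lborel (\<lambda>x::real. 1 * exp (- c * of_real (pi * x\<^sup>2)))" if "Re w / 2 < Re c" for c
        unfolding eq using that w by (intro gauss_integrable) simp
      show "integrable lborel (\<lambda>x::real. of_real (pi * x\<^sup>2) * 1 * exp (- complex_of_real (Re w / 2) * of_real (pi * x\<^sup>2)))"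
        unfolding eq1 by (intro integrable_mult_right int2) (use w in simp)
    qed (use w in auto)
    then show ?thesis
      unfolding eq eq1 by (simp add: I_def[abs_def] I2_def)
  qed
  \<comment> \<open>the integral of the derivative of \<open>x * gauss w x\<close> vanishes\<close>
  have ibp: "I w = 2 * of_real pi * w * I2 w" if w: "0 < Re w" for w
  proof -
    obtain A where A: "\<And>x::real. (1 + norm x) ^ (2 * DIM(real) + 2) * norm (gauss w x) \<le> A"
      using gauss_decay[OF w] by blast
    have A2: "(1 + norm x) ^ (2 * DIM(real)) * (t * norm (gauss w x)) \<le> A"
      if "t \<le> (1 + norm x)\<^sup>2" for t x :: real
    proof -
      have "(1 + norm x) ^ (2 * DIM(real)) * (t * norm (gauss w x))
          \<le> (1 + norm x) ^ (2 * DIM(real)) * ((1 + norm x)\<^sup>2 * norm (gauss w x))"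
        by (intro mult_left_mono mult_right_mono that) auto
      also have "\<dots> = (1 + norm x) ^ (2 * DIM(real) + 2) * norm (gauss w x)"
        by (simp only: power_add mult.assoc)
      finally show ?thesis using A[of x] by linarith
    qed
    let ?g' = "\<lambda>x v::real. of_real x * (- 2 * of_real pi * w * of_real (x \<bullet> v) * gauss w x) + of_real v * gauss w x"
    have "(LINT x|lborel. ?g' x 1) = 0"
    proof (rule integral_directional_derivative_eq_0[where g = "\<lambda>x. of_real x * gauss w x"
          and g' = ?g' and A = A and B = "2 * pi * norm w * A + A"])
      fix x :: real
      have "((\<lambda>x. complex_of_real x) has_derivative (\<lambda>v. of_real v)) (at x)"
        by (auto intro!: derivative_eq_intros)
      from has_derivative_mult[OF this gauss_has_derivative]
      show "((\<lambda>x. of_real x * gauss w x) has_derivative ?g' x) (at x)" .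
      have "\<bar>x\<bar> \<le> (1 + norm x)\<^sup>2" "x\<^sup>2 \<le> (1 + norm x)\<^sup>2" "1 \<le> (1 + norm x)\<^sup>2"
        by (simp_all add: power2_sum add_increasing2)
      note b = this[THEN A2]
      show "(1 + norm x) ^ (2 * DIM(real)) * norm (of_real x * gauss w x) \<le> A"
        unfolding norm_mult norm_of_real by (rule b)
      have "norm (?g' x 1) \<le> 2 * pi * norm w * (x\<^sup>2 * norm (gauss w x)) + 1 * norm (gauss w x)"
        by (rule order_trans[OF norm_triangle_ineq]) (simp add: norm_mult power2_eq_square mult_ac)
      then have "(1 + norm x) ^ (2 * DIM(real)) * norm (?g' x 1)
        \<le> (1 + norm x) ^ (2 * DIM(real)) * (2 * pi * norm w * (x\<^sup>2 * norm (gauss w x)) + 1 * norm (gauss w x))"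
        by (intro mult_left_mono) auto
      also have "\<dots> = 2 * pi * norm w * ((1 + norm x) ^ (2 * DIM(real)) * (x\<^sup>2 * norm (gauss w x)))
           + (1 + norm x) ^ (2 * DIM(real)) * (1 * norm (gauss w x))"
        by (simp only: distrib_left mult.left_commute)
      also have "\<dots> \<le> 2 * pi * norm w * A + A"
        by (intro add_mono mult_left_mono b) auto
      finally show "(1 + norm x) ^ (2 * DIM(real)) * norm (?g' x 1) \<le> 2 * pi * norm w * A + A" .
    qed auto
    moreover have "?g' x 1 = (- 2 * of_real pi * w) * (of_real (x\<^sup>2) * gauss w x) + 1 * gauss w x" for x
      by (simp add: power2_eq_square mult_ac)
    ultimately have "(- 2 * of_real pi * w) * I2 w + 1 * I w = 0"
      unfolding I_def I2_def
      by (simp only: integral_lincomb[OF int2[OF w] gauss_integrable[OF w, where 'a = real]])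
    then show ?thesis
      by (simp add: algebra_simps)
  qed
  have "\<exists>c. \<forall>z\<in>{z. 0 < Re z}. I z * z powr (1/2) = c"
  proof (rule has_field_derivative_zero_constant)
    show "convex {z. 0 < Re z}" by (rule convex_halfspace_Re_gt)
    fix z assume z: "z \<in> {z. 0 < Re z}"
    then have z': "z \<notin> \<real>\<^sub>\<le>\<^sub>0" "z \<noteq> 0" by (auto simp: complex_nonpos_Reals_iff)
    have "((\<lambda>z. I z * z powr (1/2)) has_field_derivative
       (- of_real pi * I2 z) * z powr (1/2) + ((1/2) * z powr (1/2 - 1)) * I z) (at z)"
      by (rule DERIV_mult[OF der has_field_derivative_powr]) (use z z' in auto)
    moreover have "(- of_real pi * I2 z) * z powr (1/2) + ((1/2) * z powr (1/2 - 1)) * I z = 0"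
    proof -
      have "z powr (1/2 - 1) = z powr (1/2) / z" using z' by (subst powr_diff) auto
      then show ?thesis using ibp[of z] z z' by (simp add: field_simps)
    qed
    ultimately show "((\<lambda>z. I z * z powr (1/2)) has_field_derivative 0) (at z within {z. 0 < Re z})"
      by (simp add: has_field_derivative_at_within)
  qed
  then obtain c where c: "\<And>z. 0 < Re z \<Longrightarrow> I z * z powr (1/2) = c" by blast
  have "I 1 = 1"
  proof -
    have "(LINT x|lborel. normal_density 0 (1 / sqrt (2 * pi)) x) = 1"
      by (rule integral_normal_density) simp
    moreover have "normal_density 0 (1 / sqrt (2 * pi)) x = exp (- pi * x\<^sup>2)" for x
      by (simp add: normal_density_def power_divide field_simps)
    ultimately have "(LINT x|lborel. complex_of_real (exp (- pi * x\<^sup>2))) = 1" by simp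
    moreover have "gauss 1 (x::real) = complex_of_real (exp (- pi * x\<^sup>2))" for x
      by (simp flip: exp_of_real)
    ultimately show ?thesis by (simp add: I_def)
  qed
  then have "c = 1" using c[of 1] by simp
  then have "w powr (1/2) * I w = 1" using c[OF w] by (simp only: mult.commute)
  from inverse_unique[OF this] have "I w = w powr - (1/2)"
    by (simp only: powr_minus)
  then show ?thesis
    unfolding I_def by (simp only: minus_divide_left)
qed

lemma powr_half_power: "w \<noteq> 0 \<Longrightarrow> (w powr (- 1 / 2)) ^ n = w powr (- of_nat n / 2)" for w :: complex
  by (simp add: powr_def flip: exp_of_nat_mult)

lemma integral_gauss:
  assumes w: "0 < Re w"
  shows "(LINT x|lborel. gauss w (x::'a::euclidean_space)) = w powr (- of_nat DIM('a) / 2)"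
proof -
  have "gauss w x = (\<Prod>b\<in>Basis. gauss w (x \<bullet> b))" for x :: 'a
  proof -
    have "(norm x)\<^sup>2 = (\<Sum>b\<in>Basis. (x \<bullet> b)\<^sup>2)"
      using trans[OF power2_norm_eq_inner euclidean_inner[of x x]] by (simp only: power2_eq_square)
    then show ?thesis
      by (simp add: sum_distrib_left exp_sum)
  qed
  then have "(LINT x|lborel. gauss w (x::'a)) = integral\<^sup>L lborel (\<lambda>x::'a. \<Prod>b\<in>Basis. gauss w (x \<bullet> b))"
    by simp
  also have "\<dots> = (\<Prod>b\<in>(Basis::'a set). LINT x|lborel. gauss w (x::real))"
    by (rule integral_lborel_prod_Basis(2)) (rule gauss_integrable[OF w])
  also have "\<dots> = (w powr (- 1 / 2)) ^ DIM('a)"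
    unfolding integral_gauss_real[OF w] by simp
  also have "\<dots> = w powr (- of_nat DIM('a) / 2)"
    by (rule powr_half_power) (use w in auto)
  finally show ?thesis .
qed

text \<open>
  By \<open>fourier_coord_gauss\<close> the product of the Fourier transform with \<open>gauss (- 1 / w)\<close> has derivative zero.
\<close>

lemma fourier_gauss:
  fixes \<zeta> :: "'a::euclidean_space"
  assumes w: "0 < Re w"
  shows "fourier (gauss w) \<zeta> = w powr (- of_nat DIM('a) / 2) * gauss (1 / w) \<zeta>"
proof -
  have w0: "w \<noteq> 0" using w by auto
  let ?F = "fourier (gauss w) :: 'a \<Rightarrow> complex"
  define P where "P \<zeta> = ?F \<zeta> * gauss (- 1 / w) \<zeta>" for \<zeta> :: 'a
  have "(P has_derivative (\<lambda>v. 0)) (at \<zeta>)" for \<zeta>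
  proof -
    have D: "(?F has_derivative (\<lambda>v. fourier (\<lambda>x. - 2 * of_real pi * \<i> * of_real (x \<bullet> v) * gauss w x) \<zeta>)) (at \<zeta>)"
      by (rule fourier_has_derivative[OF gauss_integrable[OF w] gauss_weighted_integrable[OF w, where j = 1 and A = 1]])
         auto
    from has_derivative_mult[OF this gauss_has_derivative]
    have DP: "(P has_derivative (\<lambda>v. ?F \<zeta> * (- 2 * of_real pi * (- 1 / w) * of_real (\<zeta> \<bullet> v) * gauss (- 1 / w) \<zeta>)
        + fourier (\<lambda>x. - 2 * of_real pi * \<i> * of_real (x \<bullet> v) * gauss w x) \<zeta> * gauss (- 1 / w) \<zeta>)) (at \<zeta>)"
      (is "(P has_derivative ?D) (at \<zeta>)")
      unfolding P_def[abs_def] .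
    have "?D b = 0" if b: "b \<in> Basis" for b
    proof -
      have "fourier (\<lambda>x. - 2 * of_real pi * \<i> * of_real (x \<bullet> b) * gauss w x) \<zeta>
          = - 2 * of_real pi * \<i> * fourier (\<lambda>x. of_real (x \<bullet> b) * gauss w x) \<zeta>"
      proof -
        have "exp (- 2 * of_real pi * \<i> * of_real (\<zeta> \<bullet> x)) * (- 2 * of_real pi * \<i> * of_real (x \<bullet> b) * gauss w x)
          = (- 2 * of_real pi * \<i>) * (exp (- 2 * of_real pi * \<i> * of_real (\<zeta> \<bullet> x)) * (of_real (x \<bullet> b) * gauss w x))" for x
          by (simp only: mult_ac)
        then show ?thesis unfolding fourier_def by (simp only: integral_mult_right_zero)
      qed
      also have "fourier (\<lambda>x. of_real (x \<bullet> b) * gauss w x) \<zeta> = - \<i> * of_real (\<zeta> \<bullet> b) * ?F \<zeta> / w"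
        using fourier_coord_gauss[OF w b, of \<zeta>] w0 by (simp add: field_simps)
      finally have E: "fourier (\<lambda>x. - 2 * of_real pi * \<i> * of_real (x \<bullet> b) * gauss w x) \<zeta>
          = - 2 * of_real pi * \<i> * (- \<i> * of_real (\<zeta> \<bullet> b) * ?F \<zeta> / w)" .
      show ?thesis unfolding E using w0 by (simp add: field_simps)
    qed
    moreover have "linear ?D" using DP by (rule has_derivative_linear)
    ultimately have "?D = (\<lambda>v. 0)"
      by (intro linear_eq_stdbasis) (auto simp: linear_zero)
    then show ?thesis using DP by simp
  qed
  then have "P \<zeta> = P 0"
    by (intro has_derivative_zero_unique[where s = UNIV]) (auto intro: has_derivative_at_withinI)
  also have "P 0 = w powr (- of_nat DIM('a) / 2)"
    using integral_gauss[OF w, where 'a = 'a] by (simp add: P_def fourier_def)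
  finally have "?F \<zeta> * gauss (- 1 / w) \<zeta> = w powr (- of_nat DIM('a) / 2)" by (simp add: P_def)
  then have "?F \<zeta> * (gauss (- 1 / w) \<zeta> * gauss (1 / w) \<zeta>) = w powr (- of_nat DIM('a) / 2) * gauss (1 / w) \<zeta>"
    by (simp only: mult.assoc[symmetric])
  moreover have "gauss (- 1 / w) \<zeta> * gauss (1 / w) \<zeta> = 1"
    by (simp flip: exp_add)
  ultimately show ?thesis by (simp only: mult_1_right)
qed

text \<open>
  Insert the convergence factor \<open>gauss (\<epsilon>\<^sup>2)\<close>. After exchanging the integrals and rescaling, \<open>f\<close> is averaged over
  distances of order \<open>\<epsilon>\<close> against a fixed Gaussian of total mass \<open>1\<close>; both sides have limits as \<open>\<epsilon>\<close> tends
  to \<open>0\<close>.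
\<close>

lemma inv_fourier_fourier:
  fixes f :: "'a::euclidean_space \<Rightarrow> complex"
  assumes f: "f \<in> schwartz"
  shows "inv_fourier (fourier f) x = f x"
proof -
  have [measurable]: "f \<in> borel_measurable borel" "fourier f \<in> borel_measurable borel"
    using f fourier_schwartz[OF f] schwartz_borel_measurable by auto
  note fi = schwartz_integrable[OF f] and Fi = schwartz_integrable[OF fourier_schwartz[OF f]]
  let ?e = "\<lambda>\<zeta>. exp (2 * of_real pi * \<i> * of_real (\<zeta> \<bullet> x)) :: complex"
  \<comment> \<open>the parameter is \<open>\<epsilon>\<^sup>2\<close> so that the substitution below is a dilation by \<open>\<epsilon>\<close>\<close>
  define A where "A \<epsilon> = (LINT \<zeta>|lborel. ?e \<zeta> * gauss (of_real (\<epsilon>\<^sup>2)) \<zeta> * fourier f \<zeta>)" for \<epsilon> :: real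
  have lim1: "(A \<longlongrightarrow> inv_fourier (fourier f) x) (at 0 within {0<..})"
    unfolding A_def inv_fourier_def
  proof (rule tendsto_integral_dominated[where w = "\<lambda>\<zeta>. norm (fourier f \<zeta>)"])
    show "AE \<zeta> in lborel. ((\<lambda>\<epsilon>. ?e \<zeta> * gauss (of_real (\<epsilon>\<^sup>2)) \<zeta> * fourier f \<zeta>) \<longlongrightarrow> ?e \<zeta> * fourier f \<zeta>) (at 0 within {0<..})"
    proof (rule AE_I2)
      fix \<zeta> :: 'a
      have "((\<lambda>\<epsilon>. ?e \<zeta> * gauss (of_real (\<epsilon>\<^sup>2)) \<zeta> * fourier f \<zeta>) \<longlongrightarrow> ?e \<zeta> * gauss (of_real (0\<^sup>2)) \<zeta> * fourier f \<zeta>) (at 0 within {0<..})"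
        by (intro tendsto_intros)
      then show "((\<lambda>\<epsilon>. ?e \<zeta> * gauss (of_real (\<epsilon>\<^sup>2)) \<zeta> * fourier f \<zeta>) \<longlongrightarrow> ?e \<zeta> * fourier f \<zeta>) (at 0 within {0<..})"
        by simp
    qed
    fix \<epsilon> :: real
    have "norm (?e \<zeta> * gauss (of_real (\<epsilon>\<^sup>2)) \<zeta> * fourier f \<zeta>) \<le> norm (fourier f \<zeta>)" for \<zeta>
      unfolding norm_mult norm_exp_ii norm_gauss by (simp add: mult_left_le_one_le)
    then show "AE \<zeta> in lborel. norm (?e \<zeta> * gauss (of_real (\<epsilon>\<^sup>2)) \<zeta> * fourier f \<zeta>) \<le> norm (fourier f \<zeta>)"
      by blast
  qed (use Fi in auto)
  have eq: "A \<epsilon> = (LINT h|lborel. f (x + \<epsilon> *\<^sub>R h) * gauss 1 h)" if \<epsilon>: "\<epsilon> \<in> {0<..}" for \<epsilon>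
  proof -
    have w: "0 < Re (complex_of_real (\<epsilon>\<^sup>2))" using \<epsilon> by simp
    have I: "integrable lborel (\<lambda>\<zeta>::'a. ?e \<zeta> * gauss (of_real (\<epsilon>\<^sup>2)) \<zeta>)"
      by (rule gauss_weighted_integrable[OF w, where A = 1 and j = 0]) (simp_all add: norm_exp_eq_Re)
    have "A \<epsilon> = (LINT y|lborel. f y * (LINT \<zeta>|lborel. exp (- 2 * of_real pi * \<i> * of_real (\<zeta> \<bullet> y)) * (?e \<zeta> * gauss (of_real (\<epsilon>\<^sup>2)) \<zeta>)))"
      unfolding A_def fourier_def[of f]
      by (rule Fubini_bounded_kernel(2)[OF I fi, where B = 1]) (auto simp: norm_exp_eq_Re case_prod_unfold intro!: borel_measurable_continuous_onI continuous_intros)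
    also have "\<dots> = (LINT y|lborel. f y * fourier (gauss (of_real (\<epsilon>\<^sup>2))) (y - x))"
    proof (intro Bochner_Integration.integral_cong refl arg_cong2[where f = "(*)"])
      fix y
      have "exp (- 2 * of_real pi * \<i> * of_real (\<zeta> \<bullet> y)) * (?e \<zeta> * gauss (of_real (\<epsilon>\<^sup>2)) \<zeta>)
          = exp (- 2 * of_real pi * \<i> * of_real ((y - x) \<bullet> \<zeta>)) * gauss (of_real (\<epsilon>\<^sup>2)) \<zeta>" for \<zeta>
        unfolding mult.assoc[symmetric] exp_add[symmetric]
        by (simp add: inner_diff_left inner_commute[of \<zeta>] algebra_simps)
      then show "(LINT \<zeta>|lborel. exp (- 2 * of_real pi * \<i> * of_real (\<zeta> \<bullet> y)) * (?e \<zeta> * gauss (of_real (\<epsilon>\<^sup>2)) \<zeta>))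
         = fourier (gauss (of_real (\<epsilon>\<^sup>2))) (y - x)"
        unfolding fourier_def by (simp only:)
    qed
    also have "\<dots> = (LINT y|lborel. f y * (of_real (\<epsilon>\<^sup>2) powr (- of_nat DIM('a) / 2) * gauss (1 / of_real (\<epsilon>\<^sup>2)) (y - x)))"
      unfolding fourier_gauss[OF w] ..
    also have "\<dots> = \<bar>\<epsilon>\<bar> ^ DIM('a) *\<^sub>R (LINT h|lborel. f (x + \<epsilon> *\<^sub>R h) * (of_real (\<epsilon>\<^sup>2) powr (- of_nat DIM('a) / 2) * gauss (1 / of_real (\<epsilon>\<^sup>2)) (x + \<epsilon> *\<^sub>R h - x)))"
      by (rule integral_lborel_affine) (use \<epsilon> in auto)
    also have "\<dots> = (LINT h|lborel. f (x + \<epsilon> *\<^sub>R h) * gauss 1 h)"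
    proof -
      have "complex_of_real (\<epsilon>\<^sup>2) powr (- of_nat DIM('a) / 2) = inverse (of_real \<epsilon> ^ DIM('a))"
      proof -
        have "complex_of_real (\<epsilon>\<^sup>2) powr (- 1 / 2) = inverse (of_real \<epsilon>)"
        proof -
          have "(\<epsilon>\<^sup>2) powr (- 1/2) = inverse \<epsilon>"
            using \<epsilon> by (simp add: powr_minus powr_half_sqrt)
          moreover have "complex_of_real (\<epsilon>\<^sup>2) powr (of_real (- 1 / 2)) = of_real ((\<epsilon>\<^sup>2) powr (- 1/2))"
            by (rule powr_of_real) auto
          ultimately show ?thesis by simp
        qed
        then show ?thesis
          using powr_half_power[of "complex_of_real (\<epsilon>\<^sup>2)" "DIM('a)"] \<epsilon> by (simp add: power_inverse)
      qed
      moreover have "gauss (1 / of_real (\<epsilon>\<^sup>2)) (x + \<epsilon> *\<^sub>R h - x) = gauss 1 h" for h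
        using \<epsilon> by (simp add: power_mult_distrib)
      ultimately show ?thesis
        using \<epsilon> by (simp add: scaleR_conv_of_real mult_ac)
    qed
    finally show ?thesis .
  qed
  obtain C where C: "\<And>y. norm (f y) \<le> C"
    using schwartz_decay_ex[OF f, of 0] by auto
  have "((\<lambda>\<epsilon>. LINT h|lborel. f (x + \<epsilon> *\<^sub>R h) * gauss 1 h) \<longlongrightarrow> (LINT h|lborel. f x * gauss 1 (h::'a))) (at 0 within {0<..})"
  proof (rule tendsto_integral_dominated[where w = "\<lambda>h::'a. C * norm (gauss 1 h)"
        and f = "\<lambda>\<epsilon> h. f (x + \<epsilon> *\<^sub>R h) * gauss 1 h" and l = "\<lambda>h. f x * gauss 1 h"])
    show "AE h in lborel. ((\<lambda>\<epsilon>. f (x + \<epsilon> *\<^sub>R h) * gauss 1 h) \<longlongrightarrow> f x * gauss 1 h) (at 0 within {0<..})"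
    proof (rule AE_I2)
      fix h
      have "isCont f (x + 0 *\<^sub>R h)"
        using schwartz_continuous[OF f, of UNIV] by (simp add: continuous_on_eq_continuous_at)
      moreover have "((\<lambda>\<epsilon>. x + \<epsilon> *\<^sub>R h) \<longlongrightarrow> x + 0 *\<^sub>R h) (at 0 within {0<..})"
        by (intro tendsto_intros)
      ultimately have "((\<lambda>\<epsilon>. f (x + \<epsilon> *\<^sub>R h)) \<longlongrightarrow> f (x + 0 *\<^sub>R h)) (at 0 within {0<..})"
        by (rule isCont_tendsto_compose)
      then show "((\<lambda>\<epsilon>. f (x + \<epsilon> *\<^sub>R h) * gauss 1 h) \<longlongrightarrow> f x * gauss 1 h) (at 0 within {0<..})"
        by (intro tendsto_mult) auto
    qed
    show "integrable lborel (\<lambda>h::'a. C * norm (gauss 1 h))"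
      by (intro integrable_mult_right integrable_norm gauss_integrable) simp
    fix \<epsilon> :: real
    show "AE h in lborel. norm (f (x + \<epsilon> *\<^sub>R h) * gauss 1 h) \<le> C * norm (gauss 1 h)"
      unfolding norm_mult by (intro AE_I2 mult_right_mono C) auto
  qed auto
  moreover have "(LINT h|lborel. f x * gauss 1 (h::'a)) = f x"
    using integral_gauss[of 1, where 'a = 'a] by simp
  ultimately have "((\<lambda>\<epsilon>. LINT h|lborel. f (x + \<epsilon> *\<^sub>R h) * gauss 1 h) \<longlongrightarrow> f x) (at 0 within {0<..})"
    by (simp only:)
  moreover have "\<forall>\<^sub>F \<epsilon> in at 0 within {0<..}. (LINT h|lborel. f (x + \<epsilon> *\<^sub>R h) * gauss 1 h) = A \<epsilon>"
    using eq by (auto simp: eventually_at_filter)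
  ultimately have "(A \<longlongrightarrow> f x) (at 0 within {0<..})"
    by (rule Lim_transform_eventually)
  with lim1 show ?thesis
    using tendsto_unique trivial_limit_at_right_real by blast
qed

lemma fourier_inv_fourier:
  fixes f :: "'a::euclidean_space \<Rightarrow> complex"
  assumes f: "f \<in> schwartz"
  shows "fourier (inv_fourier f) x = f x"
proof -
  have r: "inv_fourier f = fourier (\<lambda>y. f (- y))"
  proof
    fix \<zeta>
    have "inv_fourier f \<zeta> = (LINT y|lborel. exp (2 * of_real pi * \<i> * of_real ((- 1 *\<^sub>R y) \<bullet> \<zeta>)) * f (- 1 *\<^sub>R y))"
      using integral_lborel_affine[of "\<lambda>y. exp (2 * of_real pi * \<i> * of_real (y \<bullet> \<zeta>)) * f y" "-1" 0]
        schwartz_borel_measurable[OF f] by (simp add: inv_fourier_def)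
    then show "inv_fourier f \<zeta> = fourier (\<lambda>y. f (- y)) \<zeta>"
      by (simp add: fourier_def inner_commute[of \<zeta>])
  qed
  have "fourier (inv_fourier f) x = inv_fourier (fourier (\<lambda>y. f (- y))) (- x)"
    unfolding r by (rule fourier_eq_inv_fourier)
  also have "\<dots> = f x"
    using inv_fourier_fourier[OF schwartz_uminus[OF f], of "- x"] by simp
  finally show ?thesis .
qed

section \<open>Bessel series\<close>

text \<open>
  The entire function in \<open>besselI \<nu> w = (w / 2) powr \<nu> * hyp01 \<nu> (w\<^sup>2 / 4)\<close>, that is, the hypergeometric
  function \<open>0F1(; \<nu> + 1; q)\<close> divided by \<open>Gamma (\<nu> + 1)\<close>.
\<close>

definition hyp01 :: "complex \<Rightarrow> complex \<Rightarrow> complex" where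
  "hyp01 \<nu> q = (\<Sum>k. q ^ k / fact k * rGamma (\<nu> + of_nat k + 1))"

lemma rGamma_shift: "rGamma (\<nu> + of_nat k + 1) = (\<nu> + of_nat k + 1) * rGamma (\<nu> + 1 + of_nat k + 1)" for \<nu> :: complex
  using rGamma_plus1[of "\<nu> + of_nat k + 1"] by (simp add: algebra_simps)

lemma hyp01_summable: "summable (\<lambda>k. q ^ k / fact k * rGamma (\<nu> + of_nat k + 1))" for q \<nu> :: complex
proof (rule summable_ratio_test[where c = "1/2" and N = "nat \<lceil>max (norm \<nu>) (2 * norm q)\<rceil>"])
  \<comment> \<open>beyond this index \<open>\<nu> + k + 1\<close> is at least \<open>1\<close> in modulus, and \<open>q / (k + 1)\<close> at most \<open>1 / 2\<close>\<close>
  fix k assume "k \<ge> nat \<lceil>max (norm \<nu>) (2 * norm q)\<rceil>"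
  then have k: "norm \<nu> \<le> real k" "2 * norm q \<le> real k" by linarith+
  let ?R = "norm (rGamma (\<nu> + 1 + of_nat k + 1))"
  have "1 + real k = norm (of_nat k + 1 :: complex)"
    by (metis add.commute norm_of_nat of_nat_Suc)
  also have "\<dots> \<le> norm (\<nu> + of_nat k + 1) + norm \<nu>"
    using norm_triangle_ineq4[of "\<nu> + of_nat k + 1" \<nu>] by simp
  finally have one: "1 \<le> norm (\<nu> + of_nat k + 1)" using k by simp
  have eq: "\<nu> + of_nat (Suc k) + 1 = \<nu> + 1 + of_nat k + 1" by simp
  have "norm (q ^ Suc k / fact (Suc k) * rGamma (\<nu> + of_nat (Suc k) + 1))
      = (norm q / (1 + real k)) * (norm q ^ k / fact k * ?R)"
  proof -
    have "norm (q ^ Suc k / fact (Suc k) * rGamma (\<nu> + of_nat (Suc k) + 1)) = norm q ^ Suc k / fact (Suc k) * ?R"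
      unfolding eq by (simp only: norm_mult norm_divide norm_power norm_fact)
    then show ?thesis by simp
  qed
  also have "\<dots> \<le> (1/2) * (norm q ^ k / fact k * ?R)"
    using k by (intro mult_right_mono) (auto simp: field_simps)
  also have "\<dots> \<le> (1/2) * (norm q ^ k / fact k * (norm (\<nu> + of_nat k + 1) * ?R))"
    using mult_right_mono[OF one norm_ge_zero[of "rGamma (\<nu> + 1 + of_nat k + 1)"]]
    by (intro mult_left_mono) auto
  also have "\<dots> = (1/2) * norm (q ^ k / fact k * rGamma (\<nu> + of_nat k + 1))"
    unfolding rGamma_shift[of \<nu> k] by (simp add: norm_mult norm_divide norm_power)
  finally show "norm (q ^ Suc k / fact (Suc k) * rGamma (\<nu> + of_nat (Suc k) + 1))
    \<le> (1/2) * norm (q ^ k / fact k * rGamma (\<nu> + of_nat k + 1))" .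
qed simp

lemma hyp01_has_field_derivative: "(hyp01 \<nu> has_field_derivative hyp01 (\<nu> + 1) q) (at q)"
proof -
  define c where "c k = rGamma (\<nu> + of_nat k + 1) / fact k" for k
  have "((\<lambda>q. \<Sum>k. c k * q ^ k) has_field_derivative (\<Sum>k. diffs c k * q ^ k)) (at q)"
    by (rule termdiffs_strong_converges_everywhere)
       (use hyp01_summable in \<open>simp add: c_def mult_ac\<close>)
  moreover have "diffs c k = rGamma (\<nu> + 1 + of_nat k + 1) / fact k" for k
  proof -
    have e: "\<nu> + of_nat (Suc k) + 1 = \<nu> + 1 + of_nat k + 1" by simp
    have "of_nat (Suc k) \<noteq> (0 :: complex)" by (rule of_nat_neq_0)
    then show ?thesis
      unfolding diffs_def c_def fact_Suc e of_nat_mult by (simp del: of_nat_Suc)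
  qed
  ultimately show ?thesis
    by (simp add: hyp01_def[abs_def] c_def mult_ac)
qed

lemmas hyp01_DERIV = DERIV_chain'[OF _ hyp01_has_field_derivative]

lemma hyp01_continuous: "continuous_on A (hyp01 \<nu>)"
  by (rule DERIV_continuous_on[OF has_field_derivative_at_within[OF hyp01_has_field_derivative]])

text \<open>
  The Bessel equation in terms of \<open>hyp01\<close>, as \<open>hyp01 (\<nu> + 1)\<close> and \<open>hyp01 (\<nu> + 2)\<close> are the first two
  derivatives. Coefficient by coefficient it is the functional equation of \<open>rGamma\<close>.
\<close>

lemma hyp01_recurrence: "q * hyp01 (\<nu> + 2) q + (\<nu> + 1) * hyp01 (\<nu> + 1) q = hyp01 \<nu> q"
proof -
  let ?a = "\<lambda>\<nu> k. q ^ k / fact k * rGamma (\<nu> + of_nat k + 1)"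
  have s: "?a \<nu> sums hyp01 \<nu> q" for \<nu>
    unfolding hyp01_def using hyp01_summable by (rule summable_sums)
  have "(\<lambda>k. of_nat (Suc k) * ?a (\<nu> + 1) (Suc k)) sums (q * hyp01 (\<nu> + 2) q)"
  proof -
    have "of_nat (Suc k) * ?a (\<nu> + 1) (Suc k) = q * ?a (\<nu> + 2) k" for k
      by (simp add: field_simps del: of_nat_Suc) (simp add: algebra_simps)
    then show ?thesis using sums_mult[OF s[of "\<nu> + 2"], of q] by (simp only:)
  qed
  then have "(\<lambda>k. of_nat k * ?a (\<nu> + 1) k) sums (q * hyp01 (\<nu> + 2) q)"
    using sums_Suc_iff[of "\<lambda>k. of_nat k * ?a (\<nu> + 1) k"] by simp
  from sums_add[OF this sums_mult[OF s[of "\<nu> + 1"], of "\<nu> + 1"]]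
  have "(\<lambda>k. of_nat k * ?a (\<nu> + 1) k + (\<nu> + 1) * ?a (\<nu> + 1) k) sums
      (q * hyp01 (\<nu> + 2) q + (\<nu> + 1) * hyp01 (\<nu> + 1) q)" .
  moreover have "of_nat k * ?a (\<nu> + 1) k + (\<nu> + 1) * ?a (\<nu> + 1) k = ?a \<nu> k" for k
    unfolding rGamma_shift[of \<nu> k] by (simp add: algebra_simps add_divide_distrib)
  ultimately show ?thesis
    using s[of \<nu>] sums_unique2 by force
qed

lemma hyp01_0: "hyp01 \<nu> 0 = rGamma (\<nu> + 1)"
proof -
  have "(\<lambda>k. 0 ^ k * (rGamma (\<nu> + of_nat k + 1) / fact k)) sums (rGamma (\<nu> + of_nat 0 + 1) / fact 0)"
    using powser_sums_zero[of "\<lambda>k. rGamma (\<nu> + of_nat k + 1) / fact k"] by (simp add: mult.commute)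
  then show ?thesis
    unfolding hyp01_def by (simp add: sums_iff mult_ac)
qed

section \<open>Bessel integrals\<close>

text \<open>
  The time dependence of the kernel, after the Fourier transform in space and time, is of this form with
  \<open>m = - 1 - s\<close> and with \<open>\<alpha>\<close> and \<open>\<beta>\<close> on the imaginary axis, where absolute convergence at \<open>0\<close> fails.
  For \<open>\<alpha>\<close> and \<open>\<beta>\<close> in the right half plane the integral \<open>bessel_int\<close> below is classically
  \<open>2 (\<alpha>/\<beta>)\<^bsup>(m+1)/2\<^esup> K\<^bsub>m+1\<^esub>(2 (\<alpha>\<beta>)\<^bsup>1/2\<^esup>)\<close>.
\<close>

definition bessel_kern :: "real \<Rightarrow> complex \<Rightarrow> complex \<Rightarrow> real \<Rightarrow> complex" where
  "bessel_kern m \<alpha> \<beta> t = (if 0 < t then of_real (t powr m) * exp (- (\<alpha> / of_real t) - \<beta> * of_real t) else 0)"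

definition bessel_int :: "real \<Rightarrow> complex \<Rightarrow> complex \<Rightarrow> complex" where
  "bessel_int m \<alpha> \<beta> = (LINT t|lborel. bessel_kern m \<alpha> \<beta> t)"

lemma bessel_kern_measurable[measurable]: "bessel_kern m \<alpha> \<beta> \<in> borel_measurable borel"
  unfolding bessel_kern_def[abs_def] by measurable

lemma norm_bessel_kern: "0 < t \<Longrightarrow> norm (bessel_kern m \<alpha> \<beta> t) = t powr m * exp (- (Re \<alpha> / t) - Re \<beta> * t)"
  by (simp add: bessel_kern_def norm_mult norm_exp_eq_Re)

lemma continuous_on_cbox_bounded:
  fixes h :: "real \<Rightarrow> real"
  assumes "continuous_on {a..b} h"
  obtains D where "0 \<le> D" "\<And>t. t \<in> {a..b} \<Longrightarrow> h t \<le> D"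
proof -
  have "bounded (h ` {a..b})"
    by (intro compact_imp_bounded compact_continuous_image assms) auto
  then obtain D where "\<And>t. t \<in> {a..b} \<Longrightarrow> norm (h t) \<le> D"
    unfolding bounded_iff by blast
  then have "h t \<le> \<bar>D\<bar>" if "t \<in> {a..b}" for t
    using that unfolding real_norm_def by (smt (verit))
  then show ?thesis by (intro that[of "\<bar>D\<bar>"]) auto
qed

lemma powr_exp_bounded_near_0:
  fixes m a :: real
  assumes "0 < a"
  obtains C where "0 \<le> C" "\<And>t. 0 < t \<Longrightarrow> t \<le> 1 \<Longrightarrow> t powr m * exp (- (a / t)) \<le> C"
proof -
  have "((\<lambda>t. t powr m * exp (- (a / t))) \<longlongrightarrow> 0) (at_right 0)"
    using assms by real_asymp
  then have "\<forall>\<^sub>F t in at_right 0. t powr m * exp (- (a / t)) < 1"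
    by (rule order_tendstoD) simp
  then obtain d where d: "0 < d" "\<And>t. 0 < t \<Longrightarrow> t < d \<Longrightarrow> t powr m * exp (- (a / t)) < 1"
    by (auto simp: eventually_at_right_field)
  have "continuous_on {d..1} (\<lambda>t. t powr m * exp (- (a / t)))"
    using d by (intro continuous_intros) auto
  then obtain D where D: "0 \<le> D" "\<And>t. t \<in> {d..1} \<Longrightarrow> t powr m * exp (- (a / t)) \<le> D"
    using continuous_on_cbox_bounded by blast
  show ?thesis
  proof (rule that[of "1 + D"])
    show "t powr m * exp (- (a / t)) \<le> 1 + D" if "0 < t" "t \<le> 1" for t
      using d(2)[of t] D(2)[of t] D(1) that by (cases "t < d") (auto intro: less_imp_le)
  qed (use D in auto)
qed

lemma powr_integrable_at_top:
  assumes "e < -1" "0 < a"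
  shows "integrable lborel (\<lambda>t::real. if t \<in> {a..} then t powr e else 0)"
  by (rule lborel_integral_of_has_integral_nonneg(1)[OF has_integral_powr_to_inf[OF assms]]) (auto intro!: measurable_If)

text \<open>
  At \<open>0\<close> the factor \<open>exp (- \<alpha> / t)\<close> beats every power. The bound \<open>D\<close> separates this from the behaviour at
  infinity, which comes from \<open>exp (- \<beta> * t)\<close> or, for \<open>Re \<beta> = 0\<close>, from \<open>m < - 1\<close>.
\<close>

lemma bessel_kern_integrable_aux:
  assumes \<alpha>: "0 < Re \<alpha>" and \<beta>: "0 \<le> Re \<beta>" and p: "p < - 1"
    and D: "\<And>t. 1 \<le> t \<Longrightarrow> t powr m * exp (- Re \<beta> * t) \<le> D * t powr p"
  shows "integrable lborel (bessel_kern m \<alpha> \<beta>)"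
proof -
  obtain C where C: "0 \<le> C" "\<And>t. 0 < t \<Longrightarrow> t \<le> 1 \<Longrightarrow> t powr m * exp (- (Re \<alpha> / t)) \<le> C"
    using powr_exp_bounded_near_0[OF \<alpha>] by blast
  have D0: "0 \<le> D"
    using order_trans[OF _ D[of 1]] by simp
  show ?thesis
  proof (rule Bochner_Integration.integrable_bound)
    show "integrable lborel (\<lambda>t. C * indicat_real {0..1} t + D * (if t \<in> {1..} then t powr p else 0))"
      by (intro Bochner_Integration.integrable_add integrable_mult_right powr_integrable_at_top p)
         (auto simp: integrable_indicator_iff)
    show "AE t in lborel. norm (bessel_kern m \<alpha> \<beta> t) \<le> norm (C * indicat_real {0..1} t + D * (if t \<in> {1..} then t powr p else 0))"
    proof (rule AE_I2)
      fix t :: real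
      consider "t \<le> 0" | "0 < t" "t \<le> 1" | "1 < t" by linarith
      then show "norm (bessel_kern m \<alpha> \<beta> t) \<le> norm (C * indicat_real {0..1} t + D * (if t \<in> {1..} then t powr p else 0))"
      proof cases
        case 1
        then show ?thesis by (simp add: bessel_kern_def)
      next
        case 2
        have "norm (bessel_kern m \<alpha> \<beta> t) = t powr m * exp (- (Re \<alpha> / t)) * exp (- (Re \<beta> * t))"
          using 2 by (simp add: norm_bessel_kern mult_exp_exp)
        also have "\<dots> \<le> C * 1"
          using 2 C \<beta> by (intro mult_mono) auto
        also have "\<dots> \<le> norm (C * indicat_real {0..1} t + D * (if t \<in> {1..} then t powr p else 0))"
          using 2 C D0 by simp
        finally show ?thesis .
      next
        case 3
        have "norm (bessel_kern m \<alpha> \<beta> t) = exp (- (Re \<alpha> / t)) * (t powr m * exp (- Re \<beta> * t))"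
          using 3 by (simp add: norm_bessel_kern mult_exp_exp)
        also have "\<dots> \<le> 1 * (D * t powr p)"
          using 3 \<alpha> by (intro mult_mono D) auto
        also have "\<dots> \<le> norm (C * indicat_real {0..1} t + D * (if t \<in> {1..} then t powr p else 0))"
          using 3 D0 by simp
        finally show ?thesis .
      qed
    qed
  qed measurable
qed

lemma bessel_kern_integrable_0:
  assumes "0 < Re \<alpha>" "0 \<le> Re \<beta>" "m < - 1"
  shows "integrable lborel (bessel_kern m \<alpha> \<beta>)"
proof (rule bessel_kern_integrable_aux[OF assms(1,2,3), where D = 1])
  fix t :: real assume "1 \<le> t"
  then show "t powr m * exp (- Re \<beta> * t) \<le> 1 * t powr m"
    using assms(2) by (simp add: mult_left_le)
qed

lemma bessel_kern_integrable:
  assumes "0 < Re \<alpha>" "0 < Re \<beta>"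
  shows "integrable lborel (bessel_kern m \<alpha> \<beta>)"
proof -
  define b where "b = Re \<beta>"
  have b: "0 < b" using assms by (simp add: b_def)
  have "((\<lambda>t. t powr (m + 2) * exp (- b * t)) \<longlongrightarrow> 0) at_top"
    using b by real_asymp
  then have "\<forall>\<^sub>F t in at_top. t powr (m + 2) * exp (- b * t) < 1"
    by (rule order_tendstoD) simp
  then obtain R where R: "\<And>t. R \<le> t \<Longrightarrow> t powr (m + 2) * exp (- b * t) < 1"
    by (auto simp: eventually_at_top_linorder)
  have "continuous_on {1..R} (\<lambda>t. t powr (m + 2) * exp (- b * t))"
    by (intro continuous_intros) auto
  then obtain D where D: "0 \<le> D" "\<And>t. t \<in> {1..R} \<Longrightarrow> t powr (m + 2) * exp (- b * t) \<le> D"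
    using continuous_on_cbox_bounded by blast
  show ?thesis
  \<comment> \<open>any exponent below \<open>- 1\<close> would do in place of \<open>- 2\<close>\<close>
  proof (rule bessel_kern_integrable_aux[where D = "1 + D" and p = "-2"])
    fix t :: real assume t: "1 \<le> t"
    have "t powr (m + 2) * exp (- b * t) \<le> 1 + D"
      using R[of t] D(2)[of t] D(1) t by (cases "t \<le> R") auto
    then have "t powr (m + 2) * exp (- b * t) * t powr (-2) \<le> (1 + D) * t powr (-2)"
      by (rule mult_right_mono) simp
    moreover have "t powr (m + 2) * exp (- b * t) * t powr (-2) = t powr m * exp (- b * t)"
    proof -
      have "t powr (m + 2) * t powr (-2) = t powr m"
        by (simp flip: powr_add)
      moreover have "t powr (m + 2) * exp (- b * t) * t powr (-2) = (t powr (m + 2) * t powr (-2)) * exp (- b * t)"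
        by (simp only: mult_ac)
      ultimately show ?thesis by (simp only:)
    qed
    ultimately show "t powr m * exp (- Re \<beta> * t) \<le> (1 + D) * t powr (-2)"
      by (simp only: b_def)
  qed (use assms in auto)
qed

lemma bessel_int_deriv_beta:
  assumes \<alpha>: "0 < Re \<alpha>" and \<beta>: "0 < Re \<beta>"
  shows "(bessel_int m \<alpha> has_field_derivative - bessel_int (m + 1) \<alpha> \<beta>) (at \<beta>)"
proof -
  define w where "w = bessel_kern m \<alpha> 0"
  define \<phi> where "\<phi> t = max 0 t" for t :: real
  have [measurable]: "w \<in> borel_measurable lborel" "\<phi> \<in> borel_measurable lborel"
    unfolding w_def \<phi>_def by measurable
  have eq: "w t * exp (- c * of_real (\<phi> t)) = bessel_kern m \<alpha> c t" for c t
    by (auto simp: w_def \<phi>_def bessel_kern_def mult_exp_exp)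
  have eq1: "of_real (\<phi> t) * w t * exp (- c * of_real (\<phi> t)) = bessel_kern (m + 1) \<alpha> c t" for c t
    by (auto simp: w_def \<phi>_def bessel_kern_def mult_exp_exp powr_add)
  have "((\<lambda>c. LINT t|lborel. w t * exp (- c * of_real (\<phi> t))) has_field_derivative
      - (LINT t|lborel. of_real (\<phi> t) * w t * exp (- \<beta> * of_real (\<phi> t)))) (at \<beta>)"
  proof (rule has_field_derivative_laplace[where \<delta> = "Re \<beta> / 2"])
    show "integrable lborel (\<lambda>t. w t * exp (- c * of_real (\<phi> t)))" if "Re \<beta> / 2 < Re c" for c
      unfolding eq using that \<alpha> \<beta> by (intro bessel_kern_integrable) auto
    show "integrable lborel (\<lambda>t. of_real (\<phi> t) * w t * exp (- of_real (Re \<beta> / 2) * of_real (\<phi> t)))"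
      unfolding eq1 using \<alpha> \<beta> by (intro bessel_kern_integrable) auto
  qed (use \<beta> in \<open>auto simp: \<phi>_def\<close>)
  then show ?thesis
    unfolding eq eq1 by (simp add: bessel_int_def[abs_def])
qed

lemma bessel_int_deriv_alpha:
  assumes \<alpha>: "0 < Re \<alpha>" and m: "m < - 1"
  shows "((\<lambda>\<alpha>. bessel_int m \<alpha> 0) has_field_derivative - bessel_int (m - 1) \<alpha> 0) (at \<alpha>)"
proof -
  define w where "w = bessel_kern m 0 0"
  define \<phi> where "\<phi> t = max 0 (1 / t)" for t :: real
  have [measurable]: "w \<in> borel_measurable lborel" "\<phi> \<in> borel_measurable lborel"
    unfolding w_def \<phi>_def by measurable
  have eq: "w t * exp (- c * of_real (\<phi> t)) = bessel_kern m c 0 t" for c t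
    by (auto simp: w_def \<phi>_def bessel_kern_def)
  have eq1: "of_real (\<phi> t) * w t * exp (- c * of_real (\<phi> t)) = bessel_kern (m - 1) c 0 t" for c t
    by (auto simp: w_def \<phi>_def bessel_kern_def powr_diff)
  have "((\<lambda>c. LINT t|lborel. w t * exp (- c * of_real (\<phi> t))) has_field_derivative
      - (LINT t|lborel. of_real (\<phi> t) * w t * exp (- \<alpha> * of_real (\<phi> t)))) (at \<alpha>)"
  proof (rule has_field_derivative_laplace[where \<delta> = "Re \<alpha> / 2"])
    show "integrable lborel (\<lambda>t. w t * exp (- c * of_real (\<phi> t)))" if "Re \<alpha> / 2 < Re c" for c
      unfolding eq using that \<alpha> m by (intro bessel_kern_integrable_0) auto
    show "integrable lborel (\<lambda>t. of_real (\<phi> t) * w t * exp (- of_real (Re \<alpha> / 2) * of_real (\<phi> t)))"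
      unfolding eq1 using \<alpha> m by (intro bessel_kern_integrable_0) auto
  qed (use \<alpha> in \<open>auto simp: \<phi>_def\<close>)
  then show ?thesis
    unfolding eq eq1 by (simp add: bessel_int_def)
qed

lemma of_real_powr_derivative:
  assumes "0 < z"
  shows "((\<lambda>z. complex_of_real (z powr e)) has_vector_derivative of_real (e * z powr (e - 1))) (at z)"
  using has_real_derivative_powr[OF assms, of e]
  unfolding has_real_derivative_iff_has_vector_derivative
  by (rule bounded_linear.has_vector_derivative[OF bounded_linear_of_real])

lemma bessel_kern_has_vector_derivative:
  assumes t: "0 < t"
  shows "(bessel_kern p \<alpha> \<beta> has_vector_derivative
      of_real p * bessel_kern (p - 1) \<alpha> \<beta> t + \<alpha> * bessel_kern (p - 2) \<alpha> \<beta> t - \<beta> * bessel_kern p \<alpha> \<beta> t) (at t)"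
    (is "(_ has_vector_derivative ?f t) _")
proof -
  have pw: "t powr (p - 1) = t powr p / t" "t powr (p - 2) = t powr p / t\<^sup>2"
    using t by (simp_all add: powr_diff)
  have d1: "((\<lambda>r. complex_of_real (r powr p)) has_vector_derivative of_real (p * t powr (p - 1))) (at t)"
    by (rule of_real_powr_derivative[OF t])
  have d2: "((\<lambda>r. exp (- (\<alpha> / of_real r) - \<beta> * of_real r)) has_vector_derivative
      exp (- (\<alpha> / of_real t) - \<beta> * of_real t) * (\<alpha> / (of_real t)\<^sup>2 - \<beta>)) (at t)"
  proof -
    have "((\<lambda>z. exp (- (\<alpha> / z) - \<beta> * z)) has_field_derivative
      exp (- (\<alpha> / of_real t) - \<beta> * of_real t) * (\<alpha> / (of_real t)\<^sup>2 - \<beta>)) (at (of_real t))"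
      using t by (auto intro!: derivative_eq_intros simp: power2_eq_square)
    from has_vector_derivative_real_field[OF this] show ?thesis by simp
  qed
  have "((\<lambda>r. of_real (r powr p) * exp (- (\<alpha> / of_real r) - \<beta> * of_real r)) has_vector_derivative
     of_real (t powr p) * (exp (- (\<alpha> / of_real t) - \<beta> * of_real t) * (\<alpha> / (of_real t)\<^sup>2 - \<beta>))
     + of_real (p * t powr (p - 1)) * exp (- (\<alpha> / of_real t) - \<beta> * of_real t)) (at t)"
    by (rule has_vector_derivative_mult[OF d1 d2])
  moreover have "of_real (t powr p) * (exp (- (\<alpha> / of_real t) - \<beta> * of_real t) * (\<alpha> / (of_real t)\<^sup>2 - \<beta>))
     + of_real (p * t powr (p - 1)) * exp (- (\<alpha> / of_real t) - \<beta> * of_real t) = ?f t"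
    using t by (simp add: bessel_kern_def pw algebra_simps)
  ultimately have "((\<lambda>r. of_real (r powr p) * exp (- (\<alpha> / of_real r) - \<beta> * of_real r)) has_vector_derivative ?f t) (at t)"
    by (simp only:)
  then show ?thesis
    by (rule has_vector_derivative_transform_within_open[of _ _ _ "{0<..}"]) (use t in \<open>auto simp: bessel_kern_def\<close>)
qed

lemma isCont_bessel_kern:
  assumes t: "0 < t"
  shows "isCont (bessel_kern m \<alpha> \<beta>) t"
proof -
  have A: "isCont (\<lambda>r. of_real (r powr m) * exp (- (\<alpha> / of_real r) - \<beta> * of_real r)) t"
    using t by (intro continuous_intros) auto
  have B: "\<forall>\<^sub>F r in nhds t. (of_real (r powr m) * exp (- (\<alpha> / of_real r) - \<beta> * of_real r)) = bessel_kern m \<alpha> \<beta> r"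
    using eventually_nhds_in_open[of "{0<..}" t] t
    by (auto elim!: eventually_mono simp: bessel_kern_def)
  show ?thesis using A unfolding isCont_cong[OF B] .
qed

text \<open>
  The integrand is the derivative of \<open>bessel_kern p\<close>, which vanishes at both ends of the half line.
\<close>

lemma bessel_int_by_parts_aux:
  assumes \<alpha>: "0 < Re \<alpha>"
    and int: "integrable lborel (\<lambda>t. of_real p * bessel_kern (p - 1) \<alpha> \<beta> t + \<alpha> * bessel_kern (p - 2) \<alpha> \<beta> t - \<beta> * bessel_kern p \<alpha> \<beta> t)"
    and lim: "((\<lambda>t. t powr p * exp (- Re \<beta> * t)) \<longlongrightarrow> 0) at_top"
  shows "(LINT t|lborel. of_real p * bessel_kern (p - 1) \<alpha> \<beta> t + \<alpha> * bessel_kern (p - 2) \<alpha> \<beta> t - \<beta> * bessel_kern p \<alpha> \<beta> t) = 0"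
proof -
  let ?f = "\<lambda>t. of_real p * bessel_kern (p - 1) \<alpha> \<beta> t + \<alpha> * bessel_kern (p - 2) \<alpha> \<beta> t - \<beta> * bessel_kern p \<alpha> \<beta> t"
  let ?F = "bessel_kern p \<alpha> \<beta>"
  have ind: "indicator {0<..} t *\<^sub>R ?f t = ?f t" for t :: real
    by (auto simp: bessel_kern_def indicator_def)
  have "(LBINT t=0..\<infinity>. ?f t) = 0 - 0"
  proof (rule interval_integral_FTC_integrable[where F = ?F])
    fix t :: real assume "0 < ereal t"
    then have t: "0 < t" by simp
    show "(?F has_vector_derivative ?f t) (at t)"
      by (rule bessel_kern_has_vector_derivative[OF t])
    show "isCont ?f t" by (intro continuous_intros isCont_bessel_kern t)
  next
    show "set_integrable lborel (einterval 0 \<infinity>) ?f"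
      using int unfolding set_integrable_def by (simp add: ind einterval_eq zero_ereal_def)
    have n: "((\<lambda>t. norm (?F t)) \<longlongrightarrow> 0) (at_right 0)"
    proof -
      define a b where "a = Re \<alpha>" and "b = Re \<beta>"
      have "0 < a" using \<alpha> by (simp add: a_def)
      then have "((\<lambda>t. t powr p * exp (- (a / t) - b * t)) \<longlongrightarrow> 0) (at_right 0)"
        by real_asymp
      moreover have "\<forall>\<^sub>F t in at_right 0. t powr p * exp (- (a / t) - b * t) = norm (?F t)"
        using eventually_at_right_less[of "0::real"] by eventually_elim (simp add: norm_bessel_kern a_def b_def)
      ultimately show ?thesis by (rule Lim_transform_eventually)
    qed
    show "((?F \<circ> real_of_ereal) \<longlongrightarrow> 0) (at_right 0)"
      unfolding zero_ereal_def ereal_tendsto_simps using n by (rule tendsto_norm_zero_cancel)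
    have n: "((\<lambda>t. norm (?F t)) \<longlongrightarrow> 0) at_top"
    proof (rule tendsto_sandwich[OF _ _ tendsto_const lim])
      show "\<forall>\<^sub>F t in at_top. norm (?F t) \<le> t powr p * exp (- Re \<beta> * t)"
        using eventually_gt_at_top[of 0]
      proof eventually_elim
        case (elim t)
        have "exp (- (Re \<alpha> / t) - Re \<beta> * t) \<le> exp (- Re \<beta> * t)" using \<alpha> elim by simp
        then show ?case using elim by (simp add: norm_bessel_kern mult_left_mono)
      qed
    qed auto
    show "((?F \<circ> real_of_ereal) \<longlongrightarrow> 0) (at_left \<infinity>)"
      unfolding ereal_tendsto_simps using n by (rule tendsto_norm_zero_cancel)
  qed simp
  then show ?thesis
    unfolding interval_lebesgue_integral_0_infty set_lebesgue_integral_def by (simp add: ind)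
qed

lemma bessel_int_by_parts:
  assumes \<alpha>: "0 < Re \<alpha>" and \<beta>: "0 < Re \<beta>"
  shows "of_real p * bessel_int (p - 1) \<alpha> \<beta> + \<alpha> * bessel_int (p - 2) \<alpha> \<beta> = \<beta> * bessel_int p \<alpha> \<beta>"
proof -
  note [simp] = bessel_kern_integrable[OF \<alpha> \<beta>]
  have lim: "((\<lambda>t. t powr p * exp (- Re \<beta> * t)) \<longlongrightarrow> 0) at_top"
    using \<beta> by real_asymp
  have "(LINT t|lborel. of_real p * bessel_kern (p - 1) \<alpha> \<beta> t + \<alpha> * bessel_kern (p - 2) \<alpha> \<beta> t - \<beta> * bessel_kern p \<alpha> \<beta> t) = 0"
    by (rule bessel_int_by_parts_aux[OF \<alpha> _ lim]) simp
  then show ?thesis by (simp add: bessel_int_def)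
qed

lemma bessel_int_by_parts_0:
  assumes \<alpha>: "0 < Re \<alpha>" and p: "p < 0"
  shows "of_real p * bessel_int (p - 1) \<alpha> 0 + \<alpha> * bessel_int (p - 2) \<alpha> 0 = 0"
proof -
  have i: "integrable lborel (bessel_kern (p - 1) \<alpha> 0)" "integrable lborel (bessel_kern (p - 2) \<alpha> 0)"
    by (rule bessel_kern_integrable_0; use \<alpha> p in simp)+
  have lim: "((\<lambda>t. t powr p * exp (- Re 0 * t)) \<longlongrightarrow> 0) at_top"
    using p by (simp add: tendsto_neg_powr filterlim_ident)
  have "(LINT t|lborel. of_real p * bessel_kern (p - 1) \<alpha> 0 t + \<alpha> * bessel_kern (p - 2) \<alpha> 0 t - 0 * bessel_kern p \<alpha> 0 t) = 0"
    by (rule bessel_int_by_parts_aux[OF \<alpha> _ lim]) (use i in simp)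
  then show ?thesis using i by (simp add: bessel_int_def)
qed

section \<open>Bessel integrals as combinations of Bessel series\<close>

lemma Gamma_lborel_integral:
  assumes x: "0 < x"
  shows "integrable lborel (\<lambda>t::real. if t \<in> {0..} then t powr (x - 1) / exp t else 0)"
    and "(LINT t|lborel. (if t \<in> {0..} then t powr (x - 1) / exp t else 0)) = Gamma x"
  by (rule lborel_integral_of_has_integral_nonneg[OF Gamma_integral_real[OF x]]; auto intro!: measurable_If)+

text \<open>
  The substitution \<open>t \<mapsto> 1 / t\<close> leads to the Gamma integral.
\<close>

lemma bessel_int_one_zero:
  assumes s: "0 < s"
  shows "bessel_int (- 1 - s) 1 0 = of_real (Gamma s)"
proof -
  let ?f = "\<lambda>u::real. u powr (s - 1) / exp u"
  let ?h = "\<lambda>t::real. t powr (- 1 - s) * exp (- (1 / t))"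
  have "(?f has_integral Gamma s) {0<..}"
  proof -
    have "((\<lambda>u. if u \<in> {0<..} then ?f u else 0) has_integral Gamma s) {0..}"
      by (rule has_integral_spike[of "{0}", OF _ _ Gamma_integral_real[OF s]]) auto
    then show ?thesis by (subst (asm) has_integral_restrict) auto
  qed
  then have f: "?f integrable_on {0<..}" "integral {0<..} ?f = Gamma s"
    by (auto simp: has_integral_iff)
  have "?f absolutely_integrable_on {0<..}"
    by (rule nonnegative_absolutely_integrable_1) (use f in auto)
  moreover have im: "inverse ` {0::real<..} = {0<..}"
    by (auto intro!: image_eqI[of _ inverse "inverse _"])
  moreover have "(\<lambda>t. \<bar>- (1 / t\<^sup>2)\<bar> * ?f (inverse t)) absolutely_integrable_on {0<..} \<and>
      integral {0<..} (\<lambda>t. \<bar>- (1 / t\<^sup>2)\<bar> * ?f (inverse t)) = Gamma s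
    \<longleftrightarrow> ?f absolutely_integrable_on inverse ` {0<..} \<and> integral (inverse ` {0<..}) ?f = Gamma s"
    by (rule has_absolute_integral_change_of_variables_1')
       (auto intro!: derivative_eq_intros simp: inj_on_def power2_eq_square field_simps)
  ultimately have g: "(\<lambda>t. \<bar>- (1 / t\<^sup>2)\<bar> * ?f (inverse t)) absolutely_integrable_on {0<..}"
    "integral {0<..} (\<lambda>t. \<bar>- (1 / t\<^sup>2)\<bar> * ?f (inverse t)) = Gamma s"
    using f(2) by auto
  then have "((\<lambda>t. \<bar>- (1 / t\<^sup>2)\<bar> * ?f (inverse t)) has_integral Gamma s) {0<..}"
    using set_lebesgue_integral_eq_integral(1) has_integral_integral by metis
  then have "(?h has_integral Gamma s) {0<..}"
  proof (rule has_integral_eq[rotated])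
    fix t :: real assume "t \<in> {0<..}"
    then have t: "0 < t" by simp
    have "inverse t powr (s - 1) = t powr (1 - s)"
      using t by (simp add: powr_minus[symmetric] inverse_powr)
    moreover have "t powr (1 - s) / t\<^sup>2 = t powr (- 1 - s)"
    proof -
      have "t powr (- 1 - s) = t powr (1 - s - 2)" by simp
      also have "\<dots> = t powr (1 - s) / t powr 2" by (rule powr_diff)
      finally show ?thesis using t by simp
    qed
    ultimately show "\<bar>- (1 / t\<^sup>2)\<bar> * ?f (inverse t) = ?h t"
      using t by (simp add: exp_minus field_simps)
  qed
  from lborel_integral_of_has_integral_nonneg(2)[OF this]
  have "(LINT t|lborel. (if t \<in> {0<..} then ?h t else 0)) = Gamma s"
    by (simp add: measurable_If)
  moreover have "bessel_kern (- 1 - s) 1 0 = (\<lambda>t. of_real (if t \<in> {0<..} then ?h t else 0))"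
    by (rule ext) (simp add: bessel_kern_def flip: exp_of_real)
  ultimately show ?thesis
    unfolding bessel_int_def by (simp only: integral_complex_of_real)
qed

text \<open>
  As a function of \<open>\<alpha>\<close> the integral satisfies \<open>\<alpha> J'(\<alpha>) = - s J(\<alpha>)\<close>, which extends the value at \<open>\<alpha> = 1\<close> to
  the half plane.
\<close>

lemma bessel_int_zero:
  assumes s: "0 < s" and \<alpha>: "0 < Re \<alpha>"
  shows "bessel_int (- 1 - s) \<alpha> 0 = of_real (Gamma s) * \<alpha> powr (- of_real s)"
proof -
  have "\<exists>c. \<forall>z\<in>{z. 0 < Re z}. bessel_int (- 1 - s) z 0 * z powr of_real s = c"
  proof (rule has_field_derivative_zero_constant)
    show "convex {z. 0 < Re z}" by (rule convex_halfspace_Re_gt)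
    fix z assume "z \<in> {z. 0 < Re z}"
    then have z: "0 < Re z" "z \<notin> \<real>\<^sub>\<le>\<^sub>0" "z \<noteq> 0" by (auto simp: complex_nonpos_Reals_iff)
    have "((\<lambda>z. bessel_int (- 1 - s) z 0 * z powr of_real s) has_field_derivative
       (- bessel_int (- 1 - s - 1) z 0) * z powr of_real s + (of_real s * z powr (of_real s - 1)) * bessel_int (- 1 - s) z 0) (at z)"
      by (rule DERIV_mult[OF bessel_int_deriv_alpha has_field_derivative_powr]) (use z s in auto)
    moreover have "(- bessel_int (- 1 - s - 1) z 0) * z powr of_real s + (of_real s * z powr (of_real s - 1)) * bessel_int (- 1 - s) z 0 = 0"
    proof -
      have "z powr (of_real s - 1) = z powr of_real s / z" using z by (subst powr_diff) auto
      moreover have "z * bessel_int (- 1 - s - 1) z 0 = of_real s * bessel_int (- 1 - s) z 0"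
      proof -
        have e: "- s - 1 = - 1 - s" "- s - 2 = - 1 - s - 1" by auto
        have "of_real (- s) * bessel_int (- 1 - s) z 0 + z * bessel_int (- 1 - s - 1) z 0 = 0"
          using bessel_int_by_parts_0[of z "- s"] z s unfolding e by simp
        then have "z * bessel_int (- 1 - s - 1) z 0 = - (of_real (- s) * bessel_int (- 1 - s) z 0)"
          by (simp only: eq_neg_iff_add_eq_0 add.commute)
        then show ?thesis by simp
      qed
      then have "bessel_int (- 1 - s - 1) z 0 = of_real s * bessel_int (- 1 - s) z 0 / z"
        using z by (simp add: nonzero_eq_divide_eq mult.commute)
      ultimately show ?thesis by (simp only:) simp
    qed
    ultimately show "((\<lambda>z. bessel_int (- 1 - s) z 0 * z powr of_real s) has_field_derivative 0) (at z within {z. 0 < Re z})"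
      by (simp add: has_field_derivative_at_within)
  qed
  then obtain c where c: "\<And>z. 0 < Re z \<Longrightarrow> bessel_int (- 1 - s) z 0 * z powr of_real s = c" by blast
  have "c = of_real (Gamma s)"
    using c[of 1] bessel_int_one_zero[OF s] by simp
  then have "bessel_int (- 1 - s) \<alpha> 0 * \<alpha> powr of_real s = of_real (Gamma s)" using c[OF \<alpha>] by simp
  moreover have "\<alpha> powr of_real s \<noteq> 0" using \<alpha> by auto
  ultimately show ?thesis by (simp add: powr_minus field_simps)
qed

lemma bessel_int_scale:
  assumes r: "0 < r"
  shows "bessel_int m \<alpha> (of_real r) = of_real (r powr (- m - 1)) * bessel_int m (\<alpha> * of_real r) 1"
proof -
  have "bessel_int m \<alpha> (of_real r) = \<bar>1 / r\<bar> *\<^sub>R (LINT u|lborel. bessel_kern m \<alpha> (of_real r) (0 + (1 / r) * u))"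
    unfolding bessel_int_def by (rule lborel_integral_real_affine) (use r in simp)
  also have "(\<lambda>u. bessel_kern m \<alpha> (of_real r) (0 + (1 / r) * u)) = (\<lambda>u. of_real (r powr (- m)) * bessel_kern m (\<alpha> * of_real r) 1 u)"
    using r by (auto simp: bessel_kern_def powr_divide powr_minus field_simps fun_eq_iff)
  also have "\<bar>1 / r\<bar> *\<^sub>R (LINT u|lborel. of_real (r powr (- m)) * bessel_kern m (\<alpha> * of_real r) 1 u)
     = of_real (r powr (- m) / r) * bessel_int m (\<alpha> * of_real r) 1"
    using r by (simp add: bessel_int_def scaleR_conv_of_real)
  also have "r powr (- m) / r = r powr (- m - 1)"
    using r by (simp add: powr_diff)
  finally show ?thesis .
qed

lemma bessel_int_tendsto_0:
  assumes s: "0 < s" and \<alpha>: "0 < Re \<alpha>"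
  shows "((\<lambda>r. bessel_int (- 1 - s) \<alpha> (of_real r)) \<longlongrightarrow> of_real (Gamma s) * \<alpha> powr (- of_real s)) (at_right 0)"
  unfolding bessel_int_zero[OF s \<alpha>, symmetric] bessel_int_def
proof (rule tendsto_integral_dominated[where w = "\<lambda>t. norm (bessel_kern (- 1 - s) \<alpha> 0 t)"])
  show "AE t in lborel. ((\<lambda>r. bessel_kern (- 1 - s) \<alpha> (of_real r) t) \<longlongrightarrow> bessel_kern (- 1 - s) \<alpha> 0 t) (at_right 0)"
  proof (rule AE_I2)
    fix t :: real
    have "((\<lambda>r. of_real (t powr (- 1 - s)) * exp (- (\<alpha> / of_real t) - of_real r * of_real t))
        \<longlongrightarrow> of_real (t powr (- 1 - s)) * exp (- (\<alpha> / of_real t) - of_real 0 * of_real t)) (at_right 0)"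
      by (intro tendsto_intros)
    then show "((\<lambda>r. bessel_kern (- 1 - s) \<alpha> (of_real r) t) \<longlongrightarrow> bessel_kern (- 1 - s) \<alpha> 0 t) (at_right 0)"
      by (cases "0 < t") (auto simp: bessel_kern_def)
  qed
  show "integrable lborel (\<lambda>t. norm (bessel_kern (- 1 - s) \<alpha> 0 t))"
    by (intro integrable_norm bessel_kern_integrable_0) (use s \<alpha> in auto)
  show "AE t in lborel. norm (bessel_kern (- 1 - s) \<alpha> (of_real r) t) \<le> norm (bessel_kern (- 1 - s) \<alpha> 0 t)" if "r \<in> {0<..}" for r
  proof (rule AE_I2)
    fix t :: real
    show "norm (bessel_kern (- 1 - s) \<alpha> (of_real r) t) \<le> norm (bessel_kern (- 1 - s) \<alpha> 0 t)"
      using that by (cases "0 < t") (simp add: norm_bessel_kern, simp add: bessel_kern_def)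
  qed
qed auto

text \<open>
  In contrast to exponent \<open>- 1 - s\<close>, the integral with exponent \<open>- s\<close> diverges as \<open>\<beta>\<close> tends to \<open>0\<close>. After the
  substitution \<open>t \<mapsto> t / \<beta>\<close> the integrand converges to that of \<open>Gamma (1 - s)\<close>.
\<close>

lemma bessel_int_scaled_tendsto_0:
  assumes s: "s < 1" and \<alpha>: "0 < Re \<alpha>"
  shows "((\<lambda>r. of_real r powr (1 - of_real s) * bessel_int (- s) \<alpha> (of_real r)) \<longlongrightarrow> of_real (Gamma (1 - s))) (at_right 0)"
proof -
  have "((\<lambda>r. LINT t|lborel. bessel_kern (- s) (\<alpha> * of_real r) 1 t) \<longlongrightarrow> (LINT t|lborel. bessel_kern (- s) 0 1 t)) (at_right 0)"
  proof (rule tendsto_integral_dominated[where w = "\<lambda>t. if t \<in> {0..} then t powr ((1 - s) - 1) / exp t else 0"])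
    show "AE t in lborel. ((\<lambda>r. bessel_kern (- s) (\<alpha> * of_real r) 1 t) \<longlongrightarrow> bessel_kern (- s) 0 1 t) (at_right 0)"
    proof (rule AE_I2)
      fix t :: real
      have "((\<lambda>r. of_real (t powr (- s)) * exp (- (\<alpha> * of_real r * (1 / of_real t)) - 1 * of_real t))
        \<longlongrightarrow> of_real (t powr (- s)) * exp (- (\<alpha> * of_real 0 * (1 / of_real t)) - 1 * of_real t)) (at_right 0)"
        by (intro tendsto_intros)
      then show "((\<lambda>r. bessel_kern (- s) (\<alpha> * of_real r) 1 t) \<longlongrightarrow> bessel_kern (- s) 0 1 t) (at_right 0)"
        by (cases "0 < t") (auto simp: bessel_kern_def)
    qed
    show "integrable lborel (\<lambda>t. if t \<in> {0..} then t powr ((1 - s) - 1) / exp t else 0)"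
      using s by (intro Gamma_lborel_integral) simp
    show "AE t in lborel. norm (bessel_kern (- s) (\<alpha> * of_real r) 1 t) \<le> (if t \<in> {0..} then t powr ((1 - s) - 1) / exp t else 0)"
      if "r \<in> {0<..}" for r
    proof (rule AE_I2)
      fix t :: real
      show "norm (bessel_kern (- s) (\<alpha> * of_real r) 1 t) \<le> (if t \<in> {0..} then t powr ((1 - s) - 1) / exp t else 0)"
      proof (cases "0 < t")
        case True
        have "exp (- (Re \<alpha> * r / t) - t) \<le> exp (- t)" using that \<alpha> True by simp
        then show ?thesis
          using True by (simp add: norm_bessel_kern divide_inverse mult_left_mono flip: exp_minus)
      qed (simp add: bessel_kern_def)
    qed
  qed auto
  moreover have "(LINT t|lborel. bessel_kern (- s) 0 1 t) = of_real (Gamma (1 - s))"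
  proof -
    have "bessel_kern (- s) 0 1 t = of_real (if t \<in> {0..} then t powr ((1 - s) - 1) / exp t else 0)" for t
      by (auto simp: bessel_kern_def divide_inverse exp_minus simp flip: exp_of_real)
    then show ?thesis
      using Gamma_lborel_integral(2)[of "1 - s"] s by (simp only: integral_complex_of_real)
  qed
  ultimately have "((\<lambda>r. bessel_int (- s) (\<alpha> * of_real r) 1) \<longlongrightarrow> of_real (Gamma (1 - s))) (at_right 0)"
    by (simp add: bessel_int_def)
  moreover have "\<forall>\<^sub>F r in at_right 0. bessel_int (- s) (\<alpha> * of_real r) 1 = of_real r powr (1 - of_real s) * bessel_int (- s) \<alpha> (of_real r)"
    using eventually_at_right_less[of "0::real"]
  proof eventually_elim
    case (elim r)
    have "of_real r powr (1 - of_real s) = complex_of_real (r powr (1 - s))"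
      using elim powr_of_real[of r "1 - s"] by simp
    moreover have "r powr (1 - s) * r powr (s - 1) = 1"
      using elim by (simp flip: powr_add)
    then have "complex_of_real (r powr (1 - s)) * complex_of_real (r powr (s - 1)) = 1"
      by (metis of_real_1 of_real_mult)
    ultimately show ?case
      using bessel_int_scale[OF elim, of "- s" \<alpha>] by simp
  qed
  ultimately show ?thesis by (rule Lim_transform_eventually)
qed

text \<open>
  The pairs \<open>(f, f1)\<close> and \<open>(g, g1)\<close> solve the same linear system \<open>y' = \<beta>\<^bsup>s-1\<^esup> y1\<close>, \<open>y1' = \<alpha> \<beta>\<^bsup>-s\<^esup> y\<close>, the modified
  Bessel equation in self-adjoint form. Its matrix has trace zero, so the Wronskian is constant, and the
  constant can be read off in the limit \<open>\<beta> \<rightarrow> 0\<close>.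
\<close>

lemma wronskian_const:
  fixes f f1 g g1 :: "complex \<Rightarrow> complex"
  assumes f: "\<And>\<beta>. 0 < Re \<beta> \<Longrightarrow> (f has_field_derivative \<beta> powr (s - 1) * f1 \<beta>) (at \<beta>)"
    and f1: "\<And>\<beta>. 0 < Re \<beta> \<Longrightarrow> (f1 has_field_derivative \<alpha> * \<beta> powr (- s) * f \<beta>) (at \<beta>)"
    and g: "\<And>\<beta>. 0 < Re \<beta> \<Longrightarrow> (g has_field_derivative \<beta> powr (s - 1) * g1 \<beta>) (at \<beta>)"
    and g1: "\<And>\<beta>. 0 < Re \<beta> \<Longrightarrow> (g1 has_field_derivative \<alpha> * \<beta> powr (- s) * g \<beta>) (at \<beta>)"
    and lim: "((\<lambda>r. f (of_real r)) \<longlongrightarrow> a) (at_right 0)" "((\<lambda>r. f1 (of_real r)) \<longlongrightarrow> a1) (at_right 0)"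
      "((\<lambda>r. g (of_real r)) \<longlongrightarrow> b) (at_right 0)" "((\<lambda>r. g1 (of_real r)) \<longlongrightarrow> b1) (at_right 0)"
    and \<beta>: "0 < Re \<beta>"
  shows "f \<beta> * g1 \<beta> - g \<beta> * f1 \<beta> = a * b1 - b * a1"
proof -
  let ?W = "\<lambda>\<beta>. f \<beta> * g1 \<beta> - g \<beta> * f1 \<beta>"
  have "\<exists>c. \<forall>z\<in>{z. 0 < Re z}. ?W z = c"
  proof (rule has_field_derivative_zero_constant)
    show "convex {z. 0 < Re z}" by (rule convex_halfspace_Re_gt)
    fix z assume "z \<in> {z. 0 < Re z}"
    then have z: "0 < Re z" by simp
    have "(?W has_field_derivative 0) (at z)"
      by (rule derivative_eq_intros f f1 g g1 z refl)+ (simp add: algebra_simps)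
    then show "(?W has_field_derivative 0) (at z within {z. 0 < Re z})"
      by (rule has_field_derivative_at_within)
  qed
  then obtain c where c: "\<And>z. 0 < Re z \<Longrightarrow> ?W z = c" by blast
  have "((\<lambda>r. ?W (of_real r)) \<longlongrightarrow> a * b1 - b * a1) (at_right 0)"
    by (intro tendsto_intros lim)
  moreover have "\<forall>\<^sub>F r in at_right 0. ?W (of_real r) = c"
    using eventually_at_right_less[of "0::real"] by eventually_elim (rule c, simp)
  ultimately have "((\<lambda>r::real. c) \<longlongrightarrow> a * b1 - b * a1) (at_right 0)"
    by (rule Lim_transform_eventually)
  then have "c = a * b1 - b * a1"
    by (simp add: tendsto_const_iff)
  then show ?thesis using c[OF \<beta>] by simp
qed

lemma of_real_powr_tendsto_0:
  assumes "0 < e"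
  shows "((\<lambda>r::real. complex_of_real r powr of_real e) \<longlongrightarrow> 0) (at_right 0)"
proof -
  have "((\<lambda>r::real. r powr e) \<longlongrightarrow> 0) (at_right 0)"
    using assms by real_asymp
  then have "((\<lambda>r::real. complex_of_real (r powr e)) \<longlongrightarrow> of_real 0) (at_right 0)"
    by (rule tendsto_of_real)
  moreover have "\<forall>\<^sub>F r in at_right 0. complex_of_real (r powr e) = of_real r powr of_real e"
    using eventually_at_right_less[of "0::real"] by eventually_elim (simp add: powr_of_real)
  ultimately show ?thesis
    by (simp add: Lim_transform_eventually)
qed

lemma hyp01_along_ray_tendsto: "((\<lambda>r. hyp01 \<nu> (\<alpha> * of_real r)) \<longlongrightarrow> rGamma (\<nu> + 1)) (at_right 0)"
proof -
  have "isCont (hyp01 \<nu>) (\<alpha> * of_real 0)"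
    using hyp01_has_field_derivative DERIV_isCont by blast
  moreover have "((\<lambda>r. \<alpha> * of_real r) \<longlongrightarrow> \<alpha> * of_real 0) (at_right 0)"
    by (intro tendsto_intros)
  ultimately show ?thesis
    using isCont_tendsto_compose[of "\<alpha> * of_real 0" "hyp01 \<nu>"] by (simp add: hyp01_0)
qed

text \<open>
  This is the integral representation of \<open>K\<^sub>s\<close>: the right-hand side is, up to a factor, the difference
  \<open>I\<^bsub>-s\<^esub> - I\<^sub>s\<close> that defines \<open>besselK\<close>. The integral \<open>J\<close> and the two series \<open>f\<close> and \<open>g\<close> on the right solve the
  system of \<open>wronskian_const\<close> in the variable \<open>\<beta>\<close>. Three vectors in a plane are linearly dependent, with
  Wronskians as coefficients, and the Wronskians are known from the limits at \<open>\<beta> = 0\<close>.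
\<close>

lemma bessel_int_formula:
  assumes s: "0 < s" "s < 1" and \<alpha>: "0 < Re \<alpha>" and \<beta>: "0 < Re \<beta>"
  shows "of_real (rGamma s * rGamma (1 - s)) * bessel_int (- 1 - s) \<alpha> \<beta>
    = \<alpha> powr (- of_real s) * hyp01 (- of_real s) (\<alpha> * \<beta>) - \<beta> powr of_real s * hyp01 (of_real s) (\<alpha> * \<beta>)"
proof -
  define \<sigma> where "\<sigma> = complex_of_real s"
  let ?J = "bessel_int (- 1 - s) \<alpha>" and ?J1 = "\<lambda>\<beta>. - (\<beta> powr (1 - \<sigma>) * bessel_int (- s) \<alpha> \<beta>)"
  let ?f = "\<lambda>\<beta>. hyp01 (- \<sigma>) (\<alpha> * \<beta>)" and ?f1 = "\<lambda>\<beta>. \<alpha> * \<beta> powr (1 - \<sigma>) * hyp01 (1 - \<sigma>) (\<alpha> * \<beta>)"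
  let ?g = "\<lambda>\<beta>. \<beta> powr \<sigma> * hyp01 \<sigma> (\<alpha> * \<beta>)" and ?g1 = "\<lambda>\<beta>. hyp01 (\<sigma> - 1) (\<alpha> * \<beta>)"
  have lin: "((\<lambda>z. \<alpha> * z) has_field_derivative \<alpha>) (at z)" for z
    by (auto intro!: derivative_eq_intros)
  have pw: "z powr (1 - \<sigma>) = z * z powr (- \<sigma>)" "z powr (\<sigma> - 1) = z powr \<sigma> / z" "z powr (- \<sigma>) = 1 / z powr \<sigma>"
    "z powr (1 - \<sigma> - 1) = z powr (- \<sigma>)" "z powr \<sigma> \<noteq> 0" "z \<noteq> 0"
    "z powr (\<sigma> - 1) * z powr (1 - \<sigma>) = 1"
    if "0 < Re z" for z
  proof -
    show z: "z \<noteq> 0" using that by auto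
    show "z powr (1 - \<sigma>) = z * z powr (- \<sigma>)"
      using z powr_add[of z 1 "- \<sigma>"] by simp
    show "z powr (\<sigma> - 1) = z powr \<sigma> / z" using z by (subst powr_diff) auto
    show "z powr \<sigma> \<noteq> 0" using z by simp
    show "z powr (\<sigma> - 1) * z powr (1 - \<sigma>) = 1" using z by (simp flip: powr_add)
  qed (auto simp: powr_minus divide_inverse)
  \<comment> \<open>\<open>J\<close>, \<open>f\<close> and \<open>g\<close>, each with its second component, solve the system\<close>
  have J: "(?J has_field_derivative z powr (\<sigma> - 1) * ?J1 z) (at z)" if z: "0 < Re z" for z
  proof -
    have "- bessel_int (- 1 - s + 1) \<alpha> z = z powr (\<sigma> - 1) * ?J1 z"
      using pw(7)[OF z] by (simp add: mult.assoc[symmetric])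
    then show ?thesis using bessel_int_deriv_beta[OF \<alpha> z, of "- 1 - s"] by (simp only:)
  qed
  have J1: "(?J1 has_field_derivative \<alpha> * z powr (- \<sigma>) * ?J z) (at z)" if z: "0 < Re z" for z
  proof -
    have "(?J1 has_field_derivative - (((1 - \<sigma>) * z powr (1 - \<sigma> - 1)) * bessel_int (- s) \<alpha> z + (- bessel_int (- s + 1) \<alpha> z) * z powr (1 - \<sigma>))) (at z)"
      by (intro DERIV_minus DERIV_mult has_field_derivative_powr bessel_int_deriv_beta \<alpha> z)
         (use z in \<open>auto simp: complex_nonpos_Reals_iff\<close>)
    moreover have "- (((1 - \<sigma>) * z powr (1 - \<sigma> - 1)) * bessel_int (- s) \<alpha> z + (- bessel_int (- s + 1) \<alpha> z) * z powr (1 - \<sigma>))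
        = \<alpha> * z powr (- \<sigma>) * ?J z"
    proof -
      have "z * bessel_int (- s + 1) \<alpha> z = (1 - \<sigma>) * bessel_int (- s) \<alpha> z + \<alpha> * ?J z"
        using bessel_int_by_parts[OF \<alpha> z, of "1 - s"] by (simp add: \<sigma>_def algebra_simps)
      then have "z powr (- \<sigma>) * (z * bessel_int (- s + 1) \<alpha> z) = z powr (- \<sigma>) * ((1 - \<sigma>) * bessel_int (- s) \<alpha> z + \<alpha> * ?J z)"
        by (simp only:)
      then show ?thesis
        unfolding pw(4)[OF z] pw(1)[OF z] by (simp add: algebra_simps)
    qed
    ultimately show ?thesis by (simp only:)
  qed
  have f: "(?f has_field_derivative z powr (\<sigma> - 1) * ?f1 z) (at z)" if z: "0 < Re z" for z
  proof -
    have "(?f has_field_derivative hyp01 (- \<sigma> + 1) (\<alpha> * z) * \<alpha>) (at z)"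
      by (rule hyp01_DERIV[OF lin])
    moreover have "hyp01 (- \<sigma> + 1) (\<alpha> * z) * \<alpha> = z powr (\<sigma> - 1) * ?f1 z"
      using pw[OF z] by (simp add: field_simps)
    ultimately show ?thesis by (simp only:)
  qed
  have f1: "(?f1 has_field_derivative \<alpha> * z powr (- \<sigma>) * ?f z) (at z)" if z: "0 < Re z" for z
  proof -
    have "(?f1 has_field_derivative (\<alpha> * ((1 - \<sigma>) * z powr (1 - \<sigma> - 1))) * hyp01 (1 - \<sigma>) (\<alpha> * z)
        + (hyp01 (1 - \<sigma> + 1) (\<alpha> * z) * \<alpha>) * (\<alpha> * z powr (1 - \<sigma>))) (at z)"
      by (intro DERIV_mult DERIV_cmult has_field_derivative_powr hyp01_DERIV[OF lin])
         (use z in \<open>auto simp: complex_nonpos_Reals_iff\<close>)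
    moreover have "(\<alpha> * ((1 - \<sigma>) * z powr (1 - \<sigma> - 1))) * hyp01 (1 - \<sigma>) (\<alpha> * z)
        + (hyp01 (1 - \<sigma> + 1) (\<alpha> * z) * \<alpha>) * (\<alpha> * z powr (1 - \<sigma>)) = \<alpha> * z powr (- \<sigma>) * ?f z"
    proof -
      have E: "?f z = \<alpha> * z * hyp01 (1 - \<sigma> + 1) (\<alpha> * z) + (1 - \<sigma>) * hyp01 (1 - \<sigma>) (\<alpha> * z)"
        using hyp01_recurrence[of "\<alpha> * z" "- \<sigma>"] by (simp add: algebra_simps)
      show ?thesis
        unfolding pw(4)[OF z] pw(1)[OF z] E by (simp add: algebra_simps)
    qed
    ultimately show ?thesis by (simp only:)
  qed
  have g: "(?g has_field_derivative z powr (\<sigma> - 1) * ?g1 z) (at z)" if z: "0 < Re z" for z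
  proof -
    have "(?g has_field_derivative (\<sigma> * z powr (\<sigma> - 1)) * hyp01 \<sigma> (\<alpha> * z) + (hyp01 (\<sigma> + 1) (\<alpha> * z) * \<alpha>) * z powr \<sigma>) (at z)"
      by (intro DERIV_mult has_field_derivative_powr hyp01_DERIV[OF lin])
         (use z in \<open>auto simp: complex_nonpos_Reals_iff\<close>)
    moreover have "(\<sigma> * z powr (\<sigma> - 1)) * hyp01 \<sigma> (\<alpha> * z) + (hyp01 (\<sigma> + 1) (\<alpha> * z) * \<alpha>) * z powr \<sigma> = z powr (\<sigma> - 1) * ?g1 z"
    proof -
      have "?g1 z = \<alpha> * z * hyp01 (\<sigma> + 1) (\<alpha> * z) + \<sigma> * hyp01 \<sigma> (\<alpha> * z)"
        using hyp01_recurrence[of "\<alpha> * z" "\<sigma> - 1"] by (simp add: algebra_simps)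
      then show ?thesis
        unfolding pw(2)[OF z] using pw(6)[OF z] by (simp add: field_simps)
    qed
    ultimately show ?thesis by (simp only:)
  qed
  have g1: "(?g1 has_field_derivative \<alpha> * z powr (- \<sigma>) * ?g z) (at z)" if z: "0 < Re z" for z
  proof -
    have "(?g1 has_field_derivative hyp01 (\<sigma> - 1 + 1) (\<alpha> * z) * \<alpha>) (at z)"
      by (rule hyp01_DERIV[OF lin])
    moreover have "hyp01 (\<sigma> - 1 + 1) (\<alpha> * z) * \<alpha> = \<alpha> * z powr (- \<sigma>) * ?g z"
      using pw[OF z] by simp
    ultimately show ?thesis by (simp only:)
  qed
  \<comment> \<open>initial values at \<open>\<beta> = 0\<close>, from which the Wronskians follow\<close>
  have limJ: "((\<lambda>r. ?J (of_real r)) \<longlongrightarrow> of_real (Gamma s) * \<alpha> powr (- \<sigma>)) (at_right 0)"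
    unfolding \<sigma>_def by (rule bessel_int_tendsto_0[OF s(1) \<alpha>])
  have limJ1: "((\<lambda>r. ?J1 (of_real r)) \<longlongrightarrow> - of_real (Gamma (1 - s))) (at_right 0)"
    unfolding \<sigma>_def by (intro tendsto_minus bessel_int_scaled_tendsto_0[OF s(2) \<alpha>])
  have limf: "((\<lambda>r. ?f (of_real r)) \<longlongrightarrow> rGamma (1 - \<sigma>)) (at_right 0)"
    using hyp01_along_ray_tendsto[of "- \<sigma>" \<alpha>] by simp
  have p0: "((\<lambda>r. complex_of_real r powr (1 - \<sigma>)) \<longlongrightarrow> 0) (at_right 0)" "((\<lambda>r. complex_of_real r powr \<sigma>) \<longlongrightarrow> 0) (at_right 0)"
    using of_real_powr_tendsto_0[of "1 - s"] of_real_powr_tendsto_0[of s] s by (auto simp: \<sigma>_def)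
  have limf1: "((\<lambda>r. ?f1 (of_real r)) \<longlongrightarrow> 0) (at_right 0)"
    using tendsto_mult[OF tendsto_mult[OF tendsto_const p0(1)] hyp01_along_ray_tendsto, of \<alpha> "1 - \<sigma>" \<alpha>] by simp
  have limg: "((\<lambda>r. ?g (of_real r)) \<longlongrightarrow> 0) (at_right 0)"
    using tendsto_mult[OF p0(2) hyp01_along_ray_tendsto, of \<sigma> \<alpha>] by simp
  have limg1: "((\<lambda>r. ?g1 (of_real r)) \<longlongrightarrow> rGamma \<sigma>) (at_right 0)"
    using hyp01_along_ray_tendsto[of "\<sigma> - 1" \<alpha>] by simp
  note W = wronskian_const[of _ \<sigma> _ \<alpha>]
  have fg: "?f \<beta> * ?g1 \<beta> - ?g \<beta> * ?f1 \<beta> = rGamma (1 - \<sigma>) * rGamma \<sigma> - 0 * 0"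
    by (rule W[OF f f1 g g1 limf limf1 limg limg1 \<beta>])
  have Jg: "?J \<beta> * ?g1 \<beta> - ?g \<beta> * ?J1 \<beta> = (of_real (Gamma s) * \<alpha> powr (- \<sigma>)) * rGamma \<sigma> - 0 * (- of_real (Gamma (1 - s)))"
    by (rule W[OF J J1 g g1 limJ limJ1 limg limg1 \<beta>])
  have Jf: "?J \<beta> * ?f1 \<beta> - ?f \<beta> * ?J1 \<beta> = (of_real (Gamma s) * \<alpha> powr (- \<sigma>)) * 0 - rGamma (1 - \<sigma>) * (- of_real (Gamma (1 - s)))"
    by (rule W[OF J J1 f f1 limJ limJ1 limf limf1 \<beta>])
  have G: "of_real (Gamma s) * rGamma \<sigma> = 1" "rGamma (1 - \<sigma>) * of_real (Gamma (1 - s)) = 1"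
    "rGamma \<sigma> = of_real (rGamma s)" "rGamma (1 - \<sigma>) = of_real (rGamma (1 - s))"
  proof -
    show 3: "rGamma \<sigma> = of_real (rGamma s)" "rGamma (1 - \<sigma>) = of_real (rGamma (1 - s))"
      unfolding \<sigma>_def by (simp_all flip: rGamma_complex_of_real)
    have "Gamma s * rGamma s = 1" "rGamma (1 - s) * Gamma (1 - s) = 1"
      using s by (simp_all add: rGamma_inverse_Gamma Gamma_eq_zero_iff nonpos_Ints_def)
        (auto simp: rGamma_inverse_Gamma less_imp_neq[OF Gamma_real_pos, symmetric])
    then show "of_real (Gamma s) * rGamma \<sigma> = 1" "rGamma (1 - \<sigma>) * of_real (Gamma (1 - s)) = 1"
      unfolding 3 by (metis of_real_1 of_real_mult)+
  qed
  \<comment> \<open>linear dependence of \<open>J\<close>, \<open>f\<close> and \<open>g\<close>\<close>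
  have "?J \<beta> * (?f \<beta> * ?g1 \<beta> - ?g \<beta> * ?f1 \<beta>) = ?f \<beta> * (?J \<beta> * ?g1 \<beta> - ?g \<beta> * ?J1 \<beta>) - ?g \<beta> * (?J \<beta> * ?f1 \<beta> - ?f \<beta> * ?J1 \<beta>)"
    by (simp add: algebra_simps)
  then have "?J \<beta> * (rGamma (1 - \<sigma>) * rGamma \<sigma>) = ?f \<beta> * (\<alpha> powr (- \<sigma>) * (of_real (Gamma s) * rGamma \<sigma>)) - ?g \<beta> * (rGamma (1 - \<sigma>) * of_real (Gamma (1 - s)))"
    unfolding fg Jg Jf by (simp add: algebra_simps)
  then have "?J \<beta> * (rGamma (1 - \<sigma>) * rGamma \<sigma>) = ?f \<beta> * \<alpha> powr (- \<sigma>) - ?g \<beta>"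
    unfolding G(1,2) by (simp only: mult_1_right)
  then show ?thesis
    unfolding G(3,4) by (simp add: algebra_simps \<sigma>_def)
qed

section \<open>Truncated Bessel integrals with imaginary parameters\<close>

lemma norm_bessel_kern_le:
  assumes "0 \<le> Re \<alpha>" "0 \<le> Re \<beta>" "0 < t"
  shows "norm (bessel_kern m \<alpha> \<beta> t) \<le> t powr m"
proof -
  have "0 \<le> Re \<alpha> / t" "0 \<le> Re \<beta> * t" using assms by simp_all
  then have "- (Re \<alpha> / t) - Re \<beta> * t \<le> 0" by linarith
  then have "exp (- (Re \<alpha> / t) - Re \<beta> * t) \<le> 1" by (simp only: exp_le_one_iff)
  then show ?thesis using assms by (simp add: norm_bessel_kern mult_left_le)
qed

lemma powr_integrable_at_0:
  assumes "- 1 < e"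
  shows "integrable lborel (\<lambda>t::real. if t \<in> {0..1} then t powr e else 0)"
    and "(LINT t|lborel. (if t \<in> {0..1} then t powr e else 0)) = 1 / (e + 1)"
  using lborel_integral_of_has_integral_nonneg[OF has_integral_powr_from_0[OF assms, of 1]]
  by (auto intro!: measurable_If)

lemma powr_tail_integral:
  assumes "0 < (s::real)"
  shows "(LINT t|lborel. (if t \<in> {1..} then t powr (- 1 - s) else 0)) = 1 / s"
  using lborel_integral_of_has_integral_nonneg(2)[OF has_integral_powr_to_inf[of "- 1 - s" 1]] assms
  by (auto intro!: measurable_If)

lemma bessel_kern_set_integrable:
  assumes "0 < s" "0 \<le> Re \<alpha>" "0 \<le> Re \<beta>" "0 < \<epsilon>"
  shows "set_integrable lborel {\<epsilon>..} (bessel_kern (- 1 - s) \<alpha> \<beta>)"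
  unfolding set_integrable_def
proof (rule Bochner_Integration.integrable_bound)
  show "integrable lborel (\<lambda>t::real. if t \<in> {\<epsilon>..} then t powr (- 1 - s) else 0)"
    by (rule powr_integrable_at_top) (use assms in auto)
  show "AE t in lborel. norm (indicat_real {\<epsilon>..} t *\<^sub>R bessel_kern (- 1 - s) \<alpha> \<beta> t)
      \<le> norm (if t \<in> {\<epsilon>..} then t powr (- 1 - s) else 0)"
    using assms norm_bessel_kern_le[OF assms(2,3)] by (intro AE_I2) (auto simp: indicator_def)
qed measurable

lemma bessel_kern_tail_bound:
  assumes "0 < s" "0 \<le> Re \<alpha>" "0 \<le> Re \<beta>" and A: "A \<in> sets borel" "A \<subseteq> {1..}"
  shows "norm (LINT t:A|lborel. bessel_kern (- 1 - s) \<alpha> \<beta> t) \<le> 1 / s"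
proof -
  have "norm (LINT t:A|lborel. bessel_kern (- 1 - s) \<alpha> \<beta> t)
      \<le> (LINT t|lborel. (if t \<in> {1..} then t powr (- 1 - s) else 0))"
    unfolding set_lebesgue_integral_def
  proof (rule norm_integral_le)
    have "set_integrable lborel A (bessel_kern (- 1 - s) \<alpha> \<beta>)"
      by (rule set_integrable_subset[OF bessel_kern_set_integrable[of s \<alpha> \<beta> 1]]) (use assms in auto)
    then show "integrable lborel (\<lambda>t. indicat_real A t *\<^sub>R bessel_kern (- 1 - s) \<alpha> \<beta> t)"
      by (simp add: set_integrable_def)
    show "integrable lborel (\<lambda>t::real. if t \<in> {1..} then t powr (- 1 - s) else 0)"
      by (rule powr_integrable_at_top) (use assms in auto)
    show "norm (indicat_real A t *\<^sub>R bessel_kern (- 1 - s) \<alpha> \<beta> t) \<le> (if t \<in> {1..} then t powr (- 1 - s) else 0)" for t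
      using assms norm_bessel_kern_le[OF assms(2,3)] by (auto simp: indicator_def)
  qed
  then show ?thesis using powr_tail_integral[OF assms(1)] by simp
qed

text \<open>
  What is left after integration by parts. In \<open>\<alpha> * t powr (- 1 - s) * exp (- \<alpha> / t - \<beta> * t)\<close> the factor
  \<open>\<alpha> * t powr (- 2) * exp (- \<alpha> / t)\<close> is the derivative of \<open>exp (- \<alpha> / t)\<close>. Differentiation of the other factor
  \<open>t powr (1 - s) * exp (- \<beta> * t)\<close> leaves \<open>t powr (- s)\<close>, which is integrable at \<open>0\<close>.
\<close>

definition bessel_rem :: "real \<Rightarrow> complex \<Rightarrow> complex \<Rightarrow> real \<Rightarrow> complex" where
  "bessel_rem s \<alpha> \<beta> t = of_real (1 - s) * bessel_kern (- s) \<alpha> \<beta> t - \<beta> * bessel_kern (1 - s) \<alpha> \<beta> t"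

lemma bessel_rem_measurable[measurable]: "bessel_rem s \<alpha> \<beta> \<in> borel_measurable borel"
  unfolding bessel_rem_def[abs_def] by measurable

lemma norm_bessel_rem_le:
  assumes "0 < s" "s < 1" "0 \<le> Re \<alpha>" "0 \<le> Re \<beta>" "0 < t" "t \<le> 1"
  shows "norm (bessel_rem s \<alpha> \<beta> t) \<le> (1 + norm \<beta>) * t powr (- s)"
proof -
  have n: "norm (complex_of_real (1 - s)) = 1 - s"
    using assms by (simp only: norm_of_real)
  have "norm (bessel_rem s \<alpha> \<beta> t) \<le> (1 - s) * norm (bessel_kern (- s) \<alpha> \<beta> t) + norm \<beta> * norm (bessel_kern (1 - s) \<alpha> \<beta> t)"
    unfolding bessel_rem_def
    by (rule order_trans[OF norm_triangle_ineq4]) (simp only: norm_mult n order_refl)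
  also have "\<dots> \<le> 1 * t powr (- s) + norm \<beta> * t powr (- s)"
  proof (intro add_mono mult_mono)
    have "t powr (1 - s) \<le> t powr (- s)" using assms by (intro powr_mono') auto
    then show "norm (bessel_kern (1 - s) \<alpha> \<beta> t) \<le> t powr (- s)"
      using norm_bessel_kern_le[OF assms(3-5), of "1 - s"] by linarith
  qed (use assms norm_bessel_kern_le[OF assms(3-5)] in auto)
  finally show ?thesis by (simp add: algebra_simps)
qed

lemma truncated_by_parts:
  assumes s: "0 < s" "s < 1" and \<alpha>: "0 \<le> Re \<alpha>" and \<beta>: "0 \<le> Re \<beta>" and \<epsilon>: "0 < \<epsilon>" "\<epsilon> \<le> 1"
  shows "\<alpha> * (LINT t:{\<epsilon>..}|lborel. bessel_kern (- 1 - s) \<alpha> \<beta> t) =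
     bessel_kern (1 - s) \<alpha> \<beta> 1 - bessel_kern (1 - s) \<alpha> \<beta> \<epsilon> - (LINT t:{\<epsilon>..1}|lborel. bessel_rem s \<alpha> \<beta> t)
     + \<alpha> * (LINT t:{1<..}|lborel. bessel_kern (- 1 - s) \<alpha> \<beta> t)"
proof -
  have cont: "continuous_on {\<epsilon>..1} (bessel_kern m \<alpha> \<beta>)" for m
    using \<epsilon> by (intro continuous_at_imp_continuous_on ballI isCont_bessel_kern) auto
  have contG: "continuous_on {\<epsilon>..1} (bessel_rem s \<alpha> \<beta>)"
    unfolding bessel_rem_def[abs_def] by (intro continuous_intros cont)
  let ?f = "\<lambda>t. \<alpha> * bessel_kern (- 1 - s) \<alpha> \<beta> t + bessel_rem s \<alpha> \<beta> t"
  have "integral\<^sup>L lborel (\<lambda>t. indicator {\<epsilon>..1} t *\<^sub>R ?f t) = bessel_kern (1 - s) \<alpha> \<beta> 1 - bessel_kern (1 - s) \<alpha> \<beta> \<epsilon>"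
  proof (rule integral_FTC_atLeastAtMost)
    fix t assume "\<epsilon> \<le> t" "t \<le> 1"
    then have t: "0 < t" using \<epsilon> by simp
    have e: "1 - s - 1 = - s" "1 - s - 2 = - 1 - s" by auto
    have "(bessel_kern (1 - s) \<alpha> \<beta> has_vector_derivative ?f t) (at t)"
      using bessel_kern_has_vector_derivative[OF t, of "1 - s" \<alpha> \<beta>] unfolding e
      by (simp add: bessel_rem_def algebra_simps)
    then show "(bessel_kern (1 - s) \<alpha> \<beta> has_vector_derivative ?f t) (at t within {\<epsilon>..1})"
      by (rule has_vector_derivative_at_within)
  qed (use \<epsilon> cont contG in \<open>auto intro!: continuous_intros\<close>)
  moreover have "integral\<^sup>L lborel (\<lambda>t. indicator {\<epsilon>..1} t *\<^sub>R ?f t)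
     = \<alpha> * (LINT t:{\<epsilon>..1}|lborel. bessel_kern (- 1 - s) \<alpha> \<beta> t) + (LINT t:{\<epsilon>..1}|lborel. bessel_rem s \<alpha> \<beta> t)"
    using borel_integrable_atLeastAtMost'[OF cont, of "- 1 - s"] borel_integrable_atLeastAtMost'[OF contG]
    by (simp add: set_integral_add(2) flip: set_lebesgue_integral_def)
  moreover have "(LINT t:{\<epsilon>..}|lborel. bessel_kern (- 1 - s) \<alpha> \<beta> t)
     = (LINT t:{\<epsilon>..1}|lborel. bessel_kern (- 1 - s) \<alpha> \<beta> t) + (LINT t:{1<..}|lborel. bessel_kern (- 1 - s) \<alpha> \<beta> t)"
  proof -
    have e: "{\<epsilon>..} = {\<epsilon>..1} \<union> {1<..}" "{\<epsilon>..1} \<inter> {1<..} = {}" using \<epsilon> by auto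
    have "set_integrable lborel {1<..} (bessel_kern (- 1 - s) \<alpha> \<beta>)"
      by (rule set_integrable_subset[OF bessel_kern_set_integrable[of s \<alpha> \<beta> 1]]) (use s \<alpha> \<beta> in auto)
    then show ?thesis
      unfolding e(1) by (rule set_integral_Un[OF e(2) borel_integrable_atLeastAtMost'[OF cont]])
  qed
  ultimately show ?thesis by (simp add: algebra_simps)
qed

text \<open>
  The bound does not depend on \<open>\<epsilon>\<close> and is linear in \<open>\<beta>\<close>. It provides the dominating function when the limit
  \<open>\<epsilon> \<rightarrow> 0\<close> is taken after pairing with a Schwartz function.
\<close>

lemma truncated_bound:
  assumes s: "0 < s" "s < 1" and \<alpha>: "0 \<le> Re \<alpha>" and \<beta>: "0 \<le> Re \<beta>" and \<epsilon>: "0 < \<epsilon>"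
  shows "norm (\<alpha> * (LINT t:{\<epsilon>..}|lborel. bessel_kern (- 1 - s) \<alpha> \<beta> t)) \<le> 2 + (1 + norm \<beta>) / (1 - s) + norm \<alpha> / s"
proof (cases "\<epsilon> \<le> 1")
  case True
  have a: "norm (bessel_kern (1 - s) \<alpha> \<beta> t) \<le> 1" if "0 < t" "t \<le> 1" for t
  proof -
    have "t powr (1 - s) \<le> 1 powr (1 - s)" using s that by (intro powr_mono2) auto
    then show ?thesis using norm_bessel_kern_le[OF \<alpha> \<beta> that(1), of "1 - s"] by simp
  qed
  have c: "norm (LINT t:{\<epsilon>..1}|lborel. bessel_rem s \<alpha> \<beta> t) \<le> (1 + norm \<beta>) / (1 - s)"
  proof -
    have "norm (LINT t:{\<epsilon>..1}|lborel. bessel_rem s \<alpha> \<beta> t)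
        \<le> (LINT t|lborel. (1 + norm \<beta>) * (if t \<in> {0..1} then t powr (- s) else 0))"
      unfolding set_lebesgue_integral_def
    proof (rule norm_integral_le)
      have "continuous_on {\<epsilon>..1} (bessel_rem s \<alpha> \<beta>)"
        unfolding bessel_rem_def[abs_def]
        by (intro continuous_intros continuous_at_imp_continuous_on ballI isCont_bessel_kern) (use \<epsilon> in auto)
      from borel_integrable_atLeastAtMost'[OF this]
      show "integrable lborel (\<lambda>t. indicat_real {\<epsilon>..1} t *\<^sub>R bessel_rem s \<alpha> \<beta> t)"
        by (simp add: set_integrable_def)
      show "integrable lborel (\<lambda>t. (1 + norm \<beta>) * (if t \<in> {0..1} then t powr (- s) else 0))"
        using s by (intro integrable_mult_right powr_integrable_at_0) auto
      show "norm (indicat_real {\<epsilon>..1} t *\<^sub>R bessel_rem s \<alpha> \<beta> t) \<le> (1 + norm \<beta>) * (if t \<in> {0..1} then t powr (- s) else 0)" for t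
        using norm_bessel_rem_le[OF s \<alpha> \<beta>, of t] \<epsilon> by (auto simp: indicator_def)
    qed
    also have "\<dots> = (1 + norm \<beta>) * (1 / (- s + 1))"
      using powr_integrable_at_0(2)[of "- s"] s by (simp only: integral_mult_right_zero)
    finally show ?thesis by simp
  qed
  have d: "norm (LINT t:{1<..}|lborel. bessel_kern (- 1 - s) \<alpha> \<beta> t) \<le> 1 / s"
    by (rule bessel_kern_tail_bound) (use s \<alpha> \<beta> in auto)
  have "norm (\<alpha> * (LINT t:{\<epsilon>..}|lborel. bessel_kern (- 1 - s) \<alpha> \<beta> t)) \<le>
     norm (bessel_kern (1 - s) \<alpha> \<beta> 1) + norm (bessel_kern (1 - s) \<alpha> \<beta> \<epsilon>) + norm (LINT t:{\<epsilon>..1}|lborel. bessel_rem s \<alpha> \<beta> t)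
     + norm (\<alpha> * (LINT t:{1<..}|lborel. bessel_kern (- 1 - s) \<alpha> \<beta> t))"
    unfolding truncated_by_parts[OF s \<alpha> \<beta> \<epsilon> True]
    by (intro norm_triangle_le add_right_mono order_trans[OF norm_triangle_ineq4] order_refl)
  also have "\<dots> \<le> 1 + 1 + (1 + norm \<beta>) / (1 - s) + norm \<alpha> * (1 / s)"
    unfolding norm_mult by (intro add_mono a c mult_left_mono d) (use \<epsilon> True in auto)
  finally show ?thesis by simp
next
  case False
  have "norm (\<alpha> * (LINT t:{\<epsilon>..}|lborel. bessel_kern (- 1 - s) \<alpha> \<beta> t)) \<le> norm \<alpha> * (1 / s)"
    unfolding norm_mult by (intro mult_left_mono bessel_kern_tail_bound) (use s \<alpha> \<beta> False in auto)
  also have "\<dots> \<le> 2 + (1 + norm \<beta>) / (1 - s) + norm \<alpha> / s"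
    using s by simp
  finally show ?thesis .
qed

text \<open>
  The limit of \<open>\<alpha>\<close> times the truncated integrals. All integrals in it converge absolutely, with locally uniform
  bounds for \<open>\<alpha>\<close> and \<open>\<beta>\<close> in the closed right half plane, so that it extends
  \<open>\<alpha> * bessel_int (- 1 - s) \<alpha> \<beta>\<close> continuously to the imaginary axes.
\<close>

definition bessel_reg :: "real \<Rightarrow> complex \<Rightarrow> complex \<Rightarrow> complex" where
  "bessel_reg s \<alpha> \<beta> = bessel_kern (1 - s) \<alpha> \<beta> 1 - (LINT t:{0<..1}|lborel. bessel_rem s \<alpha> \<beta> t)
     + \<alpha> * (LINT t:{1<..}|lborel. bessel_kern (- 1 - s) \<alpha> \<beta> t)"

lemma truncated_tendsto_bessel_reg:
  assumes s: "0 < s" "s < 1" and \<alpha>: "0 \<le> Re \<alpha>" and \<beta>: "0 \<le> Re \<beta>"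
  shows "((\<lambda>\<epsilon>. \<alpha> * (LINT t:{\<epsilon>..}|lborel. bessel_kern (- 1 - s) \<alpha> \<beta> t)) \<longlongrightarrow> bessel_reg s \<alpha> \<beta>) (at_right 0)"
proof -
  have ev: "\<forall>\<^sub>F \<epsilon> in at_right 0. 0 < \<epsilon> \<and> \<epsilon> \<le> (1::real)"
    using eventually_at_right_less[of "0::real"] eventually_at_rightI[of 0 1 "\<lambda>\<epsilon>. \<epsilon> \<le> (1::real)"]
    by (intro eventually_conj) auto
  have l1: "((\<lambda>\<epsilon>. bessel_kern (1 - s) \<alpha> \<beta> \<epsilon>) \<longlongrightarrow> 0) (at_right 0)"
  proof (rule Lim_null_comparison)
    show "\<forall>\<^sub>F \<epsilon> in at_right 0. norm (bessel_kern (1 - s) \<alpha> \<beta> \<epsilon>) \<le> \<epsilon> powr (1 - s)"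
      using ev by eventually_elim (use norm_bessel_kern_le[OF \<alpha> \<beta>] in auto)
    show "((\<lambda>\<epsilon>::real. \<epsilon> powr (1 - s)) \<longlongrightarrow> 0) (at_right 0)"
    proof -
      have "0 < 1 - s" using s by simp
      then show ?thesis by real_asymp
    qed
  qed
  have l2: "((\<lambda>\<epsilon>. LINT t:{\<epsilon>..1}|lborel. bessel_rem s \<alpha> \<beta> t) \<longlongrightarrow> (LINT t:{0<..1}|lborel. bessel_rem s \<alpha> \<beta> t)) (at_right 0)"
    unfolding set_lebesgue_integral_def
  proof (rule tendsto_integral_dominated[where w = "\<lambda>t. (1 + norm \<beta>) * (if t \<in> {0..1} then t powr (- s) else 0)"])
    show "AE t in lborel. ((\<lambda>\<epsilon>. indicat_real {\<epsilon>..1} t *\<^sub>R bessel_rem s \<alpha> \<beta> t) \<longlongrightarrow> indicat_real {0<..1} t *\<^sub>R bessel_rem s \<alpha> \<beta> t) (at_right 0)"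
    proof (rule AE_I2)
      fix t :: real
      have "\<forall>\<^sub>F \<epsilon> in at_right 0. indicat_real {0<..1} t *\<^sub>R bessel_rem s \<alpha> \<beta> t = indicat_real {\<epsilon>..1} t *\<^sub>R bessel_rem s \<alpha> \<beta> t"
      proof (cases "0 < t")
        case True
        have "\<forall>\<^sub>F \<epsilon> in at_right 0. \<epsilon> < t" using eventually_at_right_real[OF True] by eventually_elim auto
        then show ?thesis by eventually_elim (use True in \<open>auto simp: indicator_def\<close>)
      next
        case False
        show ?thesis using ev by eventually_elim (use False in \<open>auto simp: indicator_def\<close>)
      qed
      then show "((\<lambda>\<epsilon>. indicat_real {\<epsilon>..1} t *\<^sub>R bessel_rem s \<alpha> \<beta> t) \<longlongrightarrow> indicat_real {0<..1} t *\<^sub>R bessel_rem s \<alpha> \<beta> t) (at_right 0)"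
        by (rule Lim_transform_eventually[OF tendsto_const])
    qed
    show "integrable lborel (\<lambda>t. (1 + norm \<beta>) * (if t \<in> {0..1} then t powr (- s) else 0))"
      using s by (intro integrable_mult_right powr_integrable_at_0) auto
    show "AE t in lborel. norm (indicat_real {\<epsilon>..1} t *\<^sub>R bessel_rem s \<alpha> \<beta> t)
        \<le> (1 + norm \<beta>) * (if t \<in> {0..1} then t powr (- s) else 0)" if "\<epsilon> \<in> {0<..}" for \<epsilon>
      using norm_bessel_rem_le[OF s \<alpha> \<beta>] that by (intro AE_I2) (auto simp: indicator_def)
  qed auto
  have "((\<lambda>\<epsilon>. bessel_kern (1 - s) \<alpha> \<beta> 1 - bessel_kern (1 - s) \<alpha> \<beta> \<epsilon> - (LINT t:{\<epsilon>..1}|lborel. bessel_rem s \<alpha> \<beta> t)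
     + \<alpha> * (LINT t:{1<..}|lborel. bessel_kern (- 1 - s) \<alpha> \<beta> t)) \<longlongrightarrow> bessel_kern (1 - s) \<alpha> \<beta> 1 - 0 - (LINT t:{0<..1}|lborel. bessel_rem s \<alpha> \<beta> t)
     + \<alpha> * (LINT t:{1<..}|lborel. bessel_kern (- 1 - s) \<alpha> \<beta> t)) (at_right 0)"
    by (intro tendsto_intros l1 l2)
  moreover have "\<forall>\<^sub>F \<epsilon> in at_right 0. bessel_kern (1 - s) \<alpha> \<beta> 1 - bessel_kern (1 - s) \<alpha> \<beta> \<epsilon> - (LINT t:{\<epsilon>..1}|lborel. bessel_rem s \<alpha> \<beta> t)
     + \<alpha> * (LINT t:{1<..}|lborel. bessel_kern (- 1 - s) \<alpha> \<beta> t) = \<alpha> * (LINT t:{\<epsilon>..}|lborel. bessel_kern (- 1 - s) \<alpha> \<beta> t)"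
    using ev by eventually_elim (use truncated_by_parts[OF s \<alpha> \<beta>] in simp)
  ultimately show ?thesis
    unfolding bessel_reg_def by (simp add: Lim_transform_eventually)
qed

lemma bessel_reg_eq:
  assumes s: "0 < s" "s < 1" and \<alpha>: "0 < Re \<alpha>" and \<beta>: "0 < Re \<beta>"
  shows "bessel_reg s \<alpha> \<beta> = \<alpha> * bessel_int (- 1 - s) \<alpha> \<beta>"
proof -
  have "((\<lambda>\<epsilon>. LINT t:{\<epsilon>..}|lborel. bessel_kern (- 1 - s) \<alpha> \<beta> t) \<longlongrightarrow> (LINT t|lborel. bessel_kern (- 1 - s) \<alpha> \<beta> t)) (at_right 0)"
    unfolding set_lebesgue_integral_def
  proof (rule tendsto_integral_dominated[where w = "\<lambda>t. norm (bessel_kern (- 1 - s) \<alpha> \<beta> t)"])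
    show "AE t in lborel. ((\<lambda>\<epsilon>. indicat_real {\<epsilon>..} t *\<^sub>R bessel_kern (- 1 - s) \<alpha> \<beta> t) \<longlongrightarrow> bessel_kern (- 1 - s) \<alpha> \<beta> t) (at_right 0)"
    proof (rule AE_I2)
      fix t :: real
      have "\<forall>\<^sub>F \<epsilon> in at_right 0. bessel_kern (- 1 - s) \<alpha> \<beta> t = indicat_real {\<epsilon>..} t *\<^sub>R bessel_kern (- 1 - s) \<alpha> \<beta> t"
      proof (cases "0 < t")
        case True
        have "\<forall>\<^sub>F \<epsilon> in at_right 0. \<epsilon> < t" using eventually_at_right_real[OF True] by eventually_elim auto
        then show ?thesis by eventually_elim (use True in \<open>auto simp: indicator_def\<close>)
      qed (simp add: bessel_kern_def)
      then show "((\<lambda>\<epsilon>. indicat_real {\<epsilon>..} t *\<^sub>R bessel_kern (- 1 - s) \<alpha> \<beta> t) \<longlongrightarrow> bessel_kern (- 1 - s) \<alpha> \<beta> t) (at_right 0)"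
        by (rule Lim_transform_eventually[OF tendsto_const])
    qed
    show "integrable lborel (\<lambda>t. norm (bessel_kern (- 1 - s) \<alpha> \<beta> t))"
      by (intro integrable_norm bessel_kern_integrable \<alpha> \<beta>)
    show "AE t in lborel. norm (indicat_real {\<epsilon>..} t *\<^sub>R bessel_kern (- 1 - s) \<alpha> \<beta> t) \<le> norm (bessel_kern (- 1 - s) \<alpha> \<beta> t)" for \<epsilon>
      by (intro AE_I2) (auto simp: indicator_def)
  qed auto
  then have "((\<lambda>\<epsilon>. \<alpha> * (LINT t:{\<epsilon>..}|lborel. bessel_kern (- 1 - s) \<alpha> \<beta> t)) \<longlongrightarrow> \<alpha> * bessel_int (- 1 - s) \<alpha> \<beta>) (at_right 0)"
    unfolding bessel_int_def by (intro tendsto_mult tendsto_const)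
  with truncated_tendsto_bessel_reg[OF s, of \<alpha> \<beta>] \<alpha> \<beta> show ?thesis
    using tendsto_unique trivial_limit_at_right_real less_imp_le by blast
qed

lemma bessel_reg_tendsto:
  assumes s: "0 < s" "s < 1" and \<alpha>: "0 \<le> Re \<alpha>" and \<beta>: "0 \<le> Re \<beta>"
  shows "((\<lambda>\<delta>. bessel_reg s (\<alpha> + of_real \<delta>) (\<beta> + of_real \<delta>)) \<longlongrightarrow> bessel_reg s \<alpha> \<beta>) (at 0 within {0<..<1})"
proof -
  \<comment> \<open>the restriction to \<open>\<delta> < 1\<close> keeps \<open>norm (\<beta> + \<delta>)\<close> below \<open>norm \<beta> + 1\<close>\<close>
  have kl: "((\<lambda>\<delta>. bessel_kern m (\<alpha> + of_real \<delta>) (\<beta> + of_real \<delta>) t) \<longlongrightarrow> bessel_kern m \<alpha> \<beta> t) (at 0 within {0<..<1})" for m t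
  proof (cases "0 < t")
    case True
    have "((\<lambda>\<delta>. of_real (t powr m) * exp (- ((\<alpha> + of_real \<delta>) * (1 / of_real t)) - (\<beta> + of_real \<delta>) * of_real t))
        \<longlongrightarrow> of_real (t powr m) * exp (- ((\<alpha> + of_real 0) * (1 / of_real t)) - (\<beta> + of_real 0) * of_real t)) (at 0 within {0<..<1})"
      by (intro tendsto_intros)
    then show ?thesis using True by (simp add: bessel_kern_def)
  qed (simp add: bessel_kern_def)
  have Gl: "((\<lambda>\<delta>. bessel_rem s (\<alpha> + of_real \<delta>) (\<beta> + of_real \<delta>) t) \<longlongrightarrow> bessel_rem s \<alpha> \<beta> t) (at 0 within {0<..<1})" for t
  proof -
    have "((\<lambda>\<delta>. \<beta> + complex_of_real \<delta>) \<longlongrightarrow> \<beta> + of_real 0) (at 0 within {0<..<1})"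
      by (intro tendsto_intros)
    then have "((\<lambda>\<delta>. \<beta> + complex_of_real \<delta>) \<longlongrightarrow> \<beta>) (at 0 within {0<..<1})" by simp
    then show ?thesis
      unfolding bessel_rem_def by (intro tendsto_intros kl)
  qed
  have l2: "((\<lambda>\<delta>. LINT t:{0<..1}|lborel. bessel_rem s (\<alpha> + of_real \<delta>) (\<beta> + of_real \<delta>) t) \<longlongrightarrow> (LINT t:{0<..1}|lborel. bessel_rem s \<alpha> \<beta> t)) (at 0 within {0<..<1})"
    unfolding set_lebesgue_integral_def
  proof (rule tendsto_integral_dominated[where w = "\<lambda>t. (2 + norm \<beta>) * (if t \<in> {0..1} then t powr (- s) else 0)"])
    show "AE t in lborel. ((\<lambda>\<delta>. indicat_real {0<..1} t *\<^sub>R bessel_rem s (\<alpha> + of_real \<delta>) (\<beta> + of_real \<delta>) t)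
        \<longlongrightarrow> indicat_real {0<..1} t *\<^sub>R bessel_rem s \<alpha> \<beta> t) (at 0 within {0<..<1})"
      by (intro AE_I2 tendsto_intros Gl)
    show "integrable lborel (\<lambda>t. (2 + norm \<beta>) * (if t \<in> {0..1} then t powr (- s) else 0))"
      using s by (intro integrable_mult_right powr_integrable_at_0) auto
    fix \<delta> :: real assume \<delta>: "\<delta> \<in> {0<..<1}"
    have n: "norm (\<beta> + of_real \<delta>) \<le> norm \<beta> + 1"
      using \<delta> by (intro order_trans[OF norm_triangle_ineq]) auto
    have "norm (bessel_rem s (\<alpha> + of_real \<delta>) (\<beta> + of_real \<delta>) t) \<le> (2 + norm \<beta>) * t powr (- s)" if "0 < t" "t \<le> 1" for t
    proof -
      have "norm (bessel_rem s (\<alpha> + of_real \<delta>) (\<beta> + of_real \<delta>) t) \<le> (1 + norm (\<beta> + of_real \<delta>)) * t powr (- s)"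
        by (rule norm_bessel_rem_le) (use s \<alpha> \<beta> \<delta> that in auto)
      also have "\<dots> \<le> (2 + norm \<beta>) * t powr (- s)"
        using n by (intro mult_right_mono) auto
      finally show ?thesis .
    qed
    then show "AE t in lborel. norm (indicat_real {0<..1} t *\<^sub>R bessel_rem s (\<alpha> + of_real \<delta>) (\<beta> + of_real \<delta>) t)
        \<le> (2 + norm \<beta>) * (if t \<in> {0..1} then t powr (- s) else 0)"
      by (intro AE_I2) (auto simp: indicator_def)
  qed auto
  have l3: "((\<lambda>\<delta>. LINT t:{1<..}|lborel. bessel_kern (- 1 - s) (\<alpha> + of_real \<delta>) (\<beta> + of_real \<delta>) t) \<longlongrightarrow> (LINT t:{1<..}|lborel. bessel_kern (- 1 - s) \<alpha> \<beta> t)) (at 0 within {0<..<1})"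
    unfolding set_lebesgue_integral_def
  proof (rule tendsto_integral_dominated[where w = "\<lambda>t. if t \<in> {1..} then t powr (- 1 - s) else 0"])
    show "AE t in lborel. ((\<lambda>\<delta>. indicat_real {1<..} t *\<^sub>R bessel_kern (- 1 - s) (\<alpha> + of_real \<delta>) (\<beta> + of_real \<delta>) t)
        \<longlongrightarrow> indicat_real {1<..} t *\<^sub>R bessel_kern (- 1 - s) \<alpha> \<beta> t) (at 0 within {0<..<1})"
      by (intro AE_I2 tendsto_intros kl)
    show "integrable lborel (\<lambda>t::real. if t \<in> {1..} then t powr (- 1 - s) else 0)"
      by (rule powr_integrable_at_top) (use s in auto)
    show "AE t in lborel. norm (indicat_real {1<..} t *\<^sub>R bessel_kern (- 1 - s) (\<alpha> + of_real \<delta>) (\<beta> + of_real \<delta>) t)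
        \<le> (if t \<in> {1..} then t powr (- 1 - s) else 0)" if "\<delta> \<in> {0<..<1}" for \<delta>
      using norm_bessel_kern_le[of "\<alpha> + of_real \<delta>" "\<beta> + of_real \<delta>"] \<alpha> \<beta> that by (intro AE_I2) (auto simp: indicator_def)
  qed auto
  have "((\<lambda>\<delta>. \<alpha> + complex_of_real \<delta>) \<longlongrightarrow> \<alpha> + of_real 0) (at 0 within {0<..<1})"
    by (intro tendsto_intros)
  then have l4: "((\<lambda>\<delta>. \<alpha> + complex_of_real \<delta>) \<longlongrightarrow> \<alpha>) (at 0 within {0<..<1})" by simp
  show ?thesis
    unfolding bessel_reg_def by (intro tendsto_intros kl l2 l3 l4)
qed

text \<open>
  \<open>bessel_int_formula\<close> extends to the closed half planes: the left-hand side through \<open>bessel_reg\<close>, the right-hand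
  side because the powers are continuous off the negative axis.
\<close>

lemma truncated_tendsto:
  assumes s: "0 < s" "s < 1" and \<alpha>: "0 \<le> Re \<alpha>" "\<alpha> \<notin> \<real>\<^sub>\<le>\<^sub>0" and \<beta>: "0 \<le> Re \<beta>" "\<beta> \<notin> \<real>\<^sub>\<le>\<^sub>0"
  shows "((\<lambda>\<epsilon>. of_real (rGamma s * rGamma (1 - s)) * (LINT t:{\<epsilon>..}|lborel. bessel_kern (- 1 - s) \<alpha> \<beta> t)) \<longlongrightarrow>
     \<alpha> powr (- of_real s) * hyp01 (- of_real s) (\<alpha> * \<beta>) - \<beta> powr of_real s * hyp01 (of_real s) (\<alpha> * \<beta>)) (at_right 0)"
proof -
  let ?c = "complex_of_real (rGamma s * rGamma (1 - s))"
  let ?R = "\<lambda>\<alpha> \<beta>. \<alpha> powr (- of_real s) * hyp01 (- of_real s) (\<alpha> * \<beta>) - \<beta> powr of_real s * hyp01 (of_real s) (\<alpha> * \<beta>)"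
  let ?F = "at (0::real) within {0<..<1}"
  have \<alpha>0: "\<alpha> \<noteq> 0" using \<alpha>(2) by auto
  have t: "((\<lambda>\<delta>. \<alpha> + complex_of_real \<delta>) \<longlongrightarrow> \<alpha>) ?F" "((\<lambda>\<delta>. \<beta> + complex_of_real \<delta>) \<longlongrightarrow> \<beta>) ?F"
  proof -
    have "((\<lambda>\<delta>. \<gamma> + complex_of_real \<delta>) \<longlongrightarrow> \<gamma> + of_real 0) ?F" for \<gamma>
      by (intro tendsto_intros)
    then show "((\<lambda>\<delta>. \<alpha> + complex_of_real \<delta>) \<longlongrightarrow> \<alpha>) ?F" "((\<lambda>\<delta>. \<beta> + complex_of_real \<delta>) \<longlongrightarrow> \<beta>) ?F" by simp_all
  qed
  have h: "((\<lambda>\<delta>. hyp01 \<nu> ((\<alpha> + of_real \<delta>) * (\<beta> + of_real \<delta>))) \<longlongrightarrow> hyp01 \<nu> (\<alpha> * \<beta>)) ?F" for \<nu>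
    by (rule isCont_tendsto_compose[OF DERIV_isCont[OF hyp01_has_field_derivative]]) (intro tendsto_mult t)
  have "((\<lambda>\<delta>. (\<alpha> + of_real \<delta>) * ?R (\<alpha> + of_real \<delta>) (\<beta> + of_real \<delta>)) \<longlongrightarrow> \<alpha> * ?R \<alpha> \<beta>) ?F"
    by (intro tendsto_intros t h) (use \<alpha> \<beta> in auto)
  moreover have "\<forall>\<^sub>F \<delta> in ?F. (\<alpha> + of_real \<delta>) * ?R (\<alpha> + of_real \<delta>) (\<beta> + of_real \<delta>) = ?c * bessel_reg s (\<alpha> + of_real \<delta>) (\<beta> + of_real \<delta>)"
  proof -
    have "(\<alpha> + of_real \<delta>) * ?R (\<alpha> + of_real \<delta>) (\<beta> + of_real \<delta>) = ?c * bessel_reg s (\<alpha> + of_real \<delta>) (\<beta> + of_real \<delta>)"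
      if "0 < \<delta>" for \<delta>
    proof -
      have re: "0 < Re (\<alpha> + of_real \<delta>)" "0 < Re (\<beta> + of_real \<delta>)" using that \<alpha> \<beta> by auto
      show ?thesis
        unfolding bessel_reg_eq[OF s re] bessel_int_formula[OF s re, symmetric] by (simp only: mult.left_commute)
    qed
    then show ?thesis by (auto simp: eventually_at_filter)
  qed
  ultimately have "((\<lambda>\<delta>. ?c * bessel_reg s (\<alpha> + of_real \<delta>) (\<beta> + of_real \<delta>)) \<longlongrightarrow> \<alpha> * ?R \<alpha> \<beta>) ?F"
    by (rule Lim_transform_eventually)
  moreover have "((\<lambda>\<delta>. ?c * bessel_reg s (\<alpha> + of_real \<delta>) (\<beta> + of_real \<delta>)) \<longlongrightarrow> ?c * bessel_reg s \<alpha> \<beta>) ?F"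
    by (intro tendsto_mult tendsto_const bessel_reg_tendsto s \<alpha> \<beta>)
  moreover have "?F \<noteq> bot"
    unfolding trivial_limit_within using islimpt_greaterThanLessThan1[of "0::real" 1] by simp
  ultimately have "?c * bessel_reg s \<alpha> \<beta> = \<alpha> * ?R \<alpha> \<beta>"
    using tendsto_unique by blast
  then have e: "?c * bessel_reg s \<alpha> \<beta> / \<alpha> = ?R \<alpha> \<beta>" using \<alpha>0 by simp
  have "((\<lambda>\<epsilon>. ?c * (\<alpha> * (LINT t:{\<epsilon>..}|lborel. bessel_kern (- 1 - s) \<alpha> \<beta> t)) / \<alpha>) \<longlongrightarrow> ?c * bessel_reg s \<alpha> \<beta> / \<alpha>) (at_right 0)"
    by (intro tendsto_intros truncated_tendsto_bessel_reg s \<alpha> \<beta> \<alpha>0)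
  then show ?thesis unfolding e using \<alpha>0 by (simp add: mult.assoc)
qed

section \<open>The multiplier as a function of the symbol\<close>

text \<open>
  The boundary value of \<open>p powr s\<close> from the lower half plane. For \<open>p = symb \<xi> \<tau>\<close> it is \<open>\<theta>\<^bsup>2s\<^esup> |p|\<^sup>s\<close>, so the choice
  \<open>\<theta> = - \<i>\<close> on the set where the symbol is negative is the choice of this boundary value.
\<close>

definition lower_powr :: "real \<Rightarrow> real \<Rightarrow> complex" where
  "lower_powr s p = (if 0 < p then 1 else exp (- (\<i> * of_real (pi * s)))) * of_real (\<bar>p\<bar> powr s)"

text \<open>
  The multiplier as a function of \<open>z\<close> and of the value \<open>p\<close> of the symbol. The Bessel argument \<open>w\<close> enters
  \<open>w powr s * besselI (- s) w\<close> and \<open>w powr s * besselI s w\<close> only through \<open>w\<^sup>2 = z\<^sup>2 * p\<close> and \<open>w powr (2 * s)\<close>,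
  which leaves \<open>lower_powr\<close> as the only trace of the branch.
\<close>

definition profile :: "real \<Rightarrow> real \<Rightarrow> real \<Rightarrow> complex" where
  "profile s z p = of_real (Gamma (1 - s)) *
     (hyp01 (- of_real s) (of_real (z\<^sup>2 * p / 4))
      - of_real (2 powr (- 2 * s)) * lower_powr s p * of_real (z powr (2 * s)) * hyp01 (of_real s) (of_real (z\<^sup>2 * p / 4)))"

lemma norm_lower_powr: "norm (lower_powr s p) = \<bar>p\<bar> powr s"
  by (simp add: lower_powr_def norm_mult norm_exp_eq_Re)

lemma powr_of_real_times:
  assumes "0 < r" "y \<noteq> 0"
  shows "(of_real r * y) powr of_real e = of_real (r powr e) * exp (of_real e * Ln y)"
proof -
  have "(of_real r * y) powr of_real e = of_real r powr of_real e * y powr of_real e"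
    by (rule powr_times_real_left) (use assms in auto)
  also have "complex_of_real r powr of_real e = of_real (r powr e)"
    by (rule powr_of_real) (use assms in auto)
  also have "y powr of_real e = exp (of_real e * Ln y)"
    using assms by (simp only: powr_def if_False)
  finally show ?thesis .
qed

lemma Gamma_reflection_real: "Gamma s * Gamma (1 - s) = pi / sin (pi * s)" for s :: real
proof -
  have 1: "1 - complex_of_real s = of_real (1 - s)" by simp
  have 2: "sin (of_real pi * complex_of_real s) = of_real (sin (pi * s))"
    by (simp flip: sin_of_real)
  have "complex_of_real (Gamma s * Gamma (1 - s)) = of_real (pi / sin (pi * s))"
    using Gamma_reflection_complex[of "of_real s"]
    unfolding 1 2 Gamma_complex_of_real of_real_mult of_real_divide .
  then show ?thesis by (simp only: of_real_eq_iff)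
qed

text \<open>
  Since \<open>\<theta>\<^sup>2 |p| = p\<close>, the series in \<open>besselI\<close> have real arguments; the constants match by the reflection
  formula \<open>Gamma s * Gamma (1 - s) = pi / sin (pi * s)\<close>.
\<close>

lemma multiplier_eq_profile:
  assumes s: "0 < s" "s < 1" and z: "0 < z" and p0: "symb \<xi> \<tau> \<noteq> 0"
  shows "multiplier s z \<xi> \<tau> = profile s z (symb \<xi> \<tau>)"
proof -
  define p where "p = symb \<xi> \<tau>"
  define \<sigma> where "\<sigma> = complex_of_real s"
  define \<theta> where "\<theta> = (if p > 0 then 1 else - \<i>)"
  define r where "r = z * sqrt \<bar>p\<bar>"
  have p: "p \<noteq> 0" using p0 by (simp add: p_def)
  have r: "0 < r" using z p by (simp add: r_def)
  define w where "w = of_real r * \<theta>"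
  have w_eq: "of_real z * theta \<xi> \<tau> * of_real (sqrt \<bar>symb \<xi> \<tau>\<bar>) = w"
    by (simp add: w_def r_def \<theta>_def theta_def p_def)
  have w0: "w \<noteq> 0" using r by (auto simp: w_def \<theta>_def)
  have w2: "w\<^sup>2 / 4 = of_real (z\<^sup>2 * p / 4)"
  proof -
    have "(sqrt \<bar>p\<bar>)\<^sup>2 = \<bar>p\<bar>" by simp
    then have "r\<^sup>2 = z\<^sup>2 * \<bar>p\<bar>" by (simp add: r_def power_mult_distrib)
    moreover have "\<theta>\<^sup>2 * of_real \<bar>p\<bar> = of_real p" using p by (simp add: \<theta>_def)
    ultimately have "w\<^sup>2 = of_real (z\<^sup>2) * of_real p"
      unfolding w_def power_mult_distrib by (simp flip: of_real_power add: mult.left_commute mult.commute)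
    then show ?thesis by simp
  qed
  have I: "besselI \<nu> w = (w / 2) powr \<nu> * hyp01 \<nu> (of_real (z\<^sup>2 * p / 4))" for \<nu>
    unfolding besselI_def hyp01_def w2 ..
  \<comment> \<open>all powers of \<open>w\<close> and of \<open>w / 2\<close> are expressed by \<open>W\<close>, so that the branch is discussed only in \<open>W2\<close>\<close>
  define W where "W = w powr \<sigma>"
  define T where "T = 2 powr s"
  have T: "0 < T" by (simp add: T_def)
  have W0: "W \<noteq> 0" using w0 by (simp add: W_def)
  have Wh: "(w / 2) powr \<sigma> = W / of_real T"
  proof -
    have "W = (2 * (w / 2)) powr \<sigma>" by (simp add: W_def)
    also have "\<dots> = 2 powr \<sigma> * (w / 2) powr \<sigma>" by (rule powr_times_real_left) auto
    also have "2 powr \<sigma> = complex_of_real T"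
      using powr_of_real[of 2 s] by (simp add: T_def \<sigma>_def)
    finally show ?thesis using T by simp
  qed
  have Wh': "(w / 2) powr (- \<sigma>) = of_real T / W"
    unfolding powr_minus Wh by (simp add: divide_simps)
  have W2: "W * W = of_real (z powr (2 * s)) * lower_powr s p"
  proof -
    have \<theta>0: "\<theta> \<noteq> 0" by (simp add: \<theta>_def)
    have "W = of_real (r powr s) * exp (of_real s * Ln \<theta>)"
      unfolding W_def w_def \<sigma>_def by (rule powr_of_real_times[OF r \<theta>0])
    then have "W * W = of_real (r powr s * r powr s) * exp (of_real s * Ln \<theta> + of_real s * Ln \<theta>)"
      by (simp only: exp_add of_real_mult mult_ac)
    also have "r powr s * r powr s = z powr (2 * s) * \<bar>p\<bar> powr s"
    proof -
      have "sqrt \<bar>p\<bar> powr s * sqrt \<bar>p\<bar> powr s = \<bar>p\<bar> powr s"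
        by (simp flip: powr_mult)
      moreover have "z powr s * z powr s = z powr (2 * s)"
        by (simp flip: powr_add)
      ultimately show ?thesis
        using z unfolding r_def by (subst (1 2) powr_mult) (simp_all add: mult_ac)
    qed
    also have "exp (of_real s * Ln \<theta> + of_real s * Ln \<theta>) = (if 0 < p then 1 else exp (- (\<i> * of_real (pi * s))))"
      by (simp add: \<theta>_def field_simps)
    finally show ?thesis by (simp add: lower_powr_def)
  qed
  have "\<sigma> \<notin> \<int>"
  proof
    assume "\<sigma> \<in> \<int>"
    then obtain k where "complex_of_real s = of_int k" unfolding \<sigma>_def by (auto elim: Ints_cases)
    then have "s = of_int k" by (metis of_real_eq_iff of_real_of_int_eq)
    with s have "0 < k" "k < 1" by simp_all
    then show False by simp
  qed
  then have K: "besselK \<sigma> w = of_real pi / 2 * (besselI (- \<sigma>) w - besselI \<sigma> w) / sin (of_real pi * \<sigma>)"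
    by (simp add: besselK_def)
  define S where "S = sin (pi * s)"
  have S0: "S \<noteq> 0" unfolding S_def using s by (intro less_imp_neq[symmetric] sin_gt_zero) auto
  have sS: "sin (of_real pi * \<sigma>) = complex_of_real S"
    by (simp add: S_def \<sigma>_def flip: sin_of_real)
  have G0: "Gamma s \<noteq> 0" using less_imp_neq[OF Gamma_real_pos[OF s(1)]] by (rule not_sym)
  have refl: "Gamma (1 - s) = pi / (Gamma s * S)"
  proof -
    have "Gamma (1 - s) * Gamma s = pi / S"
      using Gamma_reflection_real[of s] by (simp only: S_def mult.commute)
    then have "Gamma (1 - s) = (pi / S) / Gamma s"
      by (simp only: nonzero_eq_divide_eq[OF G0])
    then show ?thesis by (simp add: mult.commute)
  qed
  have t1: "2 powr (1 - s) = 2 / T" by (simp add: T_def powr_diff)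
  have t2: "2 powr (- 2 * s) = 1 / (T * T)"
  proof -
    have "T * T = 2 powr (2 * s)" by (simp add: T_def flip: powr_add)
    then show ?thesis by (simp add: powr_minus divide_inverse)
  qed
  let ?h1 = "hyp01 (- \<sigma>) (of_real (z\<^sup>2 * p / 4))" and ?h2 = "hyp01 \<sigma> (of_real (z\<^sup>2 * p / 4))"
  have "multiplier s z \<xi> \<tau> = of_real (2 / T / Gamma s) * W * (of_real pi / 2 * (of_real T / W * ?h1 - W / of_real T * ?h2) / of_real S)"
    unfolding multiplier_def w_eq Let_def \<sigma>_def[symmetric] K I Wh Wh' sS t1 W_def[symmetric] ..
  also have "\<dots> = of_real (pi / (Gamma s * S)) * (?h1 - of_real (1 / (T * T)) * (W * W) * ?h2)"
    using T W0 S0 G0 by (simp add: field_simps)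
  also have "\<dots> = profile s z p"
    unfolding profile_def refl W2 t2 \<sigma>_def by (simp only: mult_ac)
  finally show ?thesis by (simp add: p_def)
qed

section \<open>The kernel as a function of time\<close>

definition P_const :: "real \<Rightarrow> real \<Rightarrow> complex" where
  "P_const s z = exp (- (\<i> * of_real (pi * s / 2))) * of_real (z powr (2 * s) / (2 powr (2 * s) * Gamma s))"

lemma P_kernel_exp_eq:
  "P_kernel (1 - 2 * s) z t * exp (- (\<i> * of_real (p * t)))
     = P_const s z * bessel_kern (- 1 - s) (of_real (z\<^sup>2 / 4) * - \<i>) (of_real p * \<i>) t"
proof (cases "0 < t")
  case True
  have "t powr (- 1 - s) = 1 / t powr (1 + s)"
  proof -
    have "- 1 - s = - (1 + s)" by simp
    then show ?thesis by (simp only: powr_minus divide_inverse mult_1)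
  qed
  moreover have "P_kernel (1 - 2 * s) z t = exp (- (\<i> * of_real (pi * s / 2))) / of_real (2 powr (2 * s) * Gamma s)
      * of_real (z powr (2 * s) / t powr (1 + s)) * exp (\<i> * of_real (z\<^sup>2 / (4 * t)))"
  proof -
    have e: "1 - (1 - 2 * s) = 2 * s" "(3 - (1 - 2 * s)) / 2 = 1 + s" "2 * s / 2 = s"
      "(1 - 2 * s - 1) * pi / 4 = - (pi * s / 2)" by simp_all
    show ?thesis using True unfolding P_kernel_def e by simp
  qed
  moreover have "exp (- (of_real (z\<^sup>2 / 4) * - \<i> / of_real t) - of_real p * \<i> * of_real t)
      = exp (\<i> * of_real (z\<^sup>2 / (4 * t))) * exp (- (\<i> * of_real (p * t)))"
    unfolding exp_add[symmetric] using True by (simp add: field_simps)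
  ultimately show ?thesis
    unfolding bessel_kern_def P_const_def using True by (simp only: if_True) simp
qed (simp add: P_kernel_def bessel_kern_def)

text \<open>
  The Fourier transform of the truncated kernel in time, at the frequency \<open>p / (2 * pi)\<close>.
\<close>

definition P_trunc :: "real \<Rightarrow> real \<Rightarrow> real \<Rightarrow> real \<Rightarrow> complex" where
  "P_trunc s z \<epsilon> p = (LINT t:{\<epsilon>..}|lborel. P_kernel (1 - 2 * s) z t * exp (- (\<i> * of_real (p * t))))"

lemma P_trunc_eq:
  "P_trunc s z \<epsilon> p = P_const s z * (LINT t:{\<epsilon>..}|lborel. bessel_kern (- 1 - s) (of_real (z\<^sup>2 / 4) * - \<i>) (of_real p * \<i>) t)"
  unfolding P_trunc_def P_kernel_exp_eq by (rule set_integral_mult_right)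

lemma P_trunc_bound:
  assumes s: "0 < s" "s < 1" and z: "0 < z"
  shows "\<exists>K. 0 \<le> K \<and> (\<forall>\<epsilon>>0. \<forall>p. norm (P_trunc s z \<epsilon> p) \<le> K * (1 + \<bar>p\<bar>))"
proof -
  define \<alpha> where "\<alpha> = of_real (z\<^sup>2 / 4) * - \<i>"
  have n\<alpha>: "norm \<alpha> = z\<^sup>2 / 4"
    unfolding \<alpha>_def norm_mult norm_minus_cancel norm_of_real norm_ii by simp
  have \<alpha>0: "0 < norm \<alpha>" using z by (simp add: n\<alpha>)
  define B where "B = 2 + 1 / (1 - s) + norm \<alpha> / s"
  define K where "K = norm (P_const s z) / norm \<alpha> * B"
  have B0: "0 \<le> B" using s by (simp add: B_def)
  have "norm (P_trunc s z \<epsilon> p) \<le> K * (1 + \<bar>p\<bar>)" if \<epsilon>: "0 < \<epsilon>" for \<epsilon> p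
  proof -
    let ?I = "LINT t:{\<epsilon>..}|lborel. bessel_kern (- 1 - s) \<alpha> (of_real p * \<i>) t"
    have "norm (\<alpha> * ?I) \<le> 2 + (1 + norm (of_real p * \<i>)) / (1 - s) + norm \<alpha> / s"
      by (rule truncated_bound[OF s _ _ \<epsilon>]) (auto simp: \<alpha>_def)
    also have "\<dots> = B + \<bar>p\<bar> * (1 / (1 - s))"
      by (simp add: B_def norm_mult add_divide_distrib)
    also have "\<dots> \<le> B + \<bar>p\<bar> * B"
      using s by (intro add_left_mono mult_left_mono) (auto simp: B_def)
    finally have "norm \<alpha> * norm ?I \<le> B * (1 + \<bar>p\<bar>)"
      by (simp add: norm_mult algebra_simps)
    then have "norm ?I \<le> B * (1 + \<bar>p\<bar>) / norm \<alpha>"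
      using \<alpha>0 by (simp add: pos_le_divide_eq mult.commute)
    then have "norm (P_const s z) * norm ?I \<le> norm (P_const s z) * (B * (1 + \<bar>p\<bar>) / norm \<alpha>)"
      by (rule mult_left_mono) simp
    then show ?thesis
      unfolding P_trunc_eq \<alpha>_def[symmetric] norm_mult K_def by simp
  qed
  moreover have "0 \<le> K" unfolding K_def using B0 by simp
  ultimately show ?thesis by blast
qed

text \<open>
  The limit is \<open>truncated_tendsto\<close> at \<open>\<alpha> = - \<i> * z\<^sup>2 / 4\<close> and \<open>\<beta> = \<i> * p\<close>. The phase in the constant of the kernel
  cancels that of \<open>\<alpha> powr (- s)\<close> and turns \<open>\<beta> powr s\<close> into \<open>lower_powr s p\<close>.
\<close>

lemma P_trunc_tendsto:
  assumes s: "0 < s" "s < 1" and z: "0 < z" and p: "p \<noteq> 0"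
  shows "((\<lambda>\<epsilon>. P_trunc s z \<epsilon> p) \<longlongrightarrow> profile s z p) (at_right 0)"
proof -
  define \<sigma> where "\<sigma> = complex_of_real s"
  define \<alpha> where "\<alpha> = of_real (z\<^sup>2 / 4) * - \<i>"
  define \<beta> where "\<beta> = complex_of_real p * \<i>"
  have \<alpha>: "0 \<le> Re \<alpha>" "\<alpha> \<notin> \<real>\<^sub>\<le>\<^sub>0" using z by (auto simp: \<alpha>_def complex_nonpos_Reals_iff)
  have \<beta>: "0 \<le> Re \<beta>" "\<beta> \<notin> \<real>\<^sub>\<le>\<^sub>0" using p by (auto simp: \<beta>_def complex_nonpos_Reals_iff)
  have \<alpha>\<beta>: "\<alpha> * \<beta> = of_real (z\<^sup>2 * p / 4)" by (simp add: \<alpha>_def \<beta>_def mult_ac)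
  let ?h1 = "hyp01 (- \<sigma>) (of_real (z\<^sup>2 * p / 4))" and ?h2 = "hyp01 \<sigma> (of_real (z\<^sup>2 * p / 4))"
  let ?E = "exp (\<i> * of_real (pi * s / 2))"
  define T where "T = 2 powr (2 * s)"
  have T: "0 < T" by (simp add: T_def)
  define Z where "Z = z powr (2 * s)"
  have Z: "0 < Z" using z by (simp add: Z_def)
  have G: "Gamma s \<noteq> 0" "Gamma (1 - s) \<noteq> 0" "rGamma s = 1 / Gamma s" "rGamma (1 - s) = 1 / Gamma (1 - s)"
  proof -
    have "0 < Gamma s" "0 < Gamma (1 - s)" by (rule Gamma_real_pos; use s in simp)+
    then show "Gamma s \<noteq> 0" "Gamma (1 - s) \<noteq> 0" by (auto dest: less_imp_neq)
  qed (auto simp: rGamma_inverse_Gamma divide_inverse)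
  have a: "\<alpha> powr (- \<sigma>) = of_real (T / Z) * ?E"
  proof -
    have "\<alpha> powr (of_real (- s)) = of_real ((z\<^sup>2 / 4) powr (- s)) * exp (of_real (- s) * Ln (- \<i>))"
      unfolding \<alpha>_def by (rule powr_of_real_times) (use z in auto)
    also have "(z\<^sup>2 / 4) powr (- s) = T / Z"
    proof -
      have "z\<^sup>2 / 4 = (z / 2) powr 2" using z by (simp add: power_divide)
      then have "(z\<^sup>2 / 4) powr (- s) = (z / 2) powr (- (2 * s))" by (simp add: powr_powr)
      also have "\<dots> = T / Z" using z by (simp add: powr_divide powr_minus T_def Z_def divide_simps)
      finally show ?thesis .
    qed
    also have "exp (of_real (- s) * Ln (- \<i>)) = ?E" by (simp add: mult_ac)
    finally show ?thesis by (simp add: \<sigma>_def)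
  qed
  have b: "exp (- (\<i> * of_real (pi * s / 2))) * \<beta> powr \<sigma> = lower_powr s p"
  proof (cases "0 < p")
    case True
    then have "\<beta> powr \<sigma> = of_real (p powr s) * exp (of_real s * Ln \<i>)"
      unfolding \<beta>_def \<sigma>_def by (intro powr_of_real_times) auto
    also have "exp (of_real s * Ln \<i>) = ?E" by (simp add: mult_ac)
    finally show ?thesis
      using True by (simp add: lower_powr_def mult.left_commute flip: exp_add)
  next
    case False
    then have e: "\<beta> = of_real \<bar>p\<bar> * - \<i>" by (simp add: \<beta>_def)
    have "\<beta> powr \<sigma> = of_real (\<bar>p\<bar> powr s) * exp (of_real s * Ln (- \<i>))"
      unfolding e \<sigma>_def using p by (intro powr_of_real_times) auto
    moreover have "exp (- (\<i> * of_real (pi * s / 2))) * exp (of_real s * Ln (- \<i>)) = exp (- (\<i> * of_real (pi * s)))"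
      unfolding exp_add[symmetric] by (simp add: field_simps)
    ultimately show ?thesis
      using False by (simp add: lower_powr_def mult.left_commute)
  qed
  have "((\<lambda>\<epsilon>. P_const s z * of_real (Gamma s * Gamma (1 - s)) *
       (of_real (rGamma s * rGamma (1 - s)) * (LINT t:{\<epsilon>..}|lborel. bessel_kern (- 1 - s) \<alpha> \<beta> t))) \<longlongrightarrow>
     P_const s z * of_real (Gamma s * Gamma (1 - s)) * (\<alpha> powr (- \<sigma>) * ?h1 - \<beta> powr \<sigma> * ?h2)) (at_right 0)"
    using truncated_tendsto[OF s \<alpha> \<beta>] unfolding \<alpha>\<beta> \<sigma>_def by (intro tendsto_mult tendsto_const)
  moreover have "P_const s z * of_real (Gamma s * Gamma (1 - s)) *
       (of_real (rGamma s * rGamma (1 - s)) * (LINT t:{\<epsilon>..}|lborel. bessel_kern (- 1 - s) \<alpha> \<beta> t)) = P_trunc s z \<epsilon> p" for \<epsilon>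
    unfolding P_trunc_eq \<alpha>_def[symmetric] \<beta>_def[symmetric] G(3,4) using G(1,2) by simp
  moreover have "P_const s z * of_real (Gamma s * Gamma (1 - s)) * (\<alpha> powr (- \<sigma>) * ?h1 - \<beta> powr \<sigma> * ?h2) = profile s z p"
  proof -
    let ?e = "exp (- (\<i> * of_real (pi * s / 2)))"
    have eE: "?e * ?E = 1" by (simp flip: exp_add)
    have P: "P_const s z = ?e * of_real (Z / (T * Gamma s))"
      by (simp add: P_const_def Z_def T_def)
    have T': "2 powr (- 2 * s) = 1 / T"
      by (simp add: T_def powr_minus divide_inverse)
    have "P_const s z * of_real (Gamma s * Gamma (1 - s)) * (\<alpha> powr (- \<sigma>) * ?h1 - \<beta> powr \<sigma> * ?h2)
      = of_real (Gamma (1 - s)) * ((of_real (Z / T) * of_real (T / Z)) * (?e * ?E) * ?h1 - of_real (Z / T) * (?e * \<beta> powr \<sigma>) * ?h2)"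
      unfolding P a using G(1) by (simp add: algebra_simps)
    also have "\<dots> = profile s z p"
      unfolding b eE profile_def T' Z_def[symmetric] using T Z by (simp add: \<sigma>_def mult_ac)
    finally show ?thesis .
  qed
  ultimately show ?thesis by (simp only:)
qed

lemma profile_scale:
  assumes "0 < z"
  shows "profile s z p = profile s 1 (z\<^sup>2 * p)"
proof -
  have "lower_powr s (z\<^sup>2 * p) = lower_powr s p * of_real (z powr (2 * s))"
  proof -
    have "\<bar>z\<^sup>2 * p\<bar> powr s = z powr (2 * s) * \<bar>p\<bar> powr s"
    proof -
      have "z\<^sup>2 = z powr 2" using assms by simp
      then have "(z\<^sup>2) powr s = z powr (2 * s)" by (simp only: powr_powr)
      then show ?thesis by (simp add: abs_mult powr_mult)
    qed
    then show ?thesis using assms by (simp add: lower_powr_def zero_less_mult_iff mult_ac)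
  qed
  then show ?thesis
    by (simp add: profile_def mult_ac)
qed

text \<open>
  The bound of the truncated integrals passes to their limit, so that no asymptotics of Bessel functions are
  involved; homogeneity (\<open>profile_scale\<close>) makes it uniform in \<open>z\<close>.
\<close>

lemma profile_bound:
  assumes s: "0 < s" "s < 1"
  shows "\<exists>K. 0 \<le> K \<and> (\<forall>z>0. \<forall>p. p \<noteq> 0 \<longrightarrow> norm (profile s z p) \<le> K * (1 + z\<^sup>2 * \<bar>p\<bar>))"
proof -
  obtain K where K: "0 \<le> K" "\<And>\<epsilon> p. 0 < \<epsilon> \<Longrightarrow> norm (P_trunc s 1 \<epsilon> p) \<le> K * (1 + \<bar>p\<bar>)"
    using P_trunc_bound[OF s, of 1] by auto
  have 1: "norm (profile s 1 p) \<le> K * (1 + \<bar>p\<bar>)" if "p \<noteq> 0" for p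
  proof (rule tendsto_upperbound[OF tendsto_norm[OF P_trunc_tendsto[OF s _ that]]])
    show "\<forall>\<^sub>F \<epsilon> in at_right 0. norm (P_trunc s 1 \<epsilon> p) \<le> K * (1 + \<bar>p\<bar>)"
      using eventually_at_right_less[of "0::real"] by eventually_elim (rule K)
  qed auto
  have "norm (profile s z p) \<le> K * (1 + z\<^sup>2 * \<bar>p\<bar>)" if "0 < z" "p \<noteq> 0" for z p
    unfolding profile_scale[OF that(1)] using 1[of "z\<^sup>2 * p"] that by (simp add: abs_mult)
  with K(1) show ?thesis by blast
qed

lemma profile_tendsto_1:
  assumes s: "0 < s" "s < 1"
  shows "((\<lambda>z. profile s z p) \<longlongrightarrow> 1) (at_right 0)"
proof -
  have h: "((\<lambda>z::real. hyp01 \<nu> (of_real (z\<^sup>2 * p / 4))) \<longlongrightarrow> rGamma (\<nu> + 1)) (at_right 0)" for \<nu>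
  proof -
    have "((\<lambda>z. complex_of_real (z\<^sup>2 * p / 4)) \<longlongrightarrow> of_real (0\<^sup>2 * p / 4)) (at_right 0)"
      by (intro tendsto_intros) auto
    from isCont_tendsto_compose[OF DERIV_isCont[OF hyp01_has_field_derivative] this, of \<nu>]
    show ?thesis by (simp add: hyp01_0)
  qed
  have "((\<lambda>z::real. z powr (2 * s)) \<longlongrightarrow> 0) (at_right 0)" using s by real_asymp
  then have Zt: "((\<lambda>z. complex_of_real (z powr (2 * s))) \<longlongrightarrow> of_real 0) (at_right 0)"
    by (rule tendsto_of_real)
  have "((\<lambda>z. profile s z p) \<longlongrightarrow> of_real (Gamma (1 - s)) * (rGamma (- of_real s + 1)
      - of_real (2 powr (- 2 * s)) * lower_powr s p * of_real 0 * rGamma (of_real s + 1))) (at_right 0)"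
    unfolding profile_def by (intro tendsto_mult tendsto_diff tendsto_const h Zt)
  moreover have "of_real (Gamma (1 - s)) * rGamma (- of_real s + 1 :: complex) = 1"
  proof -
    have "rGamma (- of_real s + 1 :: complex) = of_real (rGamma (1 - s))"
      by (simp flip: rGamma_complex_of_real)
    moreover have "Gamma (1 - s) * rGamma (1 - s) = 1"
    proof -
      have "0 < Gamma (1 - s)" by (rule Gamma_real_pos) (use s in simp)
      then have "Gamma (1 - s) \<noteq> 0" by (auto dest: less_imp_neq)
      then show ?thesis unfolding rGamma_inverse_Gamma by (rule right_inverse)
    qed
    ultimately show ?thesis by (metis of_real_1 of_real_mult)
  qed
  ultimately show ?thesis by simp
qed

section \<open>The differential equation of the multiplier\<close>

text \<open>
  The flux \<open>z\<^bsup>1-2s\<^esup> \<partial>\<^sub>z M\<close> of \<open>M z = profile s z p\<close>, computed from the series. It is continuous up to \<open>z = 0\<close>,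
  and \<open>profile_flux_derivative\<close> is the equation \<open>\<partial>\<^sub>z (z\<^bsup>1-2s\<^esup> \<partial>\<^sub>z M) = z\<^bsup>1-2s\<^esup> p M\<close>, the extension problem after
  the Fourier transform.
\<close>

definition profile_flux :: "real \<Rightarrow> real \<Rightarrow> real \<Rightarrow> complex" where
  "profile_flux s z p = of_real (Gamma (1 - s)) *
     (of_real (p / 2 * z powr (2 - 2 * s)) * hyp01 (1 - of_real s) (of_real (z\<^sup>2 * p / 4))
      - 2 * of_real (2 powr (- 2 * s)) * lower_powr s p * hyp01 (of_real s - 1) (of_real (z\<^sup>2 * p / 4)))"

lemma hyp01_quadratic_derivative:
  "((\<lambda>z. hyp01 \<nu> (of_real (z\<^sup>2 * p / 4))) has_vector_derivative
     hyp01 (\<nu> + 1) (of_real (z\<^sup>2 * p / 4)) * of_real (z * p / 2)) (at z)"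
proof -
  have "((\<lambda>z. z\<^sup>2 * p / 4) has_vector_derivative (z * p / 2)) (at z)"
    unfolding has_real_derivative_iff_has_vector_derivative[symmetric]
    by (auto intro!: derivative_eq_intros)
  then have "((\<lambda>z. complex_of_real (z\<^sup>2 * p / 4)) has_vector_derivative of_real (z * p / 2)) (at z)"
    by (rule bounded_linear.has_vector_derivative[OF bounded_linear_of_real])
  from field_vector_diff_chain_at[OF this hyp01_has_field_derivative]
  show ?thesis by (simp add: o_def mult.commute)
qed

lemma profile_derivative:
  assumes z: "0 < z"
  shows "((\<lambda>z. profile s z p) has_vector_derivative of_real (z powr (2 * s - 1)) * profile_flux s z p) (at z)"
proof -
  let ?q = "complex_of_real (z\<^sup>2 * p / 4)" and ?c = "complex_of_real (2 powr (- 2 * s)) * lower_powr s p"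
  let ?G = "complex_of_real (Gamma (1 - s))" and ?\<sigma> = "complex_of_real s"
  let ?Z = "complex_of_real (z powr (2 * s - 1))"
  have D: "((\<lambda>z. profile s z p) has_vector_derivative
     ?G * (hyp01 (- ?\<sigma> + 1) ?q * of_real (z * p / 2)
       - ((?c * of_real (z powr (2 * s))) * (hyp01 (?\<sigma> + 1) ?q * of_real (z * p / 2))
         + (?c * of_real (2 * s * z powr (2 * s - 1))) * hyp01 ?\<sigma> ?q))) (at z)"
    unfolding profile_def
    by (intro has_vector_derivative_mult_right has_vector_derivative_diff has_vector_derivative_mult
        hyp01_quadratic_derivative of_real_powr_derivative z)
  have r: "hyp01 (?\<sigma> - 1) ?q = ?q * hyp01 (?\<sigma> + 1) ?q + ?\<sigma> * hyp01 ?\<sigma> ?q"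
  proof -
    have e: "?\<sigma> - 1 + 2 = ?\<sigma> + 1" "?\<sigma> - 1 + 1 = ?\<sigma>" by simp_all
    show ?thesis using hyp01_recurrence[of ?q "?\<sigma> - 1"] unfolding e by (rule sym)
  qed
  have z1: "complex_of_real (z powr (2 * s)) = ?Z * of_real z"
  proof -
    have "z powr (2 * s) = z powr (2 * s - 1) * z"
      using z powr_add[of z "2 * s - 1" 1] by simp
    then show ?thesis by (simp only: of_real_mult)
  qed
  have z2: "?Z * of_real (z powr (2 - 2 * s)) = of_real z"
  proof -
    have "z powr (2 * s - 1) * z powr (2 - 2 * s) = z"
      using z by (simp flip: powr_add)
    then show ?thesis by (metis of_real_mult)
  qed
  have "?Z * profile_flux s z p = ?G * ((?Z * of_real (z powr (2 - 2 * s))) * of_real (p / 2) * hyp01 (1 - ?\<sigma>) ?q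
      - 2 * ?c * ?Z * hyp01 (?\<sigma> - 1) ?q)"
    by (simp add: profile_flux_def algebra_simps)
  also have "\<dots> = ?G * (hyp01 (- ?\<sigma> + 1) ?q * of_real (z * p / 2)
       - ((?c * of_real (z powr (2 * s))) * (hyp01 (?\<sigma> + 1) ?q * of_real (z * p / 2))
         + (?c * of_real (2 * s * z powr (2 * s - 1))) * hyp01 ?\<sigma> ?q))"
    unfolding z1 z2 r by (simp add: algebra_simps power2_eq_square)
  finally show ?thesis using D by (simp only:)
qed

lemma profile_flux_derivative:
  assumes z: "0 < z"
  shows "((\<lambda>z. profile_flux s z p) has_vector_derivative of_real (p * z powr (1 - 2 * s)) * profile s z p) (at z)"
proof -
  let ?q = "complex_of_real (z\<^sup>2 * p / 4)" and ?c = "complex_of_real (2 powr (- 2 * s)) * lower_powr s p"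
  let ?G = "complex_of_real (Gamma (1 - s))" and ?\<sigma> = "complex_of_real s"
  let ?Z = "complex_of_real (z powr (1 - 2 * s))"
  have "((\<lambda>z. of_real (p / 2 * z powr (2 - 2 * s))) has_vector_derivative
      of_real (p / 2) * complex_of_real ((2 - 2 * s) * z powr (2 - 2 * s - 1))) (at z)"
    unfolding of_real_mult by (intro has_vector_derivative_mult_right of_real_powr_derivative[OF z, unfolded of_real_mult])
  then have D: "((\<lambda>z. profile_flux s z p) has_vector_derivative
     ?G * ((of_real (p / 2 * z powr (2 - 2 * s)) * (hyp01 (1 - ?\<sigma> + 1) ?q * of_real (z * p / 2))
        + of_real (p / 2) * complex_of_real ((2 - 2 * s) * z powr (2 - 2 * s - 1)) * hyp01 (1 - ?\<sigma>) ?q)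
       - 2 * ?c * (hyp01 (?\<sigma> - 1 + 1) ?q * of_real (z * p / 2)))) (at z)"
    unfolding profile_flux_def mult.assoc[of 2, symmetric] mult.assoc[of _ _ "lower_powr s p", symmetric]
    by (intro has_vector_derivative_mult_right has_vector_derivative_diff has_vector_derivative_mult
        hyp01_quadratic_derivative)
  have r: "hyp01 (- ?\<sigma>) ?q = ?q * hyp01 (1 - ?\<sigma> + 1) ?q + (1 - ?\<sigma>) * hyp01 (1 - ?\<sigma>) ?q"
  proof -
    have e: "- ?\<sigma> + 2 = 1 - ?\<sigma> + 1" "- ?\<sigma> + 1 = 1 - ?\<sigma>" by simp_all
    show ?thesis using hyp01_recurrence[of ?q "- ?\<sigma>"] unfolding e by (rule sym)
  qed
  have z1: "z powr (2 - 2 * s - 1) = z powr (1 - 2 * s)" "z powr (2 - 2 * s) = z powr (1 - 2 * s) * z"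
    using z powr_add[of z "1 - 2 * s" 1] by simp_all
  have z2: "?Z * of_real (z powr (2 * s)) = of_real z"
  proof -
    have "z powr (1 - 2 * s) * z powr (2 * s) = z"
      using z by (simp flip: powr_add)
    then show ?thesis by (metis of_real_mult)
  qed
  have "of_real (p * z powr (1 - 2 * s)) * profile s z p = ?G * of_real p * (?Z * hyp01 (- ?\<sigma>) ?q
      - ?c * (?Z * of_real (z powr (2 * s))) * hyp01 ?\<sigma> ?q)"
    by (simp add: profile_def algebra_simps)
  also have "\<dots> = ?G * ((of_real (p / 2 * z powr (2 - 2 * s)) * (hyp01 (1 - ?\<sigma> + 1) ?q * of_real (z * p / 2))
        + of_real (p / 2) * complex_of_real ((2 - 2 * s) * z powr (2 - 2 * s - 1)) * hyp01 (1 - ?\<sigma>) ?q)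
       - 2 * ?c * (hyp01 (?\<sigma> - 1 + 1) ?q * of_real (z * p / 2)))"
    unfolding z1 z2 r by (simp add: algebra_simps power2_eq_square)
  finally show ?thesis using D by (simp only:)
qed

lemma one_plus_square_mult_le:
  fixes p :: real
  assumes "0 \<le> z" "z \<le> Z"
  shows "1 + z\<^sup>2 * \<bar>p\<bar> \<le> (1 + Z\<^sup>2) * (1 + \<bar>p\<bar>)"
proof -
  have "z\<^sup>2 \<le> Z\<^sup>2" using assms by (intro power_mono) auto
  then have "z\<^sup>2 * \<bar>p\<bar> \<le> Z\<^sup>2 * \<bar>p\<bar>" by (rule mult_right_mono) simp
  moreover have "(1 + Z\<^sup>2) * (1 + \<bar>p\<bar>) = 1 + \<bar>p\<bar> + Z\<^sup>2 + Z\<^sup>2 * \<bar>p\<bar>"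
    by (simp add: algebra_simps)
  moreover have "0 \<le> \<bar>p\<bar>" "0 \<le> Z\<^sup>2" by simp_all
  ultimately show ?thesis by linarith
qed

text \<open>
  Integrate the derivative of the flux from \<open>0\<close> to \<open>z\<close>: at \<open>0\<close> the flux is a multiple of \<open>\<bar>p\<bar> powr s\<close>, and the
  derivative is controlled by \<open>profile_bound\<close>. In this way the polynomial bound of \<open>M\<close> carries over to its
  derivatives.
\<close>

lemma profile_flux_bound:
  assumes s: "0 < s" "s < 1" and Z: "0 < Z"
  shows "\<exists>K. 0 \<le> K \<and> (\<forall>z p. 0 < z \<longrightarrow> z \<le> Z \<longrightarrow> p \<noteq> 0 \<longrightarrow> norm (profile_flux s z p) \<le> K * (1 + \<bar>p\<bar>)\<^sup>2)"
proof -
  obtain C where C: "0 \<le> C" "\<And>z p. 0 < z \<Longrightarrow> p \<noteq> 0 \<Longrightarrow> norm (profile s z p) \<le> C * (1 + z\<^sup>2 * \<bar>p\<bar>)"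
    using profile_bound[OF s] by blast
  define c0 where "c0 = \<bar>Gamma (1 - s)\<bar> * (2 * 2 powr (- 2 * s) * norm (hyp01 (of_real s - 1) 0))"
  define c1 where "c1 = C * (1 + Z\<^sup>2) * (Z powr (2 - 2 * s) / (2 - 2 * s))"
  have c: "0 \<le> c0" "0 \<le> c1" unfolding c0_def c1_def using C s by auto
  have "norm (profile_flux s z p) \<le> (c0 + c1) * (1 + \<bar>p\<bar>)\<^sup>2" if z: "0 < z" "z \<le> Z" and p: "p \<noteq> 0" for z p
  proof -
    have sq: "1 + \<bar>p\<bar> \<le> (1 + \<bar>p\<bar>)\<^sup>2" by (simp add: power2_eq_square algebra_simps)
    \<comment> \<open>the derivative of the flux at \<open>x \<le> Z\<close> is at most \<open>K * x powr (1 - 2 * s)\<close>\<close>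
    define K where "K = \<bar>p\<bar> * (C * ((1 + Z\<^sup>2) * (1 + \<bar>p\<bar>)))"
    have e: "0 < 2 - 2 * s" using s by simp
    have h: "continuous_on A (\<lambda>z. hyp01 \<nu> (complex_of_real (z\<^sup>2 * p / 4)))" for A \<nu>
      by (rule continuous_on_compose2[OF hyp01_continuous[of UNIV]]) (auto intro!: continuous_intros)
    have pc: "continuous_on {0..z} (\<lambda>z. z powr (2 - 2 * s))"
      by (rule continuous_on_powr') (use e in \<open>auto intro!: continuous_intros\<close>)
    have "norm (profile_flux s z p - profile_flux s 0 p)
        \<le> K * (z powr (2 - 2 * s) / (2 - 2 * s)) - K * (0 powr (2 - 2 * s) / (2 - 2 * s))"
    proof (rule differentiable_bound_general[OF z(1)])
      show "continuous_on {0..z} (\<lambda>z. profile_flux s z p)"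
        unfolding profile_flux_def by (intro continuous_intros h pc)
      show "continuous_on {0..z} (\<lambda>z. K * (z powr (2 - 2 * s) / (2 - 2 * s)))"
        by (intro continuous_intros pc) (use e in auto)
      fix x assume x: "0 < x" "x < z"
      show "((\<lambda>z. profile_flux s z p) has_vector_derivative of_real (p * x powr (1 - 2 * s)) * profile s x p) (at x)"
        by (rule profile_flux_derivative[OF x(1)])
      have "((\<lambda>z. K * (z powr (2 - 2 * s) / (2 - 2 * s))) has_real_derivative K * ((2 - 2 * s) * x powr (2 - 2 * s - 1) / (2 - 2 * s))) (at x)"
        by (intro DERIV_cmult DERIV_cdivide has_real_derivative_powr x)
      then have "((\<lambda>z. K * (z powr (2 - 2 * s) / (2 - 2 * s))) has_real_derivative K * x powr (1 - 2 * s)) (at x)"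
        using e by simp
      then show "((\<lambda>z. K * (z powr (2 - 2 * s) / (2 - 2 * s))) has_vector_derivative K * x powr (1 - 2 * s)) (at x)"
        unfolding has_real_derivative_iff_has_vector_derivative .
      have "1 + x\<^sup>2 * \<bar>p\<bar> \<le> (1 + Z\<^sup>2) * (1 + \<bar>p\<bar>)"
        by (rule one_plus_square_mult_le) (use x z in auto)
      then have "norm (profile s x p) \<le> C * ((1 + Z\<^sup>2) * (1 + \<bar>p\<bar>))"
        using C(2)[OF x(1) p] C(1) by (meson mult_left_mono order_trans)
      then have "\<bar>p\<bar> * x powr (1 - 2 * s) * norm (profile s x p) \<le> \<bar>p\<bar> * x powr (1 - 2 * s) * (C * ((1 + Z\<^sup>2) * (1 + \<bar>p\<bar>)))"
        by (intro mult_left_mono) auto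
      then show "norm (of_real (p * x powr (1 - 2 * s)) * profile s x p) \<le> K * x powr (1 - 2 * s)"
        by (simp add: norm_mult abs_mult K_def mult_ac)
    qed
    also have "\<dots> = K * (z powr (2 - 2 * s) / (2 - 2 * s))" using e by simp
    also have "\<dots> \<le> K * (Z powr (2 - 2 * s) / (2 - 2 * s))"
      using z e C(1) by (intro mult_left_mono divide_right_mono powr_mono2) (auto simp: K_def)
    also have "\<dots> = (\<bar>p\<bar> * (1 + \<bar>p\<bar>)) * c1" by (simp add: K_def c1_def)
    also have "\<dots> \<le> (1 + \<bar>p\<bar>)\<^sup>2 * c1"
      using c by (intro mult_right_mono) (auto simp: power2_eq_square intro!: mult_right_mono)
    finally have d: "norm (profile_flux s z p - profile_flux s 0 p) \<le> (1 + \<bar>p\<bar>)\<^sup>2 * c1" .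
    have "norm (profile_flux s 0 p) = c0 * \<bar>p\<bar> powr s"
      using e by (simp add: profile_flux_def c0_def norm_mult norm_lower_powr mult_ac)
    also have "\<dots> \<le> c0 * (1 + \<bar>p\<bar>)\<^sup>2"
    proof -
      have "\<bar>p\<bar> powr s \<le> (1 + \<bar>p\<bar>) powr s" using s by (intro powr_mono2) auto
      also have "\<dots> \<le> (1 + \<bar>p\<bar>) powr 1" using s by (intro powr_mono) auto
      also have "\<dots> = 1 + \<bar>p\<bar>" by simp
      finally have "\<bar>p\<bar> powr s \<le> (1 + \<bar>p\<bar>)\<^sup>2" using sq by linarith
      then show ?thesis using c by (intro mult_left_mono)
    qed
    finally have "norm (profile_flux s 0 p) \<le> c0 * (1 + \<bar>p\<bar>)\<^sup>2" .
    then show ?thesis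
      using d norm_triangle_ineq[of "profile_flux s z p - profile_flux s 0 p" "profile_flux s 0 p"]
      by (simp add: algebra_simps)
  qed
  then show ?thesis using c by (intro exI[of _ "c0 + c1"]) auto
qed

section \<open>Functions of polynomial growth\<close>

text \<open>
  The multiplier is not smooth where the symbol vanishes, so it is not a multiplier of \<open>schwartz\<close>; it still maps
  \<open>schwartz\<close> to integrable functions.
\<close>

definition slowly_increasing :: "('a::euclidean_space \<Rightarrow> complex) \<Rightarrow> bool" where
  "slowly_increasing h \<longleftrightarrow> h \<in> borel_measurable borel \<and> (\<exists>A j. \<forall>x. norm (h x) \<le> A * (1 + norm x) ^ j)"

lemma slowly_increasingI:
  "h \<in> borel_measurable borel \<Longrightarrow> (\<And>x. norm (h x) \<le> A * (1 + norm x) ^ j) \<Longrightarrow> slowly_increasing h"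
  unfolding slowly_increasing_def by blast

lemma slowly_increasing_measurable: "slowly_increasing h \<Longrightarrow> h \<in> borel_measurable borel"
  by (simp add: slowly_increasing_def)

lemma slowly_increasing_mult:
  assumes f: "slowly_increasing f" and g: "slowly_increasing g"
  shows "slowly_increasing (\<lambda>x. f x * g x)"
proof -
  note [measurable] = slowly_increasing_measurable[OF f] slowly_increasing_measurable[OF g]
  obtain A j where A: "\<And>x. norm (f x) \<le> A * (1 + norm x) ^ j" using f unfolding slowly_increasing_def by blast
  obtain B k where B: "\<And>x. norm (g x) \<le> B * (1 + norm x) ^ k" using g unfolding slowly_increasing_def by blast
  show ?thesis
  proof (rule slowly_increasingI)
    fix x
    have "norm (f x * g x) \<le> (A * (1 + norm x) ^ j) * (B * (1 + norm x) ^ k)"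
      unfolding norm_mult by (intro mult_mono' A B) auto
    then show "norm (f x * g x) \<le> (A * B) * (1 + norm x) ^ (j + k)"
      by (simp only: power_add mult_ac)
  qed measurable
qed

lemma slowly_increasing_const: "slowly_increasing (\<lambda>x. c)"
  by (rule slowly_increasingI[where A = "norm c" and j = 0]) auto

lemma slowly_increasing_inner: "slowly_increasing (\<lambda>x. of_real (x \<bullet> v))"
proof (rule slowly_increasingI[where A = "norm v" and j = 1])
  fix x
  have "\<bar>x \<bullet> v\<bar> \<le> norm x * norm v" by (rule Cauchy_Schwarz_ineq2)
  also have "\<dots> \<le> (1 + norm x) * norm v" by (rule mult_right_mono) auto
  finally show "norm (complex_of_real (x \<bullet> v)) \<le> norm v * (1 + norm x) ^ 1" by (simp add: mult.commute)
qed simp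

lemma slowly_increasing_norm: "slowly_increasing (\<lambda>x. of_real (norm x))"
  by (rule slowly_increasingI[where A = 1 and j = 1]) auto

lemma slowly_increasing_schwartz:
  assumes f: "f \<in> schwartz"
  shows "slowly_increasing f"
proof -
  obtain C where "\<And>x. (1 + norm x) ^ 0 * norm (f x) \<le> C" using schwartz_decay_ex[OF f] by blast
  then show ?thesis
    using schwartz_borel_measurable[OF f] by (intro slowly_increasingI[where A = C and j = 0]) auto
qed

lemma slowly_increasing_integrable:
  assumes h: "slowly_increasing h" and f: "f \<in> schwartz"
  shows "integrable lborel (\<lambda>x. h x * f x)"
proof -
  obtain A j where "\<And>x. norm (h x) \<le> A * (1 + norm x) ^ j"
    using h unfolding slowly_increasing_def by blast
  then show ?thesis
    by (rule schwartz_weighted_integrable[OF f slowly_increasing_measurable[OF h]])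
qed

lemma tempered_distributionI:
  assumes "\<And>f g. f \<in> schwartz \<Longrightarrow> g \<in> schwartz \<Longrightarrow> T (\<lambda>x. f x + g x) = T f + T g"
    and "\<And>c f. f \<in> schwartz \<Longrightarrow> T (\<lambda>x. c * f x) = c * T f"
    and "\<And>f. f \<in> schwartz \<Longrightarrow> norm (T f) \<le> C * schwartz_norm N f"
  shows "tempered_distribution T"
  unfolding tempered_distribution_def
proof (intro conjI ballI allI)
  show "\<exists>C N. \<forall>f\<in>schwartz. norm (T f) \<le> C * (\<Sum>k\<le>N. \<Sum>bs | set bs \<subseteq> Basis \<and> length bs \<le> N. schwartz_seminorm k bs f)"
    using assms(3) unfolding schwartz_norm_def by blast
qed (use assms in auto)

lemma tempered_function_slowly_increasing:
  fixes h :: "'a::euclidean_space \<Rightarrow> complex"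
  assumes h: "slowly_increasing h"
  shows "tempered_function h"
  unfolding tempered_function_def
proof (intro conjI ballI)
  show "integrable lborel (\<lambda>x. h x * \<Phi> x)" if "\<Phi> \<in> schwartz" for \<Phi>
    by (rule slowly_increasing_integrable[OF h that])
  note [measurable] = slowly_increasing_measurable[OF h]
  note int = slowly_increasing_integrable[OF h]
  obtain A j where A: "\<And>x. norm (h x) \<le> A * (1 + norm x) ^ j" using h unfolding slowly_increasing_def by blast
  have A0: "0 \<le> A" using order_trans[OF norm_ge_zero A[of 0]] by simp
  define I where "I = (\<integral>x. inverse ((1 + norm (x::'a)) ^ (2 * DIM('a))) \<partial>lborel)"
  define K where "K = 2 * DIM('a) + j"
  show "tempered_distribution (regular_dist h)"
  proof (rule tempered_distributionI[where N = K and C = "A * 2 ^ K * 2 * I"])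
    fix f g :: "'a \<Rightarrow> complex" assume f: "f \<in> schwartz" and g: "g \<in> schwartz"
    show "regular_dist h (\<lambda>x. f x + g x) = regular_dist h f + regular_dist h g"
      using int[OF f] int[OF g] by (simp add: regular_dist_def distrib_left)
  next
    fix c and f :: "'a \<Rightarrow> complex" assume f: "f \<in> schwartz"
    show "regular_dist h (\<lambda>x. c * f x) = c * regular_dist h f"
      by (simp add: regular_dist_def mult.left_commute[of _ c])
  next
    fix f :: "'a \<Rightarrow> complex" assume f: "f \<in> schwartz"
    note [measurable] = schwartz_borel_measurable[OF f]
    have "norm (regular_dist h f) \<le> A * (2 ^ K * (2 * schwartz_norm K f)) * I"
      unfolding regular_dist_def I_def
    proof (rule weighted_integral(2)[OF _ _ A])
      fix x
      have "schwartz_seminorm 0 [] f \<le> schwartz_norm K f" "schwartz_seminorm K [] f \<le> schwartz_norm K f"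
        by (rule schwartz_seminorm_le_norm[OF f]; simp)+
      then have "2 ^ K * (schwartz_seminorm 0 [] f + schwartz_seminorm K [] f) \<le> 2 ^ K * (2 * schwartz_norm K f)"
        by (intro mult_left_mono) auto
      then have "(1 + norm x) ^ K * norm (iter_pderiv [] f x) \<le> 2 ^ K * (2 * schwartz_norm K f)"
        by (rule order_trans[OF schwartz_decay[OF f], rotated]) simp
      then show "(1 + norm x) ^ (2 * DIM('a) + j) * norm (f x) \<le> 2 ^ K * (2 * schwartz_norm K f)"
        by (simp only: iter_pderiv.simps K_def)
    qed measurable
    then show "norm (regular_dist h f) \<le> A * 2 ^ K * 2 * I * schwartz_norm K f"
      by (simp add: mult_ac)
  qed
qed

section \<open>The multiplier as a tempered function\<close>

abbreviation psymb :: "(real^'d) \<times> real \<Rightarrow> real" where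
  "psymb \<zeta> \<equiv> symb (fst \<zeta>) (snd \<zeta>)"

lemma psymb_continuous: "continuous_on A psymb"
  unfolding symb_def by (intro continuous_intros)

lemma psymb_measurable[measurable]: "psymb \<in> borel_measurable borel"
  by (intro borel_measurable_continuous_onI psymb_continuous)

lemma fst_snd_borel_measurable[measurable]:
  "(fst :: 'a::euclidean_space \<times> 'b::euclidean_space \<Rightarrow> 'a) \<in> borel_measurable borel"
  "(snd :: 'a::euclidean_space \<times> 'b::euclidean_space \<Rightarrow> 'b) \<in> borel_measurable borel"
  by (auto intro!: borel_measurable_continuous_onI continuous_intros)

lemma psymb_bound: "1 + \<bar>psymb \<zeta>\<bar> \<le> (1 + 4 * pi\<^sup>2) * (1 + norm \<zeta>)\<^sup>2"
proof -
  have pi: "pi \<le> pi\<^sup>2"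
    using pi_gt3 by (simp add: power2_eq_square)
  have 1: "\<bar>snd \<zeta>\<bar> \<le> norm \<zeta>" "norm (fst \<zeta>) \<le> norm \<zeta>"
    using norm_snd_le[of "snd \<zeta>" "fst \<zeta>"] norm_fst_le[of "fst \<zeta>" "snd \<zeta>"] by auto
  have "\<bar>psymb \<zeta>\<bar> \<le> 2 * pi * \<bar>snd \<zeta>\<bar> + 4 * pi\<^sup>2 * (norm (fst \<zeta>))\<^sup>2"
    unfolding symb_def by (rule order_trans[OF abs_triangle_ineq]) (simp add: abs_mult)
  also have "\<dots> \<le> 4 * pi\<^sup>2 * norm \<zeta> + 4 * pi\<^sup>2 * (norm \<zeta>)\<^sup>2"
    using pi 1 by (intro add_mono mult_mono power_mono) auto
  also have "\<dots> \<le> 4 * pi\<^sup>2 * (1 + norm \<zeta>)\<^sup>2"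
    by (simp add: power2_sum distrib_left)
  also have "1 + 4 * pi\<^sup>2 * (1 + norm \<zeta>)\<^sup>2 \<le> (1 + norm \<zeta>)\<^sup>2 + 4 * pi\<^sup>2 * (1 + norm \<zeta>)\<^sup>2"
    by (simp add: power2_sum)
  finally show ?thesis by (simp add: algebra_simps)
qed

lemma slowly_increasing_psymb_bound:
  fixes h :: "(real^'d) \<times> real \<Rightarrow> complex"
  assumes "h \<in> borel_measurable borel" "0 \<le> K" "\<And>\<zeta>. norm (h \<zeta>) \<le> K * (1 + \<bar>psymb \<zeta>\<bar>) ^ n"
  shows "slowly_increasing h"
proof (rule slowly_increasingI[where A = "K * (1 + 4 * pi\<^sup>2) ^ n" and j = "2 * n"])
  fix \<zeta> :: "(real^'d) \<times> real"
  have "K * (1 + \<bar>psymb \<zeta>\<bar>) ^ n \<le> K * ((1 + 4 * pi\<^sup>2) * (1 + norm \<zeta>)\<^sup>2) ^ n"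
    using assms(2) by (intro mult_left_mono power_mono psymb_bound) auto
  also have "\<dots> = K * (1 + 4 * pi\<^sup>2) ^ n * (1 + norm \<zeta>) ^ (2 * n)"
    by (simp add: power_mult_distrib power_mult)
  finally show "norm (h \<zeta>) \<le> K * (1 + 4 * pi\<^sup>2) ^ n * (1 + norm \<zeta>) ^ (2 * n)"
    using assms(3)[of \<zeta>] by linarith
qed (rule assms(1))

text \<open>
  For fixed \<open>\<xi>\<close> the symbol vanishes for a single \<open>\<tau>\<close>.
\<close>

lemma AE_psymb_nonzero: "AE \<zeta> in (lborel :: ((real^'d) \<times> real) measure). psymb \<zeta> \<noteq> 0"
proof -
  have "AE \<xi> in (lborel :: (real^'d) measure). AE \<tau> in (lborel :: real measure). symb \<xi> \<tau> \<noteq> 0"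
  proof (rule AE_I2)
    fix \<xi> :: "real^'d"
    show "AE \<tau> in lborel. symb \<xi> \<tau> \<noteq> 0"
      using AE_lborel_singleton[of "- 2 * pi * (norm \<xi>)\<^sup>2"]
    proof eventually_elim
      case (elim \<tau>)
      have "symb \<xi> \<tau> = 2 * pi * (\<tau> - (- 2 * pi * (norm \<xi>)\<^sup>2))"
        by (simp add: symb_def power2_eq_square algebra_simps)
      then show ?case using elim by simp
    qed
  qed
  then have "AE \<zeta> in (lborel :: (real^'d) measure) \<Otimes>\<^sub>M (lborel :: real measure). psymb \<zeta> \<noteq> 0"
  proof (intro lborel_pair.AE_pair_measure)
    show "{\<zeta> \<in> space (lborel \<Otimes>\<^sub>M lborel). psymb \<zeta> \<noteq> 0} \<in> sets ((lborel :: (real^'d) measure) \<Otimes>\<^sub>M (lborel :: real measure))"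
      unfolding lborel_prod by measurable
  qed simp
  then show ?thesis by (simp only: lborel_prod)
qed

abbreviation mult_fun :: "real \<Rightarrow> real \<Rightarrow> (real^'d) \<times> real \<Rightarrow> complex" where
  "mult_fun s z \<equiv> (\<lambda>(\<xi>, \<tau>). multiplier s z \<xi> \<tau>)"

lemma hyp01_measurable[measurable]: "hyp01 \<nu> \<in> borel_measurable borel"
  by (intro borel_measurable_continuous_onI hyp01_continuous)

lemma lower_powr_measurable[measurable]: "lower_powr s \<in> borel_measurable borel"
  unfolding lower_powr_def[abs_def] by measurable

lemma profile_measurable[measurable]: "profile s z \<in> borel_measurable borel"
  unfolding profile_def[abs_def] by measurable

text \<open>
  Where the symbol vanishes the definition of the multiplier gives \<open>0\<close>, because \<open>0 powr s = 0\<close>.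
\<close>

lemma mult_fun_eq:
  assumes "0 < s" "s < 1" "0 < z"
  shows "mult_fun s z \<zeta> = (if psymb \<zeta> = 0 then 0 else profile s z (psymb \<zeta>))"
proof (cases "psymb \<zeta> = 0")
  case True
  then show ?thesis by (simp add: case_prod_beta multiplier_def)
next
  case False
  then show ?thesis using multiplier_eq_profile[OF assms False] by (simp add: case_prod_beta)
qed

lemma mult_fun_slowly_increasing:
  assumes s: "0 < s" "s < 1" and z: "0 < z"
  shows "slowly_increasing (mult_fun s z :: (real^'d) \<times> real \<Rightarrow> complex)"
proof -
  obtain K where K: "0 \<le> K" "\<And>z p. 0 < z \<Longrightarrow> p \<noteq> 0 \<Longrightarrow> norm (profile s z p) \<le> K * (1 + z\<^sup>2 * \<bar>p\<bar>)"
    using profile_bound[OF s] by blast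
  show ?thesis
  proof (rule slowly_increasing_psymb_bound[where K = "K * (1 + z\<^sup>2)" and n = 1])
    show "(mult_fun s z :: (real^'d) \<times> real \<Rightarrow> complex) \<in> borel_measurable borel"
      unfolding mult_fun_eq[OF s z, abs_def] by measurable
    fix \<zeta> :: "(real^'d) \<times> real"
    have "1 + z\<^sup>2 * \<bar>psymb \<zeta>\<bar> \<le> (1 + z\<^sup>2) * (1 + \<bar>psymb \<zeta>\<bar>)"
      by (simp add: algebra_simps)
    then have "K * (1 + z\<^sup>2 * \<bar>psymb \<zeta>\<bar>) \<le> K * ((1 + z\<^sup>2) * (1 + \<bar>psymb \<zeta>\<bar>))"
      using K(1) by (rule mult_left_mono)
    then show "norm (mult_fun s z \<zeta>) \<le> K * (1 + z\<^sup>2) * (1 + \<bar>psymb \<zeta>\<bar>) ^ 1"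
      unfolding mult_fun_eq[OF s z] using K(2)[OF z, of "psymb \<zeta>"] K(1) by auto
  qed (use K in auto)
qed

section \<open>The kernel as a tempered distribution\<close>

text \<open>
  Up to a factor, \<open>S(\<cdot>, t)\<close> is \<open>gauss w0\<close> with \<open>w0 = 1 / (4 \<pi> \<i> t)\<close> on the imaginary axis. For \<open>w0 + \<delta>\<close> the
  identity is \<open>fourier_gauss\<close> and Fubini, and both sides converge as \<open>\<delta>\<close> tends to \<open>0\<close>. On the right only the
  symbol is left, so that the time integral that comes next is a scalar one.
\<close>

lemma schroedinger_identity:
  fixes \<Psi> :: "(real^'d) \<times> real \<Rightarrow> complex"
  assumes \<Psi>: "\<Psi> \<in> schwartz" and t: "0 < t"
  shows "(LINT x|lborel. S_kernel x t * fourier \<Psi> (x, t))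
    = (LINT \<zeta>|lborel. exp (- (\<i> * of_real (psymb \<zeta> * t))) * \<Psi> \<zeta>)"
proof -
  define w0 where "w0 = - \<i> / of_real (4 * pi * t)"
  define w where "w \<delta> = of_real \<delta> + w0" for \<delta> :: real
  have w0: "Re w0 = 0" "w0 \<noteq> 0" "w0 \<notin> \<real>\<^sub>\<le>\<^sub>0"
    using t by (auto simp: w0_def complex_nonpos_Reals_iff)
  have Rew: "0 < Re (w \<delta>)" if "\<delta> \<in> {0<..}" for \<delta> using that w0 by (simp add: w_def)
  have wl: "(w \<longlongrightarrow> w0) (at 0 within {0<..})"
  proof -
    have "((\<lambda>\<delta>. of_real \<delta> + w0) \<longlongrightarrow> of_real 0 + w0) (at 0 within {0<..})" by (intro tendsto_intros)
    then show ?thesis by (simp add: w_def[abs_def])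
  qed
  note [measurable] = schwartz_borel_measurable[OF \<Psi>]
  note F\<Psi> = fourier_schwartz[OF \<Psi>]
  let ?d = "complex_of_nat CARD('d)"
  let ?E = "\<lambda>\<zeta>::(real^'d) \<times> real. exp (- 2 * of_real pi * \<i> * of_real (t * snd \<zeta>)) :: complex"
  have Fm[measurable]: "(\<lambda>x. fourier \<Psi> (x, t)) \<in> borel_measurable borel"
    by (intro borel_measurable_continuous_onI continuous_on_compose2[OF schwartz_continuous[OF F\<Psi>, of UNIV]])
       (auto intro!: continuous_intros)
  have Fi: "integrable lborel (\<lambda>x. fourier \<Psi> (x, t))"
  proof -
    obtain C where C: "\<And>\<zeta>. (1 + norm \<zeta>) ^ (2 * DIM(real^'d)) * norm (fourier \<Psi> \<zeta>) \<le> C"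
      using schwartz_decay_ex[OF F\<Psi>] by blast
    show ?thesis
    proof (rule integrable_of_decay(1)[OF Fm])
      fix x :: "real^'d"
      have "norm x \<le> norm (x, t)" by (rule norm_fst_le)
      then have "(1 + norm x) ^ (2 * DIM(real^'d)) * norm (fourier \<Psi> (x, t)) \<le> (1 + norm (x, t)) ^ (2 * DIM(real^'d)) * norm (fourier \<Psi> (x, t))"
        by (intro mult_right_mono power_mono) auto
      then show "(1 + norm x) ^ (2 * DIM(real^'d)) * norm (fourier \<Psi> (x, t)) \<le> C" using C[of "(x, t)"] by linarith
    qed
  qed
  have eq: "(LINT x|lborel. gauss (w \<delta>) x * fourier \<Psi> (x, t))
      = w \<delta> powr (- ?d / 2) * (LINT \<zeta>|lborel. ?E \<zeta> * gauss (1 / w \<delta>) (fst \<zeta>) * \<Psi> \<zeta>)" if \<delta>: "\<delta> \<in> {0<..}" for \<delta>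
  proof -
    have "(LINT x|lborel. gauss (w \<delta>) x * fourier \<Psi> (x, t))
       = (LINT \<zeta>|lborel. \<Psi> \<zeta> * (LINT x|lborel. exp (- 2 * of_real pi * \<i> * of_real ((x, t) \<bullet> \<zeta>)) * gauss (w \<delta>) x))"
      unfolding fourier_def
      by (rule Fubini_bounded_kernel(2)[OF gauss_integrable[OF Rew[OF \<delta>]] schwartz_integrable[OF \<Psi>], where B = 1])
         (auto simp: norm_exp_eq_Re case_prod_unfold intro!: borel_measurable_continuous_onI continuous_intros)
    also have "\<dots> = (LINT \<zeta>|lborel. \<Psi> \<zeta> * (?E \<zeta> * (w \<delta> powr (- ?d / 2) * gauss (1 / w \<delta>) (fst \<zeta>))))"
    proof (intro Bochner_Integration.integral_cong refl arg_cong2[where f = "(*)"])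
      show "(LINT x|lborel. exp (- 2 * of_real pi * \<i> * of_real ((x, t) \<bullet> \<zeta>)) * gauss (w \<delta>) x)
          = ?E \<zeta> * (w \<delta> powr (- ?d / 2) * gauss (1 / w \<delta>) (fst \<zeta>))" for \<zeta> :: "(real^'d) \<times> real"
      proof -
        have "exp (- 2 * of_real pi * \<i> * of_real ((x, t) \<bullet> \<zeta>)) * gauss (w \<delta>) x
           = ?E \<zeta> * (exp (- 2 * of_real pi * \<i> * of_real (fst \<zeta> \<bullet> x)) * gauss (w \<delta>) x)" for x
          unfolding mult.assoc[symmetric] exp_add[symmetric]
          by (simp add: inner_prod_def inner_commute[of x] algebra_simps)
        then have "(LINT x|lborel. exp (- 2 * of_real pi * \<i> * of_real ((x, t) \<bullet> \<zeta>)) * gauss (w \<delta>) x)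
           = ?E \<zeta> * fourier (gauss (w \<delta>)) (fst \<zeta>)"
          unfolding fourier_def by (simp only: integral_mult_right_zero)
        then show ?thesis unfolding fourier_gauss[OF Rew[OF \<delta>]] by simp
      qed
    qed
    also have "\<dots> = (LINT \<zeta>|lborel. w \<delta> powr (- ?d / 2) * (?E \<zeta> * gauss (1 / w \<delta>) (fst \<zeta>) * \<Psi> \<zeta>))"
      by (simp only: mult_ac)
    finally show ?thesis by (simp only: integral_mult_right_zero)
  qed
  have lim1: "((\<lambda>\<delta>. LINT x|lborel. gauss (w \<delta>) x * fourier \<Psi> (x, t)) \<longlongrightarrow> (LINT x|lborel. gauss w0 x * fourier \<Psi> (x, t))) (at 0 within {0<..})"
  proof (rule tendsto_integral_dominated[where w = "\<lambda>x. norm (fourier \<Psi> (x, t))"])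
    show "AE x in lborel. ((\<lambda>\<delta>. gauss (w \<delta>) x * fourier \<Psi> (x, t)) \<longlongrightarrow> gauss w0 x * fourier \<Psi> (x, t)) (at 0 within {0<..})"
      by (intro AE_I2 tendsto_intros wl)
    show "AE x in lborel. norm (gauss (w \<delta>) x * fourier \<Psi> (x, t)) \<le> norm (fourier \<Psi> (x, t))" if "\<delta> \<in> {0<..}" for \<delta>
      unfolding norm_mult norm_gauss using Rew[OF that] by (intro AE_I2) (simp add: mult_left_le_one_le)
  qed (use Fi in auto)
  have lim2: "((\<lambda>\<delta>. LINT \<zeta>|lborel. ?E \<zeta> * gauss (1 / w \<delta>) (fst \<zeta>) * \<Psi> \<zeta>) \<longlongrightarrow> (LINT \<zeta>|lborel. ?E \<zeta> * gauss (1 / w0) (fst \<zeta>) * \<Psi> \<zeta>)) (at 0 within {0<..})"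
  proof (rule tendsto_integral_dominated[where w = "\<lambda>\<zeta>. norm (\<Psi> \<zeta>)"])
    show "AE \<zeta> in lborel. ((\<lambda>\<delta>. ?E \<zeta> * gauss (1 / w \<delta>) (fst \<zeta>) * \<Psi> \<zeta>) \<longlongrightarrow> ?E \<zeta> * gauss (1 / w0) (fst \<zeta>) * \<Psi> \<zeta>) (at 0 within {0<..})"
      by (intro AE_I2 tendsto_intros wl w0)
    show "AE \<zeta> in lborel. norm (?E \<zeta> * gauss (1 / w \<delta>) (fst \<zeta>) * \<Psi> \<zeta>) \<le> norm (\<Psi> \<zeta>)" if "\<delta> \<in> {0<..}" for \<delta>
    proof -
      have "0 \<le> Re (1 / w \<delta>)" using Rew[OF that] by (simp add: Re_divide)
      then show ?thesis
        unfolding norm_mult norm_gauss norm_exp_ii by (intro AE_I2) (simp add: mult_left_le_one_le)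
    qed
  qed (use schwartz_integrable[OF \<Psi>] in auto)
  have lim3: "((\<lambda>\<delta>. w \<delta> powr (- ?d / 2) * (LINT \<zeta>|lborel. ?E \<zeta> * gauss (1 / w \<delta>) (fst \<zeta>) * \<Psi> \<zeta>))
      \<longlongrightarrow> w0 powr (- ?d / 2) * (LINT \<zeta>|lborel. ?E \<zeta> * gauss (1 / w0) (fst \<zeta>) * \<Psi> \<zeta>)) (at 0 within {0<..})"
    by (intro tendsto_mult lim2 tendsto_powr_complex wl tendsto_const w0)
  have "\<forall>\<^sub>F \<delta> in at 0 within {0<..}. w \<delta> powr (- ?d / 2) * (LINT \<zeta>|lborel. ?E \<zeta> * gauss (1 / w \<delta>) (fst \<zeta>) * \<Psi> \<zeta>)
     = (LINT x|lborel. gauss (w \<delta>) x * fourier \<Psi> (x, t))"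
    using eq by (auto simp: eventually_at_filter)
  with lim3 have "((\<lambda>\<delta>. LINT x|lborel. gauss (w \<delta>) x * fourier \<Psi> (x, t))
      \<longlongrightarrow> w0 powr (- ?d / 2) * (LINT \<zeta>|lborel. ?E \<zeta> * gauss (1 / w0) (fst \<zeta>) * \<Psi> \<zeta>)) (at 0 within {0<..})"
    by (rule Lim_transform_eventually)
  with lim1 have main: "(LINT x|lborel. gauss w0 x * fourier \<Psi> (x, t))
      = w0 powr (- ?d / 2) * (LINT \<zeta>|lborel. ?E \<zeta> * gauss (1 / w0) (fst \<zeta>) * \<Psi> \<zeta>)"
    using tendsto_unique trivial_limit_at_right_real by blast
  let ?c = "(4 * of_real pi * \<i> * of_real t) powr of_real (- (real CARD('d) / 2)) :: complex"
  have S: "S_kernel x t = ?c * gauss w0 x" for x :: "real^'d"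
  proof -
    have "- of_real pi * w0 * of_real ((norm x)\<^sup>2) = \<i> * of_real ((norm x)\<^sup>2 / (4 * t))"
      using t by (simp add: w0_def field_simps)
    then show ?thesis by (simp only: S_kernel_def)
  qed
  have c: "?c * w0 powr (- ?d / 2) = 1"
  proof -
    have inv: "w0 = inverse (4 * of_real pi * \<i> * of_real t)"
      using t by (simp add: w0_def field_simps)
    have n: "4 * of_real pi * \<i> * complex_of_real t \<notin> \<real>\<^sub>\<le>\<^sub>0" "4 * of_real pi * \<i> * complex_of_real t \<noteq> 0"
      using t by (auto simp: complex_nonpos_Reals_iff)
    have L: "Ln w0 = - Ln (4 * of_real pi * \<i> * of_real t)"
      unfolding inv by (rule Ln_inverse[OF n(1)])
    have e: "complex_of_real (- (real CARD('d) / 2)) = - ?d / 2" by simp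
    have "?c * w0 powr (- ?d / 2) = exp ((- ?d / 2) * Ln (4 * of_real pi * \<i> * of_real t)) * exp ((- ?d / 2) * Ln w0)"
      unfolding e using n(2) w0(2) by (simp only: powr_def if_False)
    also have "\<dots> = 1" unfolding L exp_add[symmetric] by simp
    finally show ?thesis .
  qed
  have e: "?E \<zeta> * gauss (1 / w0) (fst \<zeta>) = exp (- (\<i> * of_real (psymb \<zeta> * t)))" for \<zeta> :: "(real^'d) \<times> real"
  proof -
    have "1 / w0 = 4 * of_real pi * \<i> * of_real t"
      using t by (simp add: w0_def field_simps)
    then show ?thesis
      unfolding exp_add[symmetric] by (simp add: symb_def power2_eq_square algebra_simps)
  qed
  have "(LINT x|lborel. S_kernel x t * fourier \<Psi> (x, t)) = ?c * (LINT x|lborel. gauss w0 x * fourier \<Psi> (x, t))"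
    unfolding S by (simp only: mult.assoc integral_mult_right_zero)
  also have "\<dots> = (?c * w0 powr (- ?d / 2)) * (LINT \<zeta>|lborel. ?E \<zeta> * gauss (1 / w0) (fst \<zeta>) * \<Psi> \<zeta>)"
    unfolding main by (simp only: mult.assoc)
  finally show ?thesis
    unfolding c e by (simp only: mult_1_left)
qed

lemma kernel_integrand_fourier:
  fixes \<Psi> :: "(real^'d) \<times> real \<Rightarrow> complex"
  assumes \<Psi>: "\<Psi> \<in> schwartz"
  shows "kernel_integrand a z (fourier \<Psi>) t = P_kernel a z t * (LINT \<zeta>|lborel. exp (- (\<i> * of_real (psymb \<zeta> * t))) * \<Psi> \<zeta>)"
  using schroedinger_identity[OF \<Psi>, of t] by (cases "0 < t") (simp_all add: kernel_integrand_def P_kernel_def)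

lemma P_kernel_set_integrable:
  assumes s: "0 < s" "s < 1" and \<epsilon>: "0 < \<epsilon>"
  shows "set_integrable lborel {\<epsilon>..} (P_kernel (1 - 2 * s) z)"
proof -
  have "P_kernel (1 - 2 * s) z = (\<lambda>t. P_const s z * bessel_kern (- 1 - s) (of_real (z\<^sup>2 / 4) * - \<i>) (of_real 0 * \<i>) t)"
    using P_kernel_exp_eq[of s z _ 0] by (auto simp: fun_eq_iff)
  moreover have "set_integrable lborel {\<epsilon>..} (bessel_kern (- 1 - s) (of_real (z\<^sup>2 / 4) * - \<i>) (of_real 0 * \<i>))"
    by (rule bessel_kern_set_integrable) (use s \<epsilon> in auto)
  ultimately show ?thesis by simp
qed

text \<open>
  Away from \<open>t = 0\<close> the kernel is integrable in time, so Fubini applies.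
\<close>

lemma kernel_truncated:
  fixes \<Psi> :: "(real^'d) \<times> real \<Rightarrow> complex"
  assumes s: "0 < s" "s < 1" and \<Psi>: "\<Psi> \<in> schwartz" and \<epsilon>: "0 < \<epsilon>"
  shows "set_integrable lborel {\<epsilon>..} (kernel_integrand (1 - 2 * s) z (fourier \<Psi>))"
    and "(LINT t:{\<epsilon>..}|lborel. kernel_integrand (1 - 2 * s) z (fourier \<Psi>) t) = (LINT \<zeta>|lborel. P_trunc s z \<epsilon> (psymb \<zeta>) * \<Psi> \<zeta>)"
proof -
  let ?f = "\<lambda>t. indicator {\<epsilon>..} t *\<^sub>R P_kernel (1 - 2 * s) z t"
  let ?k = "\<lambda>t \<zeta>::(real^'d) \<times> real. exp (- (\<i> * of_real (psymb \<zeta> * t))) :: complex"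
  have f: "integrable lborel ?f"
    using P_kernel_set_integrable[OF s \<epsilon>] by (simp add: set_integrable_def)
  have k: "(\<lambda>(t, \<zeta>). ?k t \<zeta>) \<in> borel_measurable borel"
    unfolding case_prod_unfold
    by (intro borel_measurable_continuous_onI continuous_intros continuous_on_compose2[OF psymb_continuous[of UNIV]]) auto
  have b: "norm (?k t \<zeta>) \<le> 1" for t \<zeta> by (simp add: norm_exp_eq_Re)
  have e: "indicator {\<epsilon>..} t *\<^sub>R kernel_integrand (1 - 2 * s) z (fourier \<Psi>) t = ?f t * (LINT \<zeta>|lborel. ?k t \<zeta> * \<Psi> \<zeta>)" for t
    unfolding kernel_integrand_fourier[OF \<Psi>] by simp
  show "set_integrable lborel {\<epsilon>..} (kernel_integrand (1 - 2 * s) z (fourier \<Psi>))"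
    unfolding set_integrable_def e
    by (rule Fubini_bounded_kernel(1)[OF f schwartz_integrable[OF \<Psi>] k b])
  have "(LINT t:{\<epsilon>..}|lborel. kernel_integrand (1 - 2 * s) z (fourier \<Psi>) t)
      = (LINT \<zeta>|lborel. \<Psi> \<zeta> * (LINT t|lborel. ?k t \<zeta> * ?f t))"
    unfolding set_lebesgue_integral_def e
    by (rule Fubini_bounded_kernel(2)[OF f schwartz_integrable[OF \<Psi>] k b])
  also have "\<dots> = (LINT \<zeta>|lborel. \<Psi> \<zeta> * P_trunc s z \<epsilon> (psymb \<zeta>))"
  proof (intro Bochner_Integration.integral_cong refl arg_cong2[where f = "(*)"])
    show "(LINT t|lborel. ?k t \<zeta> * ?f t) = P_trunc s z \<epsilon> (psymb \<zeta>)" for \<zeta>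
      unfolding P_trunc_def set_lebesgue_integral_def
      by (intro Bochner_Integration.integral_cong refl) (simp add: mult.commute)
  qed
  finally show "(LINT t:{\<epsilon>..}|lborel. kernel_integrand (1 - 2 * s) z (fourier \<Psi>) t) = (LINT \<zeta>|lborel. P_trunc s z \<epsilon> (psymb \<zeta>) * \<Psi> \<zeta>)"
    by (simp only: mult.commute)
qed

lemma P_trunc_measurable[measurable]: "P_trunc s z \<epsilon> \<in> borel_measurable borel"
proof -
  have [measurable]: "P_kernel (1 - 2 * s) z \<in> borel_measurable borel"
    unfolding P_kernel_def[abs_def] by measurable
  show ?thesis
    unfolding P_trunc_def[abs_def] set_lebesgue_integral_def by measurable
qed

lemma kernel_improper_integral:
  fixes \<Psi> :: "(real^'d) \<times> real \<Rightarrow> complex"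
  assumes s: "0 < s" "s < 1" and z: "0 < z" and \<Psi>: "\<Psi> \<in> schwartz"
  shows "has_improper_integral (kernel_integrand (1 - 2 * s) z (fourier \<Psi>)) (LINT \<zeta>|lborel. mult_fun s z \<zeta> * \<Psi> \<zeta>)"
    and "kernel_dist (1 - 2 * s) z (fourier \<Psi>) = (LINT \<zeta>|lborel. mult_fun s z \<zeta> * \<Psi> \<zeta>)"
proof -
  note [measurable] = schwartz_borel_measurable[OF \<Psi>] slowly_increasing_measurable[OF mult_fun_slowly_increasing[OF s z]]
  obtain K where K: "0 \<le> K" "\<And>\<epsilon> p. 0 < \<epsilon> \<Longrightarrow> norm (P_trunc s z \<epsilon> p) \<le> K * (1 + \<bar>p\<bar>)"
    using P_trunc_bound[OF s z] by blast
  have "((\<lambda>\<epsilon>. LINT \<zeta>|lborel. P_trunc s z \<epsilon> (psymb \<zeta>) * \<Psi> \<zeta>) \<longlongrightarrow> (LINT \<zeta>|lborel. mult_fun s z \<zeta> * \<Psi> \<zeta>)) (at_right 0)"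
  proof (rule tendsto_integral_dominated[where w = "\<lambda>\<zeta>. norm (of_real (K * (1 + \<bar>psymb \<zeta>\<bar>)) * \<Psi> \<zeta>)"])
    show "AE \<zeta> in lborel. ((\<lambda>\<epsilon>. P_trunc s z \<epsilon> (psymb \<zeta>) * \<Psi> \<zeta>) \<longlongrightarrow> mult_fun s z \<zeta> * \<Psi> \<zeta>) (at_right 0)"
      using AE_psymb_nonzero
    proof eventually_elim
      case (elim \<zeta>)
      then show ?case
        unfolding mult_fun_eq[OF s z] using P_trunc_tendsto[OF s z elim] by (auto intro: tendsto_mult)
    qed
    have "slowly_increasing (\<lambda>\<zeta>::(real^'d) \<times> real. of_real (K * (1 + \<bar>psymb \<zeta>\<bar>)))"
    proof (rule slowly_increasing_psymb_bound[where K = K and n = 1])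
      show "norm (complex_of_real (K * (1 + \<bar>psymb \<zeta>\<bar>))) \<le> K * (1 + \<bar>psymb \<zeta>\<bar>) ^ 1" for \<zeta> :: "(real^'d) \<times> real"
        unfolding norm_of_real using K(1) by (simp add: abs_mult)
    qed (use K in auto)
    then show "integrable lborel (\<lambda>\<zeta>::(real^'d) \<times> real. norm (of_real (K * (1 + \<bar>psymb \<zeta>\<bar>)) * \<Psi> \<zeta>))"
      by (intro integrable_norm slowly_increasing_integrable \<Psi>)
    show "AE \<zeta> in lborel. norm (P_trunc s z \<epsilon> (psymb \<zeta>) * \<Psi> \<zeta>) \<le> norm (of_real (K * (1 + \<bar>psymb \<zeta>\<bar>)) * \<Psi> \<zeta>)" if "\<epsilon> \<in> {0<..}" for \<epsilon>
    proof (rule AE_I2)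
      fix \<zeta> :: "(real^'d) \<times> real"
      have "norm (P_trunc s z \<epsilon> (psymb \<zeta>)) \<le> norm (complex_of_real (K * (1 + \<bar>psymb \<zeta>\<bar>)))"
        using K(2)[of \<epsilon> "psymb \<zeta>"] that K(1) unfolding norm_of_real by simp
      then show "norm (P_trunc s z \<epsilon> (psymb \<zeta>) * \<Psi> \<zeta>) \<le> norm (of_real (K * (1 + \<bar>psymb \<zeta>\<bar>)) * \<Psi> \<zeta>)"
        unfolding norm_mult by (rule mult_right_mono) simp
    qed
  qed auto
  moreover have "\<forall>\<^sub>F \<epsilon> in at_right 0. (LINT \<zeta>|lborel. P_trunc s z \<epsilon> (psymb \<zeta>) * \<Psi> \<zeta>)
      = (LINT t:{\<epsilon>..}|lborel. kernel_integrand (1 - 2 * s) z (fourier \<Psi>) t)"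
    using eventually_at_right_less[of "0::real"]
    by eventually_elim (simp only: kernel_truncated(2)[OF s \<Psi>])
  ultimately have l: "((\<lambda>\<epsilon>. LINT t:{\<epsilon>..}|lborel. kernel_integrand (1 - 2 * s) z (fourier \<Psi>) t)
      \<longlongrightarrow> (LINT \<zeta>|lborel. mult_fun s z \<zeta> * \<Psi> \<zeta>)) (at_right 0)"
    by (rule Lim_transform_eventually)
  show "has_improper_integral (kernel_integrand (1 - 2 * s) z (fourier \<Psi>)) (LINT \<zeta>|lborel. mult_fun s z \<zeta> * \<Psi> \<zeta>)"
    unfolding has_improper_integral_def using l kernel_truncated(1)[OF s \<Psi>] by blast
  show "kernel_dist (1 - 2 * s) z (fourier \<Psi>) = (LINT \<zeta>|lborel. mult_fun s z \<zeta> * \<Psi> \<zeta>)"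
    unfolding kernel_dist_def by (rule tendsto_Lim[OF _ l]) simp
qed

text \<open>
  \<open>kernel_improper_integral\<close> is a statement about all Schwartz functions, since by Fourier inversion each of
  them is a Fourier transform.
\<close>

lemma kernel_dist_eq:
  fixes \<Phi> :: "(real^'d) \<times> real \<Rightarrow> complex"
  assumes s: "0 < s" "s < 1" and z: "0 < z" and \<Phi>: "\<Phi> \<in> schwartz"
  shows "has_improper_integral (kernel_integrand (1 - 2 * s) z \<Phi>) (kernel_dist (1 - 2 * s) z \<Phi>)"
    and "kernel_dist (1 - 2 * s) z \<Phi> = (LINT \<zeta>|lborel. mult_fun s z \<zeta> * inv_fourier \<Phi> \<zeta>)"
proof -
  have e: "fourier (inv_fourier \<Phi>) = \<Phi>"
    using fourier_inv_fourier[OF \<Phi>] by auto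
  note k = kernel_improper_integral[OF s z inv_fourier_schwartz[OF \<Phi>], unfolded e]
  show "kernel_dist (1 - 2 * s) z \<Phi> = (LINT \<zeta>|lborel. mult_fun s z \<zeta> * inv_fourier \<Phi> \<zeta>)"
    by (rule k(2))
  show "has_improper_integral (kernel_integrand (1 - 2 * s) z \<Phi>) (kernel_dist (1 - 2 * s) z \<Phi>)"
    unfolding k(2) by (rule k(1))
qed

lemma kernel_dist_tempered:
  assumes s: "0 < s" "s < 1" and z: "0 < z"
  shows "tempered_distribution (kernel_dist (1 - 2 * s) z :: ((real^'d) \<times> real \<Rightarrow> complex) \<Rightarrow> complex)"
proof -
  let ?m = "mult_fun s z :: (real^'d) \<times> real \<Rightarrow> complex"
  note si = mult_fun_slowly_increasing[OF s z]
  note [measurable] = slowly_increasing_measurable[OF si]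
  obtain A j where A: "\<And>x. norm (?m x) \<le> A * (1 + norm x) ^ j" using si unfolding slowly_increasing_def by blast
  let ?K = "2 * DIM((real^'d) \<times> real) + j"
  obtain C N where C: "\<And>f \<zeta>. f \<in> schwartz \<Longrightarrow> (1 + norm (\<zeta> :: (real^'d) \<times> real)) ^ ?K * norm (fourier f \<zeta>) \<le> C * schwartz_norm N f"
    using fourier_decay[where 'a = "(real^'d) \<times> real", of ?K] by blast
  define I where "I = (\<integral>x. inverse ((1 + norm (x::(real^'d) \<times> real)) ^ (2 * DIM((real^'d) \<times> real))) \<partial>lborel)"
  note int = slowly_increasing_integrable[OF si inv_fourier_schwartz]
  show ?thesis
  proof (rule tempered_distributionI[where N = N and C = "A * C * I"])
    fix f g :: "(real^'d) \<times> real \<Rightarrow> complex" assume f: "f \<in> schwartz" and g: "g \<in> schwartz"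
    have "inv_fourier (\<lambda>x. f x + g x) \<zeta> = inv_fourier f \<zeta> + inv_fourier g \<zeta>" for \<zeta>
      using inv_fourier_lincomb[OF schwartz_integrable[OF f] schwartz_integrable[OF g], of 1 1] by simp
    then show "kernel_dist (1 - 2 * s) z (\<lambda>x. f x + g x) = kernel_dist (1 - 2 * s) z f + kernel_dist (1 - 2 * s) z g"
      unfolding kernel_dist_eq(2)[OF s z f] kernel_dist_eq(2)[OF s z g] kernel_dist_eq(2)[OF s z schwartz_add[OF f g]]
      using int[OF f] int[OF g] by (simp add: distrib_left)
  next
    fix c and f :: "(real^'d) \<times> real \<Rightarrow> complex" assume f: "f \<in> schwartz"
    have "inv_fourier (\<lambda>x. c * f x) \<zeta> = c * inv_fourier f \<zeta>" for \<zeta>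
      using inv_fourier_lincomb[OF schwartz_integrable[OF f] schwartz_integrable[OF f], of c 0] by simp
    then show "kernel_dist (1 - 2 * s) z (\<lambda>x. c * f x) = c * kernel_dist (1 - 2 * s) z f"
      unfolding kernel_dist_eq(2)[OF s z f] kernel_dist_eq(2)[OF s z schwartz_cmult[OF f]]
      by (simp only: mult.left_commute[of _ c] integral_mult_right_zero)
  next
    fix f :: "(real^'d) \<times> real \<Rightarrow> complex" assume f: "f \<in> schwartz"
    note [measurable] = schwartz_borel_measurable[OF inv_fourier_schwartz[OF f]]
    have "norm (kernel_dist (1 - 2 * s) z f) \<le> A * (C * schwartz_norm N f) * I"
      unfolding kernel_dist_eq(2)[OF s z f] I_def
    proof (rule weighted_integral(2)[OF _ _ A])
      show "(1 + norm \<zeta>) ^ ?K * norm (inv_fourier f \<zeta>) \<le> C * schwartz_norm N f" for \<zeta>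
        using C[OF f, of "- \<zeta>"] by (simp add: inv_fourier_eq_fourier)
    qed measurable
    then show "norm (kernel_dist (1 - 2 * s) z f) \<le> A * C * I * schwartz_norm N f"
      by (simp add: mult_ac)
  qed
qed

section \<open>Uniqueness of the extension\<close>

text \<open>
  Gaussians around \<open>x0\<close> suffice as test functions. The function \<open>D\<close> may grow, but it is integrable against
  the Gaussian with parameter \<open>1\<close>. Outside a ball the Gaussian with parameter \<open>n\<close> is at most
  \<open>exp (- (n - 1) * \<delta>\<^sup>2)\<close> times that one, which for large \<open>n\<close> is negligible against the contribution of a
  smaller ball.
\<close>

lemma continuous_eq_0_if_schwartz_orthogonal:
  fixes D :: "'a::euclidean_space \<Rightarrow> complex"
  assumes cont: "continuous_on UNIV D"
    and int: "\<And>\<Psi>. \<Psi> \<in> schwartz \<Longrightarrow> integrable lborel (\<lambda>x. D x * \<Psi> x)"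
    and orth: "\<And>\<Psi>. \<Psi> \<in> schwartz \<Longrightarrow> (LINT x|lborel. D x * \<Psi> x) = 0"
  shows "D x0 = 0"
proof (rule ccontr)
  assume D0: "D x0 \<noteq> 0"
  \<comment> \<open>a real-valued function that is positive at \<open>x0\<close>\<close>
  define E where "E y = Re (cnj (D x0) * D y)" for y
  define e where "e = E x0 / 2"
  define g where "g n y = exp (- n * (norm (y - x0))\<^sup>2)" for n :: real and y
  have "E x0 = (norm (D x0))\<^sup>2"
    unfolding cmod_power2 by (simp add: E_def power2_eq_square)
  then have e: "0 < e" using D0 by (simp add: e_def)
  have Ec: "continuous_on UNIV E"
    unfolding E_def by (intro continuous_intros cont)
  then obtain \<delta> where \<delta>: "0 < \<delta>" "\<And>y. dist y x0 < \<delta> \<Longrightarrow> dist (E y) (E x0) < e"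
    using e unfolding continuous_on_iff by (metis UNIV_I)
  have Ee: "e < E y" if "dist y x0 < \<delta>" for y
    using \<delta>(2)[OF that] by (simp add: dist_real_def e_def abs_if split: if_splits)
  have gi: "integrable lborel (\<lambda>y. E y * g n y)" and g0: "(LINT y|lborel. E y * g n y) = 0" if n: "0 < n" for n
  proof -
    have S: "(\<lambda>y. complex_of_real (g n y)) \<in> schwartz"
      unfolding g_def by (rule gaussian_schwartz[OF n])
    have eq: "E y * g n y = Re (cnj (D x0) * (D y * of_real (g n y)))" for y
      by (simp add: E_def algebra_simps)
    have i: "integrable lborel (\<lambda>y. cnj (D x0) * (D y * of_real (g n y)))"
      by (intro integrable_mult_right int S)
    show "integrable lborel (\<lambda>y. E y * g n y)"
      unfolding eq by (rule integrable_Re[OF i])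
    show "(LINT y|lborel. E y * g n y) = 0"
      unfolding eq integral_Re[OF i] integral_mult_right_zero orth[OF S] by simp
  qed
  define M where "M = (LINT y|lborel. \<bar>E y * g 1 y\<bar>)"
  define v where "v = measure lborel (ball x0 (\<delta> / 2))"
  have v: "0 < v" unfolding v_def by (rule content_ball_pos) (use \<delta> in simp)
  have gpos: "0 < g n y" for n y by (simp add: g_def)
  have key: "e * v \<le> M * exp (\<delta>\<^sup>2) * exp (- (3/4 * \<delta>\<^sup>2) * n)" if n: "1 \<le> n" for n :: real
  proof -
    \<comment> \<open>inside radius \<open>\<delta> / 2\<close> the Gaussian is large, between \<open>\<delta> / 2\<close> and \<open>\<delta>\<close> the integrand is
      nonnegative, outside it is dominated by the Gaussian with \<open>n = 1\<close>\<close>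
    have pw: "e * exp (- n * (\<delta> / 2)\<^sup>2) * indicator (ball x0 (\<delta> / 2)) y - exp (- (n - 1) * \<delta>\<^sup>2) * \<bar>E y * g 1 y\<bar> \<le> E y * g n y" for y
    proof -
      have nn: "0 \<le> exp (- (n - 1) * \<delta>\<^sup>2) * \<bar>E y * g 1 y\<bar>" by simp
      consider "dist y x0 < \<delta> / 2" | "\<delta> / 2 \<le> dist y x0" "dist y x0 < \<delta>" | "\<delta> \<le> dist y x0" by linarith
      then show ?thesis
      proof cases
        case 1
        have "(norm (y - x0))\<^sup>2 \<le> (\<delta> / 2)\<^sup>2" using 1 by (intro power_mono) (auto simp: dist_norm)
        then have "exp (- n * (\<delta> / 2)\<^sup>2) \<le> g n y"
          unfolding g_def using n by (simp add: mult_left_mono)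
        moreover have "e \<le> E y" using Ee[of y] 1 \<delta> by simp
        ultimately have "e * exp (- n * (\<delta> / 2)\<^sup>2) \<le> E y * g n y"
          using e by (intro mult_mono) auto
        moreover have i: "indicator (ball x0 (\<delta> / 2)) y = (1 :: real)" using 1 by (simp add: dist_commute)
        ultimately show ?thesis using nn unfolding i mult_1_right by linarith
      next
        case 2
        have "0 \<le> E y * g n y" using Ee[OF 2(2)] e gpos[of n y] by simp
        moreover have i: "indicator (ball x0 (\<delta> / 2)) y = (0 :: real)" using 2 by (simp add: dist_commute)
        ultimately show ?thesis using nn unfolding i mult_zero_right by linarith
      next
        case 3
        have "\<delta>\<^sup>2 \<le> (norm (y - x0))\<^sup>2" using 3 \<delta> by (intro power_mono) (auto simp: dist_norm)
        then have "(n - 1) * \<delta>\<^sup>2 \<le> (n - 1) * (norm (y - x0))\<^sup>2" using n by (intro mult_left_mono) auto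
        then have "exp (- (n - 1) * (norm (y - x0))\<^sup>2) \<le> exp (- (n - 1) * \<delta>\<^sup>2)"
          by (simp add: minus_mult_left[symmetric] del: minus_diff_eq)
        moreover have "g n y = exp (- (n - 1) * (norm (y - x0))\<^sup>2) * g 1 y"
          unfolding g_def exp_add[symmetric] by (simp add: algebra_simps)
        ultimately have "g n y \<le> exp (- (n - 1) * \<delta>\<^sup>2) * g 1 y"
          using gpos[of 1 y] by (simp add: mult_right_mono)
        then have "\<bar>E y\<bar> * g n y \<le> \<bar>E y\<bar> * (exp (- (n - 1) * \<delta>\<^sup>2) * g 1 y)"
          by (rule mult_left_mono) simp
        then have "\<bar>E y * g n y\<bar> \<le> exp (- (n - 1) * \<delta>\<^sup>2) * \<bar>E y * g 1 y\<bar>"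
          using gpos[of n y] gpos[of 1 y] by (simp add: abs_mult mult.left_commute)
        then have "- (exp (- (n - 1) * \<delta>\<^sup>2) * \<bar>E y * g 1 y\<bar>) \<le> E y * g n y" by linarith
        moreover have i: "indicator (ball x0 (\<delta> / 2)) y = (0 :: real)" using 3 \<delta> by (simp add: dist_commute)
        ultimately show ?thesis unfolding i mult_zero_right by linarith
      qed
    qed
    have i1: "integrable lborel (\<lambda>y. e * exp (- n * (\<delta> / 2)\<^sup>2) * indicator (ball x0 (\<delta> / 2)) y)"
      by (intro integrable_mult_right) (use emeasure_lborel_ball_finite[of x0 "\<delta> / 2"] in \<open>simp add: integrable_indicator_iff\<close>)
    have i2: "integrable lborel (\<lambda>y. exp (- (n - 1) * \<delta>\<^sup>2) * \<bar>E y * g 1 y\<bar>)"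
      using gi[of 1] by (intro integrable_mult_right integrable_abs) simp
    have "(LINT y|lborel. e * exp (- n * (\<delta> / 2)\<^sup>2) * indicator (ball x0 (\<delta> / 2)) y - exp (- (n - 1) * \<delta>\<^sup>2) * \<bar>E y * g 1 y\<bar>)
        \<le> (LINT y|lborel. E y * g n y)"
      by (intro integral_mono Bochner_Integration.integrable_diff i1 i2 gi pw) (use n in simp)
    also have "(LINT y|lborel. e * exp (- n * (\<delta> / 2)\<^sup>2) * indicator (ball x0 (\<delta> / 2)) y - exp (- (n - 1) * \<delta>\<^sup>2) * \<bar>E y * g 1 y\<bar>)
        = e * exp (- n * (\<delta> / 2)\<^sup>2) * v - exp (- (n - 1) * \<delta>\<^sup>2) * M"
      unfolding Bochner_Integration.integral_diff[OF i1 i2] integral_mult_right_zero M_def v_def by simp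
    also have "(LINT y|lborel. E y * g n y) = 0" using n by (intro g0) simp
    finally have "exp (- n * (\<delta> / 2)\<^sup>2) * (e * v) \<le> exp (- (n - 1) * \<delta>\<^sup>2) * M"
      by (simp add: mult_ac)
    then have "exp (n * (\<delta> / 2)\<^sup>2) * (exp (- n * (\<delta> / 2)\<^sup>2) * (e * v)) \<le> exp (n * (\<delta> / 2)\<^sup>2) * (exp (- (n - 1) * \<delta>\<^sup>2) * M)"
      by (rule mult_left_mono) simp
    moreover have "exp (n * (\<delta> / 2)\<^sup>2) * exp (- n * (\<delta> / 2)\<^sup>2) = 1"
      by (simp flip: exp_add)
    moreover have "exp (n * (\<delta> / 2)\<^sup>2) * exp (- (n - 1) * \<delta>\<^sup>2) = exp (\<delta>\<^sup>2) * exp (- (3/4 * \<delta>\<^sup>2) * n)"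
      unfolding exp_add[symmetric] by (simp add: power_divide field_simps)
    ultimately show ?thesis
      by (simp only: mult.assoc[symmetric] mult_1_left) (simp only: mult_ac)
  qed
  have "((\<lambda>n::real. M * exp (\<delta>\<^sup>2) * exp (- (3/4 * \<delta>\<^sup>2) * n)) \<longlongrightarrow> M * exp (\<delta>\<^sup>2) * 0) at_top"
  proof (intro tendsto_mult tendsto_const)
    have "0 < 3/4 * \<delta>\<^sup>2" using \<delta> by simp
    then show "((\<lambda>n::real. exp (- (3/4 * \<delta>\<^sup>2) * n)) \<longlongrightarrow> 0) at_top"
      by real_asymp
  qed
  moreover have "\<forall>\<^sub>F n::real in at_top. e * v \<le> M * exp (\<delta>\<^sup>2) * exp (- (3/4 * \<delta>\<^sup>2) * n)"
    using eventually_ge_at_top[of "1::real"] by eventually_elim (rule key)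
  ultimately have "e * v \<le> M * exp (\<delta>\<^sup>2) * 0"
    by (rule tendsto_lowerbound) simp
  then show False using e v by (simp add: mult_le_0_iff)
qed

text \<open>
  Inversion on \<open>schwartz\<close> shows that the difference of two extensions is orthogonal to every Schwartz function.
\<close>

lemma is_extension_unique:
  fixes u :: "(real^'d) \<times> real \<Rightarrow> complex"
  assumes U: "is_extension s u U" and V: "is_extension s u V" and z: "0 < z"
  shows "U x z t = V x z t"
proof -
  let ?U = "\<lambda>(x, t). U x z t" and ?V = "\<lambda>(x, t). V x z t"
  have U': "continuous_on UNIV ?U" "tempered_function ?U"
    "\<And>\<Phi>. \<Phi> \<in> schwartz \<Longrightarrow> fourier_dist (regular_dist ?U) \<Phi> = regular_dist (\<lambda>(\<xi>, \<tau>). multiplier s z \<xi> \<tau> * fourier u (\<xi>, \<tau>)) \<Phi>"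
    using U z unfolding is_extension_def has_tempered_fourier_def by blast+
  have V': "continuous_on UNIV ?V" "tempered_function ?V"
    "\<And>\<Phi>. \<Phi> \<in> schwartz \<Longrightarrow> fourier_dist (regular_dist ?V) \<Phi> = regular_dist (\<lambda>(\<xi>, \<tau>). multiplier s z \<xi> \<tau> * fourier u (\<xi>, \<tau>)) \<Phi>"
    using V z unfolding is_extension_def has_tempered_fourier_def by blast+
  have "(\<lambda>X. ?U X - ?V X) (x, t) = 0"
  proof (rule continuous_eq_0_if_schwartz_orthogonal[where D = "\<lambda>X. ?U X - ?V X"])
    show "continuous_on UNIV (\<lambda>X. ?U X - ?V X)"
      by (intro continuous_on_diff U' V')
    fix \<Psi> :: "(real^'d) \<times> real \<Rightarrow> complex" assume \<Psi>: "\<Psi> \<in> schwartz"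
    have i: "integrable lborel (\<lambda>X. ?U X * \<Psi> X)" "integrable lborel (\<lambda>X. ?V X * \<Psi> X)"
      using U'(2) V'(2) \<Psi> unfolding tempered_function_def by blast+
    have "integrable lborel (\<lambda>X. ?U X * \<Psi> X - ?V X * \<Psi> X)"
      using i by (rule Bochner_Integration.integrable_diff)
    then show "integrable lborel (\<lambda>X. (?U X - ?V X) * \<Psi> X)" by (simp only: left_diff_distrib)
    have "fourier (inv_fourier \<Psi>) = \<Psi>"
      using fourier_inv_fourier[OF \<Psi>] by auto
    then have "regular_dist ?U \<Psi> = regular_dist ?V \<Psi>"
      using U'(3)[OF inv_fourier_schwartz[OF \<Psi>]] V'(3)[OF inv_fourier_schwartz[OF \<Psi>]]
      by (simp only: fourier_dist_def)
    then show "(LINT X|lborel. (?U X - ?V X) * \<Psi> X) = 0"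
      unfolding left_diff_distrib Bochner_Integration.integral_diff[OF i] regular_dist_def by simp
  qed
  then show ?thesis by simp
qed

section \<open>Derivatives of the extension\<close>

lemma inv_fourier_line_derivative:
  assumes h: "slowly_increasing h" and f: "f \<in> schwartz"
  shows "((\<lambda>r. inv_fourier (\<lambda>\<zeta>. h \<zeta> * f \<zeta>) (X + r *\<^sub>R v)) has_vector_derivative
     inv_fourier (\<lambda>\<zeta>. 2 * of_real pi * \<i> * of_real (\<zeta> \<bullet> v) * h \<zeta> * f \<zeta>) (X + r0 *\<^sub>R v)) (at r0)"
proof -
  let ?D = "\<lambda>w. inv_fourier (\<lambda>\<zeta>. 2 * of_real pi * \<i> * of_real (\<zeta> \<bullet> w) * (h \<zeta> * f \<zeta>)) (X + r0 *\<^sub>R v)"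
  have D: "(inv_fourier (\<lambda>\<zeta>. h \<zeta> * f \<zeta>) has_derivative ?D) (at (X + r0 *\<^sub>R v))"
  proof (rule inv_fourier_has_derivative)
    show "integrable lborel (\<lambda>\<zeta>. h \<zeta> * f \<zeta>)" by (rule slowly_increasing_integrable[OF h f])
    have "integrable lborel (\<lambda>\<zeta>. (of_real (norm \<zeta>) * h \<zeta>) * f \<zeta>)"
      by (intro slowly_increasing_integrable slowly_increasing_mult slowly_increasing_norm h f)
    then show "integrable lborel (\<lambda>\<zeta>. of_real (norm \<zeta>) * (h \<zeta> * f \<zeta>))" by (simp only: mult.assoc)
  qed
  have "((\<lambda>r. X + r *\<^sub>R v) has_derivative (\<lambda>k. k *\<^sub>R v)) (at r0)"
    by (auto intro!: derivative_eq_intros)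
  then have "((\<lambda>r. inv_fourier (\<lambda>\<zeta>. h \<zeta> * f \<zeta>) (X + r *\<^sub>R v)) has_derivative (\<lambda>k. ?D (k *\<^sub>R v))) (at r0)"
    using D by (rule has_derivative_compose)
  moreover have "?D (k *\<^sub>R v) = k *\<^sub>R ?D v" for k
    using has_derivative_linear[OF D] by (rule linear_scale)
  ultimately show ?thesis
    unfolding has_vector_derivative_def by (simp only: mult.assoc)
qed

lemma inv_fourier_parameter_derivative:
  fixes m m' :: "real \<Rightarrow> 'a::euclidean_space \<Rightarrow> complex"
  assumes S: "open S" "convex S" "z0 \<in> S" and f: "f \<in> schwartz"
    and m: "\<And>z. z \<in> S \<Longrightarrow> slowly_increasing (m z)" and g: "slowly_increasing g"
    and der: "AE \<zeta> in lborel. \<forall>z\<in>S. ((\<lambda>z. m z \<zeta>) has_vector_derivative m' z \<zeta>) (at z)"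
    and bound: "AE \<zeta> in lborel. \<forall>z\<in>S. norm (m' z \<zeta>) \<le> norm (g \<zeta>)"
    and meas: "m' z0 \<in> borel_measurable borel"
  shows "((\<lambda>z. inv_fourier (\<lambda>\<zeta>. m z \<zeta> * f \<zeta>) X) has_vector_derivative inv_fourier (\<lambda>\<zeta>. m' z0 \<zeta> * f \<zeta>) X) (at z0)"
proof -
  note [measurable] = schwartz_borel_measurable[OF f] meas
  let ?e = "\<lambda>\<zeta>. exp (2 * of_real pi * \<i> * of_real (\<zeta> \<bullet> X)) :: complex"
  have "((\<lambda>z. LINT \<zeta>|lborel. ?e \<zeta> * (m z \<zeta> * f \<zeta>)) has_derivative
      (\<lambda>h. LINT \<zeta>|lborel. h *\<^sub>R (?e \<zeta> * (m' z0 \<zeta> * f \<zeta>)))) (at z0)"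
  proof (rule has_derivative_integral[OF S, where g = "\<lambda>\<zeta>. norm (g \<zeta> * f \<zeta>)" and f' = "\<lambda>z \<zeta> h. h *\<^sub>R (?e \<zeta> * (m' z \<zeta> * f \<zeta>))"])
    show "integrable lborel (\<lambda>\<zeta>. ?e \<zeta> * (m z \<zeta> * f \<zeta>))" if "z \<in> S" for z
      by (intro exp_mult_integrable slowly_increasing_integrable m that f)
    show "AE \<zeta> in lborel. \<forall>z\<in>S. ((\<lambda>z. ?e \<zeta> * (m z \<zeta> * f \<zeta>)) has_derivative (\<lambda>h. h *\<^sub>R (?e \<zeta> * (m' z \<zeta> * f \<zeta>)))) (at z)"
      using der
    proof eventually_elim
      case (elim \<zeta>)
      show ?case
      proof
        fix z assume "z \<in> S"
        then have "((\<lambda>z. m z \<zeta>) has_vector_derivative m' z \<zeta>) (at z)" using elim by blast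
        then have "((\<lambda>z. ?e \<zeta> * (m z \<zeta> * f \<zeta>)) has_vector_derivative ?e \<zeta> * (m' z \<zeta> * f \<zeta>)) (at z)"
          by (intro has_vector_derivative_mult_right has_vector_derivative_mult_left)
        then show "((\<lambda>z. ?e \<zeta> * (m z \<zeta> * f \<zeta>)) has_derivative (\<lambda>h. h *\<^sub>R (?e \<zeta> * (m' z \<zeta> * f \<zeta>)))) (at z)"
          unfolding has_vector_derivative_def .
      qed
    qed
    show "AE \<zeta> in lborel. \<forall>z\<in>S. \<forall>h. norm (h *\<^sub>R (?e \<zeta> * (m' z \<zeta> * f \<zeta>))) \<le> norm (g \<zeta> * f \<zeta>) * norm h"
      using bound
    proof eventually_elim
      case (elim \<zeta>)
      show ?case
      proof (intro ballI allI)
        fix z h assume "z \<in> S"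
        then have "norm (m' z \<zeta>) \<le> norm (g \<zeta>)" using elim by blast
        then have "norm (m' z \<zeta>) * norm (f \<zeta>) \<le> norm (g \<zeta>) * norm (f \<zeta>)" by (rule mult_right_mono) simp
        then have "norm (?e \<zeta> * (m' z \<zeta> * f \<zeta>)) \<le> norm (g \<zeta> * f \<zeta>)"
          unfolding norm_mult norm_exp_ii by simp
        then show "norm (h *\<^sub>R (?e \<zeta> * (m' z \<zeta> * f \<zeta>))) \<le> norm (g \<zeta> * f \<zeta>) * norm h"
          unfolding norm_scaleR real_norm_def by (subst mult.commute) (rule mult_right_mono, auto)
      qed
    qed
    show "integrable lborel (\<lambda>\<zeta>. norm (g \<zeta> * f \<zeta>))"
      by (intro integrable_norm slowly_increasing_integrable g f)
  qed measurable
  then show ?thesis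
    unfolding has_vector_derivative_def inv_fourier_def by (simp only: integral_scaleR_right)
qed

definition profile_dz :: "real \<Rightarrow> real \<Rightarrow> real \<Rightarrow> complex" where
  "profile_dz s z p = of_real (z powr (2 * s - 1)) * profile_flux s z p"

text \<open>
  The second derivative is given through the differential equation of the profile, which makes its bound and the
  extension equation immediate.
\<close>

definition profile_dzz :: "real \<Rightarrow> real \<Rightarrow> real \<Rightarrow> complex" where
  "profile_dzz s z p = of_real p * profile s z p - of_real ((1 - 2 * s) / z) * profile_dz s z p"

lemma profile_dz_measurable[measurable]:
  "profile_dz s z \<in> borel_measurable borel" "profile_dzz s z \<in> borel_measurable borel"
  unfolding profile_dzz_def[abs_def] profile_dz_def[abs_def] profile_flux_def[abs_def] by measurable

lemma profile_dz_derivative: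
  assumes z: "0 < z"
  shows "((\<lambda>z. profile_dz s z p) has_vector_derivative profile_dzz s z p) (at z)"
proof -
  have "((\<lambda>z. profile_dz s z p) has_vector_derivative
     of_real (z powr (2 * s - 1)) * (of_real (p * z powr (1 - 2 * s)) * profile s z p)
     + of_real ((2 * s - 1) * z powr (2 * s - 1 - 1)) * profile_flux s z p) (at z)"
    unfolding profile_dz_def
    by (intro has_vector_derivative_mult of_real_powr_derivative profile_flux_derivative z)
  moreover have "of_real (z powr (2 * s - 1)) * (of_real (p * z powr (1 - 2 * s)) * profile s z p)
     + of_real ((2 * s - 1) * z powr (2 * s - 1 - 1)) * profile_flux s z p = profile_dzz s z p"
  proof -
    have "z powr (2 * s - 1) * z powr (1 - 2 * s) = 1"
      using z by (simp flip: powr_add)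
    then have 1: "complex_of_real (z powr (2 * s - 1)) * of_real (z powr (1 - 2 * s)) = 1"
      by (metis of_real_1 of_real_mult)
    have 2: "z powr (2 * s - 1 - 1) = z powr (2 * s - 1) / z"
      using z powr_diff[of z "2 * s - 1" 1] by simp
    have "of_real (z powr (2 * s - 1)) * (of_real (p * z powr (1 - 2 * s)) * profile s z p)
      = (complex_of_real (z powr (2 * s - 1)) * of_real (z powr (1 - 2 * s))) * (of_real p * profile s z p)"
      by (simp add: mult_ac)
    then show ?thesis
      unfolding 1 2 profile_dzz_def profile_dz_def using z by (simp add: field_simps)
  qed
  ultimately show ?thesis by (simp only:)
qed

text \<open>
  The factor \<open>z powr (2 * s - 1)\<close> in \<open>profile_dz\<close> may be singular at \<open>0\<close>, whence a bound that is only locally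
  uniform in \<open>z\<close>; differentiation under the integral sign requires no more.
\<close>

lemma profile_dz_bounds:
  assumes s: "0 < s" "s < 1" and z0: "0 < z0"
  shows "\<exists>K. 0 \<le> K \<and> (\<forall>z\<in>ball z0 (z0 / 2). \<forall>p. p \<noteq> 0 \<longrightarrow>
     norm (profile_dz s z p) \<le> K * (1 + \<bar>p\<bar>)\<^sup>2 \<and> norm (profile_dzz s z p) \<le> K * (1 + \<bar>p\<bar>)\<^sup>2)"
proof -
  \<comment> \<open>the endpoints of the ball are \<open>z0 / 2\<close> and \<open>3 / 2 * z0\<close>\<close>
  define Z where "Z = 3 / 2 * z0"
  have Z: "0 < Z" using z0 by (simp add: Z_def)
  obtain C where C: "0 \<le> C" "\<And>z p. 0 < z \<Longrightarrow> p \<noteq> 0 \<Longrightarrow> norm (profile s z p) \<le> C * (1 + z\<^sup>2 * \<bar>p\<bar>)"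
    using profile_bound[OF s] by blast
  obtain F where F: "0 \<le> F" "\<And>z p. 0 < z \<Longrightarrow> z \<le> Z \<Longrightarrow> p \<noteq> 0 \<Longrightarrow> norm (profile_flux s z p) \<le> F * (1 + \<bar>p\<bar>)\<^sup>2"
    using profile_flux_bound[OF s Z] by blast
  define B where "B = (z0 / 2) powr (2 * s - 1) + Z powr (2 * s - 1)"
  define K1 where "K1 = B * F"
  define K2 where "K2 = C * (1 + Z\<^sup>2) + \<bar>1 - 2 * s\<bar> / (z0 / 2) * K1"
  have B: "0 \<le> B" unfolding B_def by simp
  have K: "0 \<le> K1" "0 \<le> K2" unfolding K1_def K2_def using B C F z0 by auto
  have "norm (profile_dz s z p) \<le> K1 * (1 + \<bar>p\<bar>)\<^sup>2 \<and> norm (profile_dzz s z p) \<le> K2 * (1 + \<bar>p\<bar>)\<^sup>2"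
    if zb: "z \<in> ball z0 (z0 / 2)" and p: "p \<noteq> 0" for z p
  proof -
    have z: "z0 / 2 < z" "z < Z"
      using zb by (auto simp: dist_real_def Z_def abs_if split: if_splits)
    have zp: "0 < z" using z z0 by simp
    have pwb: "z powr (2 * s - 1) \<le> B"
    proof (cases "0 \<le> 2 * s - 1")
      case True
      then have "z powr (2 * s - 1) \<le> Z powr (2 * s - 1)" using z zp by (intro powr_mono2) auto
      then show ?thesis by (simp add: B_def add_increasing)
    next
      case False
      then have "z powr (2 * s - 1) \<le> (z0 / 2) powr (2 * s - 1)" using z z0 by (intro powr_mono2') auto
      then show ?thesis by (simp add: B_def add_increasing2)
    qed
    have 1: "norm (profile_dz s z p) \<le> K1 * (1 + \<bar>p\<bar>)\<^sup>2"
    proof -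
      have "norm (profile_dz s z p) = z powr (2 * s - 1) * norm (profile_flux s z p)"
        by (simp add: profile_dz_def norm_mult)
      also have "\<dots> \<le> B * (F * (1 + \<bar>p\<bar>)\<^sup>2)"
        using z zp p B by (intro mult_mono pwb F) auto
      finally show ?thesis by (simp add: K1_def mult.assoc)
    qed
    have "norm (profile_dzz s z p) \<le> \<bar>p\<bar> * norm (profile s z p) + \<bar>1 - 2 * s\<bar> / z * norm (profile_dz s z p)"
    proof -
      have "norm (complex_of_real p * profile s z p) = \<bar>p\<bar> * norm (profile s z p)"
        by (simp only: norm_mult norm_of_real)
      moreover have "norm (complex_of_real ((1 - 2 * s) / z) * profile_dz s z p) = \<bar>1 - 2 * s\<bar> / z * norm (profile_dz s z p)"
        using zp by (simp only: norm_mult norm_of_real abs_divide abs_of_pos)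
      ultimately show ?thesis
        unfolding profile_dzz_def using norm_triangle_ineq4 by metis
    qed
    also have "\<dots> \<le> C * (1 + Z\<^sup>2) * (1 + \<bar>p\<bar>)\<^sup>2 + \<bar>1 - 2 * s\<bar> / (z0 / 2) * (K1 * (1 + \<bar>p\<bar>)\<^sup>2)"
    proof (rule add_mono)
      have "1 + z\<^sup>2 * \<bar>p\<bar> \<le> (1 + Z\<^sup>2) * (1 + \<bar>p\<bar>)"
        by (rule one_plus_square_mult_le) (use z zp in auto)
      then have "C * (1 + z\<^sup>2 * \<bar>p\<bar>) \<le> C * ((1 + Z\<^sup>2) * (1 + \<bar>p\<bar>))"
        using C(1) by (rule mult_left_mono)
      then have "norm (profile s z p) \<le> C * ((1 + Z\<^sup>2) * (1 + \<bar>p\<bar>))"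
        using C(2)[OF zp p] by linarith
      then have "\<bar>p\<bar> * norm (profile s z p) \<le> (1 + \<bar>p\<bar>) * (C * ((1 + Z\<^sup>2) * (1 + \<bar>p\<bar>)))"
        by (intro mult_mono) auto
      then show "\<bar>p\<bar> * norm (profile s z p) \<le> C * (1 + Z\<^sup>2) * (1 + \<bar>p\<bar>)\<^sup>2"
        by (simp only: power2_eq_square mult_ac)
      show "\<bar>1 - 2 * s\<bar> / z * norm (profile_dz s z p) \<le> \<bar>1 - 2 * s\<bar> / (z0 / 2) * (K1 * (1 + \<bar>p\<bar>)\<^sup>2)"
        using z z0 zp by (intro mult_mono 1 divide_left_mono) auto
    qed
    also have "\<dots> = K2 * (1 + \<bar>p\<bar>)\<^sup>2"
      by (simp only: K2_def distrib_right mult.assoc)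
    finally show ?thesis using 1 by blast
  qed
  then show ?thesis
  proof (intro exI[of _ "K1 + K2"] conjI ballI allI impI)
    fix z p assume "z \<in> ball z0 (z0 / 2)" "p \<noteq> (0::real)"
      and *: "\<And>z p. z \<in> ball z0 (z0 / 2) \<Longrightarrow> p \<noteq> 0 \<Longrightarrow>
        norm (profile_dz s z p) \<le> K1 * (1 + \<bar>p\<bar>)\<^sup>2 \<and> norm (profile_dzz s z p) \<le> K2 * (1 + \<bar>p\<bar>)\<^sup>2"
    then have "norm (profile_dz s z p) \<le> K1 * (1 + \<bar>p\<bar>)\<^sup>2" "norm (profile_dzz s z p) \<le> K2 * (1 + \<bar>p\<bar>)\<^sup>2"
      by blast+
    moreover have "0 \<le> K1 * (1 + \<bar>p\<bar>)\<^sup>2" "0 \<le> K2 * (1 + \<bar>p\<bar>)\<^sup>2" using K by simp_all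
    ultimately show "norm (profile_dz s z p) \<le> (K1 + K2) * (1 + \<bar>p\<bar>)\<^sup>2" "norm (profile_dzz s z p) \<le> (K1 + K2) * (1 + \<bar>p\<bar>)\<^sup>2"
      unfolding distrib_right by linarith+
  qed (use K in simp)
qed

lemma profile_dz_0: "profile_dz s z 0 = 0" "profile_dzz s z 0 = 0"
  by (simp_all add: profile_dz_def profile_dzz_def profile_flux_def lower_powr_def)

lemma profile_dz_slowly_increasing:
  assumes s: "0 < s" "s < 1" and z: "0 < z"
  shows "slowly_increasing (\<lambda>\<zeta>::(real^'d) \<times> real. profile_dz s z (psymb \<zeta>))"
    and "slowly_increasing (\<lambda>\<zeta>::(real^'d) \<times> real. profile_dzz s z (psymb \<zeta>))"
proof -
  obtain K where K: "0 \<le> K" "\<And>y p. y \<in> ball z (z / 2) \<Longrightarrow> p \<noteq> 0 \<Longrightarrow>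
      norm (profile_dz s y p) \<le> K * (1 + \<bar>p\<bar>)\<^sup>2 \<and> norm (profile_dzz s y p) \<le> K * (1 + \<bar>p\<bar>)\<^sup>2"
    using profile_dz_bounds[OF s z] by blast
  have zb: "z \<in> ball z (z / 2)" using z by simp
  have b: "norm (profile_dz s z p) \<le> K * (1 + \<bar>p\<bar>)\<^sup>2 \<and> norm (profile_dzz s z p) \<le> K * (1 + \<bar>p\<bar>)\<^sup>2" for p
    using K(2)[OF zb, of p] K(1) by (cases "p = 0") (simp_all add: profile_dz_0)
  show "slowly_increasing (\<lambda>\<zeta>::(real^'d) \<times> real. profile_dz s z (psymb \<zeta>))"
    by (rule slowly_increasing_psymb_bound[where K = K and n = 2]) (use b K(1) in auto)
  show "slowly_increasing (\<lambda>\<zeta>::(real^'d) \<times> real. profile_dzz s z (psymb \<zeta>))"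
    by (rule slowly_increasing_psymb_bound[where K = K and n = 2]) (use b K(1) in auto)
qed

lemma mult_fun_z_derivatives:
  fixes f :: "(real^'d) \<times> real \<Rightarrow> complex"
  assumes s: "0 < s" "s < 1" and z: "0 < z" and f: "f \<in> schwartz"
  shows "((\<lambda>z. inv_fourier (\<lambda>\<zeta>. mult_fun s z \<zeta> * f \<zeta>) X) has_vector_derivative
       inv_fourier (\<lambda>\<zeta>. profile_dz s z (psymb \<zeta>) * f \<zeta>) X) (at z)"
    and "((\<lambda>z. inv_fourier (\<lambda>\<zeta>. profile_dz s z (psymb \<zeta>) * f \<zeta>) X) has_vector_derivative
       inv_fourier (\<lambda>\<zeta>. profile_dzz s z (psymb \<zeta>) * f \<zeta>) X) (at z)"
proof -
  obtain K where K: "0 \<le> K" "\<And>y p. y \<in> ball z (z / 2) \<Longrightarrow> p \<noteq> 0 \<Longrightarrow>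
      norm (profile_dz s y p) \<le> K * (1 + \<bar>p\<bar>)\<^sup>2 \<and> norm (profile_dzz s y p) \<le> K * (1 + \<bar>p\<bar>)\<^sup>2"
    using profile_dz_bounds[OF s z] by blast
  have zb: "z \<in> ball z (z / 2)" using z by simp
  have pos: "0 < y" if "y \<in> ball z (z / 2)" for y
    using that z by (auto simp: dist_real_def abs_if split: if_splits)
  let ?g = "\<lambda>\<zeta>::(real^'d) \<times> real. complex_of_real (K * (1 + \<bar>psymb \<zeta>\<bar>)\<^sup>2)"
  have ng: "norm (?g \<zeta>) = K * (1 + \<bar>psymb \<zeta>\<bar>)\<^sup>2" for \<zeta>
    unfolding norm_of_real using K(1) by simp
  have g: "slowly_increasing ?g"
    by (rule slowly_increasing_psymb_bound[where K = K and n = 2]) (use K(1) ng in auto)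
  show "((\<lambda>z. inv_fourier (\<lambda>\<zeta>. mult_fun s z \<zeta> * f \<zeta>) X) has_vector_derivative
       inv_fourier (\<lambda>\<zeta>. profile_dz s z (psymb \<zeta>) * f \<zeta>) X) (at z)"
  proof (rule inv_fourier_parameter_derivative[OF open_ball convex_ball zb f _ g])
    show "slowly_increasing (mult_fun s y :: (real^'d) \<times> real \<Rightarrow> complex)" if "y \<in> ball z (z / 2)" for y
      by (rule mult_fun_slowly_increasing[OF s pos[OF that]])
    show "AE \<zeta>::(real^'d) \<times> real in lborel. \<forall>y\<in>ball z (z / 2). ((\<lambda>z. mult_fun s z \<zeta>) has_vector_derivative profile_dz s y (psymb \<zeta>)) (at y)"
      using AE_psymb_nonzero
    proof eventually_elim
      case (elim \<zeta>)
      show ?case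
      proof
        fix y assume y: "y \<in> ball z (z / 2)"
        show "((\<lambda>z. mult_fun s z \<zeta>) has_vector_derivative profile_dz s y (psymb \<zeta>)) (at y)"
        proof (rule has_vector_derivative_transform_within_open[of _ _ _ "{0<..}"])
          show "((\<lambda>z. profile s z (psymb \<zeta>)) has_vector_derivative profile_dz s y (psymb \<zeta>)) (at y)"
            unfolding profile_dz_def by (rule profile_derivative[OF pos[OF y]])
          show "profile s x (psymb \<zeta>) = mult_fun s x \<zeta>" if "x \<in> {0<..}" for x
            using that elim mult_fun_eq[OF s, of x \<zeta>] by simp
        qed (use pos[OF y] in auto)
      qed
    qed
    show "AE \<zeta>::(real^'d) \<times> real in lborel. \<forall>y\<in>ball z (z / 2). norm (profile_dz s y (psymb \<zeta>)) \<le> norm (?g \<zeta>)"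
      using AE_psymb_nonzero by eventually_elim (use K(2) ng in simp)
  qed measurable
  show "((\<lambda>z. inv_fourier (\<lambda>\<zeta>. profile_dz s z (psymb \<zeta>) * f \<zeta>) X) has_vector_derivative
       inv_fourier (\<lambda>\<zeta>. profile_dzz s z (psymb \<zeta>) * f \<zeta>) X) (at z)"
  proof (rule inv_fourier_parameter_derivative[OF open_ball convex_ball zb f _ g])
    show "slowly_increasing (\<lambda>\<zeta>::(real^'d) \<times> real. profile_dz s y (psymb \<zeta>))" if "y \<in> ball z (z / 2)" for y
      by (rule profile_dz_slowly_increasing[OF s pos[OF that]])
    show "AE \<zeta>::(real^'d) \<times> real in lborel. \<forall>y\<in>ball z (z / 2). ((\<lambda>z. profile_dz s z (psymb \<zeta>)) has_vector_derivative profile_dzz s y (psymb \<zeta>)) (at y)"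
      using profile_dz_derivative[OF pos] by blast
    show "AE \<zeta>::(real^'d) \<times> real in lborel. \<forall>y\<in>ball z (z / 2). norm (profile_dzz s y (psymb \<zeta>)) \<le> norm (?g \<zeta>)"
      using AE_psymb_nonzero by eventually_elim (use K(2) ng in simp)
  qed measurable
qed

section \<open>The extension\<close>

text \<open>
  The inverse Fourier transform is an absolutely convergent integral here, since the multiplier grows at most
  polynomially; so it provides the continuous representative.
\<close>

definition ext_sol :: "real \<Rightarrow> ((real^'d) \<times> real \<Rightarrow> complex) \<Rightarrow> real^'d \<Rightarrow> real \<Rightarrow> real \<Rightarrow> complex" where
  "ext_sol s u x z t = inv_fourier (\<lambda>\<zeta>. mult_fun s z \<zeta> * fourier u \<zeta>) (x, t)"

lemma ext_sol_is_extension: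
  fixes u :: "(real^'d) \<times> real \<Rightarrow> complex"
  assumes s: "0 < s" "s < 1" and u: "u \<in> schwartz"
  shows "is_extension s u (ext_sol s u)"
  unfolding is_extension_def
proof (intro allI impI conjI)
  fix z :: real assume z: "0 < z"
  let ?h = "\<lambda>\<zeta>::(real^'d) \<times> real. mult_fun s z \<zeta> * fourier u \<zeta>"
  note m = mult_fun_slowly_increasing[OF s z] and Fu = fourier_schwartz[OF u]
  have U: "(\<lambda>(x, t). ext_sol s u x z t) = inv_fourier ?h"
    by (auto simp: ext_sol_def)
  have h: "(\<lambda>(\<xi>, \<tau>). multiplier s z \<xi> \<tau> * fourier u (\<xi>, \<tau>)) = ?h"
    by auto
  have hi: "integrable lborel ?h" by (rule slowly_increasing_integrable[OF m Fu])
  have "integrable lborel (\<lambda>\<zeta>. (of_real (norm \<zeta>) * mult_fun s z \<zeta>) * fourier u \<zeta>)"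
    by (intro slowly_increasing_integrable slowly_increasing_mult slowly_increasing_norm m Fu)
  then have hi1: "integrable lborel (\<lambda>\<zeta>. of_real (norm \<zeta>) * ?h \<zeta>)" by (simp only: mult.assoc)
  show cont: "continuous_on UNIV (\<lambda>(x, t). ext_sol s u x z t)"
    unfolding U
    by (intro continuous_at_imp_continuous_on ballI has_derivative_continuous[OF inv_fourier_has_derivative[OF hi hi1]])
  show "has_tempered_fourier (\<lambda>(x, t). ext_sol s u x z t) (\<lambda>(\<xi>, \<tau>). multiplier s z \<xi> \<tau> * fourier u (\<xi>, \<tau>))"
    unfolding has_tempered_fourier_def h U
  proof (intro conjI ballI)
    show "tempered_function ?h"
      by (intro tempered_function_slowly_increasing slowly_increasing_mult m slowly_increasing_schwartz Fu)
    show "tempered_function (inv_fourier ?h)"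
    proof (intro tempered_function_slowly_increasing slowly_increasingI[where j = 0 and A = "LINT \<zeta>|lborel. norm (?h \<zeta>)"])
      show "inv_fourier ?h \<in> borel_measurable borel"
        using cont unfolding U by (rule borel_measurable_continuous_onI)
      show "norm (inv_fourier ?h X) \<le> (LINT \<zeta>|lborel. norm (?h \<zeta>)) * (1 + norm X) ^ 0" for X
        unfolding inv_fourier_eq_fourier using norm_fourier_le[of ?h "- X"] by simp
    qed
    fix \<Phi> :: "(real^'d) \<times> real \<Rightarrow> complex" assume \<Phi>: "\<Phi> \<in> schwartz"
    have "regular_dist (inv_fourier ?h) (fourier \<Phi>)
        = (LINT X|lborel. fourier \<Phi> X * (LINT \<zeta>|lborel. exp (2 * of_real pi * \<i> * of_real (\<zeta> \<bullet> X)) * ?h \<zeta>))"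
      unfolding regular_dist_def inv_fourier_def by (simp only: mult.commute)
    also have "\<dots> = (LINT \<zeta>|lborel. ?h \<zeta> * (LINT X|lborel. exp (2 * of_real pi * \<i> * of_real (\<zeta> \<bullet> X)) * fourier \<Phi> X))"
      by (rule Fubini_bounded_kernel(2)[OF schwartz_integrable[OF fourier_schwartz[OF \<Phi>]] hi, where B = 1])
         (auto simp: norm_exp_eq_Re case_prod_unfold intro!: borel_measurable_continuous_onI continuous_intros)
    also have "\<dots> = (LINT \<zeta>|lborel. ?h \<zeta> * inv_fourier (fourier \<Phi>) \<zeta>)"
      unfolding inv_fourier_def by (simp only: inner_commute)
    also have "\<dots> = regular_dist ?h \<Phi>"
      unfolding regular_dist_def inv_fourier_fourier[OF \<Phi>] ..
    finally show "fourier_dist (regular_dist (inv_fourier ?h)) \<Phi> = regular_dist ?h \<Phi>"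
      by (simp only: fourier_dist_def)
  qed
qed

lemma extension_equation_combination:
  fixes A C D :: "'x \<Rightarrow> complex" and B :: "'d::finite \<Rightarrow> 'x \<Rightarrow> complex"
  assumes "integrable M A" "\<And>j. integrable M (B j)" "integrable M C" "integrable M D"
  shows "(LINT x|M. A x) - \<i> * ((\<Sum>j\<in>UNIV. LINT x|M. B j x) + (LINT x|M. C x) + c * (LINT x|M. D x))
     = (LINT x|M. A x - \<i> * ((\<Sum>j\<in>UNIV. B j x) + C x + c * D x))"
  using assms by simp

text \<open>
  The difference to \<open>u\<close> is bounded, uniformly in \<open>(x, t)\<close>, by the \<open>L\<^sup>1\<close> norm of \<open>(mult_fun s z - 1) * fourier u\<close>.
  This tends to \<open>0\<close> by dominated convergence, as \<open>profile s z p\<close> tends to \<open>1\<close>.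
\<close>

lemma ext_sol_boundary:
  fixes u :: "(real^'d) \<times> real \<Rightarrow> complex"
  assumes s: "0 < s" "s < 1" and u: "u \<in> schwartz"
  shows "uniform_limit UNIV (\<lambda>z (x, t). ext_sol s u x z t) u (at_right 0)"
proof -
  note Fu = fourier_schwartz[OF u]
  note [measurable] = schwartz_borel_measurable[OF Fu]
  obtain K where K: "0 \<le> K" "\<And>z p. 0 < z \<Longrightarrow> p \<noteq> 0 \<Longrightarrow> norm (profile s z p) \<le> K * (1 + z\<^sup>2 * \<bar>p\<bar>)"
    using profile_bound[OF s] by blast
  define d where "d z \<zeta> = complex_of_real (norm ((mult_fun s z \<zeta> - 1) * fourier u \<zeta>))" for z and \<zeta> :: "(real^'d) \<times> real"
  have si: "slowly_increasing (\<lambda>\<zeta>::(real^'d) \<times> real. mult_fun s z \<zeta> - 1)" if z: "0 < z" for z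
  proof -
    note [measurable] = slowly_increasing_measurable[OF mult_fun_slowly_increasing[OF s z]]
    obtain A j where A: "\<And>\<zeta>::(real^'d) \<times> real. norm (mult_fun s z \<zeta>) \<le> A * (1 + norm \<zeta>) ^ j"
      using mult_fun_slowly_increasing[OF s z] unfolding slowly_increasing_def by blast
    show ?thesis
    proof (rule slowly_increasingI[where A = "A + 1" and j = j])
      fix \<zeta> :: "(real^'d) \<times> real"
      have "1 \<le> (1 + norm \<zeta>) ^ j" by (rule one_le_power) simp
      then show "norm (mult_fun s z \<zeta> - 1) \<le> (A + 1) * (1 + norm \<zeta>) ^ j"
        using norm_triangle_ineq4[of "mult_fun s z \<zeta>" 1, unfolded norm_one] A[of \<zeta>]
        unfolding distrib_right mult_1 by linarith
    qed measurable
  qed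
  have int: "integrable lborel (\<lambda>\<zeta>::(real^'d) \<times> real. (mult_fun s z \<zeta> - 1) * fourier u \<zeta>)" if "0 < z" for z
    by (rule slowly_increasing_integrable[OF si[OF that] Fu])
  have diff: "norm (ext_sol s u x z t - u (x, t)) \<le> norm (LINT \<zeta>|lborel. d z \<zeta>)" if z: "0 < z" for x z t
  proof -
    let ?e = "\<lambda>\<zeta>. exp (2 * of_real pi * \<i> * of_real (\<zeta> \<bullet> (x, t))) :: complex"
    have "ext_sol s u x z t - u (x, t) = inv_fourier (\<lambda>\<zeta>. mult_fun s z \<zeta> * fourier u \<zeta>) (x, t) - inv_fourier (fourier u) (x, t)"
      by (simp only: ext_sol_def inv_fourier_fourier[OF u])
    also have "\<dots> = inv_fourier (\<lambda>\<zeta>. (mult_fun s z \<zeta> - 1) * fourier u \<zeta>) (x, t)"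
      using inv_fourier_lincomb[OF slowly_increasing_integrable[OF mult_fun_slowly_increasing[OF s z] Fu] schwartz_integrable[OF Fu], of 1 "-1"]
      by (simp add: left_diff_distrib)
    finally have "norm (ext_sol s u x z t - u (x, t)) \<le> (LINT \<zeta>|lborel. norm ((mult_fun s z \<zeta> - 1) * fourier u \<zeta>))"
      unfolding inv_fourier_eq_fourier by (simp only: norm_fourier_le)
    also have "\<dots> = norm (LINT \<zeta>|lborel. d z \<zeta>)"
      unfolding d_def integral_complex_of_real norm_of_real by (intro abs_of_nonneg[symmetric] integral_nonneg_AE AE_I2 norm_ge_zero)
    finally show ?thesis .
  qed
  \<comment> \<open>restricted to \<open>z < 1\<close>, the bound of the profile is independent of \<open>z\<close>, as domination requires\<close>
  have "((\<lambda>z. LINT \<zeta>|lborel. d z \<zeta>) \<longlongrightarrow> (LINT \<zeta>|(lborel :: ((real^'d) \<times> real) measure). 0)) (at 0 within {0<..<1})"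
  proof (rule tendsto_integral_dominated[where w = "\<lambda>\<zeta>. norm (of_real ((K + 1) * (1 + \<bar>psymb \<zeta>\<bar>)) * fourier u \<zeta>)"])
    show "AE \<zeta>::(real^'d) \<times> real in lborel. ((\<lambda>z. d z \<zeta>) \<longlongrightarrow> 0) (at 0 within {0<..<1})"
      using AE_psymb_nonzero
    proof eventually_elim
      case (elim \<zeta>)
      have pm: "profile s z (psymb \<zeta>) = mult_fun s z \<zeta>" if "0 < z" for z
        using mult_fun_eq[OF s that, of \<zeta>] elim by simp
      have "((\<lambda>z. profile s z (psymb \<zeta>)) \<longlongrightarrow> 1) (at 0 within {0<..<1})"
        using profile_tendsto_1[OF s] by (rule tendsto_within_subset) auto
      moreover have "\<forall>\<^sub>F z in at 0 within {0<..<1}. profile s z (psymb \<zeta>) = mult_fun s z \<zeta>"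
        using pm by (auto simp: eventually_at_filter intro!: always_eventually)
      ultimately have "((\<lambda>z. mult_fun s z \<zeta>) \<longlongrightarrow> 1) (at 0 within {0<..<1})"
        by (rule Lim_transform_eventually)
      then have "((\<lambda>z. d z \<zeta>) \<longlongrightarrow> complex_of_real (norm ((1 - 1) * fourier u \<zeta>))) (at 0 within {0<..<1})"
        unfolding d_def by (intro tendsto_intros)
      then show ?case by simp
    qed
    show "d z \<in> borel_measurable lborel" if "z \<in> {0<..<1}" for z
      unfolding d_def[abs_def]
      by (rule borel_measurable_continuous_on[OF _ borel_measurable_integrable[OF int]])
         (use that in \<open>auto intro!: continuous_intros\<close>)
    have b: "norm (complex_of_real ((K + 1) * (1 + \<bar>psymb \<zeta>\<bar>))) = (K + 1) * (1 + \<bar>psymb \<zeta>\<bar>)" for \<zeta> :: "(real^'d) \<times> real"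
      unfolding norm_of_real using K(1) by simp
    have "slowly_increasing (\<lambda>\<zeta>::(real^'d) \<times> real. of_real ((K + 1) * (1 + \<bar>psymb \<zeta>\<bar>)))"
      by (rule slowly_increasing_psymb_bound[where K = "K + 1" and n = 1]) (use K(1) b in auto)
    then show "integrable lborel (\<lambda>\<zeta>::(real^'d) \<times> real. norm (of_real ((K + 1) * (1 + \<bar>psymb \<zeta>\<bar>)) * fourier u \<zeta>))"
      by (intro integrable_norm slowly_increasing_integrable Fu)
    show "AE \<zeta>::(real^'d) \<times> real in lborel. norm (d z \<zeta>) \<le> norm (of_real ((K + 1) * (1 + \<bar>psymb \<zeta>\<bar>)) * fourier u \<zeta>)" if z: "z \<in> {0<..<1}" for z
      using AE_psymb_nonzero
    proof eventually_elim
      case (elim \<zeta>)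
      have "z\<^sup>2 * \<bar>psymb \<zeta>\<bar> \<le> 1 * \<bar>psymb \<zeta>\<bar>"
        using z by (intro mult_right_mono) (auto simp: power_le_one)
      then have "K * (1 + z\<^sup>2 * \<bar>psymb \<zeta>\<bar>) \<le> K * (1 + \<bar>psymb \<zeta>\<bar>)"
        using K(1) by (intro mult_left_mono) auto
      moreover have "norm (mult_fun s z \<zeta>) \<le> K * (1 + z\<^sup>2 * \<bar>psymb \<zeta>\<bar>)"
        using mult_fun_eq[OF s, of z \<zeta>] K(2)[of z "psymb \<zeta>"] elim z by simp
      ultimately have "norm (mult_fun s z \<zeta> - 1) \<le> (K + 1) * (1 + \<bar>psymb \<zeta>\<bar>)"
        using norm_triangle_ineq4[of "mult_fun s z \<zeta>" 1] by (simp add: distrib_right)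
      then show ?case
        unfolding d_def norm_of_real norm_mult b abs_norm_cancel abs_mult using K(1) by (intro mult_right_mono) auto
    qed
  qed simp
  then have "((\<lambda>z. norm (LINT \<zeta>|lborel. d z \<zeta>)) \<longlongrightarrow> 0) (at 0 within {0<..<1})"
    by (simp add: tendsto_norm_zero)
  moreover have "at (0::real) within {0<..<1} = at_right 0"
    by (rule at_within_nhd[of _ "{-1<..<1}"]) auto
  ultimately have lim: "((\<lambda>z. norm (LINT \<zeta>|lborel. d z \<zeta>)) \<longlongrightarrow> 0) (at_right 0)" by simp
  show ?thesis
  proof (rule uniform_limitI)
    fix e :: real assume "0 < e"
    then have "\<forall>\<^sub>F z in at_right 0. norm (LINT \<zeta>|lborel. d z \<zeta>) < e"
      by (rule order_tendstoD(2)[OF lim])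
    then show "\<forall>\<^sub>F z in at_right 0. \<forall>X\<in>UNIV. dist ((\<lambda>(x, t). ext_sol s u x z t) X) (u X) < e"
      using eventually_at_right_less[of "0::real"]
      by eventually_elim (auto simp: dist_norm intro: order_le_less_trans[OF diff])
  qed
qed

text \<open>
  All derivatives may be taken under the integral sign. The equation then is the identity
  \<open>2 \<pi> \<i> \<tau> - \<i> * (- 4 \<pi>\<^sup>2 |\<xi>|\<^sup>2 + p) = 0\<close> for the symbol \<open>p\<close>, where \<open>p\<close> arises from the two \<open>z\<close>-derivatives by the
  equation of the profile.
\<close>

lemma ext_sol_solves:
  fixes u :: "(real^'d) \<times> real \<Rightarrow> complex"
  assumes s: "0 < s" "s < 1" and u: "u \<in> schwartz" and U: "\<And>x z t. 0 < z \<Longrightarrow> U x z t = ext_sol s u x z t"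
  shows "solves_extension_problem (1 - 2 * s) u U"
proof -
  note Fu = fourier_schwartz[OF u]
  let ?c = "\<lambda>v (\<zeta>::(real^'d) \<times> real). 2 * of_real pi * \<i> * complex_of_real (\<zeta> \<bullet> v)"
  let ?et = "(0, 1) :: (real^'d) \<times> real" and ?ex = "\<lambda>j. (axis j 1, 0) :: (real^'d) \<times> real"
  define L where "L h x t = inv_fourier (\<lambda>\<zeta>. h \<zeta> * fourier u \<zeta>) (x, t)" for h and x :: "real^'d" and t :: real
  have U': "U x z t = L (mult_fun s z) x t" if "0 < z" for x z t
    using U[OF that] by (simp add: ext_sol_def L_def)
  have c: "slowly_increasing (?c v)" for v
    by (intro slowly_increasing_mult slowly_increasing_const slowly_increasing_inner)
  have tder: "((\<lambda>r. L h x r) has_vector_derivative L (\<lambda>\<zeta>. ?c ?et \<zeta> * h \<zeta>) x t) (at t)" if "slowly_increasing h" for h x t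
    using inv_fourier_line_derivative[OF that Fu, of "(x, 0)" ?et t] unfolding L_def by simp
  have xder: "((\<lambda>r. L h (x + r *\<^sub>R axis j 1) t) has_vector_derivative L (\<lambda>\<zeta>. ?c (?ex j) \<zeta> * h \<zeta>) x t) (at 0)" if "slowly_increasing h" for h x t j
    using inv_fourier_line_derivative[OF that Fu, of "(x, t)" "?ex j" 0] unfolding L_def by simp
  let ?m = "\<lambda>z. mult_fun s z :: (real^'d) \<times> real \<Rightarrow> complex"
  let ?dz = "\<lambda>z (\<zeta>::(real^'d) \<times> real). profile_dz s z (psymb \<zeta>)" and ?dzz = "\<lambda>z (\<zeta>::(real^'d) \<times> real). profile_dzz s z (psymb \<zeta>)"
  note m = mult_fun_slowly_increasing[OF s]
  have eqn: "L (\<lambda>\<zeta>. ?c ?et \<zeta> * ?m z \<zeta>) x t - \<i> * ((\<Sum>j\<in>UNIV. L (\<lambda>\<zeta>. ?c (?ex j) \<zeta> * (?c (?ex j) \<zeta> * ?m z \<zeta>)) x t)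
      + L (?dzz z) x t + of_real ((1 - 2 * s) / z) * L (?dz z) x t) = 0" if z: "0 < z" for x z t
  proof -
    let ?e = "\<lambda>\<zeta>. exp (2 * of_real pi * \<i> * of_real (\<zeta> \<bullet> (x, t))) :: complex"
    have I: "integrable lborel (\<lambda>\<zeta>. ?e \<zeta> * (h \<zeta> * fourier u \<zeta>))" if "slowly_increasing h" for h
      by (intro exp_mult_integrable slowly_increasing_integrable that Fu)
    have "L (\<lambda>\<zeta>. ?c ?et \<zeta> * ?m z \<zeta>) x t - \<i> * ((\<Sum>j\<in>UNIV. L (\<lambda>\<zeta>. ?c (?ex j) \<zeta> * (?c (?ex j) \<zeta> * ?m z \<zeta>)) x t)
      + L (?dzz z) x t + of_real ((1 - 2 * s) / z) * L (?dz z) x t)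
      = (LINT \<zeta>|lborel. ?e \<zeta> * ((?c ?et \<zeta> * ?m z \<zeta>) * fourier u \<zeta>) - \<i> * ((\<Sum>j\<in>UNIV. ?e \<zeta> * ((?c (?ex j) \<zeta> * (?c (?ex j) \<zeta> * ?m z \<zeta>)) * fourier u \<zeta>))
         + ?e \<zeta> * (?dzz z \<zeta> * fourier u \<zeta>) + of_real ((1 - 2 * s) / z) * (?e \<zeta> * (?dz z \<zeta> * fourier u \<zeta>))))"
      unfolding L_def inv_fourier_def
      by (intro extension_equation_combination I slowly_increasing_mult c m z profile_dz_slowly_increasing[OF s z])
    also have "\<dots> = (LINT \<zeta>|(lborel :: ((real^'d) \<times> real) measure). 0)"
    proof (rule integral_cong_AE)
      have f: "(\<lambda>\<zeta>. ?e \<zeta> * (h \<zeta> * fourier u \<zeta>)) \<in> borel_measurable lborel" if "slowly_increasing h" for h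
        using I[OF that] by (rule borel_measurable_integrable)
      show "(\<lambda>\<zeta>. ?e \<zeta> * ((?c ?et \<zeta> * ?m z \<zeta>) * fourier u \<zeta>) - \<i> * ((\<Sum>j\<in>UNIV. ?e \<zeta> * ((?c (?ex j) \<zeta> * (?c (?ex j) \<zeta> * ?m z \<zeta>)) * fourier u \<zeta>))
         + ?e \<zeta> * (?dzz z \<zeta> * fourier u \<zeta>) + of_real ((1 - 2 * s) / z) * (?e \<zeta> * (?dz z \<zeta> * fourier u \<zeta>)))) \<in> borel_measurable lborel"
        by (intro borel_measurable_diff borel_measurable_times borel_measurable_add borel_measurable_sum borel_measurable_const f
            slowly_increasing_mult c m z profile_dz_slowly_increasing[OF s z])
      show "AE \<zeta> in lborel. ?e \<zeta> * ((?c ?et \<zeta> * ?m z \<zeta>) * fourier u \<zeta>) - \<i> * ((\<Sum>j\<in>UNIV. ?e \<zeta> * ((?c (?ex j) \<zeta> * (?c (?ex j) \<zeta> * ?m z \<zeta>)) * fourier u \<zeta>))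
         + ?e \<zeta> * (?dzz z \<zeta> * fourier u \<zeta>) + of_real ((1 - 2 * s) / z) * (?e \<zeta> * (?dz z \<zeta> * fourier u \<zeta>))) = 0"
        using AE_psymb_nonzero
      proof eventually_elim
        case (elim \<zeta>)
        define M where "M = ?m z \<zeta>"
        have pm: "profile s z (psymb \<zeta>) = M"
          using mult_fun_eq[OF s z, of \<zeta>] elim by (simp add: M_def)
        have ct: "?c ?et \<zeta> = 2 * of_real pi * \<i> * of_real (snd \<zeta>)"
          by (simp add: inner_prod_def)
        have cx: "?c (?ex j) \<zeta> = 2 * of_real pi * \<i> * of_real (fst \<zeta> $ j)" for j
          by (simp add: inner_prod_def inner_axis)
        have n: "(\<Sum>j\<in>UNIV. (fst \<zeta> $ j)\<^sup>2) = (norm (fst \<zeta>))\<^sup>2"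
          unfolding power2_norm_eq_inner inner_vec_def by (simp add: power2_eq_square)
        have lap: "(\<Sum>j\<in>UNIV. ?e \<zeta> * ((?c (?ex j) \<zeta> * (?c (?ex j) \<zeta> * M)) * fourier u \<zeta>))
            = - of_real (4 * pi\<^sup>2 * (norm (fst \<zeta>))\<^sup>2) * (?e \<zeta> * (M * fourier u \<zeta>))"
        proof -
          have "?e \<zeta> * ((?c (?ex j) \<zeta> * (?c (?ex j) \<zeta> * M)) * fourier u \<zeta>)
              = of_real ((fst \<zeta> $ j)\<^sup>2) * (- of_real (4 * pi\<^sup>2) * (?e \<zeta> * (M * fourier u \<zeta>)))" for j
            unfolding cx by (simp add: power2_eq_square algebra_simps)
          then have "(\<Sum>j\<in>UNIV. ?e \<zeta> * ((?c (?ex j) \<zeta> * (?c (?ex j) \<zeta> * M)) * fourier u \<zeta>))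
              = of_real (\<Sum>j\<in>UNIV. (fst \<zeta> $ j)\<^sup>2) * (- of_real (4 * pi\<^sup>2) * (?e \<zeta> * (M * fourier u \<zeta>)))"
            by (simp only: of_real_sum sum_distrib_right)
          then show ?thesis unfolding n by simp
        qed
        have zz: "?e \<zeta> * (?dzz z \<zeta> * fourier u \<zeta>) + of_real ((1 - 2 * s) / z) * (?e \<zeta> * (?dz z \<zeta> * fourier u \<zeta>))
            = of_real (psymb \<zeta>) * (?e \<zeta> * (M * fourier u \<zeta>))"
          unfolding profile_dzz_def pm by (simp add: algebra_simps)
        show ?case
          unfolding M_def[symmetric] lap add.assoc zz unfolding ct symb_def by (simp add: algebra_simps power2_eq_square)
      qed
    qed simp
    finally show ?thesis by simp
  qed
  show ?thesis
    unfolding solves_extension_problem_def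
  proof (intro conjI)
    show "uniform_limit UNIV (\<lambda>z (x, t). U x z t) u (at_right 0)"
    proof (rule uniform_limit_cong[THEN iffD1, OF _ _ ext_sol_boundary[OF s u]])
      show "\<forall>\<^sub>F z in at_right 0. \<forall>X\<in>UNIV. (\<lambda>(x, t). ext_sol s u x z t) X = (\<lambda>(x, t). U x z t) X"
        using eventually_at_right_less[of "0::real"] by eventually_elim (auto simp: U)
    qed simp
    show "\<exists>Ut Uz Uzz Ux Uxx. \<forall>x t. \<forall>z>0.
        ((\<lambda>r. U x z r) has_vector_derivative Ut x z t) (at t) \<and>
        ((\<lambda>r. U x r t) has_vector_derivative Uz x z t) (at z) \<and>
        ((\<lambda>r. Uz x r t) has_vector_derivative Uzz x z t) (at z) \<and>
        (\<forall>j::'d.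
           ((\<lambda>r. U (x + r *\<^sub>R axis j 1) z t) has_vector_derivative Ux j x z t) (at 0) \<and>
           ((\<lambda>r. Ux j (x + r *\<^sub>R axis j 1) z t) has_vector_derivative Uxx j x z t) (at 0)) \<and>
        Ut x z t - \<i> * ((\<Sum>j\<in>UNIV. Uxx j x z t) + Uzz x z t + of_real ((1 - 2 * s) / z) * Uz x z t) = 0"
    proof (rule exI[of _ "\<lambda>x z t. L (\<lambda>\<zeta>. ?c ?et \<zeta> * ?m z \<zeta>) x t"], rule exI[of _ "\<lambda>x z t. L (?dz z) x t"], rule exI[of _ "\<lambda>x z t. L (?dzz z) x t"],
        rule exI[of _ "\<lambda>j x z t. L (\<lambda>\<zeta>. ?c (?ex j) \<zeta> * ?m z \<zeta>) x t"],
        rule exI[of _ "\<lambda>j x z t. L (\<lambda>\<zeta>. ?c (?ex j) \<zeta> * (?c (?ex j) \<zeta> * ?m z \<zeta>)) x t"], intro allI impI conjI)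
      fix x :: "real^'d" and t z :: real assume z: "0 < z"
      show "((\<lambda>r. U x z r) has_vector_derivative L (\<lambda>\<zeta>. ?c ?et \<zeta> * ?m z \<zeta>) x t) (at t)"
        unfolding U'[OF z] by (rule tder[OF m[OF z]])
      show "((\<lambda>r. U x r t) has_vector_derivative L (?dz z) x t) (at z)"
      proof (rule has_vector_derivative_transform_within_open)
        show "((\<lambda>r. L (?m r) x t) has_vector_derivative L (?dz z) x t) (at z)"
          unfolding L_def by (rule mult_fun_z_derivatives(1)[OF s z Fu])
        show "open {0::real<..}" "z \<in> {0<..}" using z by auto
      qed (simp add: U')
      show "((\<lambda>r. L (?dz r) x t) has_vector_derivative L (?dzz z) x t) (at z)"
        unfolding L_def by (rule mult_fun_z_derivatives(2)[OF s z Fu])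
      show "((\<lambda>r. U (x + r *\<^sub>R axis j 1) z t) has_vector_derivative L (\<lambda>\<zeta>. ?c (?ex j) \<zeta> * ?m z \<zeta>) x t) (at 0)" for j
        unfolding U'[OF z] by (rule xder[OF m[OF z]])
      show "((\<lambda>r. L (\<lambda>\<zeta>. ?c (?ex j) \<zeta> * ?m z \<zeta>) (x + r *\<^sub>R axis j 1) t) has_vector_derivative
          L (\<lambda>\<zeta>. ?c (?ex j) \<zeta> * (?c (?ex j) \<zeta> * ?m z \<zeta>)) x t) (at 0)" for j
        by (rule xder[OF slowly_increasing_mult[OF c m[OF z]]])
      show "L (\<lambda>\<zeta>. ?c ?et \<zeta> * ?m z \<zeta>) x t - \<i> * ((\<Sum>j\<in>UNIV. L (\<lambda>\<zeta>. ?c (?ex j) \<zeta> * (?c (?ex j) \<zeta> * ?m z \<zeta>)) x t)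
          + L (?dzz z) x t + of_real ((1 - 2 * s) / z) * L (?dz z) x t) = 0"
        by (rule eqn[OF z])
    qed
  qed
qed

text \<open>
  Apply \<open>kernel_dist_eq\<close> to the reflected translate \<open>\<Phi>(y, \<sigma>) = u(x - y, t - \<sigma>)\<close>, whose inverse Fourier transform
  is \<open>fourier u\<close> times the exponential of the synthesis.
\<close>

lemma ext_sol_improper_integral:
  fixes u :: "(real^'d) \<times> real \<Rightarrow> complex"
  assumes s: "0 < s" "s < 1" and u: "u \<in> schwartz" and z: "0 < z"
  shows "has_improper_integral (\<lambda>\<sigma>. LINT y|lborel. P_kernel (1 - 2 * s) z \<sigma> * S_kernel (x - y) \<sigma> * u (y, t - \<sigma>)) (ext_sol s u x z t)"
proof -
  let ?X = "(x, t)"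
  define \<Phi> where "\<Phi> Y = u (?X + (-1) *\<^sub>R Y)" for Y
  have \<Phi>: "\<Phi> \<in> schwartz" unfolding \<Phi>_def[abs_def] by (rule schwartz_affine[OF u]) simp
  note [measurable] = schwartz_borel_measurable[OF u] schwartz_borel_measurable[OF \<Phi>]
  have inv: "inv_fourier \<Phi> \<zeta> = exp (2 * of_real pi * \<i> * of_real (\<zeta> \<bullet> ?X)) * fourier u \<zeta>" for \<zeta>
  proof -
    let ?g = "\<lambda>Y. exp (2 * of_real pi * \<i> * of_real (Y \<bullet> \<zeta>)) * \<Phi> Y"
    have "inv_fourier \<Phi> \<zeta> = (LINT Y|lborel. ?g (?X + (-1) *\<^sub>R Y))"
      unfolding inv_fourier_def using integral_lborel_affine[of ?g "-1" ?X] by simp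
    also have "\<dots> = (LINT Y|lborel. exp (2 * of_real pi * \<i> * of_real (\<zeta> \<bullet> ?X)) * (exp (- 2 * of_real pi * \<i> * of_real (\<zeta> \<bullet> Y)) * u Y))"
    proof (intro Bochner_Integration.integral_cong refl)
      fix Y :: "(real^'d) \<times> real"
      have "exp (2 * of_real pi * \<i> * of_real ((?X + (-1) *\<^sub>R Y) \<bullet> \<zeta>)) = exp (2 * of_real pi * \<i> * of_real (\<zeta> \<bullet> ?X)) * exp (- 2 * of_real pi * \<i> * of_real (\<zeta> \<bullet> Y))"
        unfolding exp_add[symmetric] by (simp add: inner_diff_left inner_commute[of \<zeta>] algebra_simps)
      then show "?g (?X + (-1) *\<^sub>R Y) = exp (2 * of_real pi * \<i> * of_real (\<zeta> \<bullet> ?X)) * (exp (- 2 * of_real pi * \<i> * of_real (\<zeta> \<bullet> Y)) * u Y)"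
        by (simp add: \<Phi>_def)
    qed
    finally show ?thesis unfolding fourier_def by (simp only: integral_mult_right_zero)
  qed
  have k: "kernel_integrand (1 - 2 * s) z \<Phi> \<sigma> = (LINT y|lborel. P_kernel (1 - 2 * s) z \<sigma> * S_kernel (x - y) \<sigma> * u (y, t - \<sigma>))" for \<sigma>
  proof -
    have Sm: "(\<lambda>y::real^'d. S_kernel y \<sigma>) \<in> borel_measurable borel"
      unfolding S_kernel_def by measurable
    have um: "(\<lambda>y. \<Phi> (y, \<sigma>)) \<in> borel_measurable borel"
      by (intro borel_measurable_continuous_onI continuous_on_compose2[OF schwartz_continuous[OF \<Phi>, of UNIV]])
         (auto intro!: continuous_intros)
    have "(LINT y|lborel. S_kernel y \<sigma> * \<Phi> (y, \<sigma>)) = (LINT y|lborel. S_kernel (x + (-1) *\<^sub>R y) \<sigma> * \<Phi> (x + (-1) *\<^sub>R y, \<sigma>))"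
      using integral_lborel_affine[OF borel_measurable_times[OF Sm um], of "-1" x] by simp
    also have "\<dots> = (LINT y|lborel. S_kernel (x - y) \<sigma> * u (y, t - \<sigma>))"
      by (simp add: \<Phi>_def)
    finally show ?thesis
      unfolding kernel_integrand_def by (simp only: mult.assoc integral_mult_right_zero)
  qed
  have "kernel_dist (1 - 2 * s) z \<Phi> = ext_sol s u x z t"
    unfolding kernel_dist_eq(2)[OF s z \<Phi>] inv unfolding ext_sol_def inv_fourier_def by (simp only: mult.left_commute)
  then show ?thesis
    using kernel_dist_eq(1)[OF s z \<Phi>] unfolding k[abs_def] by (simp only:)
qed

theorem theoremB:
  fixes s a :: real
  assumes "0 < s" and "s < 1" and "a = 1 - 2 * s"
  shows
    "(\<forall>z>0.
        tempered_function (\<lambda>(\<xi> :: real^'d, \<tau>). multiplier s z \<xi> \<tau>) \<and>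
        (\<forall>\<Phi> \<in> (schwartz :: ((real^'d) \<times> real \<Rightarrow> complex) set).
           has_improper_integral (kernel_integrand a z \<Phi>) (kernel_dist a z \<Phi>)) \<and>
        tempered_distribution (kernel_dist a z :: ((real^'d) \<times> real \<Rightarrow> complex) \<Rightarrow> complex) \<and>
        (\<forall>\<Phi> \<in> (schwartz :: ((real^'d) \<times> real \<Rightarrow> complex) set).
           fourier_dist (kernel_dist a z) \<Phi>
             = regular_dist (\<lambda>(\<xi>, \<tau>). multiplier s z \<xi> \<tau>) \<Phi> \<and>
           inv_fourier_dist (regular_dist (\<lambda>(\<xi>, \<tau>). multiplier s z \<xi> \<tau>)) \<Phi>
             = kernel_dist a z \<Phi>)) \<and>
     (\<forall>u \<in> (schwartz :: ((real^'d) \<times> real \<Rightarrow> complex) set).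
        (\<exists>U. is_extension s u U) \<and>
        (\<forall>U. is_extension s u U \<longrightarrow>
           solves_extension_problem a u U \<and>
           (\<forall>x t. \<forall>z>0.
              has_improper_integral
                (\<lambda>\<sigma>. LINT y|lborel. P_kernel a z \<sigma> * S_kernel (x - y) \<sigma> * u (y, t - \<sigma>))
                (U x z t))))"
proof -
  note s = assms(1,2) and a = assms(3)
  show ?thesis
    unfolding a
  proof (intro conjI allI impI ballI)
    fix z :: real assume z: "0 < z"
    show "tempered_function (\<lambda>(\<xi> :: real^'d, \<tau>). multiplier s z \<xi> \<tau>)"
      by (rule tempered_function_slowly_increasing[OF mult_fun_slowly_increasing[OF s z]])
    show "tempered_distribution (kernel_dist (1 - 2 * s) z :: ((real^'d) \<times> real \<Rightarrow> complex) \<Rightarrow> complex)"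
      by (rule kernel_dist_tempered[OF s z])
    fix \<Phi> :: "(real^'d) \<times> real \<Rightarrow> complex" assume \<Phi>: "\<Phi> \<in> schwartz"
    show "has_improper_integral (kernel_integrand (1 - 2 * s) z \<Phi>) (kernel_dist (1 - 2 * s) z \<Phi>)"
      by (rule kernel_dist_eq(1)[OF s z \<Phi>])
    show "fourier_dist (kernel_dist (1 - 2 * s) z) \<Phi> = regular_dist (\<lambda>(\<xi>, \<tau>). multiplier s z \<xi> \<tau>) \<Phi>"
      unfolding fourier_dist_def regular_dist_def by (rule kernel_improper_integral(2)[OF s z \<Phi>])
    show "inv_fourier_dist (regular_dist (\<lambda>(\<xi>, \<tau>). multiplier s z \<xi> \<tau>)) \<Phi> = kernel_dist (1 - 2 * s) z \<Phi>"
      unfolding inv_fourier_dist_def regular_dist_def by (rule kernel_dist_eq(2)[OF s z \<Phi>, symmetric])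
  next
    fix u :: "(real^'d) \<times> real \<Rightarrow> complex" assume u: "u \<in> schwartz"
    show "\<exists>U. is_extension s u U"
      using ext_sol_is_extension[OF s u] by blast
    fix U assume U: "is_extension s u U"
    have eq: "U x z t = ext_sol s u x z t" if "0 < z" for x z t
      by (rule is_extension_unique[OF U ext_sol_is_extension[OF s u] that])
    show "solves_extension_problem (1 - 2 * s) u U"
      by (rule ext_sol_solves[OF s u eq])
    show "has_improper_integral (\<lambda>\<sigma>. LINT y|lborel. P_kernel (1 - 2 * s) z \<sigma> * S_kernel (x - y) \<sigma> * u (y, t - \<sigma>)) (U x z t)"
      if "0 < z" for x t z
      unfolding eq[OF that] by (rule ext_sol_improper_integral[OF s u that])
  qed
qed

end
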